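(* For each $e \in S^{d-1}$ there exist a real number $\tilde{\varphi}(e)$ depending only on $\mathbb{P}$ and an event $\tilde{\Omega}_{e} \in \Sigma_{e}$ with $\mathbb{P}(\tilde{\Omega}_{e}) = 1$ such that for every $\omega \in \tilde{\Omega}_{e}$ and every $\kappa > 0$, \begin{align*} \tilde{\varphi}(e) &= \lim_{R \to \infty} R^{1-d} \tilde{\varphi}^{\omega}_{\infty}(e,Q(0,R)) = \lim_{h \to \infty} \limsup_{R \to \infty} R^{1-d} \tilde{\varphi}^{\omega}(e,Q(0,R),h) \\ &= \lim_{h \to \infty} \liminf_{R \to \infty} R^{1-d} \tilde{\varphi}^{\omega}(e,Q(0,R),h) = \lim_{R \to \infty} R^{1-d} \tilde{\varphi}^{\omega}(e,Q(0,R),\kappa R), \end{align*} all limits existing.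
   Context: Setting: $d \geq 1$, $\lambda,\Lambda \in (0,\infty)$; $\mathscr{F}_{d}(\lambda,\Lambda)$ is the set of continuous $\varphi : S^{d-1} \to [0,\infty)$ with $\sqrt{\lambda} \leq \varphi \leq \sqrt{\Lambda}$ and convex one-homogeneous extension, with the Borel $\sigma$-algebra of the sup norm. $(\Omega,\mathscr{B},\mathbb{P})$ is a probability space with measurable $\Phi : \Omega \to \mathscr{F}_{d}(\lambda,\Lambda)$ and a jointly measurable group action $\tau : \mathbb{R}^{d} \times \Omega \to \Omega$ ($\tau_{x+y} = \tau_{x}\circ\tau_{y}$, $\tau_{0} = \mathrm{Id}$) preserving $\mathbb{P}$ and ergodic (events invariant under all $\tau_{x}$ have probability $0$ or $1$). $\varphi^{\omega}(x,p) = \|p\|\Phi^{\tau_{x}\omega}(p/\|p\|)$ for $p \neq 0$, $\varphi^{\omega}(x,0)=0$. $W : [-1,1] \to [0,\infty)$ is continuous with zero set $\{-1,1\}$. For open $A \subseteq \mathbb{R}^{d}$ and $u \in H^{1}_{\mathrm{loc}}(A)$ with $-1 \le u \le 1$, $\mathcal{F}^{\omega}(u;A) = \int_{A} \left(\frac{1}{2}\varphi^{\omega}(x,Du)^{2} + W(u)\right) dx$. Fix a smooth $q : \mathbb{R} \to [-1,1]$ with $\int_{\mathbb{R}} (\frac{\Lambda}{2} q'(s)^{2} + W(q(s)))\,ds < \infty$ and $\lim_{s \to \pm\infty} q(s) = \pm 1$. For $e \in S^{d-1}$ let $q_{e}(y) = q(\langle y, e\rangle)$. Fix for each $e$ a linear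 isometry $O_{e} : \mathbb{R}^{d-1} \to \mathbb{R}^{d}$ onto $\langle e \rangle^{\perp}$, and for $A \subseteq \mathbb{R}^{d-1}$, $B \subseteq \mathbb{R}$ set $A \oplus_{e} B = \{O_{e}(a) + b e : a \in A, b \in B\}$. Fix an orthonormal basis $e_{1},\dots,e_{d-1}$ of $\mathbb{R}^{d-1}$ and let $Q(y,r) = \{x \in \mathbb{R}^{d-1} : \max_{i} |\langle x - y, e_{i}\rangle| < r/2\}$. For $e \in S^{d-1}$, bounded open $A \subseteq \mathbb{R}^{d-1}$ and $h > 0$: $\tilde{\varphi}^{\omega}(e,A,h) = \inf\{ \mathcal{F}^{\omega}(u; A \oplus_{e}(-h,h)) : u \in H^{1}(A\oplus_{e}(-h,h);[-1,1]),\ u - q_{e} \in H^{1}_{0}(A \oplus_{e}(-h,h))\}$ and $\tilde{\varphi}^{\omega}_{\infty}(e,A) = \min\{ \mathcal{F}^{\omega}(u; A \oplus_{e} \mathbb{R}) : u \in H^{1}_{\mathrm{loc}}(A\oplus_{e}\mathbb{R}),\ -1 \leq u \leq 1,\ u - q_{e} \in H^{1}_{0}(A \oplus_{e} \mathbb{R})\}$. $\Sigma_{e}$ is the sub-$\sigma$-algebra of $\mathscr{B}$ generated by events $E$ with $\tau_{x}^{-1}(E) = E$ for all $x \in \langle e \rangle^{\perp}$. *)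

theory Defs
  imports "HOL-Analysis.Analysis" "HOL-Probability.Probability"
begin

coinductive smooth_fn :: "('a::real_normed_vector \<Rightarrow> real) \<Rightarrow> bool" where
  "(\<forall>x. f differentiable (at x)) \<Longrightarrow>
   (\<forall>v. smooth_fn (\<lambda>x. frechet_derivative f (at x) v)) \<Longrightarrow> smooth_fn f"

definition tsupport :: "('a::real_normed_vector \<Rightarrow> real) \<Rightarrow> 'a set" where
  "tsupport f = closure {x. f x \<noteq> 0}"

definition test_fn :: "'a::euclidean_space set \<Rightarrow> ('a \<Rightarrow> real) \<Rightarrow> bool" where
  "test_fn A \<psi> \<longleftrightarrow> smooth_fn \<psi> \<and> compact (tsupport \<psi>) \<and> tsupport \<psi> \<subseteq> A"

definition grad_fn :: "('a::euclidean_space \<Rightarrow> real) \<Rightarrow> 'a \<Rightarrow> 'a" where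
  "grad_fn \<psi> x = (\<Sum>b\<in>Basis. frechet_derivative \<psi> (at x) b *\<^sub>R b)"

definition L2loc :: "'a::euclidean_space set \<Rightarrow> ('a \<Rightarrow> real) \<Rightarrow> bool" where
  "L2loc A f \<longleftrightarrow> (\<lambda>x. indicator A x * f x) \<in> borel_measurable lebesgue \<and>
     (\<forall>K. compact K \<and> K \<subseteq> A \<longrightarrow> integrable lebesgue (\<lambda>x. indicator K x * (f x)\<^sup>2))"

definition L2loc_vec :: "'a::euclidean_space set \<Rightarrow> ('a \<Rightarrow> 'a) \<Rightarrow> bool" where
  "L2loc_vec A G \<longleftrightarrow> (\<lambda>x. indicator A x *\<^sub>R G x) \<in> borel_measurable lebesgue \<and>
     (\<forall>K. compact K \<and> K \<subseteq> A \<longrightarrow> integrable lebesgue (\<lambda>x. indicator K x * (norm (G x))\<^sup>2))"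

definition weak_grad :: "'a::euclidean_space set \<Rightarrow> ('a \<Rightarrow> real) \<Rightarrow> ('a \<Rightarrow> 'a) \<Rightarrow> bool" where
  "weak_grad A u G \<longleftrightarrow> (\<forall>\<psi> v. test_fn A \<psi> \<longrightarrow>
      integral\<^sup>L lebesgue (\<lambda>x. indicator A x * u x * frechet_derivative \<psi> (at x) v)
      = - integral\<^sup>L lebesgue (\<lambda>x. indicator A x * (G x \<bullet> v) * \<psi> x))"

definition H1loc :: "'a::euclidean_space set \<Rightarrow> ('a \<Rightarrow> real) \<Rightarrow> ('a \<Rightarrow> 'a) \<Rightarrow> bool" where
  "H1loc A u G \<longleftrightarrow> L2loc A u \<and> L2loc_vec A G \<and> weak_grad A u G"

definition H1 :: "'a::euclidean_space set \<Rightarrow> ('a \<Rightarrow> real) \<Rightarrow> ('a \<Rightarrow> 'a) \<Rightarrow> bool" where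
  "H1 A u G \<longleftrightarrow> H1loc A u G \<and>
     integrable lebesgue (\<lambda>x. indicator A x * (u x)\<^sup>2) \<and>
     integrable lebesgue (\<lambda>x. indicator A x * (norm (G x))\<^sup>2)"

definition H10 :: "'a::euclidean_space set \<Rightarrow> ('a \<Rightarrow> real) \<Rightarrow> ('a \<Rightarrow> 'a) \<Rightarrow> bool" where
  "H10 A w G \<longleftrightarrow> H1 A w G \<and> (\<exists>\<psi>s. (\<forall>n. test_fn A (\<psi>s n)) \<and>
     (\<lambda>n. integral\<^sup>L lebesgue (\<lambda>x. indicator A x *
          ((w x - \<psi>s n x)\<^sup>2 + (norm (G x - grad_fn (\<psi>s n) x))\<^sup>2))) \<longlonglongrightarrow> 0)"

text \<open>Elements are represented by their (unique) convex one-homogeneous extension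
  to the whole space; the restriction to the unit sphere is the function of the paper.\<close>
definition Fclass :: "real \<Rightarrow> real \<Rightarrow> ('d::euclidean_space \<Rightarrow> real) set" where
  "Fclass lam Lam = {\<psi>. continuous_on (sphere 0 1) \<psi> \<and> convex_on UNIV \<psi> \<and>
      (\<forall>p t. t \<ge> 0 \<longrightarrow> \<psi> (t *\<^sub>R p) = t * \<psi> p) \<and>
      (\<forall>p\<in>sphere 0 1. sqrt lam \<le> \<psi> p \<and> \<psi> p \<le> sqrt Lam)}"

definition supdist :: "('d::euclidean_space \<Rightarrow> real) \<Rightarrow> ('d \<Rightarrow> real) \<Rightarrow> real" where
  "supdist f g = (SUP p\<in>sphere 0 1. \<bar>f p - g p\<bar>)"

definition Fopen :: "real \<Rightarrow> real \<Rightarrow> ('d::euclidean_space \<Rightarrow> real) set set" where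
  "Fopen lam Lam = {U. U \<subseteq> Fclass lam Lam \<and>
      (\<forall>f\<in>U. \<exists>\<epsilon>>0. \<forall>g\<in>Fclass lam Lam. supdist f g < \<epsilon> \<longrightarrow> g \<in> U)}"

definition Fmeas :: "real \<Rightarrow> real \<Rightarrow> ('d::euclidean_space \<Rightarrow> real) measure" where
  "Fmeas lam Lam = sigma (Fclass lam Lam) (Fopen lam Lam)"

text \<open>B e plays the role of the images O_e(e_1), ..., O_e(e_{d-1}) of the fixed
  orthonormal basis of R^{d-1}: an orthonormal basis of the orthogonal complement of e.
  cyl B e R h = Q(0,R) (+)_e (-h,h), cyl_inf B e R = Q(0,R) (+)_e R.\<close>
definition cyl :: "('d::euclidean_space \<Rightarrow> 'd set) \<Rightarrow> 'd \<Rightarrow> real \<Rightarrow> real \<Rightarrow> 'd set" where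
  "cyl B e R h = {x. (\<forall>b\<in>B e. \<bar>x \<bullet> b\<bar> < R / 2) \<and> \<bar>x \<bullet> e\<bar> < h}"

definition cyl_inf :: "('d::euclidean_space \<Rightarrow> 'd set) \<Rightarrow> 'd \<Rightarrow> real \<Rightarrow> 'd set" where
  "cyl_inf B e R = {x. \<forall>b\<in>B e. \<bar>x \<bullet> b\<bar> < R / 2}"

definition energy :: "('w \<Rightarrow> 'd \<Rightarrow> real) \<Rightarrow> ('d \<Rightarrow> 'w \<Rightarrow> 'w) \<Rightarrow> (real \<Rightarrow> real) \<Rightarrow> 'w
     \<Rightarrow> 'd::euclidean_space set \<Rightarrow> ('d \<Rightarrow> real) \<Rightarrow> ('d \<Rightarrow> 'd) \<Rightarrow> ennreal" where
  "energy \<Phi> \<tau> W \<omega> A u G =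
     (\<integral>\<^sup>+ x. ennreal (indicator A x * (1/2 * (\<Phi> (\<tau> x \<omega>) (G x))\<^sup>2 + W (u x))) \<partial>lebesgue)"

definition phi_fin :: "('w \<Rightarrow> 'd \<Rightarrow> real) \<Rightarrow> ('d \<Rightarrow> 'w \<Rightarrow> 'w) \<Rightarrow> (real \<Rightarrow> real) \<Rightarrow> (real \<Rightarrow> real)
     \<Rightarrow> ('d::euclidean_space \<Rightarrow> 'd set) \<Rightarrow> 'w \<Rightarrow> 'd \<Rightarrow> real \<Rightarrow> real \<Rightarrow> ennreal" where
  "phi_fin \<Phi> \<tau> W q B \<omega> e R h =
     (let D = cyl B e R h in
      INF uG \<in> {(u, G). H1 D u G \<and> (\<forall>x\<in>D. -1 \<le> u x \<and> u x \<le> 1) \<and>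
                 H10 D (\<lambda>x. u x - q (x \<bullet> e)) (\<lambda>x. G x - deriv q (x \<bullet> e) *\<^sub>R e)}.
        energy \<Phi> \<tau> W \<omega> D (fst uG) (snd uG))"

definition phi_inf :: "('w \<Rightarrow> 'd \<Rightarrow> real) \<Rightarrow> ('d \<Rightarrow> 'w \<Rightarrow> 'w) \<Rightarrow> (real \<Rightarrow> real) \<Rightarrow> (real \<Rightarrow> real)
     \<Rightarrow> ('d::euclidean_space \<Rightarrow> 'd set) \<Rightarrow> 'w \<Rightarrow> 'd \<Rightarrow> real \<Rightarrow> ennreal" where
  "phi_inf \<Phi> \<tau> W q B \<omega> e R =
     (let D = cyl_inf B e R in
      INF uG \<in> {(u, G). H1loc D u G \<and> (\<forall>x\<in>D. -1 \<le> u x \<and> u x \<le> 1) \<and>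
                 H10 D (\<lambda>x. u x - q (x \<bullet> e)) (\<lambda>x. G x - deriv q (x \<bullet> e) *\<^sub>R e)}.
        energy \<Phi> \<tau> W \<omega> D (fst uG) (snd uG))"

definition Sigma_e :: "'w measure \<Rightarrow> ('d::euclidean_space \<Rightarrow> 'w \<Rightarrow> 'w) \<Rightarrow> 'd \<Rightarrow> 'w set set" where
  "Sigma_e M \<tau> e = sigma_sets (space M)
     {E \<in> sets M. \<forall>x. x \<bullet> e = 0 \<longrightarrow> \<tau> x -` E \<inter> space M = E}"

end

theory Submission
  imports Defs "HOL-Computational_Algebra.Polynomial"
begin

text \<open>
  On a cube the cell energy is subadditive up to the energy of the planar profile on the uncovered
  part, so a multiparameter subadditive ergodic theorem for the translations orthogonal to \<open>e\<close>
  applies, both to the infinite cylinder and to cylinders of finite height. The upper bound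
  \<open>\<integral> limsup \<le> inf\<close> comes from averaging over a grid of cells; the lower bound on the liminf from
  a Vitali covering by cubes of small energy. The action orthogonal to \<open>e\<close> need not be ergodic, but
  the limsup for the infinite cylinder is also invariant under translations along \<open>e\<close>: bending
  the boundary profile near the lateral boundary costs only a surface term. Ergodicity of the full
  action then forces the limit to be the infimum of the normalised mean energies. Finite and infinite
  heights differ, uniformly in the size of the cube, by the tail energy of \<open>q\<close>.
\<close>

text \<open>The event has to be exactly invariant under translations orthogonal to \<open>e\<close>,
  not merely up to null sets. Hence no abstract limit function occurs: two explicit functions,
  \<open>lower UNIV\<close> and \<open>upper_tail\<close>, are invariant at every point, and the
  event is where \<open>rate \<le> lower UNIV\<close> and \<open>upper_tail \<le> rate\<close>. All
  four limits follow from these inequalities pointwise. The reason is that energies are nearly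
  decreasing in the height: filling up with the planar profile costs at most \<open>tail h\<close>
  per unit area, so the infimum over \<open>h\<close> of limsup plus tail controls all large heights
  at once. The two kinds of cylinder complement each other. Invariance along \<open>e\<close> makes
  sense only at infinite height; measurability is obtained in bounded domains, where the competitors
  form a separable set. A cutoff in the direction \<open>e\<close> connects them. For the liminf,
  suppose that cubes of energy below the rate were frequent. Completed by cells of one fixed size,
  whose mean excess over the rate is small because the limsup is at most the rate, they would fill a
  large cube with mean energy below the infimum of all means.\<close>

lemma ennreal_minus_le_iff_add:
 "a - ennreal e \<le> b \<longleftrightarrow> a \<le> b + ennreal e"
 using ennreal_minus_le_iff[of a "ennreal e" b] by (metis add.commute ennreal_neq_top)

lemma Limsup_ennreal_leI:
 fixes f :: "'a \<Rightarrow> ennreal"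
 assumes "\<And>\<epsilon>::real. 0 < \<epsilon> \<Longrightarrow> eventually (\<lambda>x. f x \<le> c + ennreal \<epsilon>) F"
 shows "Limsup F f \<le> c"
proof (rule ennreal_le_epsilon)
 fix \<epsilon> :: real assume "0 < \<epsilon>"
 then show "Limsup F f \<le> c + ennreal \<epsilon>" using assms by (intro Limsup_bounded) auto
qed

lemma eventually_le_Limsup_ennreal:
 fixes f :: "'a \<Rightarrow> ennreal"
 assumes "0 < \<epsilon>"
 shows "eventually (\<lambda>x. f x \<le> Limsup F f + ennreal \<epsilon>) F"
proof (cases "Limsup F f = \<top>")
 case False
 then obtain r where r: "0 \<le> r" "Limsup F f = ennreal r" by (cases "Limsup F f") auto
 have "ennreal r < ennreal (r + \<epsilon>)" using assms r by (intro ennreal_lessI) auto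
 then have "Limsup F f < Limsup F f + ennreal \<epsilon>"
  using r assms by (simp add: ennreal_plus)
 then have "eventually (\<lambda>x. f x < Limsup F f + ennreal \<epsilon>) F" by (rule Limsup_lessD)
 then show ?thesis by (rule eventually_mono) (rule less_imp_le)
qed simp

lemma Liminf_ennreal_geI:
 fixes f :: "'a \<Rightarrow> ennreal"
 assumes "\<And>\<epsilon>::real. 0 < \<epsilon> \<Longrightarrow> eventually (\<lambda>x. c \<le> f x + ennreal \<epsilon>) F"
 shows "c \<le> Liminf F f"
proof (rule ennreal_le_epsilon)
 fix \<epsilon> :: real assume e: "0 < \<epsilon>"
 have "c - ennreal \<epsilon> \<le> Liminf F f"
  unfolding ennreal_minus_le_iff_add[symmetric] using assms[OF e]
  by (intro Liminf_bounded) (simp add: ennreal_minus_le_iff_add)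
 then show "c \<le> Liminf F f + ennreal \<epsilon>" by (simp only: ennreal_minus_le_iff_add)
qed

text \<open>Finiteness is essential: for f x tending to infinity through finite values, an infinite
  liminf never lies below f x plus a constant.\<close>

lemma eventually_Liminf_le_ennreal:
 fixes f :: "'a \<Rightarrow> ennreal"
 assumes "0 < \<epsilon>" "Liminf F f < \<top>"
 shows "eventually (\<lambda>x. Liminf F f \<le> f x + ennreal \<epsilon>) F"
proof (cases "Liminf F f = 0")
 case False
 then have "Liminf F f - ennreal \<epsilon> < Liminf F f"
  using assms by (intro ennreal_between) (auto simp: zero_less_iff_neq_zero)
 then have "eventually (\<lambda>x. Liminf F f - ennreal \<epsilon> < f x) F" by (rule less_LiminfD)
 then show ?thesis by (rule eventually_mono) (simp only: ennreal_minus_le_iff_add[symmetric] less_imp_le)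
qed simp

lemma Limsup_ennreal_add_le:
 fixes f g :: "'a \<Rightarrow> ennreal"
 shows "Limsup F (\<lambda>x. f x + g x) \<le> Limsup F f + Limsup F g"
proof (rule Limsup_ennreal_leI)
 fix \<epsilon> :: real assume e: "0 < \<epsilon>"
 then have h: "0 < \<epsilon> / 2" by simp
 show "eventually (\<lambda>x. f x + g x \<le> Limsup F f + Limsup F g + ennreal \<epsilon>) F"
  using eventually_le_Limsup_ennreal[OF h, of f F] eventually_le_Limsup_ennreal[OF h, of g F]
 proof eventually_elim
  case (elim x)
  have "f x + g x \<le> (Limsup F f + ennreal (\<epsilon>/2)) + (Limsup F g + ennreal (\<epsilon>/2))"
   using elim by (rule add_mono)
  also have "\<dots> = Limsup F f + Limsup F g + (ennreal (\<epsilon>/2) + ennreal (\<epsilon>/2))" by (simp add: ac_simps)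
  also have "ennreal (\<epsilon>/2) + ennreal (\<epsilon>/2) = ennreal \<epsilon>" using e by (simp flip: ennreal_plus)
  finally show ?case .
 qed
qed

section \<open>Ergodic averages\<close>

lemma measure_preserving_funpow:
 assumes T: "T \<in> M \<rightarrow>\<^sub>M M" and "distr M M T = M"
 shows "T ^^ i \<in> M \<rightarrow>\<^sub>M M" "distr M M (T ^^ i) = M"
proof -
 show m: "T ^^ i \<in> M \<rightarrow>\<^sub>M M" for i
  using T by (rule measurable_compose_n)
 show "distr M M (T ^^ i) = M"
 proof (induction i)
  case 0
  have "distr M M (\<lambda>x. x) = M" by (rule distr_id)
  then show ?case by (simp add: id_def)
 next
  case (Suc i)
  have "distr M M (T ^^ Suc i) = distr (distr M M (T ^^ i)) M T"
   using distr_distr[OF T m[of i], symmetric] by simp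
  also have "\<dots> = M" using Suc assms(2) by simp
  finally show ?case .
 qed
qed

text \<open>The greedy argument of Katznelson and Weiss. The limsup F of the averages does not
  decrease along orbits, so a long orbit segment can be cut into blocks on each of which the average
  of f is at least about F at the starting point. Points that need a block longer than K form a set
  of small measure, on which f is raised. Integrating over the segment and using invariance of the
  measure bounds the integral of F by that of f.\<close>

lemma (in prob_space) nn_integral_limsup_average_le:
 fixes f :: "'a \<Rightarrow> real"
 assumes T: "T \<in> M \<rightarrow>\<^sub>M M" and dT: "distr M M T = M"
  and f [measurable]: "f \<in> borel_measurable M"
  and f0: "\<And>x. x \<in> space M \<Longrightarrow> 0 \<le> f x" and fC: "\<And>x. x \<in> space M \<Longrightarrow> f x \<le> C"
 shows "(\<integral>\<^sup>+x. limsup (\<lambda>N. ennreal ((\<Sum>i<N. f ((T ^^ i) x)) / real N)) \<partial>M) \<le> (\<integral>\<^sup>+x. ennreal (f x) \<partial>M)"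
proof -
 obtain x0 where x0: "x0 \<in> space M" using not_empty by blast
 have C0: "0 \<le> C" using f0[OF x0] fC[OF x0] by simp
 note Tm [measurable] = measure_preserving_funpow(1)[OF T dT]
 have Tsp: "(T ^^ i) x \<in> space M" if "x \<in> space M" for i x
  using measurable_space[OF Tm that] .
 define S where "S = (\<lambda>N x. \<Sum>i<N. f ((T ^^ i) x))"
 have Sm [measurable]: "S N \<in> borel_measurable M" for N unfolding S_def by measurable
 have S0: "0 \<le> S N x" if "x \<in> space M" for N x
  unfolding S_def by (intro sum_nonneg f0 Tsp that)
 have SC: "S N x \<le> N * C" if "x \<in> space M" for N x
  unfolding S_def using sum_bounded_above[of "{..<N}" "\<lambda>i. f ((T ^^ i) x)" C] fC[OF Tsp[OF that]] by auto
 define L where "L = (\<lambda>x. limsup (\<lambda>N. ennreal (S N x / real N)))"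
 have Lm [measurable]: "L \<in> borel_measurable M" unfolding L_def by measurable
 have LC: "L x \<le> ennreal C" if "x \<in> space M" for x
 proof -
  have "S N x / real N \<le> C" for N
   using SC[OF that, of N] C0 by (cases "N = 0") (auto simp: field_simps)
  then show ?thesis unfolding L_def
   by (intro Limsup_bounded always_eventually allI ennreal_leI)
 qed
 define F where "F = (\<lambda>x. enn2real (L x))"
 have Fm [measurable]: "F \<in> borel_measurable M" unfolding F_def by measurable
 have FL: "ennreal (F x) = L x" if "x \<in> space M" for x
  unfolding F_def using LC[OF that] by (intro ennreal_enn2real) (simp add: order_le_less_trans)
 have F0: "0 \<le> F x" for x unfolding F_def by simp
 have FC: "F x \<le> C" if "x \<in> space M" for x
  using FL[OF that] LC[OF that] C0 by (metis ennreal_le_iff)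
 have S_split: "S (a + b) x = S a x + S b ((T ^^ a) x)" for a b x
 proof -
  have "(\<Sum>i<a+b. f ((T ^^ i) x)) = (\<Sum>i<a. f ((T ^^ i) x)) + (\<Sum>i<b. f ((T ^^ (i + a)) x))"
   using sum.atLeastLessThan_shift_bounds[of "\<lambda>i. f ((T ^^ i) x)" 0 a b]
    sum.atLeastLessThan_concat[of 0 a "a+b" "\<lambda>i. f ((T ^^ i) x)"]
   by (simp add: lessThan_atLeast0 add.commute)
  then show ?thesis by (simp add: S_def funpow_add)
 qed
 \<comment> \<open>Moving the start by one step drops one bounded term and changes the length by
   one. Only this inequality is needed, since the greedy cutting moves forward along the
   orbit.\<close>
 have L_T: "L x \<le> L (T x)" if x: "x \<in> space M" for x
 proof -
  have Tx: "T x \<in> space M" using Tsp[OF x, of 1] by simp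
  have "ennreal (S (Suc N) x / real (Suc N)) \<le> ennreal (C / real (Suc N)) + ennreal (S N (T x) / real N)" for N
  proof -
   have "S (Suc N) x = f x + S N (T x)" using S_split[of 1 N x] by (simp add: S_def)
   also have "\<dots> / real (Suc N) \<le> C / real (Suc N) + S N (T x) / real N"
   proof (cases "N = 0")
    case True
    then show ?thesis using fC[OF x] by (simp add: S_def)
   next
    case False
    have "f x / real (Suc N) \<le> C / real (Suc N)" using fC[OF x] by (simp add: divide_right_mono)
    moreover have "S N (T x) / real (Suc N) \<le> S N (T x) / real N"
     using False S0[OF Tx] by (intro divide_left_mono) auto
    ultimately show ?thesis by (simp add: add_divide_distrib)
   qed
   finally have "ennreal (S (Suc N) x / real (Suc N)) \<le> ennreal (C / real (Suc N) + S N (T x) / real N)"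
    by (rule ennreal_leI)
   then show ?thesis using C0 S0[OF Tx] by (subst (asm) ennreal_plus) auto
  qed
  then have "limsup (\<lambda>N. ennreal (S (Suc N) x / real (Suc N)))
    \<le> limsup (\<lambda>N. ennreal (C / real (Suc N)) + ennreal (S N (T x) / real N))"
   by (intro Limsup_mono) auto
  also have "\<dots> \<le> limsup (\<lambda>N. ennreal (C / real (Suc N))) + limsup (\<lambda>N. ennreal (S N (T x) / real N))"
   by (rule Limsup_ennreal_add_le)
  also have "limsup (\<lambda>N. ennreal (C / real (Suc N))) = 0"
  proof (rule lim_imp_Limsup)
   have "(\<lambda>N. C / real (Suc N)) \<longlonglongrightarrow> 0"
    by (rule LIMSEQ_Suc[OF lim_const_over_n])
   then show "(\<lambda>N. ennreal (C / real (Suc N))) \<longlonglongrightarrow> 0"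
    using tendsto_ennrealI[of _ 0] by (simp only: ennreal_0)
  qed simp
  finally show ?thesis unfolding L_def
   using limsup_shift[of "\<lambda>N. ennreal (S N x / real N)"] by simp
 qed
 have F_T: "F x \<le> F ((T ^^ i) x)" if x: "x \<in> space M" for x i
 proof (induction i)
  case (Suc i)
  have "ennreal (F ((T ^^ i) x)) \<le> ennreal (F ((T ^^ Suc i) x))"
   using L_T[OF Tsp[OF x, of i]] FL[OF Tsp[OF x, of i]] FL[OF Tsp[OF x, of "Suc i"]] by simp
  then show ?case using Suc F0 by simp
 qed simp
 have main: "(\<integral>\<^sup>+x. L x \<partial>M) \<le> (\<integral>\<^sup>+x. ennreal (f x) \<partial>M) + ennreal \<epsilon>" if eps: "\<epsilon> > 0" for \<epsilon>
 proof -
  \<comment> \<open>The final loss is \<delta> for lowering the threshold plus C \<delta> for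
    raising f on a set of measure below \<delta>.\<close>
  define \<delta> where "\<delta> = \<epsilon> / (1 + C)"
  have d0: "\<delta> > 0" using eps C0 by (simp add: \<delta>_def)
  have ex: "\<exists>N\<ge>1. S N x \<ge> N * (F x - \<delta>)" if x: "x \<in> space M" for x
  proof (rule ccontr)
   assume "\<not> ?thesis"
   then have *: "S N x < N * (F x - \<delta>)" if "N \<ge> 1" for N using that by force
   have "eventually (\<lambda>N. ennreal (S N x / real N) \<le> ennreal (F x - \<delta>)) sequentially"
    using eventually_ge_at_top[of 1]
   proof eventually_elim
    case (elim N)
    then have "S N x / real N \<le> F x - \<delta>" using *[of N] by (simp add: field_simps)
    then show ?case by (rule ennreal_leI)
   qed
   then have "L x \<le> ennreal (F x - \<delta>)" unfolding L_def by (rule Limsup_bounded)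
   moreover have "ennreal (F x - \<delta>) < ennreal (F x)"
   proof -
    have "0 < F x - \<delta>" using *[of 1] S0[OF x, of 1] by simp
    then show ?thesis using d0 by (simp add: ennreal_less_iff)
   qed
   ultimately show False using FL[OF x] by simp
  qed
  define Bad where "Bad = (\<lambda>K. {x \<in> space M. \<forall>N\<in>{1..K}. S N x < N * (F x - \<delta>)})"
  have Badm [measurable]: "Bad K \<in> sets M" for K unfolding Bad_def by measurable
  have "(\<lambda>K. measure M (Bad K)) \<longlonglongrightarrow> measure M (\<Inter>K. Bad K)"
   by (intro finite_Lim_measure_decseq) (auto simp: decseq_def Bad_def)
  moreover have "(\<Inter>K. Bad K) = {}"
  proof (safe, goal_cases)
   case (1 x)
   then have x: "x \<in> space M" by (auto simp: Bad_def)
   obtain N where "N \<ge> 1" "S N x \<ge> N * (F x - \<delta>)" using ex[OF x] by blast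
   moreover have "x \<in> Bad N" using 1 by blast
   ultimately show ?case unfolding Bad_def by force
  qed
  ultimately have "(\<lambda>K. measure M (Bad K)) \<longlonglongrightarrow> 0" by simp
  then have "eventually (\<lambda>K. measure M (Bad K) < \<delta>) sequentially"
   using d0 by (rule order_tendstoD)
  then obtain K where K: "measure M (Bad K) < \<delta>" by (auto simp: eventually_sequentially)
  \<comment> \<open>On \<open>Bad K\<close> the raised function is at least C, hence above every
    threshold, so that a block of length one suffices there.\<close>
  define g where "g = (\<lambda>x. f x + C * indicator (Bad K) x)"
  have gm [measurable]: "g \<in> borel_measurable M" unfolding g_def by measurable
  have g0: "0 \<le> g x" and gf: "f x \<le> g x" if "x \<in> space M" for x
   using f0[OF that] C0 by (auto simp: g_def)
  define Sg where "Sg = (\<lambda>N x. \<Sum>i<N. g ((T ^^ i) x))"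
  have Sg0: "0 \<le> Sg N x" if "x \<in> space M" for N x
   unfolding Sg_def by (intro sum_nonneg g0 Tsp that)
  have Sg_split: "Sg (a + b) x = Sg a x + Sg b ((T ^^ a) x)" for a b x
  proof -
   have "(\<Sum>i<a+b. g ((T ^^ i) x)) = (\<Sum>i<a. g ((T ^^ i) x)) + (\<Sum>i<b. g ((T ^^ (i + a)) x))"
    using sum.atLeastLessThan_shift_bounds[of "\<lambda>i. g ((T ^^ i) x)" 0 a b]
     sum.atLeastLessThan_concat[of 0 a "a+b" "\<lambda>i. g ((T ^^ i) x)"]
    by (simp add: lessThan_atLeast0 add.commute)
   then show ?thesis by (simp add: Sg_def funpow_add)
  qed
  \<comment> \<open>The last K steps of the segment may hold no complete block; they are given up,
    which is the term - K. The level a is a free parameter so that the induction hypothesis can be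
    applied at a later point of the orbit with the same level.\<close>
  have greedy: "(real m - real K) * a \<le> Sg m x" if "x \<in> space M" "0 \<le> a" "a \<le> max 0 (F x - \<delta>)" for m x a
   using that
  proof (induction m arbitrary: x rule: less_induct)
   case (less m x)
   note x = less.prems(1)
   show ?case
   proof (cases "m \<le> K")
    case True
    then have "(real m - real K) * a \<le> 0" using less.prems by (simp add: mult_nonpos_nonneg)
    then show ?thesis using Sg0[OF x, of m] by simp
   next
    case False
    have step: "\<exists>N. 1 \<le> N \<and> N \<le> max 1 K \<and> N \<le> m \<and> real N * a \<le> Sg N x"
    proof (cases "x \<in> Bad K")
     case True
     have "a \<le> C" using less.prems FC[OF x] d0 C0 by auto
     then have "real 1 * a \<le> Sg 1 x" using True f0[OF x] by (simp add: Sg_def g_def)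
     then show ?thesis using False by (intro exI[of _ 1]) auto
    next
     case nb: False
     then obtain N where N: "1 \<le> N" "N \<le> K" "S N x \<ge> N * (F x - \<delta>)"
      using x unfolding Bad_def by force
     have "real N * a \<le> S N x"
     proof (cases "F x - \<delta> \<ge> 0")
      case True
      then have "real N * a \<le> real N * (F x - \<delta>)" using less.prems by (intro mult_left_mono) auto
      then show ?thesis using N(3) by linarith
     next
      case False
      then show ?thesis using less.prems S0[OF x] by simp
     qed
     also have "S N x \<le> Sg N x"
      unfolding S_def Sg_def by (intro sum_mono gf Tsp x)
     finally show ?thesis using N False by (intro exI[of _ N]) auto
    qed
    then obtain N where N: "1 \<le> N" "N \<le> m" "real N * a \<le> Sg N x" by blast
    \<comment> \<open>The level stays admissible at the end of the block because F does not decrease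
      along the orbit.\<close>
    have "a \<le> max 0 (F ((T ^^ N) x) - \<delta>)" using less.prems F_T[OF x, of N] by auto
    then have "(real (m - N) - real K) * a \<le> Sg (m - N) ((T ^^ N) x)"
     using N less.prems by (intro less.IH Tsp) auto
    then have "(real m - real K) * a \<le> Sg N x + Sg (m - N) ((T ^^ N) x)"
     using N by (simp add: of_nat_diff algebra_simps)
    then show ?thesis using Sg_split[of N "m - N" x] N by simp
   qed
  qed
  define h where "h = (\<lambda>x. max 0 (F x - \<delta>))"
  have hm [measurable]: "h \<in> borel_measurable M" unfolding h_def by measurable
  have ig: "integrable M g"
  proof (rule integrable_const_bound[of _ "2 * C"])
   show "AE x in M. norm (g x) \<le> 2 * C"
   proof (rule AE_I2)
    fix x assume "x \<in> space M"
    then show "norm (g x) \<le> 2 * C" using f0[of x] fC[of x] C0 by (simp add: g_def indicator_def)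
   qed
  qed measurable
  have ih: "integrable M h"
  proof (rule integrable_const_bound[of _ C])
   show "AE x in M. norm (h x) \<le> C"
   proof (rule AE_I2)
    fix x assume "x \<in> space M"
    then show "norm (h x) \<le> C" using FC[of x] C0 d0 by (simp add: h_def)
   qed
  qed measurable
  have iF: "integrable M F"
   by (rule integrable_const_bound[of _ C]) (use FC F0 in \<open>auto intro!: AE_I2\<close>)
  have ifn: "integrable M f"
   by (rule integrable_const_bound[of _ C]) (use fC f0 in \<open>auto intro!: AE_I2\<close>)
  have igT: "integrable M (\<lambda>x. g ((T ^^ i) x))" "(\<integral>x. g ((T ^^ i) x) \<partial>M) = (\<integral>x. g x \<partial>M)" for i
   using integrable_distr_eq[OF Tm[of i] gm] integral_distr[OF Tm[of i] gm]
    measure_preserving_funpow(2)[OF T dT, of i] ig by auto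
  have ineq: "(real m - real K) * (\<integral>x. h x \<partial>M) \<le> m * (\<integral>x. g x \<partial>M)" for m
  proof -
   have "(\<integral>x. (real m - real K) * h x \<partial>M) \<le> (\<integral>x. Sg m x \<partial>M)"
    unfolding Sg_def
    by (intro integral_mono integrable_mult_right ih Bochner_Integration.integrable_sum igT)
      (use greedy in \<open>auto simp: h_def Sg_def\<close>)
   also have "\<dots> = m * (\<integral>x. g x \<partial>M)"
    unfolding Sg_def by (subst Bochner_Integration.integral_sum) (auto simp: igT)
   finally show ?thesis by simp
  qed
  have "(\<integral>x. h x \<partial>M) \<le> (\<integral>x. g x \<partial>M)"
  proof (rule LIMSEQ_le_const2)
   have "(\<lambda>m. real K / real m) \<longlonglongrightarrow> 0" by (rule lim_const_over_n)
   then have "(\<lambda>m. (1 - real K / real m) * (\<integral>x. h x \<partial>M)) \<longlonglongrightarrow> (1 - 0) * (\<integral>x. h x \<partial>M)"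
    by (intro tendsto_intros)
   then show "(\<lambda>m. (1 - real K / real m) * (\<integral>x. h x \<partial>M)) \<longlonglongrightarrow> (\<integral>x. h x \<partial>M)" by simp
   show "\<exists>N. \<forall>m\<ge>N. (1 - real K / real m) * (\<integral>x. h x \<partial>M) \<le> (\<integral>x. g x \<partial>M)"
   proof (intro exI[of _ 1] allI impI)
    fix m :: nat assume "1 \<le> m"
    then show "(1 - real K / real m) * (\<integral>x. h x \<partial>M) \<le> (\<integral>x. g x \<partial>M)"
     using ineq[of m] by (simp add: field_simps)
   qed
  qed
  also have "(\<integral>x. g x \<partial>M) = (\<integral>x. f x \<partial>M) + C * measure M (Bad K)"
  proof -
   have "integrable M (\<lambda>x. C * indicator (Bad K) x :: real)"
    by (intro integrable_mult_right integrable_real_indicator) (auto simp: emeasure_eq_measure)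
   then show ?thesis unfolding g_def using ifn
    by (subst Bochner_Integration.integral_add) auto
  qed
  also have "\<dots> \<le> (\<integral>x. f x \<partial>M) + C * \<delta>" using K C0 by (simp add: mult_left_mono)
  finally have "(\<integral>x. h x \<partial>M) \<le> (\<integral>x. f x \<partial>M) + C * \<delta>" .
  moreover have "(\<integral>x. F x \<partial>M) - \<delta> \<le> (\<integral>x. h x \<partial>M)"
  proof -
   have "(\<integral>x. F x - \<delta> \<partial>M) \<le> (\<integral>x. h x \<partial>M)"
    using iF ih by (intro integral_mono) (auto simp: h_def)
   then show ?thesis using iF by (simp add: prob_space)
  qed
  ultimately have "(\<integral>x. F x \<partial>M) \<le> (\<integral>x. f x \<partial>M) + (1 + C) * \<delta>" by (simp add: algebra_simps)
  then have *: "(\<integral>x. F x \<partial>M) \<le> (\<integral>x. f x \<partial>M) + \<epsilon>" using C0 by (simp add: \<delta>_def)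
  have "(\<integral>\<^sup>+x. L x \<partial>M) = (\<integral>\<^sup>+x. ennreal (F x) \<partial>M)"
   by (intro nn_integral_cong) (simp add: FL)
  also have "\<dots> = ennreal (\<integral>x. F x \<partial>M)"
   using iF F0 by (intro nn_integral_eq_integral) auto
  also have "\<dots> \<le> ennreal ((\<integral>x. f x \<partial>M) + \<epsilon>)" using * by (rule ennreal_leI)
  also have "\<dots> = ennreal (\<integral>x. f x \<partial>M) + ennreal \<epsilon>"
   using eps f0 by (intro ennreal_plus Bochner_Integration.integral_nonneg_AE) auto
  also have "ennreal (\<integral>x. f x \<partial>M) = (\<integral>\<^sup>+x. ennreal (f x) \<partial>M)"
   using ifn f0 by (intro nn_integral_eq_integral[symmetric]) auto
  finally show ?thesis .
 qed
 have "(\<integral>\<^sup>+x. L x \<partial>M) \<le> (\<integral>\<^sup>+x. ennreal (f x) \<partial>M)"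
  by (rule ennreal_le_epsilon) (use main in auto)
 then show ?thesis by (simp add: L_def S_def)
qed

text \<open>The symmetric range consists of N forward steps from 0 and N backward steps from -1.
  Each half is a one-sided average, of f and of f composed with \<open>U (-1)\<close>, and both
  functions have the same integral. Symmetric ranges match cubes centred at the origin.\<close>

lemma (in prob_space) nn_integral_limsup_two_sided_average_le:
 fixes f :: "'a \<Rightarrow> real" and U :: "int \<Rightarrow> 'a \<Rightarrow> 'a"
 assumes U [measurable]: "\<And>i. U i \<in> M \<rightarrow>\<^sub>M M" and dU: "\<And>i. distr M M (U i) = M"
  and U_add: "\<And>i j x. x \<in> space M \<Longrightarrow> U (i + j) x = U i (U j x)"
  and U_0: "\<And>x. x \<in> space M \<Longrightarrow> U 0 x = x"
  and f [measurable]: "f \<in> borel_measurable M"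
  and f0: "\<And>x. x \<in> space M \<Longrightarrow> 0 \<le> f x" and fC: "\<And>x. x \<in> space M \<Longrightarrow> f x \<le> C"
 shows "(\<integral>\<^sup>+x. limsup (\<lambda>N. ennreal ((\<Sum>i\<in>{-int N..<int N}. f (U i x)) / (2 * real N))) \<partial>M) \<le> (\<integral>\<^sup>+x. ennreal (f x) \<partial>M)"
proof -
 have Usp: "U i x \<in> space M" if "x \<in> space M" for i x
  using measurable_space[OF U that] .
 have pow: "((U s) ^^ i) x = U (s * int i) x" if "x \<in> space M" for i x s
 proof (induction i)
  case (Suc i)
  then show ?case using that by (simp add: U_add[symmetric] distrib_left)
 qed (simp add: U_0 that)
 define g where "g = (\<lambda>x. f (U (-1) x))"
 have gm [measurable]: "g \<in> borel_measurable M" unfolding g_def by measurable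
 define a where "a = (\<lambda>N x. (\<Sum>i<N. f ((U 1 ^^ i) x)) / real N)"
 define b where "b = (\<lambda>N x. (\<Sum>i<N. g ((U (-1) ^^ i) x)) / real N)"
 note Um = measure_preserving_funpow(1)[OF U dU]
 have am [measurable]: "a N \<in> borel_measurable M" "b N \<in> borel_measurable M" for N
  unfolding a_def b_def using Um by measurable
 have eq: "(\<Sum>i\<in>{-int N..<int N}. f (U i x)) / (2 * real N) = a N x / 2 + b N x / 2"
  if x: "x \<in> space M" for N x
 proof -
  have "{-int N..<int N} = int ` {..<N} \<union> (\<lambda>i. - 1 - int i) ` {..<N}"
  proof (intro equalityI subsetI)
   fix i assume i: "i \<in> {-int N..<int N}"
   show "i \<in> int ` {..<N} \<union> (\<lambda>i. - 1 - int i) ` {..<N}"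
   proof (cases "i \<ge> 0")
    case True
    then show ?thesis using i by (auto simp: image_iff intro!: bexI[of _ "nat i"])
   next
    case False
    then have "i \<in> (\<lambda>i. - 1 - int i) ` {..<N}"
     using i by (intro image_eqI[of _ _ "nat (-1 - i)"]) auto
    then show ?thesis by simp
   qed
  qed auto
  then have "(\<Sum>i\<in>{-int N..<int N}. f (U i x))
    = (\<Sum>i\<in>int ` {..<N}. f (U i x)) + (\<Sum>i\<in>(\<lambda>i. - 1 - int i) ` {..<N}. f (U i x))"
   by (simp only:) (rule sum.union_disjoint; auto)
  also have "\<dots> = (\<Sum>i<N. f (U (int i) x)) + (\<Sum>i<N. f (U (- 1 - int i) x))"
   by (subst (1 2) sum.reindex) (auto simp: inj_on_def)
  also have "(\<Sum>i<N. f (U (int i) x)) = N * a N x" by (simp add: a_def pow x)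
  also have "(\<Sum>i<N. f (U (- 1 - int i) x)) = N * b N x"
   by (simp add: b_def g_def pow x U_add[symmetric])
  finally have *: "(\<Sum>i\<in>{-int N..<int N}. f (U i x)) = N * a N x + N * b N x" .
  show ?thesis
   unfolding * by (cases "N = 0") (auto simp: a_def b_def field_simps)
 qed
 have nn: "0 \<le> a N x" "0 \<le> b N x" if "x \<in> space M" for N x
  unfolding a_def b_def g_def
  by (auto intro!: divide_nonneg_nonneg sum_nonneg f0 Usp simp: pow that)
 have "(\<integral>\<^sup>+x. limsup (\<lambda>N. ennreal ((\<Sum>i\<in>{-int N..<int N}. f (U i x)) / (2 * real N))) \<partial>M)
   \<le> (\<integral>\<^sup>+x. ennreal (1/2) * limsup (\<lambda>N. ennreal (a N x)) + ennreal (1/2) * limsup (\<lambda>N. ennreal (b N x)) \<partial>M)"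
 proof (rule nn_integral_mono)
  fix x assume x: "x \<in> space M"
  have "ennreal (a N x / 2 + b N x / 2) = ennreal (1/2) * ennreal (a N x) + ennreal (1/2) * ennreal (b N x)" for N
  proof -
   have "ennreal (a N x / 2 + b N x / 2) = ennreal (a N x / 2) + ennreal (b N x / 2)"
    using nn[OF x] by (intro ennreal_plus) auto
   also have "ennreal (a N x / 2) = ennreal (1/2) * ennreal (a N x)"
    by (subst ennreal_mult'[symmetric]) auto
   also have "ennreal (b N x / 2) = ennreal (1/2) * ennreal (b N x)"
    by (subst ennreal_mult'[symmetric]) auto
   finally show ?thesis .
  qed
  then have "limsup (\<lambda>N. ennreal ((\<Sum>i\<in>{-int N..<int N}. f (U i x)) / (2 * real N)))
    = limsup (\<lambda>N. ennreal (1/2) * ennreal (a N x) + ennreal (1/2) * ennreal (b N x))"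
   by (simp add: eq x)
  also have "\<dots> \<le> limsup (\<lambda>N. ennreal (1/2) * ennreal (a N x)) + limsup (\<lambda>N. ennreal (1/2) * ennreal (b N x))"
   by (rule Limsup_ennreal_add_le)
  also have "\<dots> = ennreal (1/2) * limsup (\<lambda>N. ennreal (a N x)) + ennreal (1/2) * limsup (\<lambda>N. ennreal (b N x))"
   by (subst (1 2) Limsup_compose_continuous_mono[where f="\<lambda>y. ennreal (1/2) * y", symmetric])
     (auto intro!: ennreal_continuous_on_cmult monoI mult_left_mono simp: continuous_on_id less_top[symmetric])
  finally show "limsup (\<lambda>N. ennreal ((\<Sum>i\<in>{-int N..<int N}. f (U i x)) / (2 * real N)))
   \<le> ennreal (1/2) * limsup (\<lambda>N. ennreal (a N x)) + ennreal (1/2) * limsup (\<lambda>N. ennreal (b N x))" .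
 qed
 also have "\<dots> = ennreal (1/2) * (\<integral>\<^sup>+x. limsup (\<lambda>N. ennreal (a N x)) \<partial>M) + ennreal (1/2) * (\<integral>\<^sup>+x. limsup (\<lambda>N. ennreal (b N x)) \<partial>M)"
  by (subst nn_integral_add) (auto simp: nn_integral_cmult)
 also have "\<dots> \<le> ennreal (1/2) * (\<integral>\<^sup>+x. ennreal (f x) \<partial>M) + ennreal (1/2) * (\<integral>\<^sup>+x. ennreal (g x) \<partial>M)"
  unfolding a_def b_def
  by (intro add_mono mult_left_mono nn_integral_limsup_average_le[where C=C] U dU f gm)
    (auto simp: f0 fC g_def Usp)
 also have "(\<integral>\<^sup>+x. ennreal (g x) \<partial>M) = (\<integral>\<^sup>+x. ennreal (f x) \<partial>M)"
  unfolding g_def using nn_integral_distr[of "U (-1)" M M "\<lambda>x. ennreal (f x)"] dU[of "-1"] by simp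
 also have "ennreal (1/2) * (\<integral>\<^sup>+x. ennreal (f x) \<partial>M) + ennreal (1/2) * (\<integral>\<^sup>+x. ennreal (f x) \<partial>M) = (\<integral>\<^sup>+x. ennreal (f x) \<partial>M)"
 proof -
  have "ennreal (1/2) + ennreal (1/2) = 1" by (subst ennreal_plus[symmetric]) auto
  then show ?thesis by (simp only: distrib_right[symmetric] mult_1_left)
 qed
 finally show ?thesis .
qed

text \<open>Because the averaged functions may depend on the length of the average, this form can be
 iterated over several commuting directions.\<close>

lemma (in prob_space) nn_integral_limsup_two_sided_average_seq_le:
 fixes F :: "nat \<Rightarrow> 'a \<Rightarrow> real" and U :: "int \<Rightarrow> 'a \<Rightarrow> 'a"
 assumes U [measurable]: "\<And>i. U i \<in> M \<rightarrow>\<^sub>M M" and dU: "\<And>i. distr M M (U i) = M"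
  and U_add: "\<And>i j x. x \<in> space M \<Longrightarrow> U (i + j) x = U i (U j x)"
  and U_0: "\<And>x. x \<in> space M \<Longrightarrow> U 0 x = x"
  and F [measurable]: "\<And>N. F N \<in> borel_measurable M"
  and FC: "\<And>N x. x \<in> space M \<Longrightarrow> F N x \<le> C"
 shows "(\<integral>\<^sup>+x. limsup (\<lambda>N. ennreal ((\<Sum>i\<in>{-int N..<int N}. F N (U i x)) / (2 * real N))) \<partial>M)
  \<le> (\<integral>\<^sup>+x. limsup (\<lambda>N. ennreal (F N x)) \<partial>M)"
proof -
 \<comment> \<open>The supremum over all N \<ge> m is one fixed function that dominates F N from m
   on, so the result for a fixed function applies; then m tends to infinity by monotone
   convergence.\<close>
 define E where "E = (\<lambda>m x. SUP N\<in>{m..}. ennreal (F N x))"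
 have Em [measurable]: "E m \<in> borel_measurable M" for m unfolding E_def by measurable
 have Usp: "U i x \<in> space M" if "x \<in> space M" for i x
  using measurable_space[OF U that] .
 have EC: "E m x \<le> ennreal C" if "x \<in> space M" for m x
  unfolding E_def using FC[OF that] by (intro SUP_least ennreal_leI) auto
 define H where "H = (\<lambda>m x. enn2real (E m x))"
 have Hm [measurable]: "H m \<in> borel_measurable M" for m unfolding H_def by measurable
 have EH: "ennreal (H m x) = E m x" if "x \<in> space M" for m x
  unfolding H_def using EC[OF that, of m] by (intro ennreal_enn2real) (simp add: order_le_less_trans)
 have H0: "0 \<le> H m x" for m x by (simp add: H_def)
 have HC: "H m x \<le> max 0 C" if "x \<in> space M" for m x
 proof -
  have "ennreal (H m x) \<le> ennreal (max 0 C)"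
   using EH[OF that] EC[OF that] by (simp add: ennreal_max_0)
  then show ?thesis by (subst (asm) ennreal_le_iff) auto
 qed
 have FH: "F N x \<le> H m x" if "x \<in> space M" "m \<le> N" for N m x
 proof -
  have "ennreal (F N x) \<le> ennreal (H m x)"
   unfolding EH[OF that(1)] E_def using that by (intro SUP_upper) auto
  then show ?thesis using H0 by (simp add: ennreal_le_iff)
 qed
 have "(\<integral>\<^sup>+x. limsup (\<lambda>N. ennreal ((\<Sum>i\<in>{-int N..<int N}. F N (U i x)) / (2 * real N))) \<partial>M)
   \<le> (\<integral>\<^sup>+x. E m x \<partial>M)" for m
 proof -
  have "(\<integral>\<^sup>+x. limsup (\<lambda>N. ennreal ((\<Sum>i\<in>{-int N..<int N}. F N (U i x)) / (2 * real N))) \<partial>M)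
    \<le> (\<integral>\<^sup>+x. limsup (\<lambda>N. ennreal ((\<Sum>i\<in>{-int N..<int N}. H m (U i x)) / (2 * real N))) \<partial>M)"
  proof (intro nn_integral_mono Limsup_mono)
   fix x assume x: "x \<in> space M"
   show "eventually (\<lambda>N. ennreal ((\<Sum>i\<in>{-int N..<int N}. F N (U i x)) / (2 * real N))
     \<le> ennreal ((\<Sum>i\<in>{-int N..<int N}. H m (U i x)) / (2 * real N))) sequentially"
    using eventually_ge_at_top[of m]
   proof eventually_elim
    case (elim N)
    then show ?case by (intro ennreal_leI divide_right_mono sum_mono FH Usp x) auto
   qed
  qed
  also have "\<dots> \<le> (\<integral>\<^sup>+x. ennreal (H m x) \<partial>M)"
   by (rule nn_integral_limsup_two_sided_average_le[OF U dU U_add U_0, where C="max 0 C"])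
     (use HC H0 in auto)
  also have "\<dots> = (\<integral>\<^sup>+x. E m x \<partial>M)" by (intro nn_integral_cong EH)
  finally show ?thesis .
 qed
 then have "(\<integral>\<^sup>+x. limsup (\<lambda>N. ennreal ((\<Sum>i\<in>{-int N..<int N}. F N (U i x)) / (2 * real N))) \<partial>M)
   \<le> (INF m. (\<integral>\<^sup>+x. E m x \<partial>M))"
  by (intro INF_greatest)
 also have "\<dots> = (\<integral>\<^sup>+x. (INF m. E m x) \<partial>M)"
 proof (rule nn_integral_monotone_convergence_INF_decseq[symmetric, where i=0])
  show "decseq E" unfolding E_def
   by (intro decseq_SucI le_funI SUP_subset_mono) auto
  have "(\<integral>\<^sup>+x. E 0 x \<partial>M) \<le> (\<integral>\<^sup>+x. ennreal C \<partial>M)" by (intro nn_integral_mono EC)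
  also have "\<dots> < \<infinity>" by (simp add: emeasure_space_1)
  finally show "(\<integral>\<^sup>+x. E 0 x \<partial>M) < \<infinity>" .
 qed measurable
 also have "\<dots> = (\<integral>\<^sup>+x. limsup (\<lambda>N. ennreal (F N x)) \<partial>M)"
  by (simp add: limsup_INF_SUP E_def)
 finally show ?thesis .
qed

section \<open>Averages over boxes for several commuting directions\<close>

lemma sum_PiE_insert:
 fixes f :: "('i \<Rightarrow> 'j) \<Rightarrow> real"
 assumes "b \<notin> S" "finite S" "\<And>b. finite (D b)"
 shows "(\<Sum>a\<in>PiE (insert b S) D. f a) = (\<Sum>i\<in>D b. \<Sum>a\<in>PiE S D. f (a(b := i)))"
proof -
 have "(\<Sum>a\<in>PiE (insert b S) D. f a) = (\<Sum>p\<in>D b \<times> PiE S D. f ((snd p)(b := fst p)))"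
  unfolding PiE_insert_eq
  by (subst sum.reindex) (use inj_combinator[OF assms(1), of D] in \<open>auto simp: case_prod_unfold\<close>)
 also have "\<dots> = (\<Sum>i\<in>D b. \<Sum>a\<in>PiE S D. f (a(b := i)))"
  using assms by (subst sum.cartesian_product) (simp add: case_prod_unfold)
 finally show ?thesis .
qed

text \<open>An action of \<open>Z^B\<close>. Indices are total functions, which keeps addition
  pointwise; \<open>T_cong\<close> makes their values outside \<open>B\<close> irrelevant.\<close>

locale lattice_action = prob_space M for M :: "'w measure" +
 fixes T :: "('i \<Rightarrow> int) \<Rightarrow> 'w \<Rightarrow> 'w" and B :: "'i set"
 assumes finB: "finite B"
  and T_meas [measurable]: "\<And>z. T z \<in> M \<rightarrow>\<^sub>M M" and T_pres: "\<And>z. distr M M (T z) = M"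
  and T_add: "\<And>z z' x. x \<in> space M \<Longrightarrow> T (\<lambda>b. z b + z' b) x = T z (T z' x)"
  and T_cong: "\<And>z z' x. x \<in> space M \<Longrightarrow> (\<And>b. b \<in> B \<Longrightarrow> z b = z' b) \<Longrightarrow> T z x = T z' x"
  and T_0: "\<And>x. x \<in> space M \<Longrightarrow> T (\<lambda>_. 0) x = x"
begin

lemma T_space: "x \<in> space M \<Longrightarrow> T z x \<in> space M"
 using measurable_space[OF T_meas] .

lemma nn_integral_T:
 assumes [measurable]: "f \<in> borel_measurable M"
 shows "(\<integral>\<^sup>+x. f (T z x) \<partial>M) = (\<integral>\<^sup>+x. f x \<partial>M)"
 using nn_integral_distr[of "T z" M M f] T_pres[of z] by simp

lemma integral_T:
 fixes f :: "'w \<Rightarrow> real"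
 assumes [measurable]: "f \<in> borel_measurable M"
 shows "(\<integral>x. f (T z x) \<partial>M) = (\<integral>x. f x \<partial>M)"
 using integral_distr[of "T z" M M f] T_pres[of z] by simp

lemma integrable_T:
 fixes f :: "'w \<Rightarrow> real"
 assumes "integrable M f"
 shows "integrable M (\<lambda>x. f (T z x))"
 using integrable_distr_eq[of "T z" M M f] T_pres[of z] assms by simp

text \<open>Induction over the directions. The box average in the directions treated so far is
  averaged in one more direction over the same range N, which is why the averaged function has to be
  allowed to vary with N. The factor s lets the average run over the sublattice of cell
  centres.\<close>

lemma nn_integral_limsup_box_average_le:
 fixes f :: "'w \<Rightarrow> real" and s :: int
 assumes f [measurable]: "f \<in> borel_measurable M"
  and f0: "\<And>x. x \<in> space M \<Longrightarrow> 0 \<le> f x" and fC: "\<And>x. x \<in> space M \<Longrightarrow> f x \<le> C"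
  and S: "S \<subseteq> B"
 shows "(\<integral>\<^sup>+x. limsup (\<lambda>N. ennreal ((\<Sum>a\<in>PiE S (\<lambda>_. {-int N..<int N}).
   f (T (\<lambda>b. if b \<in> S then s * a b else 0) x)) / (2 * real N) ^ card S)) \<partial>M) \<le> (\<integral>\<^sup>+x. ennreal (f x) \<partial>M)"
proof -
 have "finite S" using S finB finite_subset by blast
 then show ?thesis using S
 proof (induction S rule: finite_induct)
  case empty
  have "(\<integral>\<^sup>+x. limsup (\<lambda>N. ennreal ((\<Sum>a\<in>PiE {} (\<lambda>_. {-int N..<int N}).
   f (T (\<lambda>b. if b \<in> {} then s * a b else 0) x)) / (2 * real N) ^ card {})) \<partial>M) = (\<integral>\<^sup>+x. ennreal (f x) \<partial>M)"
   by (intro nn_integral_cong) (simp add: T_0 Limsup_const)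
  then show ?case by simp
 next
  case (insert b S)
  define F where "F = (\<lambda>N x. (\<Sum>a\<in>PiE S (\<lambda>_. {-int N..<int N}).
   f (T (\<lambda>b. if b \<in> S then s * a b else 0) x)) / (2 * real N) ^ card S)"
  define U where "U = (\<lambda>i. T (\<lambda>b'. if b' = b then s * i else 0))"
  have Fm [measurable]: "F N \<in> borel_measurable M" for N unfolding F_def by measurable
  have cardP: "card (PiE S (\<lambda>_. {-int N..<int N})) = (2 * N) ^ card S" for N
   using insert(1) by (simp add: card_PiE power_mult_distrib nat_mult_distrib)
  have F0: "0 \<le> F N x" if "x \<in> space M" for N x
   unfolding F_def by (intro divide_nonneg_nonneg sum_nonneg f0 T_space that) auto
  have C0: "0 \<le> C" using f0 fC not_empty by (meson ex_in_conv order_trans)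
  have FC: "F N x \<le> C" if "x \<in> space M" for N x
  proof -
   have "(\<Sum>a\<in>PiE S (\<lambda>_. {-int N..<int N}). f (T (\<lambda>b. if b \<in> S then s * a b else 0) x)) \<le> real ((2 * N) ^ card S) * C"
    using sum_bounded_above[of "PiE S (\<lambda>_. {-int N..<int N})" _ C] fC[OF T_space[OF that]] cardP[of N]
    by (metis (no_types, lifting))
   then have "F N x * p \<le> p * C" if "p = (2 * real N) ^ card S" "p \<noteq> 0" for p
    using that by (simp add: F_def)
   moreover have "F N x = 0" if "(2 * real N) ^ card S = 0" using that by (simp only: F_def div_by_0)
   moreover have "0 \<le> (2 * real N) ^ card S" by simp
   ultimately show ?thesis using C0
    by (metis less_eq_real_def mult.commute mult_le_cancel_right_pos)
  qed
  have eq: "(\<Sum>a\<in>PiE (insert b S) (\<lambda>_. {-int N..<int N}).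
    f (T (\<lambda>b'. if b' \<in> insert b S then s * a b' else 0) x)) / (2 * real N) ^ card (insert b S)
   = (\<Sum>i\<in>{-int N..<int N}. F N (U i x)) / (2 * real N)" if x: "x \<in> space M" for N x
  proof -
   have "(\<lambda>b'. if b' \<in> insert b S then s * (a(b := i)) b' else 0)
     = (\<lambda>b'. (if b' \<in> S then s * a b' else 0) + (if b' = b then s * i else 0))" for a i
    using insert(2) by auto
   then have "T (\<lambda>b'. if b' \<in> insert b S then s * (a(b := i)) b' else 0) x
     = T (\<lambda>b'. if b' \<in> S then s * a b' else 0) (U i x)" for a i
    unfolding U_def using T_add[OF x] by simp
   then have "(\<Sum>a\<in>PiE (insert b S) (\<lambda>_. {-int N..<int N}).
     f (T (\<lambda>b'. if b' \<in> insert b S then s * a b' else 0) x))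
    = (\<Sum>i\<in>{-int N..<int N}. F N (U i x) * (2 * real N) ^ card S)"
    using insert by (cases "N = 0") (auto simp add: sum_PiE_insert F_def PiE_eq_empty_iff)
   then show ?thesis using insert by (simp add: sum_distrib_right[symmetric] field_simps)
  qed
  have "(\<integral>\<^sup>+x. limsup (\<lambda>N. ennreal ((\<Sum>a\<in>PiE (insert b S) (\<lambda>_. {-int N..<int N}).
    f (T (\<lambda>b'. if b' \<in> insert b S then s * a b' else 0) x)) / (2 * real N) ^ card (insert b S))) \<partial>M)
   = (\<integral>\<^sup>+x. limsup (\<lambda>N. ennreal ((\<Sum>i\<in>{-int N..<int N}. F N (U i x)) / (2 * real N))) \<partial>M)"
   by (intro nn_integral_cong arg_cong[where f=limsup] ext arg_cong[where f=ennreal] eq)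
  also have "\<dots> \<le> (\<integral>\<^sup>+x. limsup (\<lambda>N. ennreal (F N x)) \<partial>M)"
  proof (rule nn_integral_limsup_two_sided_average_seq_le[where C=C])
   show "U (i + j) x = U i (U j x)" if x: "x \<in> space M" for i j x
    unfolding U_def T_add[OF x, symmetric]
    by (rule arg_cong[where f="\<lambda>z. T z x"]) (auto simp: distrib_left)
   show "U 0 x = x" if "x \<in> space M" for x
    unfolding U_def by (subst T_cong[OF that, of _ "\<lambda>_. 0"]) (auto simp: T_0[OF that])
  qed (auto simp: F0 FC T_pres U_def)
  also have "\<dots> \<le> (\<integral>\<^sup>+x. ennreal (f x) \<partial>M)"
   using insert by (simp add: F_def)
  finally show ?case .
 qed
qed

end

section \<open>Subadditive processes\<close>

text \<open>Vitali selection: take a centre z of largest radius, discard every centre whose cube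
  meets the cube about z, and repeat. As discarded radii are at most r z, the discarded centres lie
  within distance less than 2 r z of z in every coordinate, which leaves at most 4 r z integers per
  coordinate.\<close>

lemma vitali_lattice_cubes:
 fixes r :: "('i \<Rightarrow> int) \<Rightarrow> nat"
 assumes B: "finite B" and G: "finite G" "G \<subseteq> PiE B (\<lambda>_. UNIV)" and r: "\<And>z. z \<in> G \<Longrightarrow> 1 \<le> r z"
 shows "\<exists>I\<subseteq>G. (\<forall>z\<in>I. \<forall>z'\<in>I. z \<noteq> z' \<longrightarrow> (\<exists>b\<in>B. int (r z + r z') \<le> \<bar>z b - z' b\<bar>)) \<and>
   card G \<le> (\<Sum>z\<in>I. (4 * r z) ^ card B)"
 using G r
proof (induction "card G" arbitrary: G rule: less_induct)
 case less
 show ?case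
 proof (cases "G = {}")
  case True
  then show ?thesis by (intro exI[of _ "{}"]) auto
 next
  case False
  have "finite (r ` G)" "r ` G \<noteq> {}" using less.prems False by auto
  then have "Max (r ` G) \<in> r ` G" by (rule Max_in)
  then obtain z where z: "z \<in> G" "r z = Max (r ` G)" by (auto simp del: Max_in)
  have rmax: "r z' \<le> r z" if "z' \<in> G" for z'
   using that z(2) less.prems(1) by simp
  define G' where "G' = {z'\<in>G. \<exists>b\<in>B. int (r z + r z') \<le> \<bar>z b - z' b\<bar>}"
  have zG': "z \<notin> G'" using less.prems(3)[OF z(1)] by (auto simp: G'_def)
  have G'G: "G' \<subset> G"
  proof (rule psubsetI)
   show "G' \<noteq> G" using z(1) zG' by blast
  qed (auto simp: G'_def)
  have "card G' < card G" using psubset_card_mono[OF less.prems(1) G'G] .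
  then obtain I where I: "I \<subseteq> G'"
    "\<forall>z\<in>I. \<forall>z'\<in>I. z \<noteq> z' \<longrightarrow> (\<exists>b\<in>B. int (r z + r z') \<le> \<bar>z b - z' b\<bar>)"
    "card G' \<le> (\<Sum>z\<in>I. (4 * r z) ^ card B)"
  proof (atomize_elim, rule less.hyps)
   show "finite G'" using less.prems(1) G'G by (meson finite_subset psubset_imp_subset)
  qed (use less.prems G'G in auto)
  have "G - G' \<subseteq> PiE B (\<lambda>b. {z b - 2 * int (r z) <..< z b + 2 * int (r z)})"
  proof
   fix y assume y: "y \<in> G - G'"
   then have yB: "y \<in> PiE B (\<lambda>_. UNIV)" using less.prems by blast
   have "\<bar>z b - y b\<bar> < 2 * int (r z)" if "b \<in> B" for b
   proof -
    have "\<bar>z b - y b\<bar> < int (r z + r y)" using y that by (force simp: G'_def)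
    also have "\<dots> \<le> 2 * int (r z)" using rmax[of y] y by simp
    finally show ?thesis .
   qed
   then show "y \<in> PiE B (\<lambda>b. {z b - 2 * int (r z) <..< z b + 2 * int (r z)})"
    using yB by (auto simp: PiE_iff abs_less_iff algebra_simps)
  qed
  then have "card (G - G') \<le> card (PiE B (\<lambda>b. {z b - 2 * int (r z) <..< z b + 2 * int (r z)}))"
   using B by (intro card_mono finite_PiE) auto
  also have "\<dots> = (\<Prod>b\<in>B. card {z b - 2 * int (r z) <..< z b + 2 * int (r z)})"
   using B by (simp add: card_PiE)
  also have "\<dots> \<le> (\<Prod>b\<in>B. 4 * r z)" by (intro prod_mono) auto
  also have "\<dots> = (4 * r z) ^ card B" by simp
  finally have 1: "card (G - G') \<le> (4 * r z) ^ card B" .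
  have finI: "finite I" using I(1) G'G less.prems(1) by (meson finite_subset psubset_imp_subset)
  have zI: "z \<notin> I" using zG' I by blast
  have "card G = card G' + card (G - G')"
   using G'G less.prems(1) by (metis card_Diff_subset card_mono finite_subset le_add_diff_inverse psubset_imp_subset)
  also have "\<dots> \<le> (\<Sum>z\<in>insert z I. (4 * r z) ^ card B)"
   using 1 I(3) finI zI by simp
  finally have c: "card G \<le> (\<Sum>z\<in>insert z I. (4 * r z) ^ card B)" .
  have d: "\<exists>b\<in>B. int (r z + r z') \<le> \<bar>z b - z' b\<bar>" if "z' \<in> I" for z'
   using that I(1) by (auto simp: G'_def)
  show ?thesis
  proof (intro exI[of _ "insert z I"] conjI ballI impI)
   show "insert z I \<subseteq> G" using I(1) z(1) by (auto simp: G'_def)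
   fix y y' assume *: "y \<in> insert z I" "y' \<in> insert z I" "y \<noteq> y'"
   then consider "y = z" "y' \<in> I" | "y' = z" "y \<in> I" | "y \<in> I" "y' \<in> I" by blast
   then show "\<exists>b\<in>B. int (r y + r y') \<le> \<bar>y b - y' b\<bar>"
   proof cases
    case 2
    then show ?thesis using d[of y] by (simp add: abs_minus_commute add.commute)
   qed (use d I(2) * in auto)
  qed (rule c)
 qed
qed

lemma card_int_in_interval_le:
 fixes x y :: real
 assumes "x \<le> y"
 shows "real (card {a::int. x < a \<and> a < y}) \<le> y - x + 1"
proof -
 have "{a::int. x < a \<and> a < y} \<subseteq> {\<lfloor>x\<rfloor> + 1..\<lceil>y\<rceil> - 1}"
  by (auto simp: less_ceiling_iff floor_less_iff) linarith+
 then have "card {a::int. x < a \<and> a < y} \<le> card {\<lfloor>x\<rfloor> + 1..\<lceil>y\<rceil> - 1}"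
  by (intro card_mono) auto
 also have "\<dots> = nat (\<lceil>y\<rceil> - 1 - \<lfloor>x\<rfloor>)" by simp
 finally have "real (card {a::int. x < a \<and> a < y}) \<le> real (nat (\<lceil>y\<rceil> - 1 - \<lfloor>x\<rfloor>))" by simp
 also have "\<dots> \<le> y - x + 1" using assms by linarith
 finally show ?thesis .
qed

text \<open>\<open>X N x\<close> models the energy in the cube of half-side N about the origin, and
  \<open>X r (T z x)\<close> that in the cube of half-side r about z. \<open>I\<close> is a set of
  pairs of centre and half-side describing disjoint cubes inside the large one; the uncovered volume
  is charged at the price c.\<close>

locale subadditive_process = lattice_action M T B for M :: "'w measure" and T and B :: "'i set" +
 fixes X :: "nat \<Rightarrow> 'w \<Rightarrow> real" and c :: real
 assumes c0: "0 \<le> c"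
  and X_meas [measurable]: "\<And>N. X N \<in> borel_measurable M"
  and X_nonneg: "\<And>N x. x \<in> space M \<Longrightarrow> 0 \<le> X N x"
  and X_le: "\<And>N x. x \<in> space M \<Longrightarrow> X N x \<le> c * (2 * real N) ^ card B"
  and subadd: "\<And>x N I. x \<in> space M \<Longrightarrow> finite I \<Longrightarrow>
   (\<And>z r. (z, r) \<in> I \<Longrightarrow> 1 \<le> r \<and> (\<forall>b\<in>B. \<bar>z b\<bar> + int r \<le> int N)) \<Longrightarrow>
   (\<And>z r z' r'. (z, r) \<in> I \<Longrightarrow> (z', r') \<in> I \<Longrightarrow> (z, r) \<noteq> (z', r') \<Longrightarrow>
     \<exists>b\<in>B. int (r + r') \<le> \<bar>z b - z' b\<bar>) \<Longrightarrow>
   X N x \<le> (\<Sum>(z, r)\<in>I. X r (T z x)) + c * ((2 * real N) ^ card B - (\<Sum>(z, r)\<in>I. (2 * real r) ^ card B))"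
begin

abbreviation vol :: "nat \<Rightarrow> real" where "vol N \<equiv> (2 * real N) ^ card B"

lemma X_integrable: "integrable M (X N)"
 by (rule integrable_const_bound[of _ "c * vol N"])
   (use X_nonneg X_le in \<open>auto intro!: AE_I2\<close>)

lemma X_mono:
 assumes "x \<in> space M" "1 \<le> N" "N \<le> N'"
 shows "X N' x \<le> X N x + c * (vol N' - vol N)"
 using subadd[of x "{(\<lambda>_. 0, N)}" N'] assms by (simp add: T_0)

text \<open>Centres are odd multiples of k, so that the cells of half-side k with indices in
  \<open>{-j..<j}\<close> tile exactly the cube of half-side 2 k j about the origin.\<close>

definition cell :: "nat \<Rightarrow> ('i \<Rightarrow> int) \<Rightarrow> 'i \<Rightarrow> int" where
 "cell k a = (\<lambda>b. int k * (2 * a b + 1))"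

lemma inj_cell: "1 \<le> k \<Longrightarrow> inj (cell k)"
 by (auto simp: inj_on_def cell_def fun_eq_iff)

lemma cell_inside:
 assumes "a \<in> PiE B (\<lambda>_. {-int j..<int j})" "b \<in> B"
 shows "\<bar>cell k a b\<bar> + int k \<le> int (2 * k * j)"
proof -
 have "- int j \<le> a b" "a b + 1 \<le> int j" using assms by (auto simp: PiE_iff)
 then have "int k * (- int j) \<le> int k * a b" "int k * (a b + 1) \<le> int k * int j"
  by (intro mult_left_mono; simp)+
 then show ?thesis unfolding cell_def by (auto simp: abs_if algebra_simps)
qed

lemma cell_disjoint:
 assumes "a \<in> PiE B D" "a' \<in> PiE B D" "a \<noteq> a'"
 shows "\<exists>b\<in>B. int (k + k) \<le> \<bar>cell k a b - cell k a' b\<bar>"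
proof -
 obtain b where b: "b \<in> B" "a b \<noteq> a' b" using PiE_ext[OF assms(1,2)] assms(3) by blast
 have "cell k a b - cell k a' b = 2 * int k * (a b - a' b)" by (simp add: cell_def algebra_simps)
 moreover have "2 * int k * 1 \<le> 2 * int k * \<bar>a b - a' b\<bar>" using b by (intro mult_left_mono) auto
 ultimately show ?thesis using b by (auto simp: abs_mult intro!: bexI[of _ b])
qed

lemma finite_cells: "finite (PiE B (\<lambda>_. {-int j..<int j}))"
 using finB by (intro finite_PiE) auto

lemma card_cells: "real (card (PiE B (\<lambda>_. {-int j..<int j}))) = vol j"
 using finB by (simp add: card_PiE nat_mult_distrib)

text \<open>The cells have the full volume of the cube, so the charge for uncovered volume
  vanishes.\<close>

lemma tiling_le:
 assumes x: "x \<in> space M" and k: "1 \<le> k"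
 shows "X (2 * k * j) x \<le> (\<Sum>a\<in>PiE B (\<lambda>_. {-int j..<int j}). X k (T (cell k a) x))"
proof -
 let ?P = "PiE B (\<lambda>_. {-int j..<int j})"
 let ?I = "(\<lambda>a. (cell k a, k)) ` ?P"
 have inj: "inj_on (\<lambda>a. (cell k a, k)) ?P" using inj_cell[OF k] by (auto simp: inj_on_def)
 have "X (2 * k * j) x \<le> (\<Sum>(z, r)\<in>?I. X r (T z x)) + c * (vol (2 * k * j) - (\<Sum>(z, r)\<in>?I. vol r))"
  using k cell_inside cell_disjoint finite_cells
  by (intro subadd x) (auto, blast)
 also have "(\<Sum>(z, r)\<in>?I. X r (T z x)) = (\<Sum>a\<in>?P. X k (T (cell k a) x))"
  by (simp add: sum.reindex[OF inj])
 also have "(\<Sum>(z, r)\<in>?I. vol r) = vol j * vol k"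
  using card_cells[of j] by (simp add: sum.reindex[OF inj])
 also have "\<dots> = vol (2 * k * j)" unfolding power_mult_distrib[symmetric] by (simp add: ac_simps)
 finally show ?thesis by simp
qed

text \<open>At the sizes 2 k j the normalised energy is at most an average of the normalised
  energies of the cells, and the box average bound applies. Any other N is rounded down to such a
  size; the price of the remaining shell is negligible against the volume.\<close>

lemma nn_integral_limsup_le:
 assumes k: "1 \<le> k"
 shows "(\<integral>\<^sup>+x. limsup (\<lambda>N. ennreal (X N x / vol N)) \<partial>M)
  \<le> (\<integral>\<^sup>+x. ennreal (X k x / vol k) \<partial>M)"
proof -
 \<comment> \<open>The centre of a cell is the lattice point 2 k a shifted by k in every coordinate;
   this constant shift is put into the averaged function.\<close>
 define f where "f = (\<lambda>x. X k (T (\<lambda>_. int k) x) / vol k)"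
 have fm [measurable]: "f \<in> borel_measurable M" unfolding f_def by measurable
 define g where "g = (\<lambda>j x. (\<Sum>a\<in>PiE B (\<lambda>_. {-int j..<int j}).
   f (T (\<lambda>b. if b \<in> B then 2 * int k * a b else 0) x)) / vol j)"
 have gX: "X (2 * k * j) x / vol (2 * k * j) \<le> g j x" if x: "x \<in> space M" for j x
 proof -
  have "T (cell k a) x = T (\<lambda>_. int k) (T (\<lambda>b. if b \<in> B then 2 * int k * a b else 0) x)" for a
   unfolding T_add[OF x, symmetric] by (rule T_cong[OF x]) (auto simp: cell_def algebra_simps)
  then have "(\<Sum>a\<in>PiE B (\<lambda>_. {-int j..<int j}). X k (T (cell k a) x))
    = vol k * (\<Sum>a\<in>PiE B (\<lambda>_. {-int j..<int j}). f (T (\<lambda>b. if b \<in> B then 2 * int k * a b else 0) x))"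
   using k by (simp add: f_def sum_distrib_left)
  then have "X (2 * k * j) x / vol (2 * k * j) \<le>
   (vol k * (\<Sum>a\<in>PiE B (\<lambda>_. {-int j..<int j}). f (T (\<lambda>b. if b \<in> B then 2 * int k * a b else 0) x)))
     / vol (2 * k * j)"
   using tiling_le[OF x k, of j] by (intro divide_right_mono) auto
  also have "\<dots> = g j x"
  proof -
   have "vol (2 * k * j) = vol k * vol j"
    unfolding power_mult_distrib[symmetric] by (simp add: ac_simps)
   then show ?thesis using k by (simp add: g_def)
  qed
  finally show ?thesis .
 qed
 \<comment> \<open>Price of the shell per unit volume: rounding down to a multiple of 2 k loses less
   than 2 k of the half-side.\<close>
 define e where "e = (\<lambda>N. c * (1 - (1 - 2 * real k / real N) ^ card B))"
 have e_lim: "(\<lambda>N. ennreal (e N)) \<longlonglongrightarrow> 0"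
 proof -
  have "(\<lambda>N. 2 * real k / real N) \<longlonglongrightarrow> 0" by (rule lim_const_over_n)
  then have "e \<longlonglongrightarrow> c * (1 - (1 - 0) ^ card B)" unfolding e_def by (intro tendsto_intros)
  then have "e \<longlonglongrightarrow> 0" by simp
  then show ?thesis using tendsto_ennrealI[of e 0] by (simp only: ennreal_0)
 qed
 have le: "limsup (\<lambda>N. ennreal (X N x / vol N)) \<le> limsup (\<lambda>j. ennreal (g j x))" if x: "x \<in> space M" for x
 proof -
  have g0: "0 \<le> g j x" for j
   unfolding g_def f_def by (intro divide_nonneg_nonneg sum_nonneg X_nonneg T_space x) auto
  have "limsup (\<lambda>N. ennreal (X N x / vol N)) \<le> limsup (\<lambda>N. ennreal (g (N div (2 * k)) x) + ennreal (e N))"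
  proof (rule Limsup_mono)
   show "eventually (\<lambda>N. ennreal (X N x / vol N) \<le> ennreal (g (N div (2 * k)) x) + ennreal (e N)) sequentially"
    using eventually_ge_at_top[of "2 * k"]
   proof eventually_elim
    case (elim N)
    define j where "j = N div (2 * k)"
    define N0 where "N0 = 2 * k * j"
    have j1: "1 \<le> j" using elim k by (simp add: j_def Suc_le_eq div_greater_zero_iff)
    have N0N: "N0 \<le> N" "N < N0 + 2 * k"
     using mult_div_mod_eq[of "2 * k" N] mod_less_divisor[of "2 * k" N] k
     unfolding N0_def j_def by linarith+
    have N1: "1 \<le> N0" using j1 k by (simp add: N0_def Suc_le_eq)
    have pos: "0 < vol N" using N1 N0N by simp
    have pw: "vol N * (1 - 2 * real k / real N) ^ card B \<le> vol N0"
    proof -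
     have "vol N * (1 - 2 * real k / real N) ^ card B = (2 * real N - 4 * real k) ^ card B"
      unfolding power_mult_distrib[symmetric] using N1 N0N by (intro arg_cong[where f="\<lambda>t. t ^ card B"]) (simp add: field_simps)
     also have "\<dots> \<le> vol N0"
      using elim N0N by (intro power_mono) auto
     finally show ?thesis .
    qed
    have "X N x \<le> X N0 x + c * (vol N - vol N0)"
     by (rule X_mono[OF x N1 N0N(1)])
    also have "\<dots> \<le> vol N * g j x + c * (vol N - vol N * (1 - 2 * real k / real N) ^ card B)"
    proof (intro add_mono mult_left_mono diff_left_mono pw c0)
     have "X N0 x \<le> vol N0 * g j x"
      using gX[OF x, of j] N1 unfolding N0_def[symmetric] by (simp add: divide_le_eq mult.commute)
     also have "\<dots> \<le> vol N * g j x"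
      using N0N g0 by (intro mult_right_mono power_mono) auto
     finally show "X N0 x \<le> vol N * g j x" .
    qed
    also have "\<dots> = (g j x + e N) * vol N" by (simp add: e_def algebra_simps)
    finally have "X N x / vol N \<le> g j x + e N" using pos by (simp add: divide_le_eq)
    then have "ennreal (X N x / vol N) \<le> ennreal (g j x + e N)" by (rule ennreal_leI)
    also have "\<dots> \<le> ennreal (g j x) + ennreal (e N)"
     using g0[of j] by (cases "e N \<ge> 0") (auto simp: ennreal_plus ennreal_neg intro!: ennreal_leI)
    finally show ?case by (simp add: j_def)
   qed
  qed
  also have "\<dots> \<le> limsup (\<lambda>N. ennreal (g (N div (2 * k)) x)) + limsup (\<lambda>N. ennreal (e N))"
   by (rule Limsup_ennreal_add_le)
  also have "limsup (\<lambda>N. ennreal (e N)) = 0" by (rule lim_imp_Limsup[OF _ e_lim]) simp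
  also have "limsup (\<lambda>N. ennreal (g (N div (2 * k)) x)) \<le> limsup (\<lambda>j. ennreal (g j x))"
  proof (rule Limsup_ennreal_leI)
   fix \<epsilon> :: real assume "0 < \<epsilon>"
   then have "eventually (\<lambda>j. ennreal (g j x) \<le> limsup (\<lambda>j. ennreal (g j x)) + ennreal \<epsilon>) sequentially"
    by (rule eventually_le_Limsup_ennreal)
   then obtain J where J: "\<And>j. j \<ge> J \<Longrightarrow> ennreal (g j x) \<le> limsup (\<lambda>j. ennreal (g j x)) + ennreal \<epsilon>"
    by (auto simp: eventually_sequentially)
   show "eventually (\<lambda>N. ennreal (g (N div (2 * k)) x) \<le> limsup (\<lambda>j. ennreal (g j x)) + ennreal \<epsilon>) sequentially"
    using eventually_ge_at_top[of "J * (2 * k)"]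
   proof eventually_elim
    case (elim N)
    then have "J \<le> N div (2 * k)" using k div_le_mono[OF elim, of "2 * k"] by simp
    then show ?case by (rule J)
   qed
  qed
  finally show ?thesis by simp
 qed
 have "(\<integral>\<^sup>+x. limsup (\<lambda>N. ennreal (X N x / vol N)) \<partial>M) \<le> (\<integral>\<^sup>+x. limsup (\<lambda>j. ennreal (g j x)) \<partial>M)"
  by (intro nn_integral_mono le)
 also have "\<dots> \<le> (\<integral>\<^sup>+x. ennreal (f x) \<partial>M)"
  unfolding g_def
 proof (rule nn_integral_limsup_box_average_le)
  fix x assume x: "x \<in> space M"
  show "0 \<le> f x" unfolding f_def by (intro divide_nonneg_nonneg X_nonneg T_space x) auto
  show "f x \<le> c" using X_le[OF T_space[OF x], of k] k by (simp add: f_def divide_le_eq)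
 qed auto
 also have "\<dots> = (\<integral>\<^sup>+x. ennreal (X k x / vol k) \<partial>M)"
  unfolding f_def by (rule nn_integral_T[where f="\<lambda>x. ennreal (X k x / vol k)"]) measurable
 finally show ?thesis .
qed


text \<open>The large cube is divided into three parts. Disjoint cubes of total volume s have energy
  at most \<gamma> - \<epsilon> per volume; cells of half-side k that miss them pay \<gamma> plus
  their positive excess; the rest pays c. The selected cubes have half-side at least K, much larger
  than k, so the rest is only a thin layer around them and costs at most \<epsilon> s / 2. A gain of
  \<epsilon> s / 2 remains, and s is at least \<open>2 ^ - card B\<close> times the number of
  centres in \<open>A\<close> by the Vitali selection.\<close>

lemma covering_le:
 fixes \<gamma> \<epsilon> :: real
 assumes x: "x \<in> space M" and k: "1 \<le> k" and K: "1 \<le> K" and \<gamma>: "0 \<le> \<gamma>" "\<gamma> \<le> c" and \<epsilon>: "0 < \<epsilon>"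
  and small: "c * ((1 + 2 * real k / real K) ^ card B - 1) \<le> \<epsilon> / 2"
  and K': "K' \<le> 2 * k * j"
 defines "N \<equiv> 2 * k * j"
 defines "A \<equiv> {x \<in> space M. \<exists>r\<in>{K..K'}. X r x \<le> (\<gamma> - \<epsilon>) * vol r}"
 shows "X N x \<le> \<gamma> * vol N
   - \<epsilon> / 2 / 2 ^ card B * (\<Sum>z\<in>PiE B (\<lambda>_. {-int (N - K')..int (N - K')}). indicator A (T z x))
   + (\<Sum>a\<in>PiE B (\<lambda>_. {-int j..<int j}). max 0 (X k (T (cell k a) x) - \<gamma> * vol k))"
proof -
 let ?n = "card B"
 \<comment> \<open>Centres keep the distance K' from the boundary, so every cube of half-side at
   most K' stays inside.\<close>
 let ?Z = "PiE B (\<lambda>_. {-int (N - K')..int (N - K')})"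
 let ?P = "PiE B (\<lambda>_. {-int j..<int j})"
 define G where "G = {z\<in>?Z. T z x \<in> A}"
 have finZ: "finite ?Z" using finB by (intro finite_PiE) auto
 have finG: "finite G" unfolding G_def using finZ by auto
 have "\<exists>r. r \<in> {K..K'} \<and> X r (T z x) \<le> (\<gamma> - \<epsilon>) * vol r" if "z \<in> G" for z
  using that by (auto simp: G_def A_def)
 then obtain r where r: "\<And>z. z \<in> G \<Longrightarrow> r z \<in> {K..K'}"
   "\<And>z. z \<in> G \<Longrightarrow> X (r z) (T z x) \<le> (\<gamma> - \<epsilon>) * vol (r z)" by metis
 have r1: "1 \<le> r z" if "z \<in> G" for z using r(1)[OF that] K by simp
 have "G \<subseteq> PiE B (\<lambda>_. UNIV)" using PiE_mono[of B "\<lambda>_. {-int (N - K')..int (N - K')}" "\<lambda>_. UNIV"] by (auto simp: G_def)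
 then have "\<exists>I\<subseteq>G. (\<forall>z\<in>I. \<forall>z'\<in>I. z \<noteq> z' \<longrightarrow> (\<exists>b\<in>B. int (r z + r z') \<le> \<bar>z b - z' b\<bar>)) \<and>
   card G \<le> (\<Sum>z\<in>I. (4 * r z) ^ ?n)"
  by (intro vitali_lattice_cubes finB finG r1)
 then obtain I where
  I: "I \<subseteq> G" "\<forall>z\<in>I. \<forall>z'\<in>I. z \<noteq> z' \<longrightarrow> (\<exists>b\<in>B. int (r z + r z') \<le> \<bar>z b - z' b\<bar>)"
   "card G \<le> (\<Sum>z\<in>I. (4 * r z) ^ ?n)"
  by (elim exE conjE) (rule that; assumption)
 have finI: "finite I" using I(1) finG finite_subset by blast
 define s where "s = (\<Sum>z\<in>I. vol (r z))"
 have s0: "0 \<le> s" unfolding s_def by (intro sum_nonneg) auto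
 have sG: "real (card G) \<le> 2 ^ ?n * s"
 proof -
  have "real (card G) \<le> real (\<Sum>z\<in>I. (4 * r z) ^ ?n)" using I(3) by (rule of_nat_mono)
  also have "\<dots> = 2 ^ ?n * s"
   unfolding s_def sum_distrib_left power_mult_distrib[symmetric] by simp
  finally show ?thesis .
 qed
 define Meet where "Meet = (\<lambda>z. {a\<in>?P. \<forall>b\<in>B. \<bar>cell k a b - z b\<bar> < int (k + r z)})"
 define Kept where "Kept = ?P - (\<Union>z\<in>I. Meet z)"
 have finP: "finite ?P" by (rule finite_cells)
 have finK: "finite Kept" unfolding Kept_def using finP by auto
 \<comment> \<open>Cells that meet the cube of half-side r z about z lie in the cube of half-side r
   z + 2 k, and K \<le> r z compares the two volumes.\<close>
 have meet: "real (card (Meet z)) * vol k \<le> (1 + 2 * real k / real K) ^ ?n * vol (r z)"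
  if z: "z \<in> I" for z
 proof -
  \<comment> \<open>Solving \<bar>k (2 a + 1) - z\<bar> < k + r for the coordinate a gives the open
    interval between \<open>lo\<close> and \<open>hi\<close>.\<close>
  define lo where "lo = (\<lambda>b. (real_of_int (z b) - 2 * real k - real (r z)) / (2 * real k))"
  define hi where "hi = (\<lambda>b. (real_of_int (z b) + real (r z)) / (2 * real k))"
  have hl: "hi b - lo b = (real (r z) + real k) / real k" for b
   using k by (simp add: hi_def lo_def field_simps)
  have lohi: "lo b \<le> hi b" for b
  proof -
   have "0 \<le> (real (r z) + real k) / real k" by simp
   then show ?thesis using hl[of b] by linarith
  qed
  have fin: "finite {a::int. lo b < a \<and> a < hi b}" for b
  proof (rule finite_subset)
   show "{a::int. lo b < a \<and> a < hi b} \<subseteq> {\<lfloor>lo b\<rfloor>..\<lceil>hi b\<rceil>}"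
    by (auto simp: floor_le_iff le_ceiling_iff)
  qed auto
  have "Meet z \<subseteq> PiE B (\<lambda>b. {a. lo b < real_of_int a \<and> real_of_int a < hi b})"
  proof
   fix a assume a: "a \<in> Meet z"
   have "lo b < real_of_int (a b) \<and> real_of_int (a b) < hi b" if "b \<in> B" for b
   proof -
    have "\<bar>cell k a b - z b\<bar> < int (k + r z)" using a that by (auto simp: Meet_def)
    then have "real_of_int \<bar>cell k a b - z b\<bar> < real (k + r z)" by linarith
    then have "\<bar>real k * (2 * real_of_int (a b) + 1) - real_of_int (z b)\<bar> < real k + real (r z)"
     by (simp add: cell_def)
    then show ?thesis using k unfolding lo_def hi_def
     by (simp add: abs_less_iff divide_less_eq less_divide_eq algebra_simps)
   qed
   then show "a \<in> PiE B (\<lambda>b. {a. lo b < real_of_int a \<and> real_of_int a < hi b})"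
    using a by (auto simp: Meet_def PiE_iff)
  qed
  then have "card (Meet z) \<le> card (PiE B (\<lambda>b. {a. lo b < real_of_int a \<and> real_of_int a < hi b}))"
   by (intro card_mono finite_PiE finB fin)
  also have "\<dots> = (\<Prod>b\<in>B. card {a::int. lo b < a \<and> a < hi b})"
   by (rule card_PiE[OF finB])
  finally have "real (card (Meet z)) \<le> (\<Prod>b\<in>B. real (card {a::int. lo b < a \<and> a < hi b}))"
   by (simp flip: of_nat_prod)
  also have "\<dots> \<le> (\<Prod>b\<in>B. (real (r z) + real k) / real k + 1)"
  proof (intro prod_mono conjI)
   fix b
   show "real (card {a::int. lo b < a \<and> a < hi b}) \<le> (real (r z) + real k) / real k + 1"
    using card_int_in_interval_le[OF lohi, of b] unfolding hl .
  qed auto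
  also have "\<dots> = ((real (r z) + real k) / real k + 1) ^ ?n" by simp
  finally have "real (card (Meet z)) * vol k \<le> ((real (r z) + real k) / real k + 1) ^ ?n * vol k"
   by (rule mult_right_mono) auto
  also have "\<dots> = (((real (r z) + real k) / real k + 1) * (2 * real k)) ^ ?n" by (rule power_mult_distrib[symmetric])
  also have "\<dots> \<le> ((1 + 2 * real k / real K) * (2 * real (r z))) ^ ?n"
  proof (rule power_mono)
   have rK: "real K \<le> real (r z)" using r(1) z I(1) by auto
   have "((real (r z) + real k) / real k + 1) * (2 * real k) = 2 * real (r z) + 4 * real k * 1"
    using k by (simp add: field_simps)
   also have "\<dots> \<le> 2 * real (r z) + 4 * real k * (real (r z) / real K)"
    using rK K by (intro add_left_mono mult_left_mono) (auto simp: le_divide_eq)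
   also have "\<dots> = (1 + 2 * real k / real K) * (2 * real (r z))" by (simp add: field_simps)
   finally show "((real (r z) + real k) / real k + 1) * (2 * real k) \<le> (1 + 2 * real k / real K) * (2 * real (r z))" .
  qed auto
  also have "\<dots> = (1 + 2 * real k / real K) ^ ?n * vol (r z)" by (rule power_mult_distrib)
  finally show ?thesis .
 qed
 have Ncard: "vol N = vol j * vol k"
  unfolding N_def power_mult_distrib[symmetric] by (simp add: ac_simps)
 define \<kappa> where "\<kappa> = real (card Kept) * vol k"
 have left: "vol N - \<kappa> \<le> (1 + 2 * real k / real K) ^ ?n * s"
 proof -
  have "card ?P \<le> card Kept + card (\<Union>z\<in>I. Meet z)"
  proof -
   have "?P = Kept \<union> (\<Union>z\<in>I. Meet z)" by (auto simp: Kept_def Meet_def)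
   then show ?thesis using card_Un_le[of Kept "\<Union>z\<in>I. Meet z"] by simp
  qed
  also have "card (\<Union>z\<in>I. Meet z) \<le> (\<Sum>z\<in>I. card (Meet z))" by (rule card_UN_le[OF finI])
  finally have "card ?P \<le> card Kept + (\<Sum>z\<in>I. card (Meet z))" by simp
  from of_nat_mono[OF this, where 'a=real]
  have "real (card ?P) \<le> real (card Kept) + (\<Sum>z\<in>I. real (card (Meet z)))"
   by (simp only: of_nat_add of_nat_sum)
  then have "real (card ?P) * vol k \<le> (real (card Kept) + (\<Sum>z\<in>I. real (card (Meet z)))) * vol k"
   by (rule mult_right_mono) auto
  then have "vol N - \<kappa> \<le> (\<Sum>z\<in>I. real (card (Meet z)) * vol k)"
   by (simp only: Ncard card_cells \<kappa>_def distrib_right sum_distrib_right)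
  also have "\<dots> \<le> (\<Sum>z\<in>I. (1 + 2 * real k / real K) ^ ?n * vol (r z))"
   by (intro sum_mono meet)
  also have "\<dots> = (1 + 2 * real k / real K) ^ ?n * s" by (simp only: s_def sum_distrib_left)
  finally show ?thesis .
 qed
 let ?J1 = "(\<lambda>z. (z, r z)) ` I" and ?J2 = "(\<lambda>a. (cell k a, k)) ` Kept"
 have inj1: "inj_on (\<lambda>z. (z, r z)) I" by (auto simp: inj_on_def)
 have inj2: "inj_on (\<lambda>a. (cell k a, k)) Kept" using inj_cell[OF k] by (auto simp: inj_on_def)
 have sep: "\<exists>b\<in>B. int (r z + k) \<le> \<bar>z b - cell k a b\<bar>" if "z \<in> I" "a \<in> Kept" for z a
  using that unfolding Kept_def Meet_def by (force simp: abs_minus_commute add.commute)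
 \<comment> \<open>A pair lying in both index sets would be separated from itself by a positive
   distance.\<close>
 have disj: "?J1 \<inter> ?J2 = {}"
 proof (rule ccontr)
  assume "?J1 \<inter> ?J2 \<noteq> {}"
  then obtain z a where "z \<in> I" "a \<in> Kept" "z = cell k a" "r z = k" by auto
  then show False using sep[of z a] k by auto
 qed
 have "X N x \<le> (\<Sum>(z, r)\<in>?J1 \<union> ?J2. X r (T z x)) + c * (vol N - (\<Sum>(z, r)\<in>?J1 \<union> ?J2. vol r))"
 proof (rule subadd[OF x])
  show "finite (?J1 \<union> ?J2)" using finI finK by auto
  fix z t assume zt: "(z, t) \<in> ?J1 \<union> ?J2"
  show "1 \<le> t \<and> (\<forall>b\<in>B. \<bar>z b\<bar> + int t \<le> int N)"
  proof (cases "(z, t) \<in> ?J1")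
   case True
   then have zI: "z \<in> I" "t = r z" by auto
   have "\<bar>z b\<bar> + int t \<le> int N" if "b \<in> B" for b
   proof -
    have "z \<in> ?Z" using zI I(1) by (auto simp: G_def)
    then have "\<bar>z b\<bar> \<le> int (N - K')" using that by (auto simp: PiE_iff abs_le_iff)
    moreover have "r z \<le> K'" using r(1) zI I(1) by auto
    ultimately show ?thesis using K' zI(2) by (simp add: N_def)
   qed
   then show ?thesis using r1 zI I(1) by auto
  next
   case False
   then obtain a where "a \<in> ?P" "z = cell k a" "t = k" using zt by (auto simp: Kept_def)
   then show ?thesis using k cell_inside[of a j _ k] unfolding N_def by blast
  qed
  fix z' t' assume zt': "(z', t') \<in> ?J1 \<union> ?J2" and ne: "(z, t) \<noteq> (z', t')"
  consider "z \<in> I" "t = r z" "z' \<in> I" "t' = r z'"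
   | a where "z \<in> I" "t = r z" "a \<in> Kept" "z' = cell k a" "t' = k"
   | a where "z' \<in> I" "t' = r z'" "a \<in> Kept" "z = cell k a" "t = k"
   | a a' where "a \<in> Kept" "z = cell k a" "t = k" "a' \<in> Kept" "z' = cell k a'" "t' = k"
   using zt zt' by blast
  then show "\<exists>b\<in>B. int (t + t') \<le> \<bar>z b - z' b\<bar>"
  proof cases
   case 1
   then have "z \<noteq> z'" using ne by auto
   then show ?thesis using I(2)[rule_format, of z z'] 1 by simp
  next
   case (2 a)
   then show ?thesis using sep[of z a] by simp
  next
   case (3 a)
   from sep[OF this(1,3)] obtain b where "b \<in> B" "int (r z' + k) \<le> \<bar>z' b - cell k a b\<bar>" by (elim bexE)
   then show ?thesis using 3 by (intro bexI[of _ b]) (simp_all add: abs_minus_commute add.commute)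
  next
   case (4 a a')
   then have "a \<noteq> a'" using ne by auto
   then show ?thesis using cell_disjoint[of a "\<lambda>_. {-int j..<int j}" a' k] 4 by (auto simp: Kept_def)
  qed
 qed
 also have "(\<Sum>(z, r)\<in>?J1 \<union> ?J2. X r (T z x)) = (\<Sum>z\<in>I. X (r z) (T z x)) + (\<Sum>a\<in>Kept. X k (T (cell k a) x))"
  using finI finK disj by (subst sum.union_disjoint) (auto simp: sum.reindex[OF inj1] sum.reindex[OF inj2])
 also have "(\<Sum>(z, r)\<in>?J1 \<union> ?J2. vol r) = s + \<kappa>"
  using finI finK disj unfolding s_def \<kappa>_def
  by (subst sum.union_disjoint) (auto simp: sum.reindex[OF inj1] sum.reindex[OF inj2] power_mult_distrib)
 also have "(\<Sum>z\<in>I. X (r z) (T z x)) \<le> (\<gamma> - \<epsilon>) * s"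
  unfolding s_def sum_distrib_left using I(1) r(2) by (intro sum_mono) auto
 also have "(\<Sum>a\<in>Kept. X k (T (cell k a) x)) \<le> \<gamma> * \<kappa> + (\<Sum>a\<in>?P. max 0 (X k (T (cell k a) x) - \<gamma> * vol k))"
 proof -
  have "(\<Sum>a\<in>Kept. X k (T (cell k a) x))
    \<le> (\<Sum>a\<in>Kept. \<gamma> * vol k + max 0 (X k (T (cell k a) x) - \<gamma> * vol k))"
   by (intro sum_mono) linarith
  also have "\<dots> = \<gamma> * \<kappa> + (\<Sum>a\<in>Kept. max 0 (X k (T (cell k a) x) - \<gamma> * vol k))"
   by (simp add: sum.distrib \<kappa>_def)
  also have "(\<Sum>a\<in>Kept. max 0 (X k (T (cell k a) x) - \<gamma> * vol k))
    \<le> (\<Sum>a\<in>?P. max 0 (X k (T (cell k a) x) - \<gamma> * vol k))"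
   using finP by (intro sum_mono2) (auto simp: Kept_def)
  finally show ?thesis by simp
 qed
 finally have 1: "X N x \<le> (\<gamma> - \<epsilon>) * s + \<gamma> * \<kappa> + (\<Sum>a\<in>?P. max 0 (X k (T (cell k a) x) - \<gamma> * vol k))
   + c * (vol N - (s + \<kappa>))" by simp
 define \<eta> where "\<eta> = (1 + 2 * real k / real K) ^ ?n - 1"
 have \<eta>0: "0 \<le> \<eta>" unfolding \<eta>_def by (simp add: one_le_power)
 have "vol N - (s + \<kappa>) \<le> \<eta> * s" using left by (simp add: \<eta>_def algebra_simps)
 \<comment> \<open>The claim already charges \<gamma> for the whole cube, so the uncovered part
   costs only c - \<gamma> in addition.\<close>
 then have "(c - \<gamma>) * (vol N - (s + \<kappa>)) \<le> (c - \<gamma>) * (\<eta> * s)"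
  using \<gamma> by (intro mult_left_mono) auto
 also have "\<dots> \<le> c * (\<eta> * s)" using \<gamma> \<eta>0 s0 by (intro mult_right_mono) auto
 also have "\<dots> = (c * \<eta>) * s" by simp
 also have "\<dots> \<le> \<epsilon> / 2 * s" using small s0 unfolding \<eta>_def by (rule mult_right_mono)
 finally have 4: "X N x \<le> \<gamma> * vol N - \<epsilon> / 2 * s + (\<Sum>a\<in>?P. max 0 (X k (T (cell k a) x) - \<gamma> * vol k))"
  using 1 by (simp add: algebra_simps)
 have "(\<Sum>z\<in>?Z. indicator A (T z x)) = real (card G)"
  using finZ by (simp add: indicator_def G_def sum.If_cases Int_def)
 then have "\<epsilon> / 2 / 2 ^ ?n * (\<Sum>z\<in>?Z. indicator A (T z x)) \<le> \<epsilon> / 2 / 2 ^ ?n * (2 ^ ?n * s)"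
  using sG \<epsilon> by (intro mult_left_mono) auto
 also have "\<dots> = \<epsilon> / 2 * s" by simp
 finally show ?thesis using 4 by linarith
qed


text \<open>Integrating \<open>covering_le\<close> compares the mean energy, which is at least
  \<gamma> per volume, with \<gamma> minus a gain proportional to the probability of seeing a cube
  of small energy, plus the mean excess of cells of size k. So this probability is bounded by a
  multiple of the mean excess, which tends to 0 with growing k because the limsup is at most
  \<gamma>.\<close>

lemma AE_liminf_ge:
 fixes \<gamma> :: real
 assumes \<gamma>0: "0 \<le> \<gamma>"
  and lim: "AE x in M. limsup (\<lambda>N. ennreal (X N x / vol N)) \<le> ennreal \<gamma>"
  and low: "\<And>k. 1 \<le> k \<Longrightarrow> \<gamma> * vol k \<le> (\<integral>x. X k x \<partial>M)"
 shows "AE x in M. ennreal \<gamma> \<le> liminf (\<lambda>N. ennreal (X N x / vol N))"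
proof -
 let ?n = "card B"
 define Y where "Y = (\<lambda>N x. X N x / vol N)"
 have Ym [measurable]: "Y N \<in> borel_measurable M" for N unfolding Y_def by measurable
 have Yc: "0 \<le> Y N x" "Y N x \<le> c" if "x \<in> space M" for N x
 proof -
  show "0 \<le> Y N x" unfolding Y_def using X_nonneg[OF that] by simp
  show "Y N x \<le> c" using X_le[OF that, of N] c0 unfolding Y_def
   by (cases "vol N = 0") (simp_all only: div_by_0, simp add: divide_le_eq)
 qed
 have \<gamma>c: "\<gamma> \<le> c"
 proof -
  have "\<gamma> * vol 1 \<le> (\<integral>x. X 1 x \<partial>M)" by (rule low) simp
  also have "\<dots> \<le> (\<integral>x. c * vol 1 \<partial>M)"
   by (intro integral_mono X_integrable integrable_const X_le)
  also have "\<dots> = c * vol 1" by (simp add: prob_space)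
  finally show ?thesis by simp
 qed
 \<comment> \<open>Mean of the positive part of the excess over \<gamma> at size k; by boundedness
   it tends to 0 under dominated convergence.\<close>
 define \<delta> where "\<delta> = (\<lambda>k. \<integral>x. max 0 (Y k x - \<gamma>) \<partial>M)"
 have \<delta>_lim: "\<delta> \<longlonglongrightarrow> 0"
 proof -
  have "\<delta> \<longlonglongrightarrow> (\<integral>x. 0 \<partial>M)"
   unfolding \<delta>_def
  proof (rule integral_dominated_convergence[where w="\<lambda>_. c"])
   show "AE x in M. (\<lambda>k. max 0 (Y k x - \<gamma>)) \<longlonglongrightarrow> 0"
    using lim
   proof eventually_elim
    case (elim x)
    show ?case
    proof (rule tendstoI)
     fix e :: real assume e: "0 < e"
     have "eventually (\<lambda>N. ennreal (Y N x) \<le> limsup (\<lambda>N. ennreal (Y N x)) + ennreal (e / 2)) sequentially"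
      using e by (intro eventually_le_Limsup_ennreal) auto
     then show "eventually (\<lambda>k. dist (max 0 (Y k x - \<gamma>)) 0 < e) sequentially"
     proof eventually_elim
      case el: (elim N)
      have "ennreal (Y N x) \<le> ennreal \<gamma> + ennreal (e / 2)"
       using el elim unfolding Y_def by (meson add_right_mono order_trans)
      then have "Y N x \<le> \<gamma> + e / 2" using e \<gamma>0 by (simp flip: ennreal_plus)
      then show ?case using e by (simp add: max_def)
     qed
    qed
   qed
   show "AE x in M. norm (max 0 (Y k x - \<gamma>)) \<le> c" for k
   proof (rule AE_I2)
    fix x assume "x \<in> space M"
    then show "norm (max 0 (Y k x - \<gamma>)) \<le> c" using Yc[of x k] \<gamma>0 c0 by simp
   qed
  qed auto
  then show ?thesis by simp
 qed
 \<comment> \<open>Order of the choices for fixed k: K is chosen large in terms of k, the size j of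
   the large cube tends to infinity for each K', and only then K' tends to infinity.\<close>
 have key: "\<epsilon> / 2 / 2 ^ ?n * measure M {x \<in> space M. liminf (\<lambda>N. ennreal (Y N x)) < ennreal (\<gamma> - \<epsilon>)} \<le> \<delta> k"
  (is "_ * measure M ?L \<le> _") if \<epsilon>: "0 < \<epsilon>" and k: "1 \<le> k" for \<epsilon> k
 proof -
  have "(\<lambda>K. c * ((1 + 2 * real k / real K) ^ ?n - 1)) \<longlonglongrightarrow> c * ((1 + 0) ^ ?n - 1)"
   by (intro tendsto_intros lim_const_over_n)
  then have "(\<lambda>K. c * ((1 + 2 * real k / real K) ^ ?n - 1)) \<longlonglongrightarrow> 0" by simp
  then have "eventually (\<lambda>K. c * ((1 + 2 * real k / real K) ^ ?n - 1) < \<epsilon> / 2) sequentially"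
   using \<epsilon> by (intro order_tendstoD(2)) auto
  then have "eventually (\<lambda>K. c * ((1 + 2 * real k / real K) ^ ?n - 1) < \<epsilon> / 2 \<and> 1 \<le> K) sequentially"
   using eventually_ge_at_top[of 1] by (rule eventually_conj)
  then obtain K where K: "c * ((1 + 2 * real k / real K) ^ ?n - 1) < \<epsilon> / 2" "1 \<le> K"
   by (auto simp: eventually_sequentially)
  define A where "A = (\<lambda>K'. {x \<in> space M. \<exists>r\<in>{K..K'}. X r x \<le> (\<gamma> - \<epsilon>) * vol r})"
  have Am [measurable]: "A K' \<in> sets M" for K' unfolding A_def by measurable
  have step: "\<epsilon> / 2 / 2 ^ ?n * measure M (A K') \<le> \<delta> k" for K'
  proof -
   have ineq: "\<epsilon> / 2 / 2 ^ ?n * measure M (A K') * (1 - real K' / (2 * real k) / real j) ^ ?n \<le> \<delta> k"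
    if j: "K' \<le> j" "1 \<le> j" for j
   proof -
    define N where "N = 2 * k * j"
    have KN: "K' \<le> N" using j k unfolding N_def by (cases k) auto
    have N1: "1 \<le> N" using j k by (simp add: N_def)
    let ?Z = "PiE B (\<lambda>_. {-int (N - K')..int (N - K')})"
    let ?P = "PiE B (\<lambda>_. {-int j..<int j})"
    have cZ: "real (card ?Z) = (2 * real (N - K') + 1) ^ ?n"
    proof -
     have "card ?Z = (2 * (N - K') + 1) ^ ?n" using finB by (simp add: card_PiE nat_add_distrib nat_mult_distrib)
     then show ?thesis by (simp add: add.commute)
    qed
    have i1: "integrable M (\<lambda>x. indicator (A K') (T z x) :: real)" for z
     by (rule integrable_T) (auto intro!: integrable_real_indicator simp: emeasure_eq_measure)
    have i2: "integrable M (\<lambda>x. max 0 (X k (T z x) - \<gamma> * vol k))" for z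
     by (rule integrable_T[where f="\<lambda>x. max 0 (X k x - \<gamma> * vol k)"])
       (intro Bochner_Integration.integrable_max Bochner_Integration.integrable_diff X_integrable integrable_const)
    have "\<gamma> * vol N \<le> (\<integral>x. X N x \<partial>M)" by (rule low[OF N1])
    also have "\<dots> \<le> (\<integral>x. \<gamma> * vol N
      - \<epsilon> / 2 / 2 ^ ?n * (\<Sum>z\<in>?Z. indicator (A K') (T z x))
      + (\<Sum>a\<in>?P. max 0 (X k (T (cell k a) x) - \<gamma> * vol k)) \<partial>M)"
    proof (rule integral_mono)
     show "integrable M (X N)" by (rule X_integrable)
     show "integrable M (\<lambda>x. \<gamma> * vol N
      - \<epsilon> / 2 / 2 ^ ?n * (\<Sum>z\<in>?Z. indicator (A K') (T z x))
      + (\<Sum>a\<in>?P. max 0 (X k (T (cell k a) x) - \<gamma> * vol k)))"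
      by (intro Bochner_Integration.integrable_add Bochner_Integration.integrable_diff integrable_mult_right
        Bochner_Integration.integrable_sum i1 i2 integrable_const)
     fix x assume "x \<in> space M"
     then show "X N x \<le> \<gamma> * vol N
      - \<epsilon> / 2 / 2 ^ ?n * (\<Sum>z\<in>?Z. indicator (A K') (T z x))
      + (\<Sum>a\<in>?P. max 0 (X k (T (cell k a) x) - \<gamma> * vol k))"
      unfolding N_def A_def using KN
      by (intro covering_le k K(2) \<gamma>0 \<gamma>c \<epsilon> less_imp_le[OF K(1)]) (auto simp: N_def)
    qed
    also have "\<dots> = \<gamma> * vol N - \<epsilon> / 2 / 2 ^ ?n * (\<Sum>z\<in>?Z. \<integral>x. indicator (A K') (T z x) \<partial>M)
      + (\<Sum>a\<in>?P. \<integral>x. max 0 (X k (T (cell k a) x) - \<gamma> * vol k) \<partial>M)"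
    proof -
     define U where "U = (\<lambda>x. \<Sum>z\<in>?Z. indicator (A K') (T z x) :: real)"
     define V where "V = (\<lambda>x. \<Sum>a\<in>?P. max 0 (X k (T (cell k a) x) - \<gamma> * vol k))"
     have iU: "integrable M U" unfolding U_def by (intro Bochner_Integration.integrable_sum i1)
     have iV: "integrable M V" unfolding V_def by (intro Bochner_Integration.integrable_sum i2)
     have e1: "(\<integral>x. a - b * U x + V x \<partial>M) = a - b * (\<integral>x. U x \<partial>M) + (\<integral>x. V x \<partial>M)" for a b
      using iU iV by (simp add: prob_space)
     have e2: "(\<integral>x. U x \<partial>M) = (\<Sum>z\<in>?Z. \<integral>x. indicator (A K') (T z x) \<partial>M)"
      unfolding U_def by (rule Bochner_Integration.integral_sum[OF i1])
     have e3: "(\<integral>x. V x \<partial>M) = (\<Sum>a\<in>?P. \<integral>x. max 0 (X k (T (cell k a) x) - \<gamma> * vol k) \<partial>M)"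
      unfolding V_def by (rule Bochner_Integration.integral_sum[OF i2])
     show ?thesis unfolding e2[symmetric] e3[symmetric] unfolding U_def V_def by (rule e1[unfolded U_def V_def])
    qed
    also have "(\<Sum>z\<in>?Z. \<integral>x. indicator (A K') (T z x) \<partial>M) = (2 * real (N - K') + 1) ^ ?n * measure M (A K')"
    proof -
     have "(\<integral>x. indicator (A K') (T z x) \<partial>M) = measure M (A K')" for z
      using integral_T[of "indicator (A K') :: _ \<Rightarrow> real" z] by simp
     then show ?thesis by (simp add: cZ[symmetric])
    qed
    also have "(\<Sum>a\<in>?P. \<integral>x. max 0 (X k (T (cell k a) x) - \<gamma> * vol k) \<partial>M)
       = vol N * \<delta> k"
    proof -
     have "(\<integral>x. max 0 (X k (T z x) - \<gamma> * vol k) \<partial>M) = vol k * \<delta> k" for z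
     proof -
      have "(\<integral>x. max 0 (X k (T z x) - \<gamma> * vol k) \<partial>M) = (\<integral>x. max 0 (X k x - \<gamma> * vol k) \<partial>M)"
       by (rule integral_T[where f="\<lambda>x. max 0 (X k x - \<gamma> * vol k)"]) measurable
      also have "\<dots> = (\<integral>x. vol k * max 0 (Y k x - \<gamma>) \<partial>M)"
      proof (intro Bochner_Integration.integral_cong refl)
       fix x
       define p where "p = vol k"
       have p: "0 < p" using k by (simp add: p_def)
       have "X k x - \<gamma> * p = p * (Y k x - \<gamma>)" unfolding Y_def p_def[symmetric] using p by (simp add: field_simps)
       then show "max 0 (X k x - \<gamma> * vol k) = vol k * max 0 (Y k x - \<gamma>)"
        unfolding p_def[symmetric] using p by (simp add: max_def zero_le_mult_iff)
      qed
      finally show ?thesis by (simp add: \<delta>_def)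
     qed
     moreover have "vol N = vol j * vol k"
      unfolding N_def power_mult_distrib[symmetric] by (simp add: ac_simps)
     ultimately show ?thesis by (simp only: sum_constant card_cells mult.assoc)
    qed
    finally have *: "\<epsilon> / 2 / 2 ^ ?n * measure M (A K') * (2 * real (N - K') + 1) ^ ?n \<le> vol N * \<delta> k"
     by (simp add: algebra_simps)
    \<comment> \<open>Since N = 2 k j, the factor in brackets is (N - K') / N: the share of
      admissible centres, which tends to 1 with j.\<close>
    have "vol N * (1 - real K' / (2 * real k) / real j) ^ ?n \<le> (2 * real (N - K') + 1) ^ ?n"
    proof -
     have "vol N * (1 - real K' / (2 * real k) / real j) ^ ?n = vol (N - K')"
      unfolding power_mult_distrib[symmetric] using KN k j
      by (intro arg_cong[where f="\<lambda>t. t ^ ?n"]) (simp add: N_def of_nat_diff field_simps)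
     also have "\<dots> \<le> (2 * real (N - K') + 1) ^ ?n" by (intro power_mono) auto
     finally show ?thesis .
    qed
    then have "\<epsilon> / 2 / 2 ^ ?n * measure M (A K') * (vol N * (1 - real K' / (2 * real k) / real j) ^ ?n)
      \<le> \<epsilon> / 2 / 2 ^ ?n * measure M (A K') * (2 * real (N - K') + 1) ^ ?n"
     using \<epsilon> by (intro mult_left_mono) auto
    also note *
    finally have "vol N * (\<epsilon> / 2 / 2 ^ ?n * measure M (A K') * (1 - real K' / (2 * real k) / real j) ^ ?n)
      \<le> vol N * \<delta> k" by (simp only: ac_simps)
    moreover have "0 < vol N" using N1 by simp
    ultimately show ?thesis by (rule mult_left_le_imp_le)
   qed
   show ?thesis
   proof (rule LIMSEQ_le_const2)
    have "(\<lambda>j. \<epsilon> / 2 / 2 ^ ?n * measure M (A K') * (1 - real K' / (2 * real k) / real j) ^ ?n)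
      \<longlonglongrightarrow> \<epsilon> / 2 / 2 ^ ?n * measure M (A K') * (1 - 0) ^ ?n"
     by (intro tendsto_intros lim_const_over_n)
    then show "(\<lambda>j. \<epsilon> / 2 / 2 ^ ?n * measure M (A K') * (1 - real K' / (2 * real k) / real j) ^ ?n)
      \<longlonglongrightarrow> \<epsilon> / 2 / 2 ^ ?n * measure M (A K')" by simp
    show "\<exists>J. \<forall>j\<ge>J. \<epsilon> / 2 / 2 ^ ?n * measure M (A K') * (1 - real K' / (2 * real k) / real j) ^ ?n \<le> \<delta> k"
     using ineq by (intro exI[of _ "max 1 K'"]) simp
   qed
  qed
  have "(\<lambda>K'. measure M (A K')) \<longlonglongrightarrow> measure M (\<Union>K'. A K')"
  proof (rule finite_Lim_measure_incseq)
   show "incseq A" unfolding A_def incseq_def by force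
  qed auto
  then have "(\<lambda>K'. \<epsilon> / 2 / 2 ^ ?n * measure M (A K')) \<longlonglongrightarrow> \<epsilon> / 2 / 2 ^ ?n * measure M (\<Union>K'. A K')"
   by (rule tendsto_mult_left)
  then have "\<epsilon> / 2 / 2 ^ ?n * measure M (\<Union>K'. A K') \<le> \<delta> k"
   by (rule LIMSEQ_le_const2) (use step in auto)
  moreover have "?L \<subseteq> (\<Union>K'. A K')"
  proof
   fix x assume x: "x \<in> ?L"
   have "\<exists>N\<ge>K. ennreal (Y N x) < ennreal (\<gamma> - \<epsilon>)"
   proof (rule ccontr)
    assume "\<not> ?thesis"
    then have "eventually (\<lambda>N. ennreal (\<gamma> - \<epsilon>) \<le> ennreal (Y N x)) sequentially"
     unfolding eventually_sequentially by (intro exI[of _ K]) (auto simp: not_less)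
    then have "ennreal (\<gamma> - \<epsilon>) \<le> liminf (\<lambda>N. ennreal (Y N x))" by (rule Liminf_bounded)
    then show False using x by (simp add: less_le_not_le)
   qed
   then obtain N where N: "N \<ge> K" "ennreal (Y N x) < ennreal (\<gamma> - \<epsilon>)" by (elim exE conjE)
   have "Y N x < \<gamma> - \<epsilon>" using N(2) Yc(1)[of x N] x by (simp add: ennreal_less_iff)
   then have "X N x \<le> (\<gamma> - \<epsilon>) * vol N"
    using N(1) K(2) unfolding Y_def by (simp add: divide_less_eq)
   then have "x \<in> A N" using x N(1) unfolding A_def by auto
   then show "x \<in> (\<Union>K'. A K')" by blast
  qed
  then have "measure M ?L \<le> measure M (\<Union>K'. A K')" by (intro finite_measure_mono) auto
  then have "\<epsilon> / 2 / 2 ^ ?n * measure M ?L \<le> \<epsilon> / 2 / 2 ^ ?n * measure M (\<Union>K'. A K')"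
   using \<epsilon> by (intro mult_left_mono) auto
  ultimately show ?thesis by linarith
 qed
 have "AE x in M. \<forall>m::nat. ennreal (\<gamma> - 1 / Suc m) \<le> liminf (\<lambda>N. ennreal (Y N x))"
 proof (subst AE_all_countable, rule allI)
  fix m :: nat
  let ?\<epsilon> = "1 / real (Suc m)"
  let ?L = "{x \<in> space M. liminf (\<lambda>N. ennreal (Y N x)) < ennreal (\<gamma> - ?\<epsilon>)}"
  have "?\<epsilon> / 2 / 2 ^ ?n * measure M ?L \<le> 0"
   by (rule LIMSEQ_le_const[OF \<delta>_lim]) (intro exI[of _ 1] allI impI key, auto)
  moreover have "0 < ?\<epsilon> / 2 / 2 ^ ?n" by simp
  ultimately have "measure M ?L \<le> 0" using mult_pos_pos[of "?\<epsilon> / 2 / 2 ^ ?n" "measure M ?L"] by linarith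
  then have m0: "measure M ?L = 0" using measure_nonneg[of M ?L] by linarith
  have Lm: "?L \<in> sets M" by measurable
  have "AE x in M. x \<notin> ?L" using m0 Lm by (intro AE_not_in) (simp add: null_sets_def emeasure_eq_measure)
  then show "AE x in M. ennreal (\<gamma> - ?\<epsilon>) \<le> liminf (\<lambda>N. ennreal (Y N x))"
   by (rule AE_mp) (auto intro!: AE_I2 simp: not_less)
 qed
 then show ?thesis
 proof eventually_elim
  case (elim x)
  have "(\<lambda>m. ennreal (\<gamma> - 1 / Suc m)) \<longlonglongrightarrow> ennreal (\<gamma> - 0)"
   by (intro tendsto_ennrealI tendsto_diff tendsto_const LIMSEQ_Suc[OF lim_const_over_n])
  then have "ennreal (\<gamma> - 0) \<le> liminf (\<lambda>N. ennreal (Y N x))"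
   by (rule LIMSEQ_le_const2) (use elim in auto)
  then show ?case by (simp add: Y_def)
 qed
qed

end

section \<open>Smooth functions\<close>

lemma smooth_fnD:
 assumes "smooth_fn f"
 shows "f differentiable (at x)" "smooth_fn (\<lambda>x. frechet_derivative f (at x) v)"
 using assms by (auto elim: smooth_fn.cases)

lemma smooth_fn_has_derivative:
 "smooth_fn f \<Longrightarrow> (f has_derivative frechet_derivative f (at x)) (at x)"
 using smooth_fnD(1) frechet_derivative_works by blast

lemma smooth_fn_continuous: "smooth_fn f \<Longrightarrow> continuous_on A f"
 using smooth_fn_has_derivative has_derivative_continuous
 by (metis continuous_at_imp_continuous_on)

lemma smooth_fn_derivative_continuous:
 "smooth_fn f \<Longrightarrow> continuous_on A (\<lambda>x. frechet_derivative f (at x) v)"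
 by (rule smooth_fn_continuous[OF smooth_fnD(2)])

abbreviation fderiv :: "('a::real_normed_vector \<Rightarrow> real) \<Rightarrow> 'a \<Rightarrow> 'a \<Rightarrow> real" where
 "fderiv f x \<equiv> frechet_derivative f (at x)"

text \<open>Smooth functions are closed under the operations below because the inductive closure under
 these operations is stable under directional derivatives.\<close>

inductive smooth_closure :: "('a::real_normed_vector \<Rightarrow> real) \<Rightarrow> bool" where
 base: "smooth_fn f \<Longrightarrow> smooth_closure f"
| add: "smooth_closure f \<Longrightarrow> smooth_closure g \<Longrightarrow> smooth_closure (\<lambda>x. f x + g x)"
| mult: "smooth_closure f \<Longrightarrow> smooth_closure g \<Longrightarrow> smooth_closure (\<lambda>x. f x * g x)"
| comp: "smooth_fn (p :: real \<Rightarrow> real) \<Longrightarrow> smooth_closure g \<Longrightarrow> smooth_closure (\<lambda>x. p (g x))"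

lemma smooth_closure_derivative:
 assumes "smooth_closure f"
 shows "\<exists>D. (\<forall>x. (f has_derivative D x) (at x)) \<and> (\<forall>v. smooth_closure (\<lambda>x. D x v))"
 using assms
proof induction
 case (base f)
 then show ?case
  by (intro exI[of _ "\<lambda>x. fderiv f x"])
    (auto intro: smooth_fn_has_derivative smooth_closure.base smooth_fnD(2))
next
 case (add f g)
 then obtain D E where D: "\<And>x. (f has_derivative D x) (at x)" "\<And>v. smooth_closure (\<lambda>x. D x v)"
  and E: "\<And>x. (g has_derivative E x) (at x)" "\<And>v. smooth_closure (\<lambda>x. E x v)" by blast
 show ?case
  by (intro exI[of _ "\<lambda>x v. D x v + E x v"] conjI allI has_derivative_add D E smooth_closure.add)
next
 case (mult f g)
 then obtain D E where D: "\<And>x. (f has_derivative D x) (at x)" "\<And>v. smooth_closure (\<lambda>x. D x v)"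
  and E: "\<And>x. (g has_derivative E x) (at x)" "\<And>v. smooth_closure (\<lambda>x. E x v)" by blast
 show ?case
  by (intro exI[of _ "\<lambda>x v. f x * E x v + D x v * g x"] conjI allI has_derivative_mult D E
    smooth_closure.add smooth_closure.mult mult.hyps)
next
 case (comp p g)
 then obtain D where D: "\<And>x. (g has_derivative D x) (at x)" "\<And>v. smooth_closure (\<lambda>x. D x v)" by blast
 have p: "(p has_derivative (\<lambda>v. v * fderiv p y 1)) (at y)" for y
 proof -
  have d: "(p has_derivative fderiv p y) (at y)"
   by (rule smooth_fn_has_derivative[OF comp.hyps(1)])
  have "fderiv p y v = v * fderiv p y 1" for v
   using linear_scale[OF has_derivative_linear[OF d], of v 1] by simp
  then have "fderiv p y = (\<lambda>v. v * fderiv p y 1)" by (rule ext)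
  then show ?thesis using d by simp
 qed
 show ?case
 proof (intro exI[of _ "\<lambda>x v. D x v * fderiv p (g x) 1"] conjI allI)
  show "((\<lambda>x. p (g x)) has_derivative (\<lambda>v. D x v * fderiv p (g x) 1)) (at x)" for x
   using has_derivative_compose[OF D(1) p] .
  show "smooth_closure (\<lambda>x. D x v * fderiv p (g x) 1)" for v
   by (intro smooth_closure.mult D(2) smooth_closure.comp[OF smooth_fnD(2)] comp.hyps)
 qed
qed

lemma smooth_fn_if_closure: "smooth_closure f \<Longrightarrow> smooth_fn f"
proof (coinduction arbitrary: f)
 case smooth_fn
 obtain D where D: "\<And>x. (f has_derivative D x) (at x)" "\<And>v. smooth_closure (\<lambda>x. D x v)"
  using smooth_closure_derivative[OF smooth_fn] by blast
 have "fderiv f x = D x" for x by (rule frechet_derivative_at[OF D(1), symmetric])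
 then show ?case using D by (auto simp: differentiable_def)
qed

text \<open>Coinduction with a set of functions, closed under directional derivatives, as the
  invariant. Derivatives may be given in any form, not only as
  \<open>frechet_derivative\<close>.\<close>

lemma smooth_fn_coinduct_family:
 assumes "f \<in> \<F>"
  and "\<And>f. f \<in> \<F> \<Longrightarrow> \<exists>D. (\<forall>x. (f has_derivative D x) (at x)) \<and> (\<forall>v. (\<lambda>x. D x v) \<in> \<F>)"
 shows "smooth_fn f"
 using assms(1)
proof (coinduction arbitrary: f)
 case smooth_fn
 obtain D where D: "\<And>x. (f has_derivative D x) (at x)" "\<And>v. (\<lambda>x. D x v) \<in> \<F>"
  using assms(2)[OF smooth_fn] by blast
 have "fderiv f x = D x" for x by (rule frechet_derivative_at[OF D(1), symmetric])
 then show ?case using D by (auto simp: differentiable_def)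
qed

lemma smooth_fn_const: "smooth_fn (\<lambda>_. c)"
 by (rule smooth_fn_coinduct_family[where \<F>="range (\<lambda>c _. c)"])
   (auto intro!: exI[of _ "\<lambda>_ _. 0"])

lemma smooth_fn_inner: "smooth_fn (\<lambda>x. x \<bullet> a)"
proof (rule smooth_fn_coinduct_family[where \<F>="insert (\<lambda>x. x \<bullet> a) (range (\<lambda>c _. c))"])
 fix f assume "f \<in> insert (\<lambda>x. x \<bullet> a) (range (\<lambda>c _. c))"
 then show "\<exists>D. (\<forall>x. (f has_derivative D x) (at x)) \<and> (\<forall>v. (\<lambda>x. D x v) \<in> insert (\<lambda>x. x \<bullet> a) (range (\<lambda>c _. c)))"
 proof
  assume f: "f = (\<lambda>x. x \<bullet> a)"
  show ?thesis unfolding f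
   by (intro exI[of _ "\<lambda>x v. v \<bullet> a"]) (auto intro!: derivative_eq_intros)
 qed (auto intro!: exI[of _ "\<lambda>_ _. 0"])
qed simp

lemma smooth_fn_add: "smooth_fn f \<Longrightarrow> smooth_fn g \<Longrightarrow> smooth_fn (\<lambda>x. f x + g x)"
 by (rule smooth_fn_if_closure, rule smooth_closure.add) (rule smooth_closure.base; assumption)+

lemma smooth_fn_mult: "smooth_fn f \<Longrightarrow> smooth_fn g \<Longrightarrow> smooth_fn (\<lambda>x. f x * g x)"
 by (rule smooth_fn_if_closure, rule smooth_closure.mult) (rule smooth_closure.base; assumption)+

lemma smooth_fn_comp: "smooth_fn (p :: real \<Rightarrow> real) \<Longrightarrow> smooth_fn g \<Longrightarrow> smooth_fn (\<lambda>x. p (g x))"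
 by (rule smooth_fn_if_closure, rule smooth_closure.comp, assumption) (rule smooth_closure.base; assumption)

lemma smooth_fn_diff: "smooth_fn f \<Longrightarrow> smooth_fn g \<Longrightarrow> smooth_fn (\<lambda>x. f x - g x)"
 using smooth_fn_add[of f "\<lambda>x. (-1) * g x"] smooth_fn_mult[OF smooth_fn_const, of g "-1"] by simp

lemma smooth_fn_prod:
 "finite I \<Longrightarrow> (\<And>i. i \<in> I \<Longrightarrow> smooth_fn (f i)) \<Longrightarrow> smooth_fn (\<lambda>x. \<Prod>i\<in>I. f i x)"
proof (induction I rule: finite_induct)
 case (insert i I)
 then show ?case using smooth_fn_mult[of "f i" "\<lambda>x. \<Prod>i\<in>I. f i x"] by simp
qed (simp add: smooth_fn_const)

lemma smooth_fn_translate: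
 assumes "smooth_fn f"
 shows "smooth_fn (\<lambda>x. f (x + y))"
proof (rule smooth_fn_coinduct_family[where \<F>="(\<lambda>f x. f (x + y)) ` {f. smooth_fn f}"])
 fix g assume "g \<in> (\<lambda>f x. f (x + y)) ` {f. smooth_fn f}"
 then obtain f where f: "smooth_fn f" "g = (\<lambda>x. f (x + y))" by blast
 have "(g has_derivative fderiv f (x + y)) (at x)" for x
  unfolding f(2)
  using has_derivative_compose[OF has_derivative_add_const[OF has_derivative_ident] smooth_fn_has_derivative[OF f(1)], of y x UNIV]
  by simp
 then show "\<exists>D. (\<forall>x. (g has_derivative D x) (at x)) \<and> (\<forall>v. (\<lambda>x. D x v) \<in> (\<lambda>f x. f (x + y)) ` {f. smooth_fn f})"
  using smooth_fnD(2)[OF f(1)]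
  by (intro exI[of _ "\<lambda>x. fderiv f (x + y)"]) (auto simp: image_iff)
qed (use assms in auto)

text \<open>The derivatives of the flat function exp (-1/x) all have this form, so admitting a
  polynomial factor gives a class closed under differentiation.\<close>

definition bump_poly :: "real poly \<Rightarrow> real \<Rightarrow> real" where
 "bump_poly P x = (if x \<le> 0 then 0 else poly P (1 / x) * exp (- (1 / x)))"

lemma poly_exp_decay: "((\<lambda>y::real. poly P y * exp (- y)) \<longlongrightarrow> 0) at_top"
proof -
 have "((\<lambda>y::real. \<Sum>i\<le>degree P. coeff P i * (y ^ i / exp y)) \<longlongrightarrow> (\<Sum>i\<le>degree P. coeff P i * 0)) at_top"
  by (intro tendsto_sum tendsto_mult tendsto_const tendsto_power_div_exp_0)
 then show ?thesis
  by (simp add: poly_altdef sum_distrib_right exp_minus divide_inverse mult.assoc)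
qed

text \<open>Away from 0 this is the chain rule; the monomial of degree two is the derivative of 1/x
  up to sign. At 0 the difference quotient from the right is y P(y) exp (-y) with y = 1/x tending to
  infinity.\<close>

lemma bump_poly_has_derivative:
 "(bump_poly P has_real_derivative bump_poly (monom 1 2 * (P - pderiv P)) x) (at x)"
proof -
 consider "x < 0" | "x > 0" | "x = 0" by linarith
 then show ?thesis
 proof cases
  case 1
  have "eventually (\<lambda>y. y \<in> {..<0}) (nhds x)" using 1 by (intro eventually_nhds_in_open) auto
  then have "eventually (\<lambda>y. bump_poly P y = 0) (nhds x)"
   by eventually_elim (simp add: bump_poly_def)
  then show ?thesis using 1 by (subst DERIV_cong_ev[OF refl _ refl]) (auto simp: bump_poly_def)
 next
  case 2
  have "eventually (\<lambda>y. y \<in> {0<..}) (nhds x)" using 2 by (intro eventually_nhds_in_open) auto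
  then have ev: "eventually (\<lambda>y. bump_poly P y = poly P (1 / y) * exp (- (1 / y))) (nhds x)"
   by eventually_elim (simp add: bump_poly_def)
  have "((\<lambda>y. poly P (1 / y) * exp (- (1 / y))) has_real_derivative
    bump_poly (monom 1 2 * (P - pderiv P)) x) (at x)"
   using 2 by (auto intro!: derivative_eq_intros DERIV_chain2[OF poly_DERIV]
    simp: bump_poly_def poly_monom field_simps power2_eq_square)
  then show ?thesis using DERIV_cong_ev[OF refl ev refl] by blast
 next
  case 3
  have lim: "((\<lambda>y. bump_poly P y / y) \<longlongrightarrow> 0) (at 0)"
   unfolding filterlim_at_split
  proof
   show "((\<lambda>y. bump_poly P y / y) \<longlongrightarrow> 0) (at_left 0)"
    by (rule tendsto_eventually)
      (auto simp: eventually_at_filter bump_poly_def intro!: always_eventually)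
   have "((\<lambda>y. poly (monom 1 1 * P) (inverse y) * exp (- inverse y)) \<longlongrightarrow> 0) (at_right 0)"
    by (rule filterlim_compose[OF poly_exp_decay filterlim_inverse_at_top_right])
   moreover have "eventually (\<lambda>y. poly (monom 1 1 * P) (inverse y) * exp (- inverse y) = bump_poly P y / y) (at_right 0)"
    by (auto simp: eventually_at_filter bump_poly_def poly_monom field_simps intro!: always_eventually)
   ultimately show "((\<lambda>y. bump_poly P y / y) \<longlongrightarrow> 0) (at_right 0)"
    by (rule Lim_transform_eventually)
  qed
  then show ?thesis unfolding 3 by (simp add: DERIV_def bump_poly_def)
 qed
qed

lemma smooth_fn_bump_poly: "smooth_fn (bump_poly P)"
\<comment> \<open>The factor c absorbs the direction v, which enters a directional derivative on the
  line as a scalar.\<close>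
proof (rule smooth_fn_coinduct_family[where \<F>="range (\<lambda>(P, c) x. bump_poly P x * c)"])
 show "bump_poly P \<in> range (\<lambda>(P, c) x. bump_poly P x * c)"
  by (intro image_eqI[of _ _ "(P, 1)"]) auto
 fix f assume "f \<in> range (\<lambda>(P, c) x. bump_poly P x * c)"
 then obtain P c where f: "f = (\<lambda>x. bump_poly P x * c)" by auto
 let ?Q = "monom 1 2 * (P - pderiv P)"
 have "(f has_derivative (\<lambda>v. bump_poly ?Q x * (c * v))) (at x)" for x
  unfolding f using has_derivative_mult_left[OF bump_poly_has_derivative[of P x, unfolded has_field_derivative_def], of c]
  by (simp add: ac_simps)
 then show "\<exists>D. (\<forall>x. (f has_derivative D x) (at x)) \<and> (\<forall>v. (\<lambda>x. D x v) \<in> range (\<lambda>(P, c) x. bump_poly P x * c))"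
  by (intro exI[of _ "\<lambda>x v. bump_poly ?Q x * (c * v)"]) (auto simp: image_iff intro!: exI[of _ ?Q])
qed

text \<open>A transition built from compositions only, without a quotient of bumps. For t \<ge> 1
  the inner bump vanishes and the outer one takes the value exp (- exp 1), which the prefactor
  normalises to 1; for t \<le> 0 the inner bump is at least exp (-1), so the outer argument is
  nonpositive.\<close>

definition smooth_step :: "real \<Rightarrow> real" where
 "smooth_step t = exp (exp 1) * bump_poly 1 (exp (- 1) - bump_poly 1 (1 - t))"

lemma smooth_fn_smooth_step: "smooth_fn smooth_step"
proof -
 have id: "smooth_fn (\<lambda>t::real. t)" using smooth_fn_inner[of "1::real"] by simp
 show ?thesis unfolding smooth_step_def[abs_def]
  by (intro smooth_fn_mult smooth_fn_const smooth_fn_comp[OF smooth_fn_bump_poly] smooth_fn_diff id)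
qed

lemma smooth_step_eq_0: "t \<le> 0 \<Longrightarrow> smooth_step t = 0"
proof -
 assume "t \<le> 0"
 then have "1 / (1 - t) \<le> 1" by (simp add: divide_le_eq)
 then have "exp (- 1) \<le> bump_poly 1 (1 - t)" using \<open>t \<le> 0\<close> by (simp add: bump_poly_def)
 then show ?thesis by (simp add: smooth_step_def bump_poly_def)
qed

lemma smooth_step_eq_1: "1 \<le> t \<Longrightarrow> smooth_step t = 1"
proof -
 assume "1 \<le> t"
 moreover have "1 / exp (-1) = exp (1::real)" by (simp add: exp_minus divide_inverse)
 ultimately show ?thesis by (simp add: smooth_step_def bump_poly_def flip: exp_add)
qed

lemma smooth_step_bounds: "0 \<le> smooth_step t" "smooth_step t \<le> 1"
proof -
 have nn: "0 \<le> bump_poly 1 s" for s by (simp add: bump_poly_def)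
 show "0 \<le> smooth_step t" unfolding smooth_step_def using nn by simp
 let ?s = "exp (- 1) - bump_poly 1 (1 - t)"
 have "bump_poly 1 ?s \<le> exp (- exp 1)"
 proof (cases "?s \<le> 0")
  case False
  have "exp 1 \<le> 1 / ?s"
  proof -
   have "?s \<le> exp (-1)" using nn by simp
   then have "1 / exp (-1) \<le> 1 / ?s" using False by (intro divide_left_mono) auto
   then show ?thesis by (simp add: exp_minus divide_inverse)
  qed
  then show ?thesis using False by (simp add: bump_poly_def)
 qed (simp add: bump_poly_def)
 then have "smooth_step t \<le> exp (exp 1) * exp (- exp 1)"
  unfolding smooth_step_def by (intro mult_left_mono) auto
 then show "smooth_step t \<le> 1" by (simp flip: exp_add)
qed

lemma smooth_fn_has_real_derivative:
 fixes f :: "real \<Rightarrow> real"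
 assumes "smooth_fn f"
 shows "(f has_real_derivative deriv f x) (at x)"
 using smooth_fnD(1)[OF assms] by (metis DERIV_deriv_iff_real_differentiable)

lemma smooth_fn_deriv:
 fixes f :: "real \<Rightarrow> real"
 assumes "smooth_fn f"
 shows "smooth_fn (deriv f)"
proof -
 have "deriv f = (\<lambda>x. fderiv f x 1)"
 proof
  fix x
  have "fderiv f x = (*) (deriv f x)"
   using smooth_fn_has_real_derivative[OF assms, of x] unfolding has_field_derivative_def
   by (rule frechet_derivative_at[symmetric])
  then show "deriv f x = fderiv f x 1" by simp
 qed
 then show ?thesis using smooth_fnD(2)[OF assms, of 1] by simp
qed

lemma smooth_step_deriv_eq_0: "t \<notin> {0..1} \<Longrightarrow> deriv smooth_step t = 0"
proof -
 assume t: "t \<notin> {0..1}"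
 obtain c U where U: "open U" "t \<in> U" "\<And>s. s \<in> U \<Longrightarrow> smooth_step s = c"
 proof (cases "t < 0")
  case True
  then show ?thesis by (intro that[of "{..<0}" 0]) (auto simp: smooth_step_eq_0)
 next
  case False
  then show ?thesis using t by (intro that[of "{1<..}" 1]) (auto simp: smooth_step_eq_1)
 qed
 have "((\<lambda>_. c) has_real_derivative deriv smooth_step t) (at t)"
  by (rule has_field_derivative_transform_within_open[OF smooth_fn_has_real_derivative[OF smooth_fn_smooth_step] U(1,2)]) (rule U(3))
 then show ?thesis by (rule DERIV_unique[OF _ DERIV_const])
qed

lemma smooth_step_deriv_bound: "\<exists>L. \<forall>t. \<bar>deriv smooth_step t\<bar> \<le> L"
proof -
 have "compact (deriv smooth_step ` {0..1})"
  by (intro compact_continuous_image smooth_fn_continuous smooth_fn_deriv smooth_fn_smooth_step) auto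
 then obtain L where "\<forall>y\<in>deriv smooth_step ` {0..1}. norm y \<le> L"
  using compact_imp_bounded bounded_iff by metis
 then have "\<bar>deriv smooth_step t\<bar> \<le> max 0 L" for t
  using smooth_step_deriv_eq_0[of t] by (cases "t \<in> {0..1}") (auto intro: max.coboundedI2)
 then show ?thesis by (intro exI allI)
qed

lemma smooth_fn_borel_measurable [measurable_dest]:
 "smooth_fn f \<Longrightarrow> f \<in> borel_measurable borel"
 by (intro borel_measurable_continuous_onI smooth_fn_continuous)

lemma frechet_derivative_mult_smooth:
 assumes "smooth_fn f" "smooth_fn g"
 shows "fderiv (\<lambda>x. f x * g x) x v = f x * fderiv g x v + fderiv f x v * g x"
 using frechet_derivative_at[OF has_derivative_mult[OF smooth_fn_has_derivative[OF assms(1)] smooth_fn_has_derivative[OF assms(2)]], symmetric]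
 by simp

lemma frechet_derivative_outside_tsupport:
 assumes "x \<notin> tsupport f"
 shows "fderiv f x v = 0" "f x = 0"
proof -
 have op: "open (- tsupport f)" unfolding tsupport_def by auto
 have z: "f y = 0" if "y \<in> - tsupport f" for y
  using that closure_subset[of "{x. f x \<noteq> 0}"] unfolding tsupport_def by auto
 show "f x = 0" using z assms by simp
 have "(f has_derivative (\<lambda>_. 0)) (at x)"
  by (rule has_derivative_transform_within_open[OF has_derivative_const[of 0] op])
    (use assms z in auto)
 then show "fderiv f x v = 0" by (simp add: frechet_derivative_at[symmetric])
qed

lemma tsupport_subsetI:
 assumes "closed K" "\<And>x. x \<notin> K \<Longrightarrow> f x = 0"
 shows "tsupport f \<subseteq> K"
 unfolding tsupport_def using assms by (intro closure_minimal) auto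

lemma compact_tsupportI:
 assumes "compact K" "\<And>x. x \<notin> K \<Longrightarrow> f x = 0"
 shows "compact (tsupport f)"
 using compact_Int_closed[of K "tsupport f"] tsupport_subsetI[OF compact_imp_closed[OF assms(1)] assms(2)] assms(1)
 by (simp add: tsupport_def Int_absorb1)

lemma closed_tsupport: "closed (tsupport f)" by (simp add: tsupport_def)

section \<open>Integration by parts against test functions\<close>

lemma integral_lborel_translate:
 fixes f :: "'a::euclidean_space \<Rightarrow> real"
 assumes "f \<in> borel_measurable borel"
 shows "(\<integral>x. f (x + a) \<partial>lborel) = (\<integral>x. f x \<partial>lborel)"
proof -
 have "(\<integral>x. f x \<partial>lborel) = (\<integral>x. f x \<partial>distr lborel borel ((+) a))"
  by (simp add: lborel_distr_plus)
 also have "\<dots> = (\<integral>x. f (a + x) \<partial>lborel)" using assms by (subst integral_distr) auto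
 finally show ?thesis by (simp add: add.commute)
qed

lemma integrable_lborel_bounded_support:
 fixes f :: "'a::euclidean_space \<Rightarrow> real"
 assumes "f \<in> borel_measurable borel" "compact K" "\<And>x. x \<notin> K \<Longrightarrow> f x = 0" "\<And>x. \<bar>f x\<bar> \<le> C"
 shows "integrable lborel f"
proof (rule Bochner_Integration.integrable_bound[of _ "\<lambda>x. C * indicator K x"])
 show "integrable lborel (\<lambda>x. C * indicator K x :: real)"
  using emeasure_bounded_finite[OF compact_imp_bounded[OF assms(2)]] borel_compact[OF assms(2)]
  by (intro integrable_mult_right integrable_real_indicator) auto
 show "AE x in lborel. norm (f x) \<le> norm (C * indicator K x)"
 proof (rule AE_I2)
  fix x
  show "norm (f x) \<le> norm (C * indicator K x)"
   using assms(3)[of x] assms(4)[of x] by (cases "x \<in> K") auto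
 qed
qed (use assms in auto)

lemma continuous_compact_support_bounded:
 fixes f :: "'a::euclidean_space \<Rightarrow> real"
 assumes "continuous_on UNIV f" "compact K" "\<And>x. x \<notin> K \<Longrightarrow> f x = 0"
 shows "\<exists>C\<ge>0. \<forall>x. \<bar>f x\<bar> \<le> C"
proof -
 have "compact (f ` K)" using assms by (intro compact_continuous_image continuous_on_subset[OF assms(1)]) auto
 then obtain C where C: "\<forall>y\<in>f ` K. norm y \<le> C" using compact_imp_bounded bounded_iff by metis
 show ?thesis
 proof (intro exI[of _ "max 0 C"] conjI allI)
  fix x show "\<bar>f x\<bar> \<le> max 0 C" using C assms(3)[of x] by (cases "x \<in> K") (auto intro: max.coboundedI2)
 qed simp
qed

text \<open>The difference quotients in direction v have integral zero by translation invariance,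
  and they converge boundedly to the derivative. This works in any direction at once, without
  coordinates.\<close>

lemma integral_frechet_derivative_eq_0:
 fixes f :: "'a::euclidean_space \<Rightarrow> real"
 assumes f: "smooth_fn f" and K: "compact (tsupport f)"
 shows "(\<integral>x. fderiv f x v \<partial>lborel) = 0"
proof -
 have cont: "continuous_on UNIV (\<lambda>x. fderiv f x v)"
  by (rule smooth_fn_derivative_continuous[OF f])
 obtain C where C: "0 \<le> C" "\<And>x. \<bar>fderiv f x v\<bar> \<le> C"
  using continuous_compact_support_bounded[OF cont K frechet_derivative_outside_tsupport(1)] by auto
 \<comment> \<open>Swept out by the support under backward shifts by up to v; all difference
   quotients with step at most 1 are supported here.\<close>
 define K' where "K' = (\<lambda>(x, s). x - s *\<^sub>R v) ` (tsupport f \<times> {0..1::real})"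
 have K': "compact K'" unfolding K'_def
  by (intro compact_continuous_image compact_Times K) (auto simp: case_prod_unfold intro!: continuous_intros)
 have K'in: "x \<in> K'" if "x + s *\<^sub>R v \<in> tsupport f" "s \<in> {0..1}" for x s
  unfolding K'_def using that by (intro image_eqI[of _ _ "(x + s *\<^sub>R v, s)"]) auto
 have line: "((\<lambda>s. f (x + s *\<^sub>R v)) has_real_derivative fderiv f (x + s *\<^sub>R v) v) (at s)" for x s
 proof -
  have "((\<lambda>s. x + s *\<^sub>R v) has_derivative (\<lambda>h. h *\<^sub>R v)) (at s)"
   by (auto intro!: derivative_eq_intros)
  from has_derivative_compose[OF this smooth_fn_has_derivative[OF f]]
  have "((\<lambda>s. f (x + s *\<^sub>R v)) has_derivative (\<lambda>h. fderiv f (x + s *\<^sub>R v) (h *\<^sub>R v))) (at s)" .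
  moreover have "fderiv f (x + s *\<^sub>R v) (h *\<^sub>R v) = fderiv f (x + s *\<^sub>R v) v * h" for h
   using linear_scale[OF has_derivative_linear[OF smooth_fn_has_derivative[OF f]], of "x + s *\<^sub>R v" h v] by simp
  ultimately show ?thesis unfolding has_field_derivative_def by simp
 qed
 define g where "g = (\<lambda>n x. (f (x + (1 / Suc n) *\<^sub>R v) - f x) * real (Suc n))"
 have fm: "f \<in> borel_measurable borel" by (rule smooth_fn_borel_measurable[OF f])
 have fsm: "(\<lambda>x. f (x + a)) \<in> borel_measurable borel" for a
  by (rule smooth_fn_borel_measurable[OF smooth_fn_translate[OF f]])
 have gm: "g n \<in> borel_measurable lborel" for n
  unfolding g_def using fm fsm by simp
 have gb: "norm (g n x) \<le> C * indicator K' x" for n x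
 proof (cases "x \<in> K'")
  case False
  have "x \<notin> tsupport f" "x + (1 / Suc n) *\<^sub>R v \<notin> tsupport f"
   using K'in[of x 0] K'in[of x "1 / Suc n"] False by auto
  then show ?thesis using False frechet_derivative_outside_tsupport(2)[of _ f] by (simp add: g_def)
 next
  case True
  have "\<exists>s>0. s < 1 / real (Suc n) \<and> f (x + (1 / Suc n) *\<^sub>R v) - f (x + 0 *\<^sub>R v) = (1 / real (Suc n) - 0) * fderiv f (x + s *\<^sub>R v) v"
   by (rule MVT2) (use line in auto)
  then obtain s where s: "f (x + (1 / Suc n) *\<^sub>R v) - f x = (1 / real (Suc n)) * fderiv f (x + s *\<^sub>R v) v"
   by auto
  have "g n x = fderiv f (x + s *\<^sub>R v) v" unfolding g_def s by simp
  then show ?thesis using C(2) True by simp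
 qed
 have lim: "(\<lambda>n. g n x) \<longlonglongrightarrow> fderiv f x v" for x
 proof -
  have "((\<lambda>h. (f (x + h *\<^sub>R v) - f x) / h) \<longlongrightarrow> fderiv f x v) (at 0)"
   using line[of x 0] by (simp add: DERIV_def)
  moreover have "filterlim (\<lambda>n. 1 / real (Suc n)) (at 0) sequentially"
   unfolding filterlim_at using LIMSEQ_Suc[OF lim_const_over_n[of 1]] by simp
  ultimately have "(\<lambda>n. (f (x + (1 / real (Suc n)) *\<^sub>R v) - f x) / (1 / real (Suc n))) \<longlonglongrightarrow> fderiv f x v"
   by (rule filterlim_compose)
  then show ?thesis by (simp add: g_def)
 qed
 have "(\<lambda>n. \<integral>x. g n x \<partial>lborel) \<longlonglongrightarrow> (\<integral>x. fderiv f x v \<partial>lborel)"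
 proof (rule integral_dominated_convergence[where w="\<lambda>x. C * indicator K' x"])
  show "integrable lborel (\<lambda>x. C * indicator K' x :: real)"
   using emeasure_bounded_finite[OF compact_imp_bounded[OF K']] borel_compact[OF K']
   by (intro integrable_mult_right integrable_real_indicator) auto
  show "(\<lambda>x. fderiv f x v) \<in> borel_measurable lborel"
   using borel_measurable_continuous_onI[OF cont] by simp
 qed (use gm gb lim in auto)
 moreover have "(\<integral>x. g n x \<partial>lborel) = 0" for n
 proof -
  obtain C' where C': "\<And>x. \<bar>f x\<bar> \<le> C'"
   using continuous_compact_support_bounded[OF smooth_fn_continuous[OF f] K] frechet_derivative_outside_tsupport(2)[of _ f] by auto
  have i1: "integrable lborel f"
   by (rule integrable_lborel_bounded_support[OF fm K _ C']) (rule frechet_derivative_outside_tsupport(2))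
  have i2: "integrable lborel (\<lambda>x. f (x + (1 / Suc n) *\<^sub>R v))"
  proof (rule integrable_lborel_bounded_support[OF fsm K' _ C'])
   fix x assume "x \<notin> K'"
   then have "x + (1 / Suc n) *\<^sub>R v \<notin> tsupport f" using K'in[of x "1 / Suc n"] by auto
   then show "f (x + (1 / Suc n) *\<^sub>R v) = 0" by (rule frechet_derivative_outside_tsupport(2))
  qed
  have "(\<integral>x. g n x \<partial>lborel) = ((\<integral>x. f (x + (1 / Suc n) *\<^sub>R v) \<partial>lborel) - (\<integral>x. f x \<partial>lborel)) * real (Suc n)"
   unfolding g_def using i1 i2 by simp
  then show ?thesis using integral_lborel_translate[OF fm] by simp
 qed
 ultimately show ?thesis using LIMSEQ_unique[OF _ tendsto_const] by simp
qed

lemma tsupport_mult_subset: "tsupport (\<lambda>x. f x * g x) \<subseteq> tsupport g"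
 unfolding tsupport_def by (intro closure_mono) auto

lemma compact_tsupport_mult: "compact (tsupport g) \<Longrightarrow> compact (tsupport (\<lambda>x. f x * g x))"
 using compact_Int_closed[of "tsupport g" "tsupport (\<lambda>x. f x * g x)"] tsupport_mult_subset[of f g]
 by (simp add: closed_tsupport Int_absorb1)

text \<open>The product of u and the test function inherits compact support from the latter, so the
  integral of its derivative vanishes.\<close>

lemma smooth_integration_by_parts:
 fixes u \<phi> :: "'a::euclidean_space \<Rightarrow> real"
 assumes u: "smooth_fn u" and p: "test_fn D \<phi>"
 shows "(\<integral>x. indicator D x * u x * fderiv \<phi> x v \<partial>lebesgue)
   = - (\<integral>x. indicator D x * fderiv u x v * \<phi> x \<partial>lebesgue)"
proof -
 have ps: "smooth_fn \<phi>" "compact (tsupport \<phi>)" "tsupport \<phi> \<subseteq> D" using p by (auto simp: test_fn_def)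
 have z: "\<phi> x = 0" "fderiv \<phi> x v = 0" if "x \<notin> tsupport \<phi>" for x
  using frechet_derivative_outside_tsupport[OF that] by auto
 have i: "integrable lborel f" if "continuous_on UNIV f" and f0: "\<And>x. x \<notin> tsupport \<phi> \<Longrightarrow> f x = 0" for f :: "'a \<Rightarrow> real"
 proof -
  obtain C where "\<And>x. \<bar>f x\<bar> \<le> C" using continuous_compact_support_bounded[OF \<open>continuous_on UNIV f\<close> ps(2)] f0 by auto
  then show ?thesis using f0 \<open>continuous_on UNIV f\<close> ps by (intro integrable_lborel_bounded_support[of f "tsupport \<phi>" C] borel_measurable_continuous_onI) auto
 qed
 note c = smooth_fn_continuous[of _ UNIV] smooth_fn_derivative_continuous[of _ UNIV]
 have c1: "continuous_on UNIV (\<lambda>x. u x * fderiv \<phi> x v)"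
  by (intro continuous_intros c u ps)
 have c2: "continuous_on UNIV (\<lambda>x. fderiv u x v * \<phi> x)"
  by (intro continuous_intros c u ps)
 have "0 = (\<integral>x. fderiv (\<lambda>x. u x * \<phi> x) x v \<partial>lborel)"
  by (rule integral_frechet_derivative_eq_0[symmetric]) (intro smooth_fn_mult u ps compact_tsupport_mult)+
 also have "\<dots> = (\<integral>x. u x * fderiv \<phi> x v \<partial>lborel) + (\<integral>x. fderiv u x v * \<phi> x \<partial>lborel)"
  unfolding frechet_derivative_mult_smooth[OF u ps(1)]
  by (intro Bochner_Integration.integral_add i c1 c2) (auto simp: z)
 finally have "(\<integral>x. u x * fderiv \<phi> x v \<partial>lborel) = - (\<integral>x. fderiv u x v * \<phi> x \<partial>lborel)" by simp
 moreover have "(\<integral>x. indicator D x * u x * fderiv \<phi> x v \<partial>lebesgue) = (\<integral>x. u x * fderiv \<phi> x v \<partial>lborel)"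
 proof -
  have "indicator D x * u x * fderiv \<phi> x v = u x * fderiv \<phi> x v" for x
   using z[of x] ps(3) by (cases "x \<in> D") auto
  then have "(\<integral>x. indicator D x * u x * fderiv \<phi> x v \<partial>lebesgue) = (\<integral>x. u x * fderiv \<phi> x v \<partial>lebesgue)" by (intro Bochner_Integration.integral_cong refl)
  then show ?thesis using borel_measurable_continuous_onI[OF c1] by (simp add: integral_completion)
 qed
 moreover have "(\<integral>x. indicator D x * fderiv u x v * \<phi> x \<partial>lebesgue) = (\<integral>x. fderiv u x v * \<phi> x \<partial>lborel)"
 proof -
  have "indicator D x * fderiv u x v * \<phi> x = fderiv u x v * \<phi> x" for x
   using z[of x] ps(3) by (cases "x \<in> D") auto
  then have "(\<integral>x. indicator D x * fderiv u x v * \<phi> x \<partial>lebesgue) = (\<integral>x. fderiv u x v * \<phi> x \<partial>lebesgue)" by (intro Bochner_Integration.integral_cong refl)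
  then show ?thesis using borel_measurable_continuous_onI[OF c2] by (simp add: integral_completion)
 qed
 ultimately show ?thesis by simp
qed

section \<open>Sobolev functions\<close>

definition measH :: "'a::euclidean_space set \<Rightarrow> ('a \<Rightarrow> real) \<Rightarrow> ('a \<Rightarrow> 'a) \<Rightarrow> bool" where
 "measH D w G \<longleftrightarrow> (\<lambda>x. indicator D x * w x) \<in> borel_measurable lebesgue \<and>
   (\<lambda>x. indicator D x *\<^sub>R G x) \<in> borel_measurable lebesgue"

text \<open>The squared Sobolev norm with value in [0, \<infinity>]. The integral in
  \<open>H10\<close> would instead default to 0 for a function that is not integrable;
  \<open>H10I\<close> and \<open>H10D\<close> show that the two notions of convergence agree where
  they are used.\<close>

definition sob :: "'a::euclidean_space set \<Rightarrow> ('a \<Rightarrow> real) \<Rightarrow> ('a \<Rightarrow> 'a) \<Rightarrow> ennreal" where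
 "sob D w G = (\<integral>\<^sup>+x. ennreal (indicator D x * ((w x)\<^sup>2 + (norm (G x))\<^sup>2)) \<partial>lebesgue)"

lemma measH_sq:
 assumes "measH D w G"
 shows "(\<lambda>x. indicator D x * (w x)\<^sup>2) \<in> borel_measurable lebesgue"
  "(\<lambda>x. indicator D x * (norm (G x))\<^sup>2) \<in> borel_measurable lebesgue"
  "(\<lambda>x. indicator D x * ((w x)\<^sup>2 + (norm (G x))\<^sup>2)) \<in> borel_measurable lebesgue"
proof -
 have m [measurable]: "(\<lambda>x. indicator D x * w x) \<in> borel_measurable lebesgue"
   "(\<lambda>x. indicator D x *\<^sub>R G x) \<in> borel_measurable lebesgue"
  using assms by (auto simp: measH_def)
 have e: "indicator D x * (w x)\<^sup>2 = (indicator D x * w x)\<^sup>2"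
   "indicator D x * (norm (G x))\<^sup>2 = (norm (indicator D x *\<^sub>R G x))\<^sup>2" for x
  by (cases "x \<in> D"; simp)+
 show 1: "(\<lambda>x. indicator D x * (w x)\<^sup>2) \<in> borel_measurable lebesgue" unfolding e(1) by measurable
 show 2: "(\<lambda>x. indicator D x * (norm (G x))\<^sup>2) \<in> borel_measurable lebesgue" unfolding e(2) by measurable
 show "(\<lambda>x. indicator D x * ((w x)\<^sup>2 + (norm (G x))\<^sup>2)) \<in> borel_measurable lebesgue"
  unfolding distrib_left by (intro borel_measurable_add 1 2)
qed

lemma measH_add:
 assumes "measH D w G" "measH D w' G'"
 shows "measH D (\<lambda>x. w x + w' x) (\<lambda>x. G x + G' x)"
 using assms unfolding measH_def distrib_left scaleR_right_distrib by (auto intro: borel_measurable_add)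

lemma measH_diff:
 assumes "measH D w G" "measH D w' G'"
 shows "measH D (\<lambda>x. w x - w' x) (\<lambda>x. G x - G' x)"
 using assms unfolding measH_def right_diff_distrib scaleR_right_diff_distrib by (auto intro: borel_measurable_diff)

lemma sq_add_le: "(a + b)\<^sup>2 \<le> 2 * a\<^sup>2 + 2 * (b::real)\<^sup>2"
 using sum_squares_bound[of a b] by (simp add: power2_sum)

lemma norm_sq_add_le: "(norm (a + b))\<^sup>2 \<le> 2 * (norm a)\<^sup>2 + 2 * (norm b)\<^sup>2"
proof -
 have "(norm (a + b))\<^sup>2 \<le> (norm a + norm b)\<^sup>2" by (intro power_mono norm_triangle_ineq) auto
 also have "\<dots> \<le> 2 * (norm a)\<^sup>2 + 2 * (norm b)\<^sup>2" by (rule sq_add_le)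
 finally show ?thesis .
qed

lemma sob_add_le:
 assumes "measH D w G" "measH D w' G'"
 shows "sob D (\<lambda>x. w x + w' x) (\<lambda>x. G x + G' x) \<le> 2 * sob D w G + 2 * sob D w' G'"
proof -
 have "sob D (\<lambda>x. w x + w' x) (\<lambda>x. G x + G' x)
  \<le> (\<integral>\<^sup>+x. 2 * ennreal (indicator D x * ((w x)\<^sup>2 + (norm (G x))\<^sup>2)) + 2 * ennreal (indicator D x * ((w' x)\<^sup>2 + (norm (G' x))\<^sup>2)) \<partial>lebesgue)"
  unfolding sob_def
 proof (rule nn_integral_mono)
  fix x
  have "(w x + w' x)\<^sup>2 + (norm (G x + G' x))\<^sup>2 \<le> 2 * ((w x)\<^sup>2 + (norm (G x))\<^sup>2) + 2 * ((w' x)\<^sup>2 + (norm (G' x))\<^sup>2)"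
   using sq_add_le[of "w x" "w' x"] norm_sq_add_le[of "G x" "G' x"] by simp
  then have "ennreal (indicator D x * ((w x + w' x)\<^sup>2 + (norm (G x + G' x))\<^sup>2))
    \<le> ennreal (2 * (indicator D x * ((w x)\<^sup>2 + (norm (G x))\<^sup>2)) + 2 * (indicator D x * ((w' x)\<^sup>2 + (norm (G' x))\<^sup>2)))"
   by (intro ennreal_leI) (cases "x \<in> D"; simp)
  also have "\<dots> = 2 * ennreal (indicator D x * ((w x)\<^sup>2 + (norm (G x))\<^sup>2)) + 2 * ennreal (indicator D x * ((w' x)\<^sup>2 + (norm (G' x))\<^sup>2))"
   by (subst ennreal_plus) (auto simp: ennreal_mult')
  finally show "ennreal (indicator D x * ((w x + w' x)\<^sup>2 + (norm (G x + G' x))\<^sup>2)) \<le> \<dots>" .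
 qed
 also have "\<dots> = 2 * sob D w G + 2 * sob D w' G'"
  unfolding sob_def using measH_sq(3)[OF assms(1)] measH_sq(3)[OF assms(2)]
  by (subst nn_integral_add) (auto simp: nn_integral_cmult)
 finally show ?thesis .
qed

lemma grad_fn_inner:
 assumes "smooth_fn \<psi>"
 shows "grad_fn \<psi> x \<bullet> v = fderiv \<psi> x v"
proof -
 have lin: "linear (fderiv \<psi> x)"
  by (rule has_derivative_linear[OF smooth_fn_has_derivative[OF assms]])
 have "fderiv \<psi> x v = fderiv \<psi> x (\<Sum>b\<in>Basis. (v \<bullet> b) *\<^sub>R b)"
  by (simp add: euclidean_representation)
 also have "\<dots> = (\<Sum>b\<in>Basis. (v \<bullet> b) * fderiv \<psi> x b)"
  by (simp add: linear_sum[OF lin] linear_scale[OF lin])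
 finally have e: "fderiv \<psi> x v = (\<Sum>b\<in>Basis. (v \<bullet> b) * fderiv \<psi> x b)" .
 show ?thesis unfolding e grad_fn_def inner_sum_left by (intro sum.cong refl) (simp add: inner_commute)
qed

lemma grad_fn_eqI:
 assumes "(\<psi> has_derivative (\<lambda>v. g \<bullet> v)) (at x)"
 shows "grad_fn \<psi> x = g"
 using frechet_derivative_at[OF assms, symmetric]
 by (simp add: grad_fn_def euclidean_representation)

lemma smooth_fn_has_derivative_grad:
 assumes "smooth_fn \<psi>"
 shows "(\<psi> has_derivative (\<lambda>v. grad_fn \<psi> x \<bullet> v)) (at x)"
 using smooth_fn_has_derivative[OF assms] unfolding grad_fn_inner[OF assms] .

lemma grad_fn_continuous: "smooth_fn \<psi> \<Longrightarrow> continuous_on A (grad_fn \<psi>)"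
 unfolding grad_fn_def[abs_def] by (intro continuous_intros smooth_fn_derivative_continuous)

lemma measH_smooth:
 assumes "D \<in> sets lebesgue" "smooth_fn \<psi>"
 shows "measH D \<psi> (grad_fn \<psi>)"
 unfolding measH_def
proof
 have [measurable]: "\<psi> \<in> borel_measurable lebesgue" "grad_fn \<psi> \<in> borel_measurable lebesgue" "D \<in> sets lebesgue"
  using assms smooth_fn_continuous[of \<psi> UNIV] grad_fn_continuous[of \<psi> UNIV]
  by (auto intro!: measurable_completion simp: borel_measurable_continuous_onI)
 show "(\<lambda>x. indicator D x * \<psi> x) \<in> borel_measurable lebesgue" by measurable
 show "(\<lambda>x. indicator D x *\<^sub>R grad_fn \<psi> x) \<in> borel_measurable lebesgue" by measurable
qed

lemma grad_fn_outside_tsupport: "x \<notin> tsupport \<psi> \<Longrightarrow> grad_fn \<psi> x = 0"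
 by (simp add: grad_fn_def frechet_derivative_outside_tsupport)

lemma sob_test_fn_finite:
 assumes "test_fn D \<psi>"
 shows "sob D \<psi> (grad_fn \<psi>) < \<infinity>"
proof -
 have s: "smooth_fn \<psi>" "compact (tsupport \<psi>)" using assms by (auto simp: test_fn_def)
 let ?f = "\<lambda>x. (\<psi> x)\<^sup>2 + (norm (grad_fn \<psi> x))\<^sup>2"
 have c: "continuous_on UNIV ?f"
  by (intro continuous_intros smooth_fn_continuous grad_fn_continuous s)
 have z: "?f x = 0" if "x \<notin> tsupport \<psi>" for x
  using that by (simp add: grad_fn_outside_tsupport frechet_derivative_outside_tsupport(2))
 obtain C where C: "\<And>x. \<bar>?f x\<bar> \<le> C" using continuous_compact_support_bounded[OF c s(2)] z by auto
 have "integrable lborel ?f"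
  by (rule integrable_lborel_bounded_support[OF borel_measurable_continuous_onI[OF c] s(2) z C])
 then have "(\<integral>\<^sup>+x. ennreal (?f x) \<partial>lborel) < \<infinity>"
  by (auto simp: integrable_iff_bounded)
 moreover have "sob D \<psi> (grad_fn \<psi>) \<le> (\<integral>\<^sup>+x. ennreal (?f x) \<partial>lebesgue)"
  unfolding sob_def by (intro nn_integral_mono ennreal_leI) (auto simp: indicator_def)
 ultimately show ?thesis by (simp add: nn_integral_completion order_le_less_trans)
qed

lemma sob_finite_integrable:
 assumes m: "measH D w G" and s: "sob D w G < \<infinity>"
 shows "integrable lebesgue (\<lambda>x. indicator D x * ((w x)\<^sup>2 + (norm (G x))\<^sup>2))"
  "integrable lebesgue (\<lambda>x. indicator D x * (w x)\<^sup>2)"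
  "integrable lebesgue (\<lambda>x. indicator D x * (norm (G x))\<^sup>2)"
proof -
 show 1: "integrable lebesgue (\<lambda>x. indicator D x * ((w x)\<^sup>2 + (norm (G x))\<^sup>2))"
  using measH_sq(3)[OF m] s by (intro integrableI_nonneg) (auto simp: sob_def)
 show "integrable lebesgue (\<lambda>x. indicator D x * (w x)\<^sup>2)"
  by (rule Bochner_Integration.integrable_bound[OF 1 measH_sq(1)[OF m]])
    (auto intro!: AE_I2 simp: indicator_def)
 show "integrable lebesgue (\<lambda>x. indicator D x * (norm (G x))\<^sup>2)"
  by (rule Bochner_Integration.integrable_bound[OF 1 measH_sq(2)[OF m]])
    (auto intro!: AE_I2 simp: indicator_def)
qed

text \<open>Young's inequality with a weight t replaces the Cauchy-Schwarz inequality. The constant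
  C depends on the test function only, so the defect in the weak gradient identity vanishes if the
  norm tends to 0 first and t to infinity afterwards.\<close>

lemma test_pairing_bound:
 fixes \<phi> :: "'a::euclidean_space \<Rightarrow> real"
 assumes D: "D \<in> sets lebesgue" and p: "test_fn D \<phi>"
 shows "\<exists>C\<ge>0. \<forall>w G. measH D w G \<longrightarrow> sob D w G < \<infinity> \<longrightarrow>
   integrable lebesgue (\<lambda>x. indicator D x * w x * fderiv \<phi> x v) \<and>
   integrable lebesgue (\<lambda>x. indicator D x * (G x \<bullet> v) * \<phi> x) \<and>
   (\<forall>t>0. \<bar>(\<integral>x. indicator D x * w x * fderiv \<phi> x v \<partial>lebesgue) +
    (\<integral>x. indicator D x * (G x \<bullet> v) * \<phi> x \<partial>lebesgue)\<bar> \<le> t * enn2real (sob D w G) + C / t)"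
proof -
 have s: "smooth_fn \<phi>" "compact (tsupport \<phi>)" using p by (auto simp: test_fn_def)
 let ?b = "\<lambda>x. fderiv \<phi> x v" and ?c = "\<lambda>x. norm v * \<bar>\<phi> x\<bar>"
 let ?f = "\<lambda>x. (?b x)\<^sup>2 + (?c x)\<^sup>2"
 have c: "continuous_on UNIV ?f"
  by (intro continuous_intros smooth_fn_continuous smooth_fn_derivative_continuous s)
 have z: "?f x = 0" if "x \<notin> tsupport \<phi>" for x
  using that by (simp add: frechet_derivative_outside_tsupport)
 obtain C where C: "\<And>x. \<bar>?f x\<bar> \<le> C" using continuous_compact_support_bounded[OF c s(2)] z by auto
 have if1: "integrable lebesgue ?f"
  by (intro integrable_completion[THEN iffD2] integrable_lborel_bounded_support[OF borel_measurable_continuous_onI[OF c] s(2) z C])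
    (use borel_measurable_continuous_onI[OF c] in auto)
 have bm [measurable]: "?b \<in> borel_measurable lebesgue" "\<phi> \<in> borel_measurable lebesgue"
  using smooth_fn_continuous[OF s(1), of UNIV] smooth_fn_derivative_continuous[OF s(1), of UNIV v]
  by (auto intro!: measurable_completion simp: borel_measurable_continuous_onI)
 show ?thesis
 proof (intro exI[of _ "\<integral>x. ?f x \<partial>lebesgue"] conjI allI impI)
  show f0: "0 \<le> (\<integral>x. ?f x \<partial>lebesgue)" by (rule Bochner_Integration.integral_nonneg) auto
  fix w :: "'a \<Rightarrow> real" and G :: "'a \<Rightarrow> 'a" assume m: "measH D w G" and fin: "sob D w G < \<infinity>"
  have mm [measurable]: "(\<lambda>x. indicator D x * w x) \<in> borel_measurable lebesgue"
    "(\<lambda>x. indicator D x *\<^sub>R G x) \<in> borel_measurable lebesgue"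
   using m by (auto simp: measH_def)
  let ?h = "\<lambda>x. indicator D x * ((w x)\<^sup>2 + (norm (G x))\<^sup>2)"
  note ih = sob_finite_integrable(1)[OF m fin]
  have m1: "(\<lambda>x. indicator D x * w x * ?b x) \<in> borel_measurable lebesgue" by measurable
  have m2: "(\<lambda>x. indicator D x * (G x \<bullet> v) * \<phi> x) \<in> borel_measurable lebesgue"
  proof -
   have "(\<lambda>x. ((indicator D x *\<^sub>R G x) \<bullet> v) * \<phi> x) \<in> borel_measurable lebesgue" by measurable
   then show ?thesis by simp
  qed
  have pt: "\<bar>a * b\<bar> \<le> (t * a\<^sup>2 + b\<^sup>2 / t) / 2" if "t > 0" for a b t :: real
  proof -
   have "0 \<le> (t * \<bar>a\<bar> - \<bar>b\<bar>)\<^sup>2 / t" using that by simp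
   then show ?thesis using that by (simp add: power2_diff power_mult_distrib field_simps abs_mult power2_eq_square[of t])
  qed
  have bnd: "\<bar>indicator D x * w x * ?b x\<bar> + \<bar>indicator D x * (G x \<bullet> v) * \<phi> x\<bar> \<le> (t * ?h x + ?f x / t) / 2" if t: "t > 0" for x t
  proof (cases "x \<in> D")
   case True
   have "\<bar>(G x \<bullet> v) * \<phi> x\<bar> \<le> \<bar>norm (G x) * ?c x\<bar>"
    using Cauchy_Schwarz_ineq2[of "G x" v] by (simp add: abs_mult mult_right_mono mult.assoc[symmetric])
   also have "\<dots> \<le> (t * (norm (G x))\<^sup>2 + (?c x)\<^sup>2 / t) / 2" by (rule pt[OF t])
   finally show ?thesis using True pt[OF t, of "w x" "?b x"] by (simp add: algebra_simps add_divide_distrib)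
  next
   case False
   then show ?thesis using t by simp
  qed
  have ig: "integrable lebesgue (\<lambda>x. (t * ?h x + ?f x / t) / 2)" for t
   by (rule integrable_divide, rule Bochner_Integration.integrable_add, rule integrable_mult_right[OF ih], rule integrable_divide[OF if1])
  show i1: "integrable lebesgue (\<lambda>x. indicator D x * w x * ?b x)"
  proof (rule Bochner_Integration.integrable_bound[OF ig[of 1] m1], rule AE_I2)
   fix x show "norm (indicator D x * w x * ?b x) \<le> norm ((1 * ?h x + ?f x / 1) / 2)"
    using bnd[of 1 x] abs_ge_zero[of "indicator D x * (G x \<bullet> v) * \<phi> x"] unfolding real_norm_def by linarith
  qed
  show i2: "integrable lebesgue (\<lambda>x. indicator D x * (G x \<bullet> v) * \<phi> x)"
  proof (rule Bochner_Integration.integrable_bound[OF ig[of 1] m2], rule AE_I2)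
   fix x show "norm (indicator D x * (G x \<bullet> v) * \<phi> x) \<le> norm ((1 * ?h x + ?f x / 1) / 2)"
    using bnd[of 1 x] abs_ge_zero[of "indicator D x * w x * ?b x"] unfolding real_norm_def by linarith
  qed
  fix t :: real assume t: "t > 0"
  have "\<bar>(\<integral>x. indicator D x * w x * ?b x \<partial>lebesgue) + (\<integral>x. indicator D x * (G x \<bullet> v) * \<phi> x \<partial>lebesgue)\<bar>
    = norm (\<integral>x. indicator D x * w x * ?b x + indicator D x * (G x \<bullet> v) * \<phi> x \<partial>lebesgue)"
   by (simp add: Bochner_Integration.integral_add[OF i1 i2])
  also have "\<dots> \<le> (\<integral>x. (t * ?h x + ?f x / t) / 2 \<partial>lebesgue)"
  proof (rule Bochner_Integration.integral_norm_bound_integral)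
   fix x
   show "norm (indicator D x * w x * ?b x + indicator D x * (G x \<bullet> v) * \<phi> x) \<le> (t * ?h x + ?f x / t) / 2"
    using order_trans[OF abs_triangle_ineq bnd[OF t, of x]] by simp
  qed (intro Bochner_Integration.integrable_add i1 i2, rule ig)
  also have "\<dots> = (t * (\<integral>x. ?h x \<partial>lebesgue) + (\<integral>x. ?f x \<partial>lebesgue) / t) / 2"
   using ih if1 by simp
  also have "(\<integral>x. ?h x \<partial>lebesgue) = enn2real (sob D w G)"
   unfolding sob_def using measH_sq(3)[OF m] by (subst integral_eq_nn_integral) auto
  also have "(t * enn2real (sob D w G) + (\<integral>x. ?f x \<partial>lebesgue) / t) / 2 \<le> t * enn2real (sob D w G) + (\<integral>x. ?f x \<partial>lebesgue) / t"
  proof -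
   have "0 \<le> t * enn2real (sob D w G)" "0 \<le> (\<integral>x. ?f x \<partial>lebesgue) / t"
    using t by (auto intro!: divide_nonneg_nonneg Bochner_Integration.integral_nonneg)
   moreover have "(a + b) / 2 \<le> a + b" if "0 \<le> a" "0 \<le> b" for a b :: real using that by simp
   ultimately show ?thesis by blast
  qed
  finally show "\<bar>(\<integral>x. indicator D x * w x * ?b x \<partial>lebesgue) + (\<integral>x. indicator D x * (G x \<bullet> v) * \<phi> x \<partial>lebesgue)\<bar>
    \<le> t * enn2real (sob D w G) + (\<integral>x. ?f x \<partial>lebesgue) / t" .
 qed
qed

text \<open>Square integrability and the weak gradient are inherited from the approximating test
  functions, so membership reduces to measurability and convergence in \<open>sob\<close>.\<close>

lemma H10I:
 assumes D: "open D" and m: "measH D w G" and t: "\<And>n. test_fn D (\<psi> n)"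
  and lim: "(\<lambda>n. sob D (\<lambda>x. w x - \<psi> n x) (\<lambda>x. G x - grad_fn (\<psi> n) x)) \<longlonglongrightarrow> 0"
 shows "H10 D w G"
proof -
 have Dm: "D \<in> sets lebesgue" using D by (simp add: borel_open)
 have ts: "smooth_fn (\<psi> n)" for n using t by (simp add: test_fn_def)
 let ?s = "\<lambda>n. sob D (\<lambda>x. w x - \<psi> n x) (\<lambda>x. G x - grad_fn (\<psi> n) x)"
 have md: "measH D (\<lambda>x. w x - \<psi> n x) (\<lambda>x. G x - grad_fn (\<psi> n) x)" for n
  by (rule measH_diff[OF m measH_smooth[OF Dm ts]])
 have "eventually (\<lambda>n. ?s n < 1) sequentially" using lim by (rule order_tendstoD) simp
 then obtain n0 where n0: "\<And>n. n \<ge> n0 \<Longrightarrow> ?s n < 1" by (auto simp: eventually_sequentially)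
 have fin: "?s n < \<infinity> \<Longrightarrow> sob D w G < \<infinity>" for n
 proof -
  assume "?s n < \<infinity>"
  have "sob D w G = sob D (\<lambda>x. (w x - \<psi> n x) + \<psi> n x) (\<lambda>x. (G x - grad_fn (\<psi> n) x) + grad_fn (\<psi> n) x)" by simp
  also have "\<dots> \<le> 2 * ?s n + 2 * sob D (\<psi> n) (grad_fn (\<psi> n))"
   by (rule sob_add_le[OF md measH_smooth[OF Dm ts]])
  also have "\<dots> < \<infinity>" using \<open>?s n < \<infinity>\<close> sob_test_fn_finite[OF t, of n] by (simp add: ennreal_mult_less_top)
  finally show ?thesis .
 qed
 have "?s n0 < \<infinity>" using order_less_trans[OF n0[OF order_refl] ennreal_one_less_top] by simp
 then have sf: "sob D w G < \<infinity>" by (rule fin)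
 have dfin: "?s n < \<infinity>" for n
 proof -
  have "?s n = sob D (\<lambda>x. w x + (-1) * \<psi> n x) (\<lambda>x. G x + (-1) *\<^sub>R grad_fn (\<psi> n) x)" by simp
  also have "\<dots> \<le> 2 * sob D w G + 2 * sob D (\<lambda>x. (-1) * \<psi> n x) (\<lambda>x. (-1) *\<^sub>R grad_fn (\<psi> n) x)"
   using measH_diff[OF measH_smooth[OF Dm smooth_fn_const[of 0]] measH_smooth[OF Dm ts[of n]]]
   by (intro sob_add_le m) (simp add: measH_def grad_fn_def)
  also have "sob D (\<lambda>x. (-1) * \<psi> n x) (\<lambda>x. (-1) *\<^sub>R grad_fn (\<psi> n) x) = sob D (\<psi> n) (grad_fn (\<psi> n))"
   by (simp add: sob_def)
  also have "2 * sob D w G + 2 * sob D (\<psi> n) (grad_fn (\<psi> n)) < \<infinity>"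
   using sf sob_test_fn_finite[OF t, of n] by (simp add: ennreal_mult_less_top)
  finally show ?thesis .
 qed
 note i = sob_finite_integrable[OF m sf]
 have sub: "integrable lebesgue (\<lambda>x. indicator K x * f x)"
  if K: "compact K" "K \<subseteq> D" and f: "integrable lebesgue (\<lambda>x. indicator D x * f x)" for K and f :: "_ \<Rightarrow> real"
 proof -
  have "(\<lambda>x. indicator K x * f x) = (\<lambda>x. indicator K x *\<^sub>R (indicator D x * f x))"
   using K(2) by (auto simp: fun_eq_iff indicator_def)
  then show ?thesis using integrable_mult_indicator[OF _ f, of K] borel_compact[OF K(1)] by simp
 qed
 have wg: "weak_grad D w G"
  unfolding weak_grad_def
 proof (intro allI impI)
  fix \<phi> v assume p: "test_fn D \<phi>"
  obtain C where C: "0 \<le> C" "\<And>w G. measH D w G \<Longrightarrow> sob D w G < \<infinity> \<Longrightarrow>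
    integrable lebesgue (\<lambda>x. indicator D x * w x * fderiv \<phi> x v) \<and>
    integrable lebesgue (\<lambda>x. indicator D x * (G x \<bullet> v) * \<phi> x) \<and>
    (\<forall>t>0. \<bar>(\<integral>x. indicator D x * w x * fderiv \<phi> x v \<partial>lebesgue) +
     (\<integral>x. indicator D x * (G x \<bullet> v) * \<phi> x \<partial>lebesgue)\<bar> \<le> t * enn2real (sob D w G) + C / t)"
   using test_pairing_bound[OF Dm p, of v] by (elim exE conjE) (rule that, assumption, blast)
  define P1 where "P1 = (\<lambda>w. \<integral>x. indicator D x * w x * fderiv \<phi> x v \<partial>lebesgue)"
  define P2 where "P2 = (\<lambda>G. \<integral>x. indicator D x * (G x \<bullet> v) * \<phi> x \<partial>lebesgue)"
  let ?E = "P1 w + P2 G"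
  \<comment> \<open>Test functions satisfy the weak identity exactly, so subtracting one leaves the
    defect unchanged.\<close>
  have "?E = P1 (\<lambda>x. w x - \<psi> n x) + P2 (\<lambda>x. G x - grad_fn (\<psi> n) x)" for n
  proof -
   note Cw = C(2)[OF m sf]
   note Cp = C(2)[OF measH_smooth[OF Dm ts[of n]] sob_test_fn_finite[OF t]]
   have "P1 (\<lambda>x. w x - \<psi> n x) = P1 w - P1 (\<psi> n)"
    unfolding P1_def using Cw Cp
    by (subst Bochner_Integration.integral_diff[symmetric]) (auto simp: algebra_simps)
   moreover have "P2 (\<lambda>x. G x - grad_fn (\<psi> n) x) = P2 G - P2 (grad_fn (\<psi> n))"
    unfolding P2_def using Cw Cp
    by (subst Bochner_Integration.integral_diff[symmetric]) (auto simp: algebra_simps inner_diff_left)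
   moreover have "P1 (\<psi> n) = - P2 (grad_fn (\<psi> n))"
    unfolding P1_def P2_def grad_fn_inner[OF ts] by (rule smooth_integration_by_parts[OF ts p])
   ultimately show ?thesis by simp
  qed
  then have b: "\<bar>?E\<bar> \<le> s * enn2real (?s n) + C / s" if "s > 0" for s n
   using C(2)[OF md[of n] dfin[of n]] that unfolding P1_def P2_def by simp
  have lim': "(\<lambda>n. enn2real (?s n)) \<longlonglongrightarrow> 0"
   using tendsto_enn2real[OF lim[folded ennreal_0]] by simp
  have b2: "\<bar>?E\<bar> \<le> C / s" if "s > 0" for s
  proof (rule LIMSEQ_le_const)
   have "(\<lambda>n. s * enn2real (?s n) + C / s) \<longlonglongrightarrow> s * 0 + C / s" by (intro tendsto_intros lim')
   then show "(\<lambda>n. s * enn2real (?s n) + C / s) \<longlonglongrightarrow> C / s" by simp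
  qed (use b[OF that] in auto)
  have "?E = 0"
  proof (rule ccontr)
   assume "?E \<noteq> 0"
   then have pos: "0 < \<bar>?E\<bar>" by simp
   \<comment> \<open>This weight makes the bound a proper fraction of the defect itself.\<close>
   have "\<bar>?E\<bar> \<le> C / ((C + 1) / \<bar>?E\<bar>)" using C(1) pos by (intro b2) auto
   also have "\<dots> = C / (C + 1) * \<bar>?E\<bar>" by simp
   also have "\<dots> < \<bar>?E\<bar>" using pos C(1) by (simp add: divide_less_eq)
   finally show False by simp
  qed
  then show "(\<integral>x. indicator D x * w x * fderiv \<phi> x v \<partial>lebesgue)
   = - (\<integral>x. indicator D x * (G x \<bullet> v) * \<phi> x \<partial>lebesgue)" by (simp add: P1_def P2_def)
 qed
 have "H1 D w G"
  unfolding H1_def H1loc_def L2loc_def L2loc_vec_def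
  using m wg i sub[OF _ _ i(2)] sub[OF _ _ i(3)] by (auto simp: measH_def)
 moreover have "(\<lambda>n. \<integral>x. indicator D x * ((w x - \<psi> n x)\<^sup>2 + (norm (G x - grad_fn (\<psi> n) x))\<^sup>2) \<partial>lebesgue) \<longlonglongrightarrow> 0"
 proof -
  have "(\<integral>x. indicator D x * ((w x - \<psi> n x)\<^sup>2 + (norm (G x - grad_fn (\<psi> n) x))\<^sup>2) \<partial>lebesgue) = enn2real (?s n)" for n
   unfolding sob_def using measH_sq(3)[OF md[of n]] by (subst integral_eq_nn_integral) auto
  then show ?thesis using tendsto_enn2real[OF lim[folded ennreal_0]] by simp
 qed
 ultimately show ?thesis unfolding H10_def using t by blast
qed

lemma H10D:
 assumes D: "open D" and h: "H10 D w G"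
 shows "measH D w G" "sob D w G < \<infinity>"
  "\<exists>\<psi>. (\<forall>n. test_fn D (\<psi> n)) \<and> (\<lambda>n. sob D (\<lambda>x. w x - \<psi> n x) (\<lambda>x. G x - grad_fn (\<psi> n) x)) \<longlonglongrightarrow> 0"
proof -
 have Dm: "D \<in> sets lebesgue" using D by (simp add: borel_open)
 have h1: "H1 D w G" using h by (simp add: H10_def)
 show m: "measH D w G" using h1 by (simp add: H1_def H1loc_def L2loc_def L2loc_vec_def measH_def)
 have "integrable lebesgue (\<lambda>x. indicator D x * (w x)\<^sup>2 + indicator D x * (norm (G x))\<^sup>2)"
  using h1 by (intro Bochner_Integration.integrable_add) (auto simp: H1_def)
 then have "(\<integral>\<^sup>+x. ennreal (norm (indicator D x * (w x)\<^sup>2 + indicator D x * (norm (G x))\<^sup>2)) \<partial>lebesgue) < \<infinity>"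
  by (simp only: integrable_iff_bounded)
 then show sf: "sob D w G < \<infinity>" unfolding sob_def by (simp add: distrib_left)
 obtain \<psi> where t: "\<And>n. test_fn D (\<psi> n)" and
  l: "(\<lambda>n. \<integral>x. indicator D x * ((w x - \<psi> n x)\<^sup>2 + (norm (G x - grad_fn (\<psi> n) x))\<^sup>2) \<partial>lebesgue) \<longlonglongrightarrow> 0"
  using h unfolding H10_def by blast
 have ts: "smooth_fn (\<psi> n)" for n using t by (simp add: test_fn_def)
 let ?s = "\<lambda>n. sob D (\<lambda>x. w x - \<psi> n x) (\<lambda>x. G x - grad_fn (\<psi> n) x)"
 have md: "measH D (\<lambda>x. w x - \<psi> n x) (\<lambda>x. G x - grad_fn (\<psi> n) x)" for n
  by (rule measH_diff[OF m measH_smooth[OF Dm ts]])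
 \<comment> \<open>Finiteness for every n ensures that the integrals in \<open>H10\<close> are true
   squared norms and not the default value 0.\<close>
 have dfin: "?s n < \<infinity>" for n
 proof -
  have "?s n = sob D (\<lambda>x. w x + (-1) * \<psi> n x) (\<lambda>x. G x + (-1) *\<^sub>R grad_fn (\<psi> n) x)" by simp
  also have "\<dots> \<le> 2 * sob D w G + 2 * sob D (\<lambda>x. (-1) * \<psi> n x) (\<lambda>x. (-1) *\<^sub>R grad_fn (\<psi> n) x)"
   using measH_diff[OF measH_smooth[OF Dm smooth_fn_const[of 0]] measH_smooth[OF Dm ts[of n]]]
   by (intro sob_add_le m) (simp add: measH_def grad_fn_def)
  also have "sob D (\<lambda>x. (-1) * \<psi> n x) (\<lambda>x. (-1) *\<^sub>R grad_fn (\<psi> n) x) = sob D (\<psi> n) (grad_fn (\<psi> n))"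
   by (simp add: sob_def)
  also have "2 * sob D w G + 2 * sob D (\<psi> n) (grad_fn (\<psi> n)) < \<infinity>"
   using sf sob_test_fn_finite[OF t, of n] by (simp add: ennreal_mult_less_top)
  finally show ?thesis .
 qed
 have "?s n = ennreal (\<integral>x. indicator D x * ((w x - \<psi> n x)\<^sup>2 + (norm (G x - grad_fn (\<psi> n) x))\<^sup>2) \<partial>lebesgue)" for n
  unfolding sob_def by (rule nn_integral_eq_integral[OF sob_finite_integrable(1)[OF md dfin]]) auto
 then have "?s \<longlonglongrightarrow> 0" using tendsto_ennrealI[OF l] by (simp only: ennreal_0)
 then show "\<exists>\<psi>. (\<forall>n. test_fn D (\<psi> n)) \<and> (\<lambda>n. sob D (\<lambda>x. w x - \<psi> n x) (\<lambda>x. G x - grad_fn (\<psi> n) x)) \<longlonglongrightarrow> 0"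
  using t by (intro exI[of _ \<psi>]) simp
qed

section \<open>Extension by zero, sums and cutoffs of functions with zero boundary values\<close>

lemma tendsto_0_le_ennreal:
 fixes f g :: "nat \<Rightarrow> ennreal"
 assumes "\<And>n. f n \<le> c * g n" "c < \<infinity>" "g \<longlonglongrightarrow> 0"
 shows "f \<longlonglongrightarrow> 0"
proof (rule tendsto_sandwich[OF _ _ tendsto_const])
 have "(\<lambda>n. c * g n) \<longlonglongrightarrow> c * 0" using assms(2,3) by (intro ennreal_tendsto_cmult) auto
 then show "(\<lambda>n. c * g n) \<longlonglongrightarrow> 0" by simp
qed (use assms in auto)

text \<open>Test functions on the smaller set are test functions on the larger one and vanish
  outside with their gradients, so the same sequence approximates the extension by zero. All gluing
  of competitors rests on this.\<close>

lemma H10_extend: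
 assumes D: "open D" "open D'" "D' \<subseteq> D" and h: "H10 D' w G"
 shows "H10 D (\<lambda>x. indicator D' x * w x) (\<lambda>x. indicator D' x *\<^sub>R G x)"
proof -
 note d = H10D[OF D(2) h]
 obtain \<psi> where t: "\<And>n. test_fn D' (\<psi> n)" and
  l: "(\<lambda>n. sob D' (\<lambda>x. w x - \<psi> n x) (\<lambda>x. G x - grad_fn (\<psi> n) x)) \<longlonglongrightarrow> 0"
  using d(3) by blast
 show ?thesis
 proof (rule H10I[OF D(1)])
  have "indicator D x * (indicator D' x * w x) = indicator D' x * w x"
    "indicator D x *\<^sub>R (indicator D' x *\<^sub>R G x) = indicator D' x *\<^sub>R G x" for x
   using D(3) by (auto simp: indicator_def)
  then show "measH D (\<lambda>x. indicator D' x * w x) (\<lambda>x. indicator D' x *\<^sub>R G x)"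
   using d(1) by (simp only: measH_def)
  show "test_fn D (\<psi> n)" for n using t[of n] D(3) by (auto simp: test_fn_def)
  have "sob D (\<lambda>x. indicator D' x * w x - \<psi> n x) (\<lambda>x. indicator D' x *\<^sub>R G x - grad_fn (\<psi> n) x)
    = sob D' (\<lambda>x. w x - \<psi> n x) (\<lambda>x. G x - grad_fn (\<psi> n) x)" for n
   unfolding sob_def
  proof (rule nn_integral_cong)
   fix x
   show "ennreal (indicator D x * ((indicator D' x * w x - \<psi> n x)\<^sup>2 + (norm (indicator D' x *\<^sub>R G x - grad_fn (\<psi> n) x))\<^sup>2))
    = ennreal (indicator D' x * ((w x - \<psi> n x)\<^sup>2 + (norm (G x - grad_fn (\<psi> n) x))\<^sup>2))"
   proof (cases "x \<in> D'")
    case True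
    then show ?thesis using D(3) by auto
   next
    case False
    then have "x \<notin> tsupport (\<psi> n)" using t[of n] by (auto simp: test_fn_def)
    then show ?thesis using False by (simp add: grad_fn_outside_tsupport frechet_derivative_outside_tsupport(2))
   qed
  qed
  then show "(\<lambda>n. sob D (\<lambda>x. indicator D' x * w x - \<psi> n x) (\<lambda>x. indicator D' x *\<^sub>R G x - grad_fn (\<psi> n) x)) \<longlonglongrightarrow> 0"
   using l by simp
 qed
qed

lemma grad_fn_add:
 assumes "smooth_fn f" "smooth_fn g"
 shows "grad_fn (\<lambda>x. f x + g x) x = grad_fn f x + grad_fn g x"
 by (rule grad_fn_eqI)
   (use has_derivative_add[OF smooth_fn_has_derivative_grad[OF assms(1)] smooth_fn_has_derivative_grad[OF assms(2)]]
   in \<open>simp add: inner_add_left\<close>)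

lemma grad_fn_mult:
 assumes "smooth_fn f" "smooth_fn g"
 shows "grad_fn (\<lambda>x. f x * g x) x = f x *\<^sub>R grad_fn g x + g x *\<^sub>R grad_fn f x"
 by (rule grad_fn_eqI)
   (use has_derivative_mult[OF smooth_fn_has_derivative_grad[OF assms(1)] smooth_fn_has_derivative_grad[OF assms(2)]]
   in \<open>simp add: inner_add_left mult.commute\<close>)

lemma H10_add:
 assumes D: "open D" and h: "H10 D w G" "H10 D w' G'"
 shows "H10 D (\<lambda>x. w x + w' x) (\<lambda>x. G x + G' x)"
proof -
 have Dm: "D \<in> sets lebesgue" using D by (simp add: borel_open)
 note d = H10D[OF D h(1)] note d' = H10D[OF D h(2)]
 obtain \<psi> where t: "\<And>n. test_fn D (\<psi> n)" and
  l: "(\<lambda>n. sob D (\<lambda>x. w x - \<psi> n x) (\<lambda>x. G x - grad_fn (\<psi> n) x)) \<longlonglongrightarrow> 0"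
  using d(3) by blast
 obtain \<psi>' where t': "\<And>n. test_fn D (\<psi>' n)" and
  l': "(\<lambda>n. sob D (\<lambda>x. w' x - \<psi>' n x) (\<lambda>x. G' x - grad_fn (\<psi>' n) x)) \<longlonglongrightarrow> 0"
  using d'(3) by blast
 have ts: "smooth_fn (\<psi> n)" "smooth_fn (\<psi>' n)" for n using t t' by (auto simp: test_fn_def)
 show ?thesis
 proof (rule H10I[OF D measH_add[OF d(1) d'(1)]])
  show "test_fn D (\<lambda>x. \<psi> n x + \<psi>' n x)" for n
  proof -
   have c: "compact (tsupport (\<psi> n) \<union> tsupport (\<psi>' n))" "tsupport (\<psi> n) \<union> tsupport (\<psi>' n) \<subseteq> D"
    using t[of n] t'[of n] by (auto simp: test_fn_def)
   have z: "\<psi> n x + \<psi>' n x = 0" if "x \<notin> tsupport (\<psi> n) \<union> tsupport (\<psi>' n)" for x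
    using that by (simp add: frechet_derivative_outside_tsupport(2))
   show ?thesis unfolding test_fn_def
   proof (intro conjI)
    show "smooth_fn (\<lambda>x. \<psi> n x + \<psi>' n x)" by (rule smooth_fn_add[OF ts])
    show "compact (tsupport (\<lambda>x. \<psi> n x + \<psi>' n x))" by (rule compact_tsupportI[OF c(1)]) (rule z)
    have "tsupport (\<lambda>x. \<psi> n x + \<psi>' n x) \<subseteq> tsupport (\<psi> n) \<union> tsupport (\<psi>' n)"
     by (rule tsupport_subsetI[OF compact_imp_closed[OF c(1)]]) (rule z)
    then show "tsupport (\<lambda>x. \<psi> n x + \<psi>' n x) \<subseteq> D" using c(2) by (rule subset_trans)
   qed
  qed
  let ?s = "\<lambda>n. sob D (\<lambda>x. w x - \<psi> n x) (\<lambda>x. G x - grad_fn (\<psi> n) x)"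
  let ?s' = "\<lambda>n. sob D (\<lambda>x. w' x - \<psi>' n x) (\<lambda>x. G' x - grad_fn (\<psi>' n) x)"
  show "(\<lambda>n. sob D (\<lambda>x. w x + w' x - (\<psi> n x + \<psi>' n x)) (\<lambda>x. G x + G' x - grad_fn (\<lambda>x. \<psi> n x + \<psi>' n x) x)) \<longlonglongrightarrow> 0"
  proof (rule tendsto_0_le_ennreal[where c=2 and g="\<lambda>n. ?s n + ?s' n"])
   fix n
   have "sob D (\<lambda>x. w x + w' x - (\<psi> n x + \<psi>' n x)) (\<lambda>x. G x + G' x - grad_fn (\<lambda>x. \<psi> n x + \<psi>' n x) x)
    = sob D (\<lambda>x. (w x - \<psi> n x) + (w' x - \<psi>' n x)) (\<lambda>x. (G x - grad_fn (\<psi> n) x) + (G' x - grad_fn (\<psi>' n) x))"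
    by (intro arg_cong2[where f="sob D"] ext) (simp_all add: grad_fn_add[OF ts])
   also have "\<dots> \<le> 2 * ?s n + 2 * ?s' n"
    by (intro sob_add_le measH_diff d(1) d'(1) measH_smooth Dm ts)
   finally show "sob D (\<lambda>x. w x + w' x - (\<psi> n x + \<psi>' n x)) (\<lambda>x. G x + G' x - grad_fn (\<lambda>x. \<psi> n x + \<psi>' n x) x) \<le> 2 * (?s n + ?s' n)"
    by (simp add: distrib_left)
   have "(\<lambda>n. ?s n + ?s' n) \<longlonglongrightarrow> 0 + 0" by (intro tendsto_add l l')
   then show "(\<lambda>n. ?s n + ?s' n) \<longlonglongrightarrow> 0" by simp
  qed simp
 qed
qed

text \<open>Multiplication by a cutoff may shrink the domain: \<open>tt\<close> states that it moves
  supports of test functions from \<open>D\<close> into \<open>D'\<close>. The product rule costs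
  the factor 2 + 2 L^2 in the squared norm.\<close>

lemma H10_mult:
 assumes D: "open D" "open D'" "D' \<subseteq> D" and h: "H10 D w G"
  and chi: "smooth_fn \<eta>" "\<And>x. \<bar>\<eta> x\<bar> \<le> 1" "\<And>x. norm (grad_fn \<eta> x) \<le> L"
  and tt: "\<And>\<psi>. test_fn D \<psi> \<Longrightarrow> test_fn D' (\<lambda>x. \<eta> x * \<psi> x)"
 shows "H10 D' (\<lambda>x. \<eta> x * w x) (\<lambda>x. \<eta> x *\<^sub>R G x + w x *\<^sub>R grad_fn \<eta> x)"
proof -
 note d = H10D[OF D(1) h]
 obtain \<psi> where t: "\<And>n. test_fn D (\<psi> n)" and
  l: "(\<lambda>n. sob D (\<lambda>x. w x - \<psi> n x) (\<lambda>x. G x - grad_fn (\<psi> n) x)) \<longlonglongrightarrow> 0"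
  using d(3) by blast
 have ts: "smooth_fn (\<psi> n)" for n using t by (auto simp: test_fn_def)
 show ?thesis
 proof (rule H10I[OF D(2)])
  have [measurable]: "D' \<in> sets lebesgue" "\<eta> \<in> borel_measurable lebesgue" "grad_fn \<eta> \<in> borel_measurable lebesgue"
   using D(2) smooth_fn_continuous[OF chi(1), of UNIV] grad_fn_continuous[OF chi(1), of UNIV]
   by (auto intro!: measurable_completion simp: borel_measurable_continuous_onI borel_open)
  have [measurable]: "(\<lambda>x. indicator D x * w x) \<in> borel_measurable lebesgue"
    "(\<lambda>x. indicator D x *\<^sub>R G x) \<in> borel_measurable lebesgue"
   using d(1) by (auto simp: measH_def)
  have e: "indicator D' x * (\<eta> x * w x) = indicator D' x * (\<eta> x * (indicator D x * w x))"
   "indicator D' x *\<^sub>R (\<eta> x *\<^sub>R G x + w x *\<^sub>R grad_fn \<eta> x)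
    = indicator D' x *\<^sub>R (\<eta> x *\<^sub>R (indicator D x *\<^sub>R G x) + (indicator D x * w x) *\<^sub>R grad_fn \<eta> x)" for x
   using D(3) by (auto simp: indicator_def)
  show "measH D' (\<lambda>x. \<eta> x * w x) (\<lambda>x. \<eta> x *\<^sub>R G x + w x *\<^sub>R grad_fn \<eta> x)"
   unfolding measH_def e by (intro conjI; measurable)
  show "test_fn D' (\<lambda>x. \<eta> x * \<psi> n x)" for n by (rule tt[OF t])
  show "(\<lambda>n. sob D' (\<lambda>x. \<eta> x * w x - \<eta> x * \<psi> n x)
    (\<lambda>x. \<eta> x *\<^sub>R G x + w x *\<^sub>R grad_fn \<eta> x - grad_fn (\<lambda>x. \<eta> x * \<psi> n x) x)) \<longlonglongrightarrow> 0"
  proof (rule tendsto_0_le_ennreal[OF _ _ l, where c="ennreal (2 + 2 * L\<^sup>2)"])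
   fix n
   let ?a = "\<lambda>x. w x - \<psi> n x" and ?A = "\<lambda>x. G x - grad_fn (\<psi> n) x"
   have Am: "measH D ?a ?A" using D(1) by (intro measH_diff d(1) measH_smooth ts) (simp add: borel_open)
   have "sob D' (\<lambda>x. \<eta> x * w x - \<eta> x * \<psi> n x)
     (\<lambda>x. \<eta> x *\<^sub>R G x + w x *\<^sub>R grad_fn \<eta> x - grad_fn (\<lambda>x. \<eta> x * \<psi> n x) x)
     \<le> (\<integral>\<^sup>+x. ennreal (2 + 2 * L\<^sup>2) * ennreal (indicator D x * ((?a x)\<^sup>2 + (norm (?A x))\<^sup>2)) \<partial>lebesgue)"
    unfolding sob_def
   proof (rule nn_integral_mono)
    fix x
    have c1: "(\<eta> x)\<^sup>2 \<le> 1" using chi(2)[of x] by (simp add: abs_square_le_1)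
    have c2: "(norm (grad_fn \<eta> x))\<^sup>2 \<le> L\<^sup>2" using chi(3)[of x] by (intro power_mono) auto
    have "(\<eta> x * w x - \<eta> x * \<psi> n x)\<^sup>2 = (\<eta> x)\<^sup>2 * (?a x)\<^sup>2" by (simp add: algebra_simps flip: power_mult_distrib)
    also have "\<dots> \<le> 1 * (?a x)\<^sup>2" using c1 by (intro mult_right_mono) auto
    finally have 1: "(\<eta> x * w x - \<eta> x * \<psi> n x)\<^sup>2 \<le> (?a x)\<^sup>2" by simp
    have "\<eta> x *\<^sub>R G x + w x *\<^sub>R grad_fn \<eta> x - grad_fn (\<lambda>x. \<eta> x * \<psi> n x) x = \<eta> x *\<^sub>R ?A x + ?a x *\<^sub>R grad_fn \<eta> x"
     by (simp add: grad_fn_mult[OF chi(1) ts] algebra_simps)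
    then have "(norm (\<eta> x *\<^sub>R G x + w x *\<^sub>R grad_fn \<eta> x - grad_fn (\<lambda>x. \<eta> x * \<psi> n x) x))\<^sup>2
      \<le> 2 * (norm (\<eta> x *\<^sub>R ?A x))\<^sup>2 + 2 * (norm (?a x *\<^sub>R grad_fn \<eta> x))\<^sup>2" by (simp only: norm_sq_add_le)
    also have "\<dots> = 2 * ((\<eta> x)\<^sup>2 * (norm (?A x))\<^sup>2) + 2 * ((?a x)\<^sup>2 * (norm (grad_fn \<eta> x))\<^sup>2)"
     by (simp add: power_mult_distrib)
    also have "\<dots> \<le> 2 * (1 * (norm (?A x))\<^sup>2) + 2 * ((?a x)\<^sup>2 * L\<^sup>2)"
     using c1 c2 by (intro add_mono mult_left_mono mult_right_mono) auto
    finally have 2: "(norm (\<eta> x *\<^sub>R G x + w x *\<^sub>R grad_fn \<eta> x - grad_fn (\<lambda>x. \<eta> x * \<psi> n x) x))\<^sup>2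
      \<le> 2 * (norm (?A x))\<^sup>2 + 2 * ((?a x)\<^sup>2 * L\<^sup>2)" by simp
    have 3: "0 \<le> L\<^sup>2 * (norm (?A x))\<^sup>2" "0 \<le> (?a x)\<^sup>2" by auto
    have "(\<eta> x * w x - \<eta> x * \<psi> n x)\<^sup>2 + (norm (\<eta> x *\<^sub>R G x + w x *\<^sub>R grad_fn \<eta> x - grad_fn (\<lambda>x. \<eta> x * \<psi> n x) x))\<^sup>2
      \<le> (2 + 2 * L\<^sup>2) * ((?a x)\<^sup>2 + (norm (?A x))\<^sup>2)"
    proof -
     have "(2 + 2 * L\<^sup>2) * ((?a x)\<^sup>2 + (norm (?A x))\<^sup>2) = 2 * (?a x)\<^sup>2 + 2 * (norm (?A x))\<^sup>2 + 2 * ((?a x)\<^sup>2 * L\<^sup>2) + 2 * (L\<^sup>2 * (norm (?A x))\<^sup>2)"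
      by (simp add: algebra_simps)
     then show ?thesis using 1 2 3 by linarith
    qed
    then have "ennreal (indicator D' x * ((\<eta> x * w x - \<eta> x * \<psi> n x)\<^sup>2 + (norm (\<eta> x *\<^sub>R G x + w x *\<^sub>R grad_fn \<eta> x - grad_fn (\<lambda>x. \<eta> x * \<psi> n x) x))\<^sup>2))
      \<le> ennreal ((2 + 2 * L\<^sup>2) * (indicator D x * ((?a x)\<^sup>2 + (norm (?A x))\<^sup>2)))"
     using D(3) by (intro ennreal_leI) (auto simp: indicator_def)
    then show "ennreal (indicator D' x * ((\<eta> x * w x - \<eta> x * \<psi> n x)\<^sup>2 + (norm (\<eta> x *\<^sub>R G x + w x *\<^sub>R grad_fn \<eta> x - grad_fn (\<lambda>x. \<eta> x * \<psi> n x) x))\<^sup>2))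
      \<le> ennreal (2 + 2 * L\<^sup>2) * ennreal (indicator D x * ((?a x)\<^sup>2 + (norm (?A x))\<^sup>2))"
     by (simp add: ennreal_mult)
   qed
   also have "\<dots> = ennreal (2 + 2 * L\<^sup>2) * sob D ?a ?A"
    unfolding sob_def using measH_sq(3)[OF Am] by (subst nn_integral_cmult) auto
   finally show "sob D' (\<lambda>x. \<eta> x * w x - \<eta> x * \<psi> n x)
     (\<lambda>x. \<eta> x *\<^sub>R G x + w x *\<^sub>R grad_fn \<eta> x - grad_fn (\<lambda>x. \<eta> x * \<psi> n x) x) \<le> ennreal (2 + 2 * L\<^sup>2) * sob D ?a ?A" .
  qed simp
 qed
qed

section \<open>Translations of domains and functions\<close>

lemma lebesgue_translate:
 fixes y :: "'a::euclidean_space"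
 shows "(\<lambda>x. x + y) \<in> lebesgue \<rightarrow>\<^sub>M lebesgue" "distr lebesgue lebesgue (\<lambda>x. x + y) = lebesgue"
proof -
 have e: "(\<lambda>x. x + y) = (\<lambda>x. y + (\<Sum>j\<in>Basis. (1 * (x \<bullet> j)) *\<^sub>R j))"
  by (auto simp: euclidean_representation)
 show m: "(\<lambda>x. x + y) \<in> lebesgue \<rightarrow>\<^sub>M lebesgue"
  unfolding e by (rule lebesgue_affine_measurable) simp
 have "lebesgue = density (distr lebesgue lebesgue (\<lambda>x. x + y)) (\<lambda>_. (\<Prod>j\<in>(Basis::'a set). \<bar>1::real\<bar>))"
  unfolding e by (rule lebesgue_affine_euclidean[where c="\<lambda>_. 1"]) simp
 then show "distr lebesgue lebesgue (\<lambda>x. x + y) = lebesgue"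
  by (simp add: density_1)
qed

lemma nn_integral_lebesgue_translate:
 assumes "f \<in> borel_measurable lebesgue"
 shows "(\<integral>\<^sup>+x. f (x + y) \<partial>lebesgue) = (\<integral>\<^sup>+x. f x \<partial>lebesgue)"
 using nn_integral_distr[OF lebesgue_translate(1)[of y], of f] assms lebesgue_translate(2)[of y] by simp

lemma test_fn_translate:
 assumes "test_fn D \<psi>"
 shows "test_fn {x. x + y \<in> D} (\<lambda>x. \<psi> (x + y))"
proof -
 have s: "smooth_fn \<psi>" "compact (tsupport \<psi>)" "tsupport \<psi> \<subseteq> D" using assms by (auto simp: test_fn_def)
 let ?K = "(\<lambda>x. x - y) ` tsupport \<psi>"
 have K: "compact ?K" using s(2) by (simp add: compact_translation_subtract)
 have z: "\<psi> (x + y) = 0" if "x \<notin> ?K" for x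
 proof -
  have "x + y \<notin> tsupport \<psi>" using that by (auto simp: image_iff)
  then show ?thesis by (rule frechet_derivative_outside_tsupport(2))
 qed
 have "tsupport (\<lambda>x. \<psi> (x + y)) \<subseteq> ?K" by (rule tsupport_subsetI[OF compact_imp_closed[OF K]]) (rule z)
 moreover have "?K \<subseteq> {x. x + y \<in> D}" using s(3) by auto
 moreover have "compact (tsupport (\<lambda>x. \<psi> (x + y)))" by (rule compact_tsupportI[OF K]) (rule z)
 ultimately show ?thesis using smooth_fn_translate[OF s(1)] unfolding test_fn_def by (meson subset_trans)
qed

lemma grad_fn_translate:
 assumes "smooth_fn \<psi>"
 shows "grad_fn (\<lambda>x. \<psi> (x + y)) x = grad_fn \<psi> (x + y)"
proof (rule grad_fn_eqI)
 have "((\<lambda>x. x + y) has_derivative (\<lambda>v. v)) (at x)" by (auto intro!: derivative_eq_intros)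
 from has_derivative_compose[OF this smooth_fn_has_derivative_grad[OF assms]]
 show "((\<lambda>x. \<psi> (x + y)) has_derivative (\<bullet>) (grad_fn \<psi> (x + y))) (at x)" .
qed

lemma open_translate: "open D \<Longrightarrow> open {x. x + y \<in> D}" for D :: "'a::real_normed_vector set"
 using continuous_open_vimage[of D "\<lambda>x. x + y"] by (simp add: vimage_def continuous_intros)

lemma sob_translate:
 assumes "measH D w G"
 shows "sob {x. x + y \<in> D} (\<lambda>x. w (x + y)) (\<lambda>x. G (x + y)) = sob D w G"
 unfolding sob_def
 using nn_integral_lebesgue_translate[of "\<lambda>x. ennreal (indicator D x * ((w x)\<^sup>2 + (norm (G x))\<^sup>2))" y] measH_sq(3)[OF assms]
 by (simp add: indicator_def)

lemma H10_translate:
 assumes D: "open D" and h: "H10 D w G"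
 shows "H10 {x. x + y \<in> D} (\<lambda>x. w (x + y)) (\<lambda>x. G (x + y))"
proof -
 note d = H10D[OF D h]
 obtain \<psi> where t: "\<And>n. test_fn D (\<psi> n)" and
  l: "(\<lambda>n. sob D (\<lambda>x. w x - \<psi> n x) (\<lambda>x. G x - grad_fn (\<psi> n) x)) \<longlonglongrightarrow> 0"
  using d(3) by blast
 have ts: "smooth_fn (\<psi> n)" for n using t by (auto simp: test_fn_def)
 show ?thesis
 proof (rule H10I[OF open_translate[OF D]])
  show "test_fn {x. x + y \<in> D} (\<lambda>x. \<psi> n (x + y))" for n by (rule test_fn_translate[OF t])
  have m: "(\<lambda>x. indicator D x * w x) \<in> borel_measurable lebesgue"
    "(\<lambda>x. indicator D x *\<^sub>R G x) \<in> borel_measurable lebesgue"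
   using d(1) by (auto simp: measH_def)
  show "measH {x. x + y \<in> D} (\<lambda>x. w (x + y)) (\<lambda>x. G (x + y))"
   using measurable_compose[OF lebesgue_translate(1) m(1), of y] measurable_compose[OF lebesgue_translate(1) m(2), of y]
   unfolding measH_def by (simp add: indicator_def)
  have "measH D (\<lambda>x. w x - \<psi> n x) (\<lambda>x. G x - grad_fn (\<psi> n) x)" for n
   using D by (intro measH_diff d(1) measH_smooth ts) (simp add: borel_open)
  from sob_translate[OF this, of y]
  show "(\<lambda>n. sob {x. x + y \<in> D} (\<lambda>x. w (x + y) - \<psi> n (x + y)) (\<lambda>x. G (x + y) - grad_fn (\<lambda>x. \<psi> n (x + y)) x)) \<longlonglongrightarrow> 0"
   using l by (simp add: grad_fn_translate[OF ts])
 qed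
qed

text \<open>For a smooth function of finite norm whose support need not be compact: cutoffs that are
  eventually 1 near each point approximate it by dominated convergence.\<close>

lemma H10_smooth:
 fixes p :: "'a::euclidean_space \<Rightarrow> real"
 assumes D: "open D" and p: "smooth_fn p" and fin: "sob D p (grad_fn p) < \<infinity>"
  and eta: "\<And>n. smooth_fn (\<eta> n)" "\<And>n x. \<bar>\<eta> n x\<bar> \<le> 1" "\<And>n x. norm (grad_fn (\<eta> n) x) \<le> L"
  and tt: "\<And>n. test_fn D (\<lambda>x. \<eta> n x * p x)"
  and ev: "\<And>x. eventually (\<lambda>n. \<eta> n x = 1 \<and> grad_fn (\<eta> n) x = 0) sequentially"
 shows "H10 D p (grad_fn p)"
proof -
 have Dm: "D \<in> sets lebesgue" using D by (simp add: borel_open)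
 let ?f = "\<lambda>n x. indicator D x * ((p x - \<eta> n x * p x)\<^sup>2 + (norm (grad_fn p x - grad_fn (\<lambda>x. \<eta> n x * p x) x))\<^sup>2)"
 \<comment> \<open>Only \<bar>\<eta>\<bar> \<le> 1 is known, so 1 - \<eta> is bounded by 2; this
   gives 4 for the function, and the product rule gives 8 and 2 L^2 for the gradient.\<close>
 let ?g = "\<lambda>x. ennreal (4 + 8 + 2 * L\<^sup>2) * ennreal (indicator D x * ((p x)\<^sup>2 + (norm (grad_fn p x))\<^sup>2))"
 have m: "measH D (\<lambda>x. p x - \<eta> n x * p x) (\<lambda>x. grad_fn p x - grad_fn (\<lambda>x. \<eta> n x * p x) x)" for n
  by (intro measH_diff measH_smooth Dm p smooth_fn_mult eta)
 show ?thesis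
 proof (rule H10I[OF D measH_smooth[OF Dm p] tt])
  have "(\<lambda>n. \<integral>\<^sup>+x. ennreal (?f n x) \<partial>lebesgue) \<longlonglongrightarrow> (\<integral>\<^sup>+(x::'a). 0 \<partial>lebesgue)"
  proof (rule nn_integral_dominated_convergence[where w="?g"])
   show "(\<lambda>x. ennreal (?f n x)) \<in> borel_measurable lebesgue" for n
    using measH_sq(3)[OF m[of n]] by simp
   have pm: "(\<lambda>x. ennreal (indicator D x * ((p x)\<^sup>2 + (norm (grad_fn p x))\<^sup>2))) \<in> borel_measurable lebesgue"
    using measH_sq(3)[OF measH_smooth[OF Dm p]] by simp
   then show "?g \<in> borel_measurable lebesgue" by measurable
   show "(\<integral>\<^sup>+x. ?g x \<partial>lebesgue) < \<infinity>"
    using fin pm by (subst nn_integral_cmult) (auto simp: sob_def ennreal_mult_less_top)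
   show "AE x in lebesgue. ennreal (?f n x) \<le> ?g x" for n
   proof (rule AE_I2)
    fix x
    have a: "\<bar>1 - \<eta> n x\<bar> \<le> 2" using eta(2)[of n x] by linarith
    have a2: "(1 - \<eta> n x)\<^sup>2 \<le> 4" using power_mono[OF a, of 2] by simp
    have c2: "(norm (grad_fn (\<eta> n) x))\<^sup>2 \<le> L\<^sup>2" using eta(3)[of n x] by (intro power_mono) auto
    have "(p x - \<eta> n x * p x)\<^sup>2 = (1 - \<eta> n x)\<^sup>2 * (p x)\<^sup>2" by (simp add: algebra_simps flip: power_mult_distrib)
    also have "\<dots> \<le> 4 * (p x)\<^sup>2" using a2 by (intro mult_right_mono) auto
    finally have 1: "(p x - \<eta> n x * p x)\<^sup>2 \<le> 4 * (p x)\<^sup>2" .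
    have "grad_fn p x - grad_fn (\<lambda>x. \<eta> n x * p x) x = (1 - \<eta> n x) *\<^sub>R grad_fn p x + (- p x) *\<^sub>R grad_fn (\<eta> n) x"
     unfolding grad_fn_mult[OF eta(1) p] by (simp add: algebra_simps)
    then have "(norm (grad_fn p x - grad_fn (\<lambda>x. \<eta> n x * p x) x))\<^sup>2
      \<le> 2 * (norm ((1 - \<eta> n x) *\<^sub>R grad_fn p x))\<^sup>2 + 2 * (norm ((- p x) *\<^sub>R grad_fn (\<eta> n) x))\<^sup>2"
     by (simp only: norm_sq_add_le)
    also have "\<dots> = 2 * ((1 - \<eta> n x)\<^sup>2 * (norm (grad_fn p x))\<^sup>2) + 2 * ((p x)\<^sup>2 * (norm (grad_fn (\<eta> n) x))\<^sup>2)"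
     by (simp add: power_mult_distrib)
    also have "\<dots> \<le> 2 * (4 * (norm (grad_fn p x))\<^sup>2) + 2 * ((p x)\<^sup>2 * L\<^sup>2)"
     using a2 c2 by (intro add_mono mult_left_mono mult_right_mono) auto
    finally have 2: "(norm (grad_fn p x - grad_fn (\<lambda>x. \<eta> n x * p x) x))\<^sup>2
     \<le> 8 * (norm (grad_fn p x))\<^sup>2 + 2 * ((p x)\<^sup>2 * L\<^sup>2)" by simp
    have 3: "0 \<le> L\<^sup>2 * (norm (grad_fn p x))\<^sup>2" "0 \<le> (p x)\<^sup>2" "0 \<le> (norm (grad_fn p x))\<^sup>2" by auto
    have "(p x - \<eta> n x * p x)\<^sup>2 + (norm (grad_fn p x - grad_fn (\<lambda>x. \<eta> n x * p x) x))\<^sup>2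
      \<le> (4 + 8 + 2 * L\<^sup>2) * ((p x)\<^sup>2 + (norm (grad_fn p x))\<^sup>2)"
    proof -
     have "(4 + 8 + 2 * L\<^sup>2) * ((p x)\<^sup>2 + (norm (grad_fn p x))\<^sup>2) = 12 * (p x)\<^sup>2 + 12 * (norm (grad_fn p x))\<^sup>2 + 2 * ((p x)\<^sup>2 * L\<^sup>2) + 2 * (L\<^sup>2 * (norm (grad_fn p x))\<^sup>2)"
      by (simp add: algebra_simps)
     then show ?thesis using 1 2 3 by linarith
    qed
    then have "ennreal (?f n x) \<le> ennreal ((4 + 8 + 2 * L\<^sup>2) * (indicator D x * ((p x)\<^sup>2 + (norm (grad_fn p x))\<^sup>2)))"
     by (intro ennreal_leI) (auto simp: indicator_def)
    then show "ennreal (?f n x) \<le> ?g x" by (rule ord_le_eq_trans) (rule ennreal_mult; simp)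
   qed
   show "AE x in lebesgue. (\<lambda>n. ennreal (?f n x)) \<longlonglongrightarrow> 0"
   proof (rule AE_I2, rule tendsto_eventually)
    fix x
    show "eventually (\<lambda>n. ennreal (?f n x) = 0) sequentially"
     using ev[of x] by eventually_elim (simp add: grad_fn_mult[OF eta(1) p])
   qed
  qed simp
  then show "(\<lambda>n. sob D (\<lambda>x. p x - \<eta> n x * p x) (\<lambda>x. grad_fn p x - grad_fn (\<lambda>x. \<eta> n x * p x) x)) \<longlonglongrightarrow> 0"
   by (simp add: sob_def)
 qed
qed

lemma H10_zero: "open D \<Longrightarrow> H10 D (\<lambda>_. 0) (\<lambda>_. 0)"
proof -
 assume D: "open D"
 have g: "grad_fn (\<lambda>_. 0) = (\<lambda>_. 0 :: 'a::euclidean_space)" by (simp add: grad_fn_def fun_eq_iff)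
 have "tsupport (\<lambda>_. 0 :: real) = ({} :: 'a set)" by (simp add: tsupport_def)
 then have t: "test_fn D (\<lambda>_. 0)" by (simp add: test_fn_def smooth_fn_const)
 show ?thesis
  by (rule H10I[OF D _ t]) (simp_all add: measH_def sob_def g)
qed

text \<open>Meant for the infinite cylinder, where the planar profile tends to -1 and 1 and is
  therefore only locally square integrable, while its difference to a competitor is in
  \<open>H10\<close>.\<close>

lemma H1loc_smooth_add_H10:
 assumes D: "open D" and p: "smooth_fn p" and h: "H10 D w G"
 shows "H1loc D (\<lambda>x. p x + w x) (\<lambda>x. grad_fn p x + G x)"
proof -
 have Dm: "D \<in> sets lebesgue" using D by (simp add: borel_open)
 note d = H10D[OF D h]
 have m: "measH D (\<lambda>x. p x + w x) (\<lambda>x. grad_fn p x + G x)"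
  by (rule measH_add[OF measH_smooth[OF Dm p] d(1)])
 have h1: "H1 D w G" using h by (simp add: H10_def)
 have pK: "integrable lebesgue (\<lambda>x. indicator K x * f x)" if "compact K" "continuous_on UNIV f" for K and f :: "'a \<Rightarrow> real"
 proof -
  have "compact (f ` K)" using that by (intro compact_continuous_image continuous_on_subset[OF that(2)]) auto
  then obtain C where C: "\<forall>y\<in>f ` K. norm y \<le> C" using compact_imp_bounded bounded_iff by metis
  have fm: "f \<in> borel_measurable borel" by (rule borel_measurable_continuous_onI[OF that(2)])
  have Km: "K \<in> sets borel" by (rule borel_compact[OF that(1)])
  have "integrable lborel (\<lambda>x. indicator K x * f x)"
  proof (rule integrable_lborel_bounded_support[OF _ that(1)])
   show "(\<lambda>x. indicator K x * f x) \<in> borel_measurable borel" using fm Km by measurable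
   fix x show "\<bar>indicator K x * f x\<bar> \<le> max 0 C" using C by (cases "x \<in> K") (auto intro: max.coboundedI2)
  qed simp
  moreover have "(\<lambda>x. indicator K x * f x) \<in> borel_measurable lborel" using fm Km by simp
  ultimately show ?thesis by (simp add: integrable_completion)
 qed
 have c: "continuous_on UNIV p" "continuous_on UNIV (grad_fn p)"
  using smooth_fn_continuous[OF p] grad_fn_continuous[OF p] by auto
 have L1: "integrable lebesgue (\<lambda>x. indicator K x * (p x + w x)\<^sup>2)"
  and L2: "integrable lebesgue (\<lambda>x. indicator K x * (norm (grad_fn p x + G x))\<^sup>2)"
  if K: "compact K" "K \<subseteq> D" for K
 proof -
  have Km: "K \<in> sets lebesgue" using borel_compact[OF K(1)] by simp
  have e: "indicator K x * (p x + w x)\<^sup>2 = indicator K x * (indicator D x * (p x + w x)\<^sup>2)"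
   "indicator K x * (norm (grad_fn p x + G x))\<^sup>2 = indicator K x * (indicator D x * (norm (grad_fn p x + G x))\<^sup>2)" for x
   using K(2) by (auto simp: indicator_def)
  have w: "integrable lebesgue (\<lambda>x. indicator K x * (w x)\<^sup>2)" "integrable lebesgue (\<lambda>x. indicator K x * (norm (G x))\<^sup>2)"
   using h1 K unfolding H1_def H1loc_def L2loc_def L2loc_vec_def by auto
  have pp: "integrable lebesgue (\<lambda>x. indicator K x * (p x)\<^sup>2)" "integrable lebesgue (\<lambda>x. indicator K x * (norm (grad_fn p x))\<^sup>2)"
   by (intro pK K(1) continuous_intros c)+
  show "integrable lebesgue (\<lambda>x. indicator K x * (p x + w x)\<^sup>2)"
  proof (rule Bochner_Integration.integrable_bound)
   show "integrable lebesgue (\<lambda>x. 2 * (indicator K x * (p x)\<^sup>2) + 2 * (indicator K x * (w x)\<^sup>2))"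
    using w pp by (intro Bochner_Integration.integrable_add integrable_mult_right)
   show "(\<lambda>x. indicator K x * (p x + w x)\<^sup>2) \<in> borel_measurable lebesgue"
    unfolding e by (rule borel_measurable_times[OF borel_measurable_indicator[OF Km] measH_sq(1)[OF m]])
   show "AE x in lebesgue. norm (indicator K x * (p x + w x)\<^sup>2) \<le> norm (2 * (indicator K x * (p x)\<^sup>2) + 2 * (indicator K x * (w x)\<^sup>2))"
    using sq_add_le by (intro AE_I2) (auto simp: indicator_def)
  qed
  show "integrable lebesgue (\<lambda>x. indicator K x * (norm (grad_fn p x + G x))\<^sup>2)"
  proof (rule Bochner_Integration.integrable_bound)
   show "integrable lebesgue (\<lambda>x. 2 * (indicator K x * (norm (grad_fn p x))\<^sup>2) + 2 * (indicator K x * (norm (G x))\<^sup>2))"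
    using w pp by (intro Bochner_Integration.integrable_add integrable_mult_right)
   show "(\<lambda>x. indicator K x * (norm (grad_fn p x + G x))\<^sup>2) \<in> borel_measurable lebesgue"
    unfolding e by (rule borel_measurable_times[OF borel_measurable_indicator[OF Km] measH_sq(2)[OF m]])
   show "AE x in lebesgue. norm (indicator K x * (norm (grad_fn p x + G x))\<^sup>2) \<le> norm (2 * (indicator K x * (norm (grad_fn p x))\<^sup>2) + 2 * (indicator K x * (norm (G x))\<^sup>2))"
    using norm_sq_add_le by (intro AE_I2) (auto simp: indicator_def)
  qed
 qed
 have "weak_grad D (\<lambda>x. p x + w x) (\<lambda>x. grad_fn p x + G x)"
  unfolding weak_grad_def
 proof (intro allI impI)
  fix \<phi> v assume t: "test_fn D \<phi>"
  have ps: "smooth_fn \<phi>" "compact (tsupport \<phi>)" "tsupport \<phi> \<subseteq> D" using t by (auto simp: test_fn_def)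
  have z: "\<phi> x = 0" "fderiv \<phi> x v = 0" if "x \<notin> tsupport \<phi>" for x
   using frechet_derivative_outside_tsupport[OF that] by auto
  have iw: "integrable lebesgue (\<lambda>x. indicator D x * w x * fderiv \<phi> x v)"
    "integrable lebesgue (\<lambda>x. indicator D x * (G x \<bullet> v) * \<phi> x)"
   using test_pairing_bound[OF Dm t, of v] d(1,2) by blast+
  have e1: "indicator D x * p x * fderiv \<phi> x v = indicator (tsupport \<phi>) x * (p x * fderiv \<phi> x v)"
   "indicator D x * (grad_fn p x \<bullet> v) * \<phi> x = indicator (tsupport \<phi>) x * ((grad_fn p x \<bullet> v) * \<phi> x)" for x
   using z[of x] ps(3) by (cases "x \<in> tsupport \<phi>"; auto)+
  have ip: "integrable lebesgue (\<lambda>x. indicator D x * p x * fderiv \<phi> x v)"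
    "integrable lebesgue (\<lambda>x. indicator D x * (grad_fn p x \<bullet> v) * \<phi> x)"
   unfolding e1 by (intro pK ps(2) continuous_intros c smooth_fn_continuous smooth_fn_derivative_continuous ps(1))+
  have 1: "(\<integral>x. indicator D x * (p x + w x) * fderiv \<phi> x v \<partial>lebesgue)
    = (\<integral>x. indicator D x * p x * fderiv \<phi> x v \<partial>lebesgue) + (\<integral>x. indicator D x * w x * fderiv \<phi> x v \<partial>lebesgue)"
   unfolding distrib_left distrib_right by (rule Bochner_Integration.integral_add[OF ip(1) iw(1)])
  have 2: "(\<integral>x. indicator D x * ((grad_fn p x + G x) \<bullet> v) * \<phi> x \<partial>lebesgue)
    = (\<integral>x. indicator D x * (grad_fn p x \<bullet> v) * \<phi> x \<partial>lebesgue) + (\<integral>x. indicator D x * (G x \<bullet> v) * \<phi> x \<partial>lebesgue)"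
   unfolding inner_add_left distrib_left distrib_right by (rule Bochner_Integration.integral_add[OF ip(2) iw(2)])
  have 3: "(\<integral>x. indicator D x * p x * fderiv \<phi> x v \<partial>lebesgue) = - (\<integral>x. indicator D x * (grad_fn p x \<bullet> v) * \<phi> x \<partial>lebesgue)"
   unfolding grad_fn_inner[OF p] by (rule smooth_integration_by_parts[OF p t])
  have 4: "(\<integral>x. indicator D x * w x * fderiv \<phi> x v \<partial>lebesgue) = - (\<integral>x. indicator D x * (G x \<bullet> v) * \<phi> x \<partial>lebesgue)"
   using h1 t unfolding H1_def H1loc_def weak_grad_def by blast
  show "(\<integral>x. indicator D x * (p x + w x) * fderiv \<phi> x v \<partial>lebesgue)
   = - (\<integral>x. indicator D x * ((grad_fn p x + G x) \<bullet> v) * \<phi> x \<partial>lebesgue)"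
   unfolding 1 2 3 4 by simp
 qed
 then show ?thesis unfolding H1loc_def L2loc_def L2loc_vec_def using m L1 L2 by (auto simp: measH_def)
qed

text \<open>The counterpart for cylinders of finite height, where the profile itself has finite
  norm.\<close>

lemma H1_smooth_add_H10:
 assumes D: "open D" and p: "smooth_fn p" and h: "H10 D w G" and fin: "sob D p (grad_fn p) < \<infinity>"
 shows "H1 D (\<lambda>x. p x + w x) (\<lambda>x. grad_fn p x + G x)"
proof -
 have Dm: "D \<in> sets lebesgue" using D by (simp add: borel_open)
 note d = H10D[OF D h]
 note pm = measH_smooth[OF Dm p]
 have m: "measH D (\<lambda>x. p x + w x) (\<lambda>x. grad_fn p x + G x)" by (rule measH_add[OF pm d(1)])
 have "sob D (\<lambda>x. p x + w x) (\<lambda>x. grad_fn p x + G x) \<le> 2 * sob D p (grad_fn p) + 2 * sob D w G"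
  by (rule sob_add_le[OF pm d(1)])
 also have "\<dots> < \<infinity>" using fin d(2) by (simp add: ennreal_mult_less_top)
 finally have "sob D (\<lambda>x. p x + w x) (\<lambda>x. grad_fn p x + G x) < \<infinity>" .
 from sob_finite_integrable[OF m this] H1loc_smooth_add_H10[OF D p h]
 show ?thesis unfolding H1_def by blast
qed

lemma sob_smooth_bounded:
 assumes D: "bounded D" and p: "smooth_fn p"
 shows "sob D p (grad_fn p) < \<infinity>"
proof -
 let ?f = "\<lambda>x. (p x)\<^sup>2 + (norm (grad_fn p x))\<^sup>2" and ?K = "closure D"
 have K: "compact ?K" using D by (simp add: compact_closure)
 have c: "continuous_on UNIV ?f" by (intro continuous_intros smooth_fn_continuous grad_fn_continuous p)
 have "compact (?f ` ?K)" using K by (intro compact_continuous_image continuous_on_subset[OF c]) auto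
 then obtain C where C: "\<forall>y\<in>?f ` ?K. norm y \<le> C" using compact_imp_bounded bounded_iff by metis
 have "sob D p (grad_fn p) \<le> (\<integral>\<^sup>+x. ennreal C * indicator ?K x \<partial>lebesgue)"
  unfolding sob_def
 proof (rule nn_integral_mono)
  fix x
  show "ennreal (indicator D x * ?f x) \<le> ennreal C * indicator ?K x"
  proof (cases "x \<in> D")
   case True
   then have "x \<in> ?K" using closure_subset by blast
   moreover from this have "?f x \<le> C" using C by force
   ultimately show ?thesis using True by (simp add: ennreal_leI del: ennreal_plus)
  qed simp
 qed
 also have "\<dots> = ennreal C * emeasure lborel ?K" by (simp add: nn_integral_completion nn_integral_cmult_indicator)
 also have "\<dots> < \<infinity>" using emeasure_bounded_finite[OF compact_imp_bounded[OF K]] by (simp add: ennreal_mult_less_top)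
 finally show ?thesis .
qed

section \<open>Cylinders\<close>

locale frame =
 fixes e :: "'d::euclidean_space" and B :: "'d set"
 assumes norm_e: "norm e = 1" and finB: "finite B" and cardB: "card B = DIM('d) - 1"
  and B_norm: "\<And>b. b \<in> B \<Longrightarrow> norm b = 1" and B_e: "\<And>b. b \<in> B \<Longrightarrow> b \<bullet> e = 0"
  and B_orth: "\<And>b b'. b \<in> B \<Longrightarrow> b' \<in> B \<Longrightarrow> b \<noteq> b' \<Longrightarrow> b \<bullet> b' = 0"
begin

lemma ee [simp]: "e \<bullet> e = 1" using norm_e by (simp add: norm_eq_1)

lemma eB: "b \<in> B \<Longrightarrow> e \<bullet> b = 0" using B_e by (simp add: inner_commute)

lemma bb: "b \<in> B \<Longrightarrow> b \<bullet> b = 1" using B_norm by (simp add: norm_eq_1)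

text \<open>\<open>B\<close> and \<open>e\<close> together are DIM many orthonormal vectors, hence a
  basis.\<close>

lemma frame_expand: "x = (x \<bullet> e) *\<^sub>R e + (\<Sum>b\<in>B. (x \<bullet> b) *\<^sub>R b)"
proof -
 let ?C = "insert e B"
 have eB: "e \<notin> B" using B_e[of e] by auto
 have orth: "pairwise orthogonal ?C"
  unfolding pairwise_def orthogonal_def using B_e B_orth by (auto simp: inner_commute)
 have n1: "norm c = 1" if "c \<in> ?C" for c using that norm_e B_norm by auto
 have "0 \<notin> ?C" using n1 by force
 then have ind: "independent ?C" by (rule pairwise_orthogonal_independent[OF orth])
 have "card ?C = DIM('d)" using finB eB cardB DIM_positive[where 'a='d] by simp
 then have "UNIV \<subseteq> span ?C"
  using card_ge_dim_independent[OF subset_UNIV ind] by (simp add: dim_UNIV)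
 then have "x \<in> span ?C" by blast
 then have "(\<Sum>i\<in>?C. (x \<bullet> i) *\<^sub>R i) = x"
  using finB n1 by (intro orthonormal_basis_expand orth) auto
 then show ?thesis using finB eB by simp
qed

lemma norm_le_frame: "norm x \<le> \<bar>x \<bullet> e\<bar> + (\<Sum>b\<in>B. \<bar>x \<bullet> b\<bar>)"
proof -
 have "norm x = norm ((x \<bullet> e) *\<^sub>R e + (\<Sum>b\<in>B. (x \<bullet> b) *\<^sub>R b))" using frame_expand[of x] by simp
 also have "\<dots> \<le> norm ((x \<bullet> e) *\<^sub>R e) + norm (\<Sum>b\<in>B. (x \<bullet> b) *\<^sub>R b)" by (rule norm_triangle_ineq)
 also have "\<dots> \<le> \<bar>x \<bullet> e\<bar> + (\<Sum>b\<in>B. \<bar>x \<bullet> b\<bar>)"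
  using norm_e B_norm by (intro add_mono order_trans[OF norm_sum] sum_mono) auto
 finally show ?thesis .
qed

text \<open>Unbounded in the direction \<open>e\<close>: a cube in the orthogonal complement times a
  line. The parameter \<rho> is half the side.\<close>

definition cube :: "'d \<Rightarrow> real \<Rightarrow> 'd set" where
 "cube y \<rho> = {x. \<forall>b\<in>B. \<bar>(x - y) \<bullet> b\<bar> < \<rho>}"

text \<open>The centre y is used for the lateral position only; heights are measured from 0.\<close>

definition dom :: "'d \<Rightarrow> real \<Rightarrow> real set \<Rightarrow> 'd set" where
 "dom y \<rho> H = {x. (\<forall>b\<in>B. \<bar>(x - y) \<bullet> b\<bar> < \<rho>) \<and> x \<bullet> e \<in> H}"

lemma dom_cube: "dom y \<rho> H = cube y \<rho> \<inter> {x. x \<bullet> e \<in> H}"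
 by (auto simp: dom_def cube_def)

lemma open_cube: "open (cube y \<rho>)"
proof -
 have "cube y \<rho> = (\<Inter>b\<in>B. {x. \<bar>(x - y) \<bullet> b\<bar> < \<rho>})" by (auto simp: cube_def)
 then show ?thesis using finB by (auto intro!: open_INT open_Collect_less continuous_intros)
qed

lemma open_dom: "open H \<Longrightarrow> open (dom y \<rho> H)"
proof -
 assume "open H"
 then have "open {x. x \<bullet> e \<in> H}"
  using continuous_open_vimage[of H "\<lambda>x. x \<bullet> e"] by (simp add: vimage_def continuous_intros)
 then show ?thesis unfolding dom_cube using open_cube by (rule open_Int[rotated])
qed

lemma cube_subset: "(\<And>b. b \<in> B \<Longrightarrow> \<bar>(y - y') \<bullet> b\<bar> + \<rho> \<le> \<rho>') \<Longrightarrow> cube y \<rho> \<subseteq> cube y' \<rho>'"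
proof
 fix x assume a: "\<And>b. b \<in> B \<Longrightarrow> \<bar>(y - y') \<bullet> b\<bar> + \<rho> \<le> \<rho>'" and x: "x \<in> cube y \<rho>"
 show "x \<in> cube y' \<rho>'" unfolding cube_def
 proof (intro CollectI ballI)
  fix b assume b: "b \<in> B"
  have "(x - y') \<bullet> b = (x - y) \<bullet> b + (y - y') \<bullet> b" by (simp add: inner_diff_left)
  then show "\<bar>(x - y') \<bullet> b\<bar> < \<rho>'" using a[OF b] x b by (auto simp: cube_def dest!: bspec[of B _ b])
 qed
qed

lemma dom_subset: "(\<And>b. b \<in> B \<Longrightarrow> \<bar>(y - y') \<bullet> b\<bar> + \<rho> \<le> \<rho>') \<Longrightarrow> H \<subseteq> H' \<Longrightarrow> dom y \<rho> H \<subseteq> dom y' \<rho>' H'"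
 unfolding dom_cube using cube_subset[of y y' \<rho> \<rho>'] by blast

lemma cube_disjoint:
 assumes "b \<in> B" "\<rho> + \<rho>' \<le> \<bar>(y - y') \<bullet> b\<bar>"
 shows "cube y \<rho> \<inter> cube y' \<rho>' = {}"
proof (rule ccontr)
 assume "cube y \<rho> \<inter> cube y' \<rho>' \<noteq> {}"
 then obtain x where "\<bar>(x - y) \<bullet> b\<bar> < \<rho>" "\<bar>(x - y') \<bullet> b\<bar> < \<rho>'" using assms(1) by (auto simp: cube_def)
 moreover have "(y - y') \<bullet> b = (x - y') \<bullet> b - (x - y) \<bullet> b" by (simp add: inner_diff_left)
 ultimately show False using assms(2) by linarith
qed

lemma bounded_dom:
 assumes "bounded H"
 shows "bounded (dom 0 \<rho> H)"
proof -
 obtain h where h: "\<And>t. t \<in> H \<Longrightarrow> \<bar>t\<bar> \<le> h" using assms unfolding bounded_iff real_norm_def by blast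
 show ?thesis unfolding bounded_iff
 proof (intro exI[of _ "h + (\<Sum>b\<in>B. \<rho>)"] ballI)
  fix x assume x: "x \<in> dom 0 \<rho> H"
  have "norm x \<le> \<bar>x \<bullet> e\<bar> + (\<Sum>b\<in>B. \<bar>x \<bullet> b\<bar>)" by (rule norm_le_frame)
  also have "\<dots> \<le> h + (\<Sum>b\<in>B. \<rho>)"
   using x h by (intro add_mono sum_mono) (auto simp: dom_def intro: less_imp_le)
  finally show "norm x \<le> h + (\<Sum>b\<in>B. \<rho>)" .
 qed
qed

text \<open>A slab of unit thickness. The volume of its intersection with a set invariant along
  \<open>e\<close> serves as the (d-1)-dimensional measure of the cross-section, which is what
  \<open>cvol\<close> below stands for.\<close>

definition slab0 :: "'d set" where "slab0 = {x. - 1 \<le> x \<bullet> e \<and> x \<bullet> e \<le> 0}"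

lemma slab0_borel [measurable]: "slab0 \<in> sets borel"
 unfolding slab0_def by measurable

text \<open>Tonelli in the direction \<open>e\<close>, proved without coordinates: insert
 \<open>1 = \<integral> indicator {0..1} (t - x \<bullet> e) dt\<close>, exchange the integrals and shift \<open>x\<close> by \<open>t *\<^sub>R e\<close>.\<close>

lemma nn_integral_cylinder:
 fixes F :: "real \<Rightarrow> ennreal" and g :: "'d \<Rightarrow> real"
 assumes F [measurable]: "F \<in> borel_measurable borel" and g [measurable]: "g \<in> borel_measurable borel"
  and U [measurable]: "U \<in> sets borel"
  and Ue: "\<And>x t. x + t *\<^sub>R e \<in> U \<longleftrightarrow> x \<in> U" and ge: "\<And>x t. g (x + t *\<^sub>R e) = g x"
 shows "(\<integral>\<^sup>+x. indicator U x * F (x \<bullet> e + g x) \<partial>lborel) = emeasure lborel (U \<inter> slab0) * (\<integral>\<^sup>+t. F t \<partial>lborel)"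
proof -
 have shift1: "(\<integral>\<^sup>+t. f (t + a) \<partial>lborel) = (\<integral>\<^sup>+t. f t \<partial>lborel)" if "f \<in> borel_measurable borel" for f :: "real \<Rightarrow> ennreal" and a
  using nn_integral_distr[of "(+) a" lborel borel f] that by (simp add: lborel_distr_plus add.commute)
 have shift2: "(\<integral>\<^sup>+t. f (t + a) \<partial>lborel) = (\<integral>\<^sup>+t. f t \<partial>lborel)" if "f \<in> borel_measurable borel" for f :: "'d \<Rightarrow> ennreal" and a
  using nn_integral_distr[of "(+) a" lborel borel f] that by (simp add: lborel_distr_plus add.commute)
 have one: "(\<integral>\<^sup>+t. indicator {0..1} (t - s) \<partial>lborel) = (1::ennreal)" for s :: real
  using shift1[of "indicator {0..1}" "- s"] by simp
 have "(\<integral>\<^sup>+x. indicator U x * F (x \<bullet> e + g x) \<partial>lborel)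
   = (\<integral>\<^sup>+x. (\<integral>\<^sup>+t. indicator U x * F (x \<bullet> e + g x) * indicator {0..1} (t - x \<bullet> e) \<partial>lborel) \<partial>lborel)"
  by (simp add: nn_integral_cmult one)
 also have "\<dots> = (\<integral>\<^sup>+t. (\<integral>\<^sup>+x. indicator U x * F (x \<bullet> e + g x) * indicator {0..1} (t - x \<bullet> e) \<partial>lborel) \<partial>lborel)"
  using lborel_pair.Fubini[of "\<lambda>p. indicator U (fst p) * F (fst p \<bullet> e + g (fst p)) * indicator {0..1} (snd p - fst p \<bullet> e)"] by simp
 also have "\<dots> = (\<integral>\<^sup>+t. (\<integral>\<^sup>+x. indicator U x * F (x \<bullet> e + t + g x) * indicator {0..1} (- (x \<bullet> e)) \<partial>lborel) \<partial>lborel)"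
 proof (rule nn_integral_cong)
  fix t :: real
  have "(\<integral>\<^sup>+x. indicator U x * F (x \<bullet> e + g x) * indicator {0..1} (t - x \<bullet> e) \<partial>lborel)
    = (\<integral>\<^sup>+x. indicator U (x + t *\<^sub>R e) * F ((x + t *\<^sub>R e) \<bullet> e + g (x + t *\<^sub>R e)) * indicator {0..1} (t - (x + t *\<^sub>R e) \<bullet> e) \<partial>lborel)"
   by (rule shift2[symmetric]) measurable
  also have "\<dots> = (\<integral>\<^sup>+x. indicator U x * F (x \<bullet> e + t + g x) * indicator {0..1} (- (x \<bullet> e)) \<partial>lborel)"
   using Ue by (simp add: ge inner_add_left indicator_def)
  finally show "(\<integral>\<^sup>+x. indicator U x * F (x \<bullet> e + g x) * indicator {0..1} (t - x \<bullet> e) \<partial>lborel) = \<dots>" .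
 qed
 also have "\<dots> = (\<integral>\<^sup>+x. (\<integral>\<^sup>+t. indicator U x * F (x \<bullet> e + t + g x) * indicator {0..1} (- (x \<bullet> e)) \<partial>lborel) \<partial>lborel)"
  using lborel_pair.Fubini[of "\<lambda>p. indicator U (fst p) * F (fst p \<bullet> e + snd p + g (fst p)) * indicator {0..1} (- (fst p \<bullet> e))"] by simp
 also have "\<dots> = (\<integral>\<^sup>+x. (\<integral>\<^sup>+t. F t \<partial>lborel) * indicator (U \<inter> slab0) x \<partial>lborel)"
 proof (rule nn_integral_cong)
  fix x
  have "(\<integral>\<^sup>+t. F (x \<bullet> e + t + g x) \<partial>lborel) = (\<integral>\<^sup>+t. F t \<partial>lborel)"
   using shift1[of F "x \<bullet> e + g x"] by (simp add: ac_simps)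
  moreover have "(\<integral>\<^sup>+t. indicator U x * F (x \<bullet> e + t + g x) * indicator {0..1} (- (x \<bullet> e)) \<partial>lborel)
    = (\<integral>\<^sup>+t. indicator (U \<inter> slab0) x * F (x \<bullet> e + t + g x) \<partial>lborel)"
   by (intro nn_integral_cong) (auto simp: slab0_def indicator_def)
  ultimately show "(\<integral>\<^sup>+t. indicator U x * F (x \<bullet> e + t + g x) * indicator {0..1} (- (x \<bullet> e)) \<partial>lborel)
    = (\<integral>\<^sup>+t. F t \<partial>lborel) * indicator (U \<inter> slab0) x"
   by (simp add: nn_integral_cmult mult.commute)
 qed
 also have "\<dots> = emeasure lborel (U \<inter> slab0) * (\<integral>\<^sup>+t. F t \<partial>lborel)"
  by (subst nn_integral_cmult_indicator) (auto simp: mult.commute)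
 finally show ?thesis .
qed

definition cvol :: "'d set \<Rightarrow> ennreal" where "cvol U = emeasure lborel (U \<inter> slab0)"

definition lat :: "('d \<Rightarrow> int) \<Rightarrow> 'd" where "lat z = (\<Sum>b\<in>B. real_of_int (z b) *\<^sub>R b)"

lemma lat_inner: "b \<in> B \<Longrightarrow> lat z \<bullet> b = real_of_int (z b)"
proof -
 assume b: "b \<in> B"
 have "lat z \<bullet> b = (\<Sum>b'\<in>B. real_of_int (z b') * (b' \<bullet> b))" by (simp add: lat_def inner_sum_left)
 also have "\<dots> = (\<Sum>b'\<in>B. if b' = b then real_of_int (z b) else 0)"
  using b B_orth bb by (intro sum.cong) auto
 finally show ?thesis using finB b by simp
qed

lemma lat_e: "lat z \<bullet> e = 0"
 unfolding lat_def inner_sum_left using B_e by (simp add: inner_scaleR_left)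

lemma cvol_translate:
 assumes "U \<in> sets borel" "y \<bullet> e = 0"
 shows "cvol {x. x + y \<in> U} = cvol U"
proof -
 have "cvol U = emeasure (distr lborel borel ((+) y)) (U \<inter> slab0)" by (simp add: cvol_def lborel_distr_plus)
 also have "\<dots> = emeasure lborel ((+) y -` (U \<inter> slab0) \<inter> space lborel)"
  using assms by (intro emeasure_distr) auto
 also have "(+) y -` (U \<inter> slab0) \<inter> space lborel = {x. x + y \<in> U} \<inter> slab0"
  using assms(2) by (auto simp: slab0_def inner_add_left add.commute)
 finally show ?thesis by (simp add: cvol_def)
qed

text \<open>Half-open unit cells, so that cubes of integer half-side decompose without
  overlap.\<close>

definition hcell :: "('d \<Rightarrow> int) \<Rightarrow> 'd set" where
 "hcell z = {x. \<forall>b\<in>B. real_of_int (z b) \<le> x \<bullet> b \<and> x \<bullet> b < real_of_int (z b) + 1}"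

lemma hcell_borel [measurable]: "hcell z \<in> sets borel"
proof -
 have "hcell z = (\<Inter>b\<in>B. {x. real_of_int (z b) \<le> x \<bullet> b \<and> x \<bullet> b < real_of_int (z b) + 1}) \<inter> UNIV" by (auto simp: hcell_def)
 also have "\<dots> \<in> sets borel"
 proof (cases "B = {}")
  case False
  have "{x. real_of_int (z b) \<le> x \<bullet> b \<and> x \<bullet> b < real_of_int (z b) + 1} \<in> sets borel" for b by measurable
  then show ?thesis using finB False by (intro sets.Int sets.finite_INT) auto
 qed simp
 finally show ?thesis .
qed

definition cvol1 :: ennreal where "cvol1 = cvol (hcell (\<lambda>_. 0))"

lemma cvol_hcell: "cvol (hcell z) = cvol1"
proof -
 have "{x. x + lat z \<in> hcell z} = hcell (\<lambda>_. 0)"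
  by (auto simp: hcell_def inner_add_left lat_inner)
 then show ?thesis using cvol_translate[OF hcell_borel lat_e, of z z] by (simp add: cvol1_def)
qed

lemma cvol_mono: "U \<subseteq> U' \<Longrightarrow> U' \<in> sets borel \<Longrightarrow> cvol U \<le> cvol U'"
 unfolding cvol_def by (intro emeasure_mono) auto

lemma cube_borel [measurable]: "cube y \<rho> \<in> sets borel"
 by (rule borel_open[OF open_cube])

lemma cvol_cube_finite: "cvol (cube 0 \<rho>) < \<infinity>"
proof -
 have "cube 0 \<rho> \<inter> slab0 \<subseteq> dom 0 \<rho> {-1..0}" by (auto simp: dom_def cube_def slab0_def)
 then have "bounded (cube 0 \<rho> \<inter> slab0)" by (rule bounded_subset[OF bounded_dom, rotated]) simp
 then show ?thesis unfolding cvol_def by (rule emeasure_bounded_finite)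
qed

lemma cvol1_finite: "cvol1 < \<infinity>"
proof -
 have "cvol1 \<le> cvol (cube 0 2)" unfolding cvol1_def
 proof (rule cvol_mono)
  show "hcell (\<lambda>_. 0) \<subseteq> cube 0 2" by (auto simp: hcell_def cube_def abs_if)
 qed (rule cube_borel)
 then show ?thesis using cvol_cube_finite[of 2] by (rule order_le_less_trans)
qed

text \<open>All unit cells are lattice translates of one another, so only their number counts and
  the constant \<open>cvol1\<close> is never evaluated. The open cube and its half-open version
  differ by subsets of finitely many hyperplanes.\<close>

lemma cvol_cube_nat: "cvol (cube 0 (real N)) = ennreal (real (2 * N) ^ card B) * cvol1"
proof -
 let ?P = "PiE B (\<lambda>_. {- int N..<int N})"
 let ?H = "{x. \<forall>b\<in>B. - real N \<le> x \<bullet> b \<and> x \<bullet> b < real N}"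
 have P: "finite ?P" using finB by (intro finite_PiE) auto
 have Hu: "?H = (\<Union>z\<in>?P. hcell z)"
 proof (intro equalityI subsetI)
  fix x assume x: "x \<in> ?H"
  let ?z = "restrict (\<lambda>b. \<lfloor>x \<bullet> b\<rfloor>) B"
  have "?z \<in> ?P"
  proof (rule restrict_PiE_iff[THEN iffD2], rule ballI)
   fix b assume "b \<in> B"
   then have *: "- real N \<le> x \<bullet> b" "x \<bullet> b < real N" using x by auto
   then show "\<lfloor>x \<bullet> b\<rfloor> \<in> {- int N..<int N}" by (simp add: le_floor_iff floor_less_iff)
  qed
  moreover have "x \<in> hcell ?z" by (auto simp: hcell_def)
  ultimately show "x \<in> (\<Union>z\<in>?P. hcell z)" by blast
 next
  fix x assume "x \<in> (\<Union>z\<in>?P. hcell z)"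
  then obtain z where z: "z \<in> ?P" "x \<in> hcell z" by blast
  show "x \<in> ?H"
  proof (intro CollectI ballI)
   fix b assume b: "b \<in> B"
   have "- int N \<le> z b" "z b + 1 \<le> int N" using z(1) b by (auto simp: PiE_iff)
   then have "- real N \<le> real_of_int (z b)" "real_of_int (z b) + 1 \<le> real N" by linarith+
   moreover have "real_of_int (z b) \<le> x \<bullet> b" "x \<bullet> b < real_of_int (z b) + 1" using z(2) b by (auto simp: hcell_def)
   ultimately show "- real N \<le> x \<bullet> b \<and> x \<bullet> b < real N" by linarith
  qed
 qed
 have disj: "disjoint_family_on (\<lambda>z. hcell z \<inter> slab0) ?P"
 proof (unfold disjoint_family_on_def, intro ballI impI)
  fix z z' assume z: "z \<in> ?P" "z' \<in> ?P" "z \<noteq> z'"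
  then obtain b where b: "b \<in> B" "z b \<noteq> z' b" using PiE_ext[OF z(1,2)] by blast
  have False if "x \<in> hcell z" "x \<in> hcell z'" for x
  proof -
   have "\<lfloor>x \<bullet> b\<rfloor> = z b" "\<lfloor>x \<bullet> b\<rfloor> = z' b"
    using that b(1) unfolding hcell_def by (simp_all add: floor_eq_iff)
   then show False using b(2) by simp
  qed
  then show "(hcell z \<inter> slab0) \<inter> (hcell z' \<inter> slab0) = {}" by blast
 qed
 have "cvol ?H = emeasure lborel (\<Union>z\<in>?P. hcell z \<inter> slab0)" unfolding Hu cvol_def by (rule arg_cong[where f="emeasure lborel"]) blast
 also have "\<dots> = (\<Sum>z\<in>?P. emeasure lborel (hcell z \<inter> slab0))"
  by (rule sum_emeasure[symmetric, OF _ disj P]) auto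
 also have "\<dots> = (\<Sum>z\<in>?P. cvol1)" by (intro sum.cong refl) (simp add: cvol_hcell[unfolded cvol_def])
 also have "\<dots> = of_nat (card ?P) * cvol1" by simp
 also have "card ?P = (2 * N) ^ card B" using finB by (simp add: card_PiE nat_mult_distrib power_mult_distrib)
 also have "of_nat ((2 * N) ^ card B) = ennreal (real (2 * N) ^ card B)" by (simp only: ennreal_of_nat_eq_real_of_nat of_nat_power)
 finally have H: "cvol ?H = ennreal (real (2 * N) ^ card B) * cvol1" .
 have null: "{x. x \<bullet> b = - real N} \<in> null_sets lborel" if "b \<in> B" for b
 proof -
  have "b \<noteq> 0" using bb[OF that] by auto
  then have "negligible {x. b \<bullet> x = - real N}" by (intro negligible_hyperplane) auto
  then have "{x. b \<bullet> x = - real N} \<in> null_sets lebesgue" by (simp add: negligible_iff_null_sets)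
  then have "{x. x \<bullet> b = - real N} \<in> null_sets (completion lborel)" by (simp add: inner_commute)
  moreover have "{x. x \<bullet> b = - real N} \<in> sets lborel" by measurable
  ultimately show ?thesis by (simp add: null_sets_completion_iff)
 qed
 have "cube 0 (real N) \<union> (\<Union>b\<in>B. {x. x \<bullet> b = - real N}) = ?H \<union> (\<Union>b\<in>B. {x. x \<bullet> b = - real N})"
 proof (rule set_eqI)
  fix x
  show "x \<in> cube 0 (real N) \<union> (\<Union>b\<in>B. {x. x \<bullet> b = - real N}) \<longleftrightarrow> x \<in> ?H \<union> (\<Union>b\<in>B. {x. x \<bullet> b = - real N})"
  proof (cases "\<exists>b\<in>B. x \<bullet> b = - real N")
   case True
   then show ?thesis by blast
  next
   case False
   then have "\<bar>x \<bullet> b\<bar> < real N \<longleftrightarrow> - real N \<le> x \<bullet> b \<and> x \<bullet> b < real N" if "b \<in> B" for b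
    using that by (auto simp: abs_less_iff)
   then show ?thesis by (simp add: cube_def)
  qed
 qed
 moreover have nb: "(\<Union>b\<in>B. {x. x \<bullet> b = - real N}) \<in> null_sets lborel"
  using finB null by (intro null_sets_UN') (auto simp: countable_finite)
 moreover have Hm: "?H \<in> sets borel" unfolding Hu using P by (intro sets.finite_UN) auto
 ultimately have "emeasure lborel (cube 0 (real N) \<inter> slab0) = emeasure lborel (?H \<inter> slab0)"
 proof -
  assume eq: "cube 0 (real N) \<union> (\<Union>b\<in>B. {x. x \<bullet> b = - real N}) = ?H \<union> (\<Union>b\<in>B. {x. x \<bullet> b = - real N})"
  let ?Z = "(\<Union>b\<in>B. {x. x \<bullet> b = - real N}) \<inter> slab0"
  have Z: "?Z \<in> null_sets lborel" using nb by (rule null_set_Int2) auto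
  have "emeasure lborel (cube 0 (real N) \<inter> slab0) = emeasure lborel ((cube 0 (real N) \<inter> slab0) \<union> ?Z)"
   by (rule emeasure_Un_null_set[symmetric, OF _ Z]) auto
  also have "(cube 0 (real N) \<inter> slab0) \<union> ?Z = (?H \<inter> slab0) \<union> ?Z" using eq by blast
  also have "emeasure lborel \<dots> = emeasure lborel (?H \<inter> slab0)"
   using Hm by (intro emeasure_Un_null_set Z) auto
  finally show ?thesis .
 qed
 then show ?thesis using H by (simp add: cvol_def)
qed

end

section \<open>Minimal energies\<close>

text \<open>All hypotheses for one fixed direction except ergodicity, which enters only in
  \<open>AE_rate\<close>.\<close>

locale medium = frame e B for e :: "'d::euclidean_space" and B +
 fixes M :: "'w measure" and \<Phi> :: "'w \<Rightarrow> 'd \<Rightarrow> real" and \<tau> :: "'d \<Rightarrow> 'w \<Rightarrow> 'w"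
  and W :: "real \<Rightarrow> real" and q :: "real \<Rightarrow> real" and lam Lam :: real
 assumes lam_pos: "0 < lam" and Lam_pos: "0 < Lam"
  and P: "prob_space M"
  and Phi_meas: "\<Phi> \<in> M \<rightarrow>\<^sub>M Fmeas lam Lam"
  and tau_meas: "(\<lambda>(x, \<omega>). \<tau> x \<omega>) \<in> (borel \<Otimes>\<^sub>M M) \<rightarrow>\<^sub>M M"
  and tau_add: "\<And>x y \<omega>. \<omega> \<in> space M \<Longrightarrow> \<tau> (x + y) \<omega> = \<tau> x (\<tau> y \<omega>)"
  and tau_0: "\<And>\<omega>. \<omega> \<in> space M \<Longrightarrow> \<tau> 0 \<omega> = \<omega>"
  and tau_pres: "\<And>x. distr M M (\<tau> x) = M"
  and W_cont: "continuous_on {-1..1} W"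
  and W_nonneg: "\<And>s. s \<in> {-1..1} \<Longrightarrow> 0 \<le> W s"
  and W_zero: "\<And>s. s \<in> {-1..1} \<Longrightarrow> W s = 0 \<longleftrightarrow> s = -1 \<or> s = 1"
  and q_smooth: "smooth_fn q"
  and q_range: "\<And>s. -1 \<le> q s \<and> q s \<le> 1"
  and q_energy: "(\<integral>\<^sup>+ s. ennreal (Lam / 2 * (deriv q s)\<^sup>2 + W (q s)) \<partial>lborel) < \<infinity>"
  and q_top: "(q \<longlongrightarrow> 1) at_top" and q_bot: "(q \<longlongrightarrow> -1) at_bot"
begin

abbreviation qe :: "'d \<Rightarrow> real" where "qe x \<equiv> q (x \<bullet> e)"
abbreviation dqe :: "'d \<Rightarrow> real" where "dqe x \<equiv> deriv q (x \<bullet> e)"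

lemma tau_space: "\<omega> \<in> space M \<Longrightarrow> \<tau> x \<omega> \<in> space M"
 using measurable_space[OF tau_meas, of "(x, \<omega>)"] by (simp add: space_pair_measure)

lemma tau_measurable [measurable]: "\<tau> x \<in> M \<rightarrow>\<^sub>M M"
 using measurable_compose[OF measurable_Pair1' tau_meas, of x] by simp

section \<open>Integrands of the class and their measurability\<close>

lemma space_Fmeas: "space (Fmeas lam Lam) = (Fclass lam Lam :: ('d \<Rightarrow> real) set)"
 and sets_Fmeas: "sets (Fmeas lam Lam) = sigma_sets (Fclass lam Lam) (Fopen lam Lam :: ('d \<Rightarrow> real) set set)"
proof -
 have "Fopen lam Lam \<subseteq> Pow (Fclass lam Lam :: ('d \<Rightarrow> real) set)" by (auto simp: Fopen_def)
 then show "space (Fmeas lam Lam) = (Fclass lam Lam :: ('d \<Rightarrow> real) set)"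
  "sets (Fmeas lam Lam) = sigma_sets (Fclass lam Lam) (Fopen lam Lam :: ('d \<Rightarrow> real) set set)"
  unfolding Fmeas_def by (auto simp: space_measure_of sets_measure_of)
qed

lemma Phi_class: "\<omega> \<in> space M \<Longrightarrow> \<Phi> \<omega> \<in> Fclass lam Lam"
 using measurable_space[OF Phi_meas] by (simp add: space_Fmeas)

lemma Fclass_polar:
 assumes "\<psi> \<in> Fclass lam Lam" "p \<noteq> 0"
 shows "\<psi> p = norm p * \<psi> (p /\<^sub>R norm p)" "p /\<^sub>R norm p \<in> sphere 0 1"
proof -
 have "\<psi> (norm p *\<^sub>R (p /\<^sub>R norm p)) = norm p * \<psi> (p /\<^sub>R norm p)"
  using assms(1) unfolding Fclass_def by (blast intro: norm_ge_zero)
 then show "\<psi> p = norm p * \<psi> (p /\<^sub>R norm p)" using assms(2) by simp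
 show "p /\<^sub>R norm p \<in> sphere 0 1" using assms(2) by simp
qed

lemma Fclass_0: "\<psi> \<in> Fclass lam Lam \<Longrightarrow> \<psi> 0 = 0"
proof -
 assume "\<psi> \<in> Fclass lam Lam"
 then have "\<psi> (0 *\<^sub>R 0) = 0 * \<psi> 0" unfolding Fclass_def by blast
 then show ?thesis by simp
qed

lemma Fclass_bounds:
 assumes "\<psi> \<in> Fclass lam Lam"
 shows "0 \<le> \<psi> p" "\<psi> p \<le> sqrt Lam * norm p"
proof -
 have "0 \<le> \<psi> p \<and> \<psi> p \<le> sqrt Lam * norm p"
 proof (cases "p = 0")
  case False
  note pol = Fclass_polar[OF assms False]
  have "sqrt lam \<le> \<psi> (p /\<^sub>R norm p)" "\<psi> (p /\<^sub>R norm p) \<le> sqrt Lam"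
   using assms pol(2) unfolding Fclass_def by blast+
  moreover have "0 < sqrt lam" using lam_pos by simp
  ultimately have "0 \<le> \<psi> (p /\<^sub>R norm p)" "\<psi> (p /\<^sub>R norm p) \<le> sqrt Lam" by linarith+
  then have "0 \<le> norm p * \<psi> (p /\<^sub>R norm p)" "norm p * \<psi> (p /\<^sub>R norm p) \<le> norm p * sqrt Lam"
   by (auto intro!: mult_nonneg_nonneg mult_left_mono)
  then show ?thesis by (simp only: pol(1)[symmetric] mult.commute[of "norm p" "sqrt Lam"])
 qed (simp add: Fclass_0[OF assms])
 then show "0 \<le> \<psi> p" "\<psi> p \<le> sqrt Lam * norm p" by auto
qed

lemma Fclass_diff_le:
 fixes f g :: "'d \<Rightarrow> real"
 assumes f: "f \<in> Fclass lam Lam" and g: "g \<in> Fclass lam Lam"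
 shows "\<bar>f p - g p\<bar> \<le> norm p * supdist f g"
proof (cases "p = 0")
 case False
 note pf = Fclass_polar[OF f False] note pg = Fclass_polar[OF g False]
 have "bdd_above ((\<lambda>p. \<bar>f p - g p\<bar>) ` sphere 0 1)"
 proof (rule bdd_aboveI2)
  fix u :: 'd assume "u \<in> sphere 0 1"
  then show "\<bar>f u - g u\<bar> \<le> sqrt Lam"
   using Fclass_bounds[OF f, of u] Fclass_bounds[OF g, of u] by simp
 qed
 then have "\<bar>f (p /\<^sub>R norm p) - g (p /\<^sub>R norm p)\<bar> \<le> supdist f g"
  unfolding supdist_def by (rule cSUP_upper[OF pf(2)])
 then have "norm p * \<bar>f (p /\<^sub>R norm p) - g (p /\<^sub>R norm p)\<bar> \<le> norm p * supdist f g"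
  by (rule mult_left_mono) simp
 moreover have "\<bar>f p - g p\<bar> = norm p * \<bar>f (p /\<^sub>R norm p) - g (p /\<^sub>R norm p)\<bar>"
  by (simp only: pf(1) pg(1) right_diff_distrib[symmetric] abs_mult abs_norm_cancel)
 ultimately show ?thesis by simp
qed (simp add: Fclass_0[OF f] Fclass_0[OF g])

text \<open>By homogeneity the value at p varies by at most norm p times the sup distance on the
  sphere, so strict superlevel sets of the evaluation are open.\<close>

lemma eval_measurable: "(\<lambda>\<psi>. \<psi> (p::'d)) \<in> borel_measurable (Fmeas lam Lam)"
proof (rule borel_measurable_iff_greater[THEN iffD2], rule allI)
 fix c :: real
 let ?U = "{\<psi> \<in> Fclass lam Lam. c < \<psi> p}"
 have "?U \<in> Fopen lam Lam" unfolding Fopen_def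
 proof (intro CollectI conjI ballI)
  fix f assume f: "f \<in> ?U"
  show "\<exists>\<epsilon>>0. \<forall>g\<in>Fclass lam Lam. supdist f g < \<epsilon> \<longrightarrow> g \<in> ?U"
  proof (intro exI[of _ "(f p - c) / (norm p + 1)"] conjI ballI impI)
   show "0 < (f p - c) / (norm p + 1)" using f by (intro divide_pos_pos) (auto intro: add_nonneg_pos)
   fix g assume g: "g \<in> Fclass lam Lam" "supdist f g < (f p - c) / (norm p + 1)"
   have "\<bar>f p - g p\<bar> \<le> norm p * supdist f g" using f g by (intro Fclass_diff_le) auto
   also have "\<dots> \<le> norm p * ((f p - c) / (norm p + 1))" using g(2) by (intro mult_left_mono) auto
   also have "\<dots> < f p - c"
   proof -
    have "0 < norm p + 1" by (intro add_nonneg_pos) auto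
    then show ?thesis using f by (simp add: pos_divide_less_eq distrib_left mult.commute)
   qed
   finally show "g \<in> ?U" using g(1) by auto
  qed
 qed auto
 then show "{w \<in> space (Fmeas lam Lam). c < w p} \<in> sets (Fmeas lam Lam)"
  unfolding space_Fmeas sets_Fmeas by (rule sigma_sets.Basic)
qed

text \<open>A Caratheodory function: measurable in the position and the medium for fixed p, and
  continuous in p by convexity. Approximating p by simple functions gives joint
  measurability.\<close>

lemma Phi_joint: "(\<lambda>((x, p), \<omega>). \<Phi> (\<tau> x \<omega>) p) \<in> borel_measurable ((borel \<Otimes>\<^sub>M borel) \<Otimes>\<^sub>M M)"
proof -
 obtain F :: "nat \<Rightarrow> 'd \<Rightarrow> 'd" where F: "\<And>i. simple_function borel (F i)" "\<And>p. (\<lambda>i. F i p) \<longlonglongrightarrow> p"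
  using borel_measurable_implies_sequence_metric[of "\<lambda>p::'d. p" borel 0] by auto
 have fixp: "(\<lambda>((x, p), \<omega>). \<Phi> (\<tau> x \<omega>) p0) \<in> borel_measurable ((borel \<Otimes>\<^sub>M (borel :: 'd measure)) \<Otimes>\<^sub>M M)" for p0
 proof -
  have 1: "(\<lambda>z. (fst (fst z), snd z)) \<in> ((borel :: 'd measure) \<Otimes>\<^sub>M (borel :: 'd measure)) \<Otimes>\<^sub>M M \<rightarrow>\<^sub>M borel \<Otimes>\<^sub>M M" by measurable
  from measurable_compose[OF measurable_compose[OF measurable_compose[OF 1 tau_meas] Phi_meas] eval_measurable, of p0]
  show ?thesis by (simp add: case_prod_unfold)
 qed
 have Fi: "(\<lambda>((x, p), \<omega>). \<Phi> (\<tau> x \<omega>) (F i p)) \<in> borel_measurable ((borel \<Otimes>\<^sub>M borel) \<Otimes>\<^sub>M M)" for i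
 proof -
  have cs: "F i \<in> borel \<rightarrow>\<^sub>M count_space (range (F i))"
   using F(1)[of i] unfolding simple_function_def by (subst measurable_count_space_eq2) auto
  have g: "(\<lambda>z. F i (snd (fst z))) \<in> ((borel :: 'd measure) \<Otimes>\<^sub>M borel) \<Otimes>\<^sub>M M \<rightarrow>\<^sub>M count_space (range (F i))"
   by (rule measurable_compose[OF _ cs]) measurable
  have "(\<lambda>z. (\<lambda>p0 z. (\<lambda>((x, p), \<omega>). \<Phi> (\<tau> x \<omega>) p0) z) (F i (snd (fst z))) z) \<in> borel_measurable ((borel \<Otimes>\<^sub>M borel) \<Otimes>\<^sub>M M)"
   by (rule measurable_compose_countable'[OF _ g])
     (use fixp F(1)[of i] in \<open>auto simp: simple_function_def countable_finite\<close>)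
  then show ?thesis by (simp add: case_prod_unfold)
 qed
 show ?thesis
 proof (rule borel_measurable_LIMSEQ_metric[OF Fi])
  fix z assume "z \<in> space (((borel :: 'd measure) \<Otimes>\<^sub>M (borel :: 'd measure)) \<Otimes>\<^sub>M M)"
  then obtain x p \<omega> where z: "z = ((x, p), \<omega>)" "\<omega> \<in> space M" by (auto simp: space_pair_measure)
  have "\<Phi> (\<tau> x \<omega>) \<in> Fclass lam Lam" by (rule Phi_class[OF tau_space[OF z(2)]])
  then have "convex_on UNIV (\<Phi> (\<tau> x \<omega>))" by (simp add: Fclass_def)
  then have "continuous_on UNIV (\<Phi> (\<tau> x \<omega>))" by (intro convex_on_continuous) auto
  then have "isCont (\<Phi> (\<tau> x \<omega>)) p" by (simp add: continuous_on_eq_continuous_at)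
  from isCont_tendsto_compose[OF this F(2)]
  show "(\<lambda>i. (\<lambda>((x, p), \<omega>). \<Phi> (\<tau> x \<omega>) (F i p)) z) \<longlonglongrightarrow> (\<lambda>((x, p), \<omega>). \<Phi> (\<tau> x \<omega>) p) z" by (simp add: z)
 qed
qed

text \<open>Nothing is known of W outside [-1, 1]. Clamping the argument gives a function that is
  continuous and bounded on the whole line and agrees with W on all admissible values.\<close>

definition Wc :: "real \<Rightarrow> real" where "Wc s = W (max (-1) (min 1 s))"

lemma Wc_eq: "s \<in> {-1..1} \<Longrightarrow> Wc s = W s" by (simp add: Wc_def)

lemma Wc_nonneg: "0 \<le> Wc s" unfolding Wc_def by (rule W_nonneg) auto

lemma Wc_continuous: "continuous_on UNIV Wc"
 unfolding Wc_def[abs_def] by (rule continuous_on_compose2[OF W_cont]) (auto intro!: continuous_intros)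

lemma Wc_measurable [measurable]: "Wc \<in> borel_measurable borel"
 by (rule borel_measurable_continuous_onI[OF Wc_continuous])

lemma Wc_bounded: "\<exists>C\<ge>0. \<forall>s. Wc s \<le> C"
proof -
 have "compact (W ` {-1..1})" by (intro compact_continuous_image W_cont) auto
 then obtain C where C: "\<forall>y\<in>W ` {-1..1}. norm y \<le> C" using compact_imp_bounded bounded_iff by metis
 show ?thesis
 proof (intro exI[of _ "max 0 C"] conjI allI)
  fix s :: real
  have "max (-1) (min 1 s) \<in> {-1..1}" by auto
  then have "norm (Wc s) \<le> C" using C unfolding Wc_def by blast
  then show "Wc s \<le> max 0 C" by auto
 qed simp
qed

text \<open>Bounds the energy density of the planar competitor.\<close>

definition f0 :: "real \<Rightarrow> real" where "f0 t = Lam / 2 * (deriv q t)\<^sup>2 + Wc (q t)"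

lemma f0_nonneg: "0 \<le> f0 t" unfolding f0_def using Lam_pos Wc_nonneg by (intro add_nonneg_nonneg) auto

lemma q_measurable [measurable]: "q \<in> borel_measurable borel" "deriv q \<in> borel_measurable borel"
 using smooth_fn_borel_measurable[OF q_smooth] smooth_fn_borel_measurable[OF smooth_fn_deriv[OF q_smooth]] .

lemma f0_measurable [measurable]: "f0 \<in> borel_measurable borel"
 unfolding f0_def[abs_def] by measurable

lemma f0_finite: "(\<integral>\<^sup>+t. ennreal (f0 t) \<partial>lborel) < \<infinity>"
 using q_energy q_range unfolding f0_def by (simp add: Wc_eq)

section \<open>Planar energy, admissible competitors and minimal energies\<close>

definition V :: "'d set \<Rightarrow> ennreal" where "V A = (\<integral>\<^sup>+x. ennreal (indicator A x * f0 (x \<bullet> e)) \<partial>lborel)"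

lemma qe_smooth: "smooth_fn (\<lambda>x. qe x)"
 by (rule smooth_fn_comp[OF q_smooth smooth_fn_inner])

lemma qe_grad: "grad_fn (\<lambda>x. qe x) x = dqe x *\<^sub>R e"
proof (rule grad_fn_eqI)
 have 1: "((\<lambda>x. x \<bullet> e) has_derivative (\<lambda>v. v \<bullet> e)) (at x)" by (auto intro!: derivative_eq_intros)
 have 2: "(q has_derivative (*) (dqe x)) (at (x \<bullet> e))"
  using smooth_fn_has_real_derivative[OF q_smooth] by (simp add: has_field_derivative_def)
 show "((\<lambda>x. qe x) has_derivative (\<bullet>) (dqe x *\<^sub>R e)) (at x)"
  using has_derivative_compose[OF 1 2] by (rule has_derivative_eq_rhs) (simp add: fun_eq_iff inner_commute)
qed

text \<open>Competitors are stored as their difference to the planar profile. The boundary condition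
  becomes membership in \<open>H10\<close>, and gluing becomes a sum of extensions by zero.\<close>

definition Adm :: "'d set \<Rightarrow> (('d \<Rightarrow> real) \<times> ('d \<Rightarrow> 'd)) set" where
 "Adm D = {(w, G). H10 D w G \<and> (\<forall>x\<in>D. -1 \<le> qe x + w x \<and> qe x + w x \<le> 1)}"

definition dens :: "'w \<Rightarrow> 'd set \<Rightarrow> ('d \<Rightarrow> real) \<Rightarrow> ('d \<Rightarrow> 'd) \<Rightarrow> 'd \<Rightarrow> real" where
 "dens \<omega> D u G x = indicator D x * (1 / 2 * (\<Phi> (\<tau> x \<omega>) (G x))\<^sup>2 + W (u x))"

definition ener :: "'w \<Rightarrow> 'd set \<Rightarrow> ('d \<Rightarrow> real) \<Rightarrow> ('d \<Rightarrow> 'd) \<Rightarrow> ennreal" where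
 "ener \<omega> D w G = energy \<Phi> \<tau> W \<omega> D (\<lambda>x. qe x + w x) (\<lambda>x. dqe x *\<^sub>R e + G x)"

lemma energy_dens: "energy \<Phi> \<tau> W \<omega> D u G = (\<integral>\<^sup>+x. ennreal (dens \<omega> D u G x) \<partial>lebesgue)"
 by (simp add: energy_def dens_def)

definition mE :: "'w \<Rightarrow> 'd set \<Rightarrow> ennreal" where
 "mE \<omega> D = (INF (w, G)\<in>Adm D. ener \<omega> D w G)"

lemma dens_measurable:
 assumes w: "\<omega> \<in> space M" and D: "open D" and m: "measH D u G" and r: "\<And>x. x \<in> D \<Longrightarrow> u x \<in> {-1..1}"
 shows "dens \<omega> D u G \<in> borel_measurable lebesgue"
proof -
 let ?u = "\<lambda>x. indicator D x * u x" and ?G = "\<lambda>x. indicator D x *\<^sub>R G x"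
 have [measurable]: "?u \<in> borel_measurable lebesgue" "?G \<in> borel_measurable lebesgue"
  using m by (auto simp: measH_def)
 have [measurable]: "D \<in> sets lebesgue" using D by (simp add: borel_open)
 have id: "(\<lambda>x. x) \<in> lebesgue \<rightarrow>\<^sub>M (borel :: 'd measure)" by (rule measurable_completion) simp
 have "(\<lambda>x. ((x, ?G x), \<omega>)) \<in> lebesgue \<rightarrow>\<^sub>M (borel \<Otimes>\<^sub>M borel) \<Otimes>\<^sub>M M"
  using w id by (intro measurable_Pair measurable_const) auto
 from measurable_compose[OF this Phi_joint]
 have [measurable]: "(\<lambda>x. \<Phi> (\<tau> x \<omega>) (?G x)) \<in> borel_measurable lebesgue" by simp
 have "dens \<omega> D u G = (\<lambda>x. indicator D x * (1 / 2 * (\<Phi> (\<tau> x \<omega>) (?G x))\<^sup>2 + Wc (?u x)))"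
 proof
  fix x
  show "dens \<omega> D u G x = indicator D x * (1 / 2 * (\<Phi> (\<tau> x \<omega>) (?G x))\<^sup>2 + Wc (?u x))"
   using Wc_eq[OF r[of x]] by (cases "x \<in> D") (simp_all add: dens_def)
 qed
 then show ?thesis by simp
qed

lemma qe_measH: "open D \<Longrightarrow> measH D (\<lambda>x. qe x) (\<lambda>x. dqe x *\<^sub>R e)"
 using measH_smooth[OF _ qe_smooth, of D] unfolding qe_grad[abs_def] by (simp add: borel_open)

lemma AdmD:
 assumes "open D" "(w, G) \<in> Adm D"
 shows "H10 D w G" "measH D (\<lambda>x. qe x + w x) (\<lambda>x. dqe x *\<^sub>R e + G x)"
  "\<And>x. x \<in> D \<Longrightarrow> qe x + w x \<in> {-1..1}"
 using assms H10D(1)[OF assms(1)] by (auto simp: Adm_def intro!: measH_add qe_measH)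

lemma Adm_dens_measurable:
 assumes "\<omega> \<in> space M" "open D" "(w, G) \<in> Adm D"
 shows "dens \<omega> D (\<lambda>x. qe x + w x) (\<lambda>x. dqe x *\<^sub>R e + G x) \<in> borel_measurable lebesgue"
 by (rule dens_measurable[OF assms(1,2) AdmD(2)[OF assms(2,3)] AdmD(3)[OF assms(2,3)]])

lemma dens_nonneg: "(\<And>x. x \<in> D \<Longrightarrow> u x \<in> {-1..1}) \<Longrightarrow> 0 \<le> dens \<omega> D u G x"
 unfolding dens_def using W_nonneg by (cases "x \<in> D") auto

lemma Phi_sq_le:
 assumes "\<omega> \<in> space M"
 shows "1 / 2 * (\<Phi> (\<tau> x \<omega>) p)\<^sup>2 \<le> Lam / 2 * (norm p)\<^sup>2"
proof -
 note b = Fclass_bounds[OF Phi_class[OF tau_space[OF assms]], of x p]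
 have "(\<Phi> (\<tau> x \<omega>) p)\<^sup>2 \<le> (sqrt Lam * norm p)\<^sup>2" using b by (intro power_mono) auto
 also have "\<dots> = Lam * (norm p)\<^sup>2" using Lam_pos by (simp add: power_mult_distrib)
 finally show ?thesis by simp
qed

lemma dens_q_le:
 assumes "\<omega> \<in> space M"
 shows "1 / 2 * (\<Phi> (\<tau> x \<omega>) (deriv q t *\<^sub>R e))\<^sup>2 + W (q t) \<le> f0 t"
 using Phi_sq_le[OF assms, of x "deriv q t *\<^sub>R e"] norm_e q_range[of t] by (simp add: f0_def Wc_eq)

lemma ener_lower: "(w, G) \<in> Adm D \<Longrightarrow> mE \<omega> D \<le> ener \<omega> D w G"
 unfolding mE_def by (rule INF_lower2[of "(w, G)"]) auto

lemma V_eq_lebesgue: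
 "V A = (\<integral>\<^sup>+x. ennreal (indicator A x * f0 (x \<bullet> e)) \<partial>lebesgue)"
 by (simp add: V_def nn_integral_completion)

section \<open>Subadditivity and stationarity of the minimal energy\<close>

lemma sum_indicator_disjoint:
 assumes "finite I" "disjoint_family_on D I" "i \<in> I" "x \<in> D i"
 shows "(\<Sum>j\<in>I. indicator (D j) x *\<^sub>R f j) = (f i :: 'b::real_vector)"
proof -
 have "(\<Sum>j\<in>I. indicator (D j) x *\<^sub>R f j) = (\<Sum>j\<in>I. if j = i then f i else 0)"
  using assms unfolding disjoint_family_on_def by (intro sum.cong refl) (auto simp: indicator_def)
 then show ?thesis using assms by simp
qed

lemma H10_glue:
 assumes "finite I" "open D" "\<And>i. i \<in> I \<Longrightarrow> open (Di i)" "\<And>i. i \<in> I \<Longrightarrow> Di i \<subseteq> D"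
  "\<And>i. i \<in> I \<Longrightarrow> H10 (Di i) (w i) (G i)"
 shows "H10 D (\<lambda>x. \<Sum>i\<in>I. indicator (Di i) x *\<^sub>R w i x) (\<lambda>x. \<Sum>i\<in>I. indicator (Di i) x *\<^sub>R G i x)"
 using assms(1,3-5)
proof (induction I rule: finite_induct)
 case empty
 then show ?case using H10_zero[OF assms(2)] by simp
next
 case (insert i I)
 have 1: "H10 D (\<lambda>x. indicator (Di i) x * w i x) (\<lambda>x. indicator (Di i) x *\<^sub>R G i x)"
  using insert.prems by (intro H10_extend assms(2)) auto
 have 2: "H10 D (\<lambda>x. \<Sum>i\<in>I. indicator (Di i) x *\<^sub>R w i x) (\<lambda>x. \<Sum>i\<in>I. indicator (Di i) x *\<^sub>R G i x)"
  using insert.prems by (intro insert.IH) auto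
 show ?case using H10_add[OF assms(2) 1 2] by (simp only: sum.insert[OF insert.hyps] real_scaleR_def)
qed

text \<open>Near-minimisers on the pieces all agree with the planar profile on the boundaries, so
  their differences to it can be extended by zero and added without interfacial energy. On the
  uncovered part the sum is the planar profile, whose energy is at most \<open>V\<close>.\<close>

lemma mE_subadd:
 assumes w: "\<omega> \<in> space M" and I: "finite I" and D: "open D" and Di: "\<And>i. i \<in> I \<Longrightarrow> open (Di i)"
  "\<And>i. i \<in> I \<Longrightarrow> Di i \<subseteq> D" and disj: "disjoint_family_on Di I"
 shows "mE \<omega> D \<le> (\<Sum>i\<in>I. mE \<omega> (Di i)) + V (D - (\<Union>i\<in>I. Di i))"
proof (cases "(\<Sum>i\<in>I. mE \<omega> (Di i)) = \<top>")
 case False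
 then have fin: "mE \<omega> (Di i) < \<top>" if "i \<in> I" for i
  using that I by (auto simp: less_top)
 let ?R = "D - (\<Union>i\<in>I. Di i)"
 have Rm: "?R \<in> sets borel" using D Di I by (intro sets.Diff sets.finite_UN) (auto intro: borel_open)
 show ?thesis
 proof (rule ennreal_le_epsilon)
  fix \<epsilon> :: real assume eps: "0 < \<epsilon>"
  \<comment> \<open>The summand 1 keeps this positive for an empty family.\<close>
  define \<delta> where "\<delta> = \<epsilon> / (card I + 1)"
  have d0: "0 < \<delta>" using eps by (simp add: \<delta>_def)
  have "\<exists>p. p \<in> Adm (Di i) \<and> ener \<omega> (Di i) (fst p) (snd p) \<le> mE \<omega> (Di i) + ennreal \<delta>" if i: "i \<in> I" for i
  proof -
   obtain r where r: "0 \<le> r" "mE \<omega> (Di i) = ennreal r" using fin[OF i] by (cases "mE \<omega> (Di i)") auto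
   have "ennreal r < ennreal (r + \<delta>)" using r(1) d0 by (intro ennreal_lessI) auto
   then have "mE \<omega> (Di i) < mE \<omega> (Di i) + ennreal \<delta>" using r d0 by (simp add: ennreal_plus)
   then obtain p where p: "p \<in> Adm (Di i)" "(case p of (w, G) \<Rightarrow> ener \<omega> (Di i) w G) < mE \<omega> (Di i) + ennreal \<delta>"
    unfolding mE_def INF_less_iff by (elim bexE)
   then show ?thesis by (intro exI[of _ p]) (simp add: case_prod_unfold less_imp_le)
  qed
  then obtain p where p: "\<And>i. i \<in> I \<Longrightarrow> p i \<in> Adm (Di i)"
   "\<And>i. i \<in> I \<Longrightarrow> ener \<omega> (Di i) (fst (p i)) (snd (p i)) \<le> mE \<omega> (Di i) + ennreal \<delta>" by metis
  define u where "u = (\<lambda>x. \<Sum>i\<in>I. indicator (Di i) x *\<^sub>R fst (p i) x)"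
  define G where "G = (\<lambda>x. \<Sum>i\<in>I. indicator (Di i) x *\<^sub>R snd (p i) x)"
  have ui: "u x = fst (p i) x" "G x = snd (p i) x" if "i \<in> I" "x \<in> Di i" for i x
   unfolding u_def G_def using sum_indicator_disjoint[OF I disj that, of "\<lambda>i. fst (p i) x"]
    sum_indicator_disjoint[OF I disj that, of "\<lambda>i. snd (p i) x"] by (simp_all only:)
  have u0: "u x = 0" "G x = 0" if "x \<notin> (\<Union>i\<in>I. Di i)" for x
   using that unfolding u_def G_def by (auto intro!: sum.neutral)
  have pA: "(fst (p i), snd (p i)) \<in> Adm (Di i)" if "i \<in> I" for i using p(1)[OF that] by simp
  have adm: "(u, G) \<in> Adm D" unfolding Adm_def
  proof (intro CollectI case_prodI conjI ballI)
   show "H10 D u G" unfolding u_def G_def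
    using AdmD(1)[OF Di(1) pA] by (intro H10_glue I D Di) auto
   fix x
   have "qe x + u x \<in> {-1..1}"
   proof (cases "x \<in> (\<Union>i\<in>I. Di i)")
    case True
    then obtain i where "i \<in> I" "x \<in> Di i" by blast
    then show ?thesis using AdmD(3)[OF Di(1) pA] ui by simp
   next
    case False
    then show ?thesis using u0 q_range by simp
   qed
   then show "-1 \<le> qe x + u x" "qe x + u x \<le> 1" by auto
  qed
  let ?d = "\<lambda>i. dens \<omega> (Di i) (\<lambda>x. qe x + fst (p i) x) (\<lambda>x. dqe x *\<^sub>R e + snd (p i) x)"
  have dm: "?d i \<in> borel_measurable lebesgue" if "i \<in> I" for i
   by (rule Adm_dens_measurable[OF w Di(1)[OF that] pA[OF that]])
  have "mE \<omega> D \<le> ener \<omega> D u G" by (rule ener_lower[OF adm])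
  also have "\<dots> \<le> (\<integral>\<^sup>+x. (\<Sum>i\<in>I. ennreal (?d i x)) + ennreal (indicator ?R x * f0 (x \<bullet> e)) \<partial>lebesgue)"
   unfolding ener_def energy_dens
  proof (rule nn_integral_mono)
   fix x
   show "ennreal (dens \<omega> D (\<lambda>x. qe x + u x) (\<lambda>x. dqe x *\<^sub>R e + G x) x)
    \<le> (\<Sum>i\<in>I. ennreal (?d i x)) + ennreal (indicator ?R x * f0 (x \<bullet> e))"
   proof (cases "x \<in> (\<Union>i\<in>I. Di i)")
    case True
    then obtain i where i: "i \<in> I" "x \<in> Di i" by blast
    then have "x \<in> D" using Di(2) by blast
    then have eq: "dens \<omega> D (\<lambda>x. qe x + u x) (\<lambda>x. dqe x *\<^sub>R e + G x) x = ?d i x"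
     using i ui by (simp add: dens_def)
    have "ennreal (?d i x) \<le> (\<Sum>i\<in>I. ennreal (?d i x))"
     by (rule member_le_sum[OF i(1) _ I]) simp
    then show ?thesis unfolding eq by (rule add_increasing2[rotated]) simp
   next
    case False
    have "dens \<omega> D (\<lambda>x. qe x + u x) (\<lambda>x. dqe x *\<^sub>R e + G x) x \<le> indicator ?R x * f0 (x \<bullet> e)"
     using False u0[OF False] dens_q_le[OF w, of x "x \<bullet> e"] by (cases "x \<in> D") (simp_all add: dens_def)
    then have "ennreal (dens \<omega> D (\<lambda>x. qe x + u x) (\<lambda>x. dqe x *\<^sub>R e + G x) x) \<le> ennreal (indicator ?R x * f0 (x \<bullet> e))"
     by (rule ennreal_leI)
    then show ?thesis by (rule add_increasing[rotated]) simp
   qed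
  qed
  also have "\<dots> = (\<integral>\<^sup>+x. (\<Sum>i\<in>I. ennreal (?d i x)) \<partial>lebesgue) + V ?R"
   unfolding V_eq_lebesgue
  proof (rule nn_integral_add)
   show "(\<lambda>x. \<Sum>i\<in>I. ennreal (?d i x)) \<in> borel_measurable lebesgue"
    using dm by (intro borel_measurable_sum) auto
   have "(\<lambda>x. ennreal (indicator ?R x * f0 (x \<bullet> e))) \<in> borel_measurable borel" using Rm by measurable
   then show "(\<lambda>x. ennreal (indicator ?R x * f0 (x \<bullet> e))) \<in> borel_measurable lebesgue"
    by (intro measurable_completion) simp
  qed
  also have "(\<integral>\<^sup>+x. (\<Sum>i\<in>I. ennreal (?d i x)) \<partial>lebesgue) = (\<Sum>i\<in>I. ener \<omega> (Di i) (fst (p i)) (snd (p i)))"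
   unfolding ener_def energy_dens using dm by (intro nn_integral_sum) auto
  also have "\<dots> \<le> (\<Sum>i\<in>I. mE \<omega> (Di i) + ennreal \<delta>)" using p(2) by (rule sum_mono)
  also have "\<dots> = (\<Sum>i\<in>I. mE \<omega> (Di i)) + of_nat (card I) * ennreal \<delta>" by (simp add: sum.distrib)
  also have "of_nat (card I) * ennreal \<delta> \<le> ennreal \<epsilon>"
  proof -
   have "of_nat (card I) * ennreal \<delta> = ennreal (real (card I) * \<delta>)"
    using d0 by (simp add: ennreal_of_nat_eq_real_of_nat ennreal_mult')
   also have "\<dots> \<le> ennreal \<epsilon>" using eps by (intro ennreal_leI) (simp add: \<delta>_def field_simps)
   finally show ?thesis .
  qed
  finally show "mE \<omega> D \<le> (\<Sum>i\<in>I. mE \<omega> (Di i)) + V ?R + ennreal \<epsilon>"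
   by (simp add: ac_simps add_mono)
 qed
qed simp


text \<open>A shift orthogonal to \<open>e\<close> does not change the planar profile, so translated
  competitors are admissible in the translated medium. The reverse inequality follows from the
  inverse shift.\<close>

lemma mE_translate_le:
 assumes w: "\<omega> \<in> space M" and y: "y \<bullet> e = 0" and D: "open D"
 shows "mE (\<tau> y \<omega>) {x. x + y \<in> D} \<le> mE \<omega> D"
 unfolding mE_def[of \<omega> D]
proof (rule INF_greatest, clarify)
 fix v G assume a: "(v, G) \<in> Adm D"
 let ?D = "{x. x + y \<in> D}"
 have "(\<lambda>x. v (x + y), \<lambda>x. G (x + y)) \<in> Adm ?D"
  unfolding Adm_def
 proof (intro CollectI case_prodI conjI ballI)
  show "H10 ?D (\<lambda>x. v (x + y)) (\<lambda>x. G (x + y))" by (rule H10_translate[OF D AdmD(1)[OF D a]])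
  fix x assume "x \<in> ?D"
  then have "q ((x + y) \<bullet> e) + v (x + y) \<in> {-1..1}" by (intro AdmD(3)[OF D a]) simp
  then show "-1 \<le> qe x + v (x + y)" "qe x + v (x + y) \<le> 1" using y by (simp_all add: inner_add_left)
 qed
 then have "mE (\<tau> y \<omega>) ?D \<le> ener (\<tau> y \<omega>) ?D (\<lambda>x. v (x + y)) (\<lambda>x. G (x + y))" by (rule ener_lower)
 also have "\<dots> = ener \<omega> D v G"
 proof -
  let ?d = "dens \<omega> D (\<lambda>x. qe x + v x) (\<lambda>x. dqe x *\<^sub>R e + G x)"
  have "(\<lambda>x. ennreal (?d x)) \<in> borel_measurable lebesgue" using Adm_dens_measurable[OF w D a] by measurable
  from nn_integral_lebesgue_translate[OF this, of y]
  have "(\<integral>\<^sup>+x. ennreal (?d (x + y)) \<partial>lebesgue) = ener \<omega> D v G" by (simp add: ener_def energy_dens)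
  moreover have "dens (\<tau> y \<omega>) ?D (\<lambda>x. qe x + v (x + y)) (\<lambda>x. dqe x *\<^sub>R e + G (x + y)) x = ?d (x + y)" for x
   using y tau_add[OF w, of x y] by (simp add: dens_def inner_add_left indicator_def)
  ultimately show ?thesis by (simp add: ener_def energy_dens)
 qed
 finally show "mE (\<tau> y \<omega>) ?D \<le> ener \<omega> D v G" .
qed

lemma dom_translate: "y \<bullet> e = 0 \<Longrightarrow> {x. x + y \<in> dom y' \<rho> H} = dom (y' - y) \<rho> H"
 by (simp add: dom_def inner_add_left inner_diff_left algebra_simps)

lemma mE_translate:
 assumes w: "\<omega> \<in> space M" and y: "y \<bullet> e = 0" and H: "open H"
 shows "mE (\<tau> y \<omega>) (dom 0 \<rho> H) = mE \<omega> (dom y \<rho> H)"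
proof (rule antisym)
 show "mE (\<tau> y \<omega>) (dom 0 \<rho> H) \<le> mE \<omega> (dom y \<rho> H)"
  using mE_translate_le[OF w y open_dom[OF H, of y \<rho>]] dom_translate[OF y, of y \<rho> H] by simp
 have y': "(- y) \<bullet> e = 0" using y by simp
 have "\<tau> (- y) (\<tau> y \<omega>) = \<omega>" using tau_add[OF w, of "- y" y] tau_0[OF w] by simp
 then show "mE \<omega> (dom y \<rho> H) \<le> mE (\<tau> y \<omega>) (dom 0 \<rho> H)"
  using mE_translate_le[OF tau_space[OF w] y' open_dom[OF H, of 0 \<rho>], of y] dom_translate[OF y', of 0 \<rho> H] by simp
qed

lemma mE_le_V:
 assumes "\<omega> \<in> space M" "open D"
 shows "mE \<omega> D \<le> V D"
 using mE_subadd[OF assms(1) _ assms(2), of "{} :: nat set" "\<lambda>_. {}"] by (simp add: disjoint_family_on_def)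

section \<open>Energy of the planar profile on cylinders\<close>

lemma cube_e: "x + t *\<^sub>R e \<in> cube y \<rho> \<longleftrightarrow> x \<in> cube y \<rho>"
 by (simp add: cube_def inner_add_left inner_diff_left eB)

lemma dom_borel [measurable]: "H \<in> sets borel \<Longrightarrow> dom y \<rho> H \<in> sets borel"
proof -
 assume "H \<in> sets borel"
 then have "(\<lambda>x. x \<bullet> e) -` H \<inter> space borel \<in> sets borel" by (intro measurable_sets[of _ borel borel]) auto
 then show ?thesis unfolding dom_cube by (intro sets.Int cube_borel) (simp add: vimage_def)
qed

lemma cvol_cube_shift: "y \<bullet> e = 0 \<Longrightarrow> cvol (cube y \<rho>) = cvol (cube 0 \<rho>)"
proof -
 assume y: "y \<bullet> e = 0"
 have "{x. x + y \<in> cube y \<rho>} = cube 0 \<rho>" by (simp add: cube_def)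
 then show ?thesis using cvol_translate[OF cube_borel y, of y \<rho>] by simp
qed

definition qmass :: "real set \<Rightarrow> ennreal" where
 "qmass H = (\<integral>\<^sup>+t. ennreal (f0 t) * indicator H t \<partial>lborel)"

lemma qmass_mono: "H \<subseteq> H' \<Longrightarrow> qmass H \<le> qmass H'"
 unfolding qmass_def by (intro nn_integral_mono mult_left_mono) (auto simp: indicator_def)

lemma qmass_finite: "qmass H < \<infinity>"
proof -
 have "qmass H \<le> (\<integral>\<^sup>+t. ennreal (f0 t) \<partial>lborel)"
  unfolding qmass_def by (intro nn_integral_mono) (auto simp: indicator_def)
 then show ?thesis using f0_finite by (rule order_le_less_trans)
qed

lemma V_cylinder:
 assumes U: "U \<in> sets borel" "\<And>x t. x + t *\<^sub>R e \<in> U \<longleftrightarrow> x \<in> U" and H: "H \<in> sets borel"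
 shows "V (U \<inter> {x. x \<bullet> e \<in> H}) = cvol U * qmass H"
proof -
 have [measurable]: "H \<in> sets borel" by (rule H)
 have "V (U \<inter> {x. x \<bullet> e \<in> H}) = (\<integral>\<^sup>+x. indicator U x * (ennreal (f0 (x \<bullet> e + 0)) * indicator H (x \<bullet> e + 0)) \<partial>lborel)"
  unfolding V_def by (intro nn_integral_cong) (auto simp: indicator_def)
 also have "\<dots> = cvol U * qmass H"
  unfolding cvol_def qmass_def
  by (rule nn_integral_cylinder[where g="\<lambda>_. 0" and F="\<lambda>t. ennreal (f0 t) * indicator H t"]) (use U in auto)
 finally show ?thesis .
qed

lemma V_dom: "H \<in> sets borel \<Longrightarrow> y \<bullet> e = 0 \<Longrightarrow> V (dom y \<rho> H) = cvol (cube 0 \<rho>) * qmass H"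
 unfolding dom_cube by (subst V_cylinder[OF cube_borel cube_e], assumption) (simp only: cvol_cube_shift)

lemma V_dom_finite: "V (dom 0 \<rho> H) < \<infinity>"
proof -
 have "V (dom 0 \<rho> H) \<le> V (dom 0 \<rho> UNIV)"
  unfolding V_def by (intro nn_integral_mono ennreal_leI mult_right_mono f0_nonneg) (auto simp: indicator_def dom_def)
 also have "\<dots> < \<infinity>" using cvol_cube_finite[of \<rho>] qmass_finite[of UNIV] by (simp add: V_dom ennreal_mult_less_top)
 finally show ?thesis .
qed

text \<open>The price c of the subadditive process for cylinders with height set H: planar energy
  per unit of lattice volume of the cross-section.\<close>

definition cH :: "real set \<Rightarrow> real" where "cH H = enn2real (cvol1 * qmass H)"

lemma cH: "ennreal (cH H) = cvol1 * qmass H" "0 \<le> cH H"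
 unfolding cH_def using cvol1_finite qmass_finite[of H] by (auto simp: ennreal_mult_less_top)

lemma V_dom_nat:
 "H \<in> sets borel \<Longrightarrow> y \<bullet> e = 0 \<Longrightarrow> V (dom y (real N) H) = ennreal (cH H * (2 * real N) ^ card B)"
proof -
 assume a: "H \<in> sets borel" "y \<bullet> e = 0"
 have "V (dom y (real N) H) = ennreal (real (2 * N) ^ card B) * (cvol1 * qmass H)"
  using V_dom[OF a] cvol_cube_nat[of N] by (simp add: mult.assoc)
 also have "\<dots> = ennreal (real (2 * N) ^ card B) * ennreal (cH H)" by (simp add: cH(1))
 also have "\<dots> = ennreal (real (2 * N) ^ card B * cH H)" by (rule ennreal_mult[symmetric]) (auto simp: cH(2))
 finally show ?thesis by (simp add: mult.commute)
qed

lemma V_Un: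
 assumes "A \<in> sets borel" "C \<in> sets borel" "A \<inter> C = {}"
 shows "V (A \<union> C) = V A + V C"
proof -
 have [measurable]: "A \<in> sets borel" "C \<in> sets borel" by fact+
 have "V (A \<union> C) = (\<integral>\<^sup>+x. ennreal (indicator A x * f0 (x \<bullet> e)) + ennreal (indicator C x * f0 (x \<bullet> e)) \<partial>lborel)"
  unfolding V_def
 proof (rule nn_integral_cong)
  fix x
  show "ennreal (indicator (A \<union> C) x * f0 (x \<bullet> e)) = ennreal (indicator A x * f0 (x \<bullet> e)) + ennreal (indicator C x * f0 (x \<bullet> e))"
   using assms(3) by (cases "x \<in> A"; cases "x \<in> C") auto
 qed
 also have "\<dots> = V A + V C" unfolding V_def by (rule nn_integral_add) measurable
 finally show ?thesis .
qed

lemma V_UN: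
 assumes "finite I" "\<And>i. i \<in> I \<Longrightarrow> Di i \<in> sets borel" "disjoint_family_on Di I"
 shows "V (\<Union>i\<in>I. Di i) = (\<Sum>i\<in>I. V (Di i))"
 using assms
proof (induction I rule: finite_induct)
 case empty
 then show ?case by (simp add: V_def)
next
 case (insert i I)
 have "V (Di i \<union> (\<Union>i\<in>I. Di i)) = V (Di i) + V (\<Union>i\<in>I. Di i)"
 proof (rule V_Un)
  show "(\<Union>i\<in>I. Di i) \<in> sets borel" using insert by (intro sets.finite_UN) auto
  show "Di i \<inter> (\<Union>i\<in>I. Di i) = {}" using insert.prems(2) insert.hyps by (auto simp: disjoint_family_on_def)
 qed (use insert in auto)
 moreover have "V (\<Union>i\<in>I. Di i) = (\<Sum>i\<in>I. V (Di i))"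
  using insert.prems by (intro insert.IH) (auto simp: disjoint_family_on_def)
 ultimately show ?case using insert.hyps by simp
qed

section \<open>Identification with the cell problems of the statement\<close>

lemma H1_qe_bounded:
 assumes "open D" "bounded D" "H10 D w G"
 shows "H1 D (\<lambda>x. qe x + w x) (\<lambda>x. dqe x *\<^sub>R e + G x)"
 using H1_smooth_add_H10[OF assms(1) qe_smooth assms(3) sob_smooth_bounded[OF assms(2) qe_smooth]]
 unfolding qe_grad .

lemma H1loc_qe:
 assumes "open D" "H10 D w G"
 shows "H1loc D (\<lambda>x. qe x + w x) (\<lambda>x. dqe x *\<^sub>R e + G x)"
 using H1loc_smooth_add_H10[OF assms(1) qe_smooth assms(2)] unfolding qe_grad .

text \<open>The regularity \<open>K\<close>, which stands for \<open>H1\<close> or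
  \<open>H1loc\<close>, follows from the boundary condition, so passing to differences leaves the
  infimum unchanged.\<close>

lemma INF_competitors_eq_mE:
 assumes D: "open D"
  and H: "\<And>w G. H10 D w G \<Longrightarrow> K (\<lambda>x. qe x + w x) (\<lambda>x. dqe x *\<^sub>R e + G x)"
 shows "(INF uG \<in> {(u, G). K u G \<and> (\<forall>x\<in>D. -1 \<le> u x \<and> u x \<le> 1) \<and>
    H10 D (\<lambda>x. u x - qe x) (\<lambda>x. G x - dqe x *\<^sub>R e)}. energy \<Phi> \<tau> W \<omega> D (fst uG) (snd uG)) = mE \<omega> D"
  (is "(INF uG \<in> ?S. _) = _")
proof (rule antisym)
 show "mE \<omega> D \<le> (INF uG \<in> ?S. energy \<Phi> \<tau> W \<omega> D (fst uG) (snd uG))"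
 proof (rule INF_greatest)
  fix uG assume s: "uG \<in> ?S"
  obtain u G where uG: "uG = (u, G)" by (cases uG)
  have "(\<lambda>x. u x - qe x, \<lambda>x. G x - dqe x *\<^sub>R e) \<in> Adm D"
   using s by (auto simp: Adm_def uG)
  from ener_lower[OF this, of \<omega>] show "mE \<omega> D \<le> energy \<Phi> \<tau> W \<omega> D (fst uG) (snd uG)"
   by (simp add: ener_def uG)
 qed
 show "(INF uG \<in> ?S. energy \<Phi> \<tau> W \<omega> D (fst uG) (snd uG)) \<le> mE \<omega> D"
  unfolding mE_def
 proof (rule INF_greatest, clarify)
  fix w G assume a: "(w, G) \<in> Adm D"
  show "(INF uG \<in> ?S. energy \<Phi> \<tau> W \<omega> D (fst uG) (snd uG)) \<le> ener \<omega> D w G"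
  proof (rule INF_lower2[of "(\<lambda>x. qe x + w x, \<lambda>x. dqe x *\<^sub>R e + G x)"])
   show "(\<lambda>x. qe x + w x, \<lambda>x. dqe x *\<^sub>R e + G x) \<in> ?S"
    using a H by (simp add: Adm_def)
  qed (simp add: ener_def)
 qed
qed

lemma phi_fin_eq:
 assumes "Bf e = B"
 shows "phi_fin \<Phi> \<tau> W q Bf \<omega> e R h = mE \<omega> (dom 0 (R / 2) {-h<..<h})"
proof -
 have D: "cyl Bf e R h = dom 0 (R / 2) {-h<..<h}"
  using assms by (auto simp: cyl_def dom_def abs_less_iff)
 show ?thesis unfolding phi_fin_def Let_def D
  by (rule INF_competitors_eq_mE[where K="H1 (dom 0 (R / 2) {-h<..<h})"])
    (rule open_dom, simp, rule H1_qe_bounded, rule open_dom, simp, rule bounded_dom, simp, assumption)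
qed

lemma phi_inf_eq:
 assumes "Bf e = B"
 shows "phi_inf \<Phi> \<tau> W q Bf \<omega> e R = mE \<omega> (dom 0 (R / 2) UNIV)"
proof -
 have D: "cyl_inf Bf e R = dom 0 (R / 2) UNIV" using assms by (auto simp: cyl_inf_def dom_def)
 show ?thesis unfolding phi_inf_def Let_def D
  by (rule INF_competitors_eq_mE[where K="H1loc (dom 0 (R / 2) UNIV)"])
    (rule open_dom, simp, rule H1loc_qe, rule open_dom, simp, assumption)
qed

end

section \<open>Cutoff functions\<close>

lemma smooth_fn_affine_comp:
 fixes a :: "'a::euclidean_space"
 assumes "smooth_fn (p :: real \<Rightarrow> real)"
 shows "smooth_fn (\<lambda>x. p (c + k * (x \<bullet> a)))"
  "grad_fn (\<lambda>x. p (c + k * (x \<bullet> a))) x = (k * deriv p (c + k * (x \<bullet> a))) *\<^sub>R a"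
proof -
 show "smooth_fn (\<lambda>x. p (c + k * (x \<bullet> a)))"
  by (intro smooth_fn_comp[OF assms] smooth_fn_add smooth_fn_mult smooth_fn_const smooth_fn_inner)
 show "grad_fn (\<lambda>x. p (c + k * (x \<bullet> a))) x = (k * deriv p (c + k * (x \<bullet> a))) *\<^sub>R a"
 proof (rule grad_fn_eqI)
  have 1: "((\<lambda>x. c + k * (x \<bullet> a)) has_derivative (\<lambda>v. k * (v \<bullet> a))) (at x)" by (auto intro!: derivative_eq_intros)
  have 2: "(p has_derivative (*) (deriv p (c + k * (x \<bullet> a)))) (at (c + k * (x \<bullet> a)))"
   using smooth_fn_has_real_derivative[OF assms] by (simp add: has_field_derivative_def)
  show "((\<lambda>x. p (c + k * (x \<bullet> a))) has_derivative (\<bullet>) ((k * deriv p (c + k * (x \<bullet> a))) *\<^sub>R a)) (at x)"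
   using has_derivative_compose[OF 1 2] by (rule has_derivative_eq_rhs) (simp add: fun_eq_iff inner_commute)
 qed
qed

text \<open>One between the hyperplanes at distance h and zero beyond h + 1/k; k is the steepness of
  the two transition layers.\<close>

definition plateau :: "real \<Rightarrow> real \<Rightarrow> 'a::euclidean_space \<Rightarrow> 'a \<Rightarrow> real" where
 "plateau k h a x = smooth_step ((1 + k * h) + (- k) * (x \<bullet> a)) * smooth_step ((1 + k * h) + k * (x \<bullet> a))"

lemma smooth_fn_plateau: "smooth_fn (plateau k h a)"
 unfolding plateau_def[abs_def] by (intro smooth_fn_mult smooth_fn_affine_comp smooth_fn_smooth_step)

lemma plateau_bounds: "0 \<le> plateau k h a x" "plateau k h a x \<le> 1"
 unfolding plateau_def using smooth_step_bounds by (auto intro: mult_nonneg_nonneg mult_le_one)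

lemma plateau_eq_1: "0 < k \<Longrightarrow> \<bar>x \<bullet> a\<bar> \<le> h \<Longrightarrow> plateau k h a x = 1"
proof -
 assume k: "0 < k" and h: "\<bar>x \<bullet> a\<bar> \<le> h"
 have "k * (x \<bullet> a) \<le> k * h" "k * (- (x \<bullet> a)) \<le> k * h" using k h by (intro mult_left_mono; simp)+
 then show ?thesis unfolding plateau_def by (simp add: smooth_step_eq_1)
qed

lemma plateau_eq_0: "0 < k \<Longrightarrow> h + 1 / k \<le> \<bar>x \<bullet> a\<bar> \<Longrightarrow> plateau k h a x = 0"
proof -
 assume k: "0 < k" and h: "h + 1 / k \<le> \<bar>x \<bullet> a\<bar>"
 have "k * (h + 1 / k) \<le> k * \<bar>x \<bullet> a\<bar>" using k h by (intro mult_left_mono) auto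
 then have "k * h + 1 \<le> k * \<bar>x \<bullet> a\<bar>" using k by (simp add: distrib_left)
 then show ?thesis unfolding plateau_def by (cases "0 \<le> x \<bullet> a") (simp_all add: smooth_step_eq_0)
qed

lemma plateau_grad:
 "grad_fn (plateau k h a) x =
  (smooth_step ((1 + k * h) + (- k) * (x \<bullet> a)) * (k * deriv smooth_step ((1 + k * h) + k * (x \<bullet> a)))
   + smooth_step ((1 + k * h) + k * (x \<bullet> a)) * ((- k) * deriv smooth_step ((1 + k * h) + (- k) * (x \<bullet> a)))) *\<^sub>R a"
 unfolding plateau_def[abs_def]
 by (subst grad_fn_mult) (intro smooth_fn_affine_comp smooth_fn_smooth_step, intro smooth_fn_affine_comp smooth_fn_smooth_step,
   simp only: smooth_fn_affine_comp(2)[OF smooth_fn_smooth_step] scaleR_scaleR scaleR_left_distrib[symmetric])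

lemma plateau_grad_eq_0: "0 < k \<Longrightarrow> \<bar>x \<bullet> a\<bar> < h \<Longrightarrow> grad_fn (plateau k h a) x = 0"
proof -
 assume k: "0 < k" and h: "\<bar>x \<bullet> a\<bar> < h"
 have "k * (x \<bullet> a) < k * h" "k * (- (x \<bullet> a)) < k * h" using k h by (intro mult_strict_left_mono; simp)+
 then show ?thesis unfolding plateau_grad by (simp add: smooth_step_deriv_eq_0)
qed

lemma plateau_grad_bound:
 assumes L: "\<And>t. \<bar>deriv smooth_step t\<bar> \<le> L" and k: "0 < k" and a: "norm a = 1"
 shows "norm (grad_fn (plateau k h a) x) \<le> 2 * k * L"
proof -
 have m: "\<bar>smooth_step s * (k' * deriv smooth_step t)\<bar> \<le> k * L" if "\<bar>k'\<bar> = k" for s t k'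
 proof -
  have "\<bar>smooth_step s * (k' * deriv smooth_step t)\<bar> = \<bar>smooth_step s\<bar> * (k * \<bar>deriv smooth_step t\<bar>)"
   using that by (simp add: abs_mult)
  also have "\<dots> \<le> 1 * (k * L)" using k L smooth_step_bounds by (intro mult_mono) auto
  finally show ?thesis by simp
 qed
 let ?A = "smooth_step ((1 + k * h) + (- k) * (x \<bullet> a)) * (k * deriv smooth_step ((1 + k * h) + k * (x \<bullet> a)))"
 let ?C = "smooth_step ((1 + k * h) + k * (x \<bullet> a)) * ((- k) * deriv smooth_step ((1 + k * h) + (- k) * (x \<bullet> a)))"
 have "\<bar>?A\<bar> \<le> k * L" "\<bar>?C\<bar> \<le> k * L" using k by (intro m; simp)+
 then have "\<bar>?A + ?C\<bar> \<le> 2 * k * L" by linarith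
 then show ?thesis unfolding plateau_grad norm_scaleR a by simp
qed

text \<open>The closed set \<open>K\<close> keeps the support of the product compact inside the
  smaller domain.\<close>

lemma test_fn_mult_restrict:
 assumes t: "test_fn D \<psi>" and s: "smooth_fn \<eta>" and K: "closed K" "\<And>x. x \<notin> K \<Longrightarrow> \<eta> x = 0" "D \<inter> K \<subseteq> D'"
 shows "test_fn D' (\<lambda>x. \<eta> x * \<psi> x)"
proof -
 have ps: "smooth_fn \<psi>" "compact (tsupport \<psi>)" "tsupport \<psi> \<subseteq> D" using t by (auto simp: test_fn_def)
 have c: "compact (tsupport \<psi> \<inter> K)" using ps(2) K(1) by (rule compact_Int_closed)
 have z: "\<eta> x * \<psi> x = 0" if "x \<notin> tsupport \<psi> \<inter> K" for x
  using that K(2)[of x] frechet_derivative_outside_tsupport(2)[of x \<psi>] by auto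
 have "tsupport (\<lambda>x. \<eta> x * \<psi> x) \<subseteq> tsupport \<psi> \<inter> K" by (rule tsupport_subsetI[OF compact_imp_closed[OF c]]) (rule z)
 moreover have "compact (tsupport (\<lambda>x. \<eta> x * \<psi> x))" by (rule compact_tsupportI[OF c]) (rule z)
 ultimately show ?thesis using ps(3) K(3) smooth_fn_mult[OF s ps(1)] unfolding test_fn_def by auto
qed

lemma nn_integral_tail_inner:
 fixes f :: "'a::euclidean_space \<Rightarrow> ennreal"
 assumes f: "f \<in> borel_measurable lebesgue" and fin: "(\<integral>\<^sup>+x. f x \<partial>lebesgue) < \<infinity>" and eps: "0 < \<epsilon>"
 shows "\<exists>h0::real. \<forall>h\<ge>h0. (\<integral>\<^sup>+x. f x * indicator {x. h \<le> \<bar>x \<bullet> a\<bar>} x \<partial>lebesgue) \<le> ennreal \<epsilon>"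
proof -
 have cl: "{x. h \<le> \<bar>x \<bullet> a\<bar>} \<in> sets lebesgue" for h :: real
  using borel_closed[OF closed_Collect_le[of "\<lambda>_. h" "\<lambda>x. \<bar>x \<bullet> a\<bar>"]] by (simp add: continuous_intros)
 have "(\<lambda>n. \<integral>\<^sup>+x. f x * indicator {x. real n \<le> \<bar>x \<bullet> a\<bar>} x \<partial>lebesgue) \<longlonglongrightarrow> (\<integral>\<^sup>+(x::'a). 0 \<partial>lebesgue)"
 proof (rule nn_integral_dominated_convergence[where w=f])
  show "(\<lambda>x. f x * indicator {x. real n \<le> \<bar>x \<bullet> a\<bar>} x) \<in> borel_measurable lebesgue" for n
   by (intro borel_measurable_times_ennreal f borel_measurable_indicator cl)
  show "AE x in lebesgue. f x * indicator {x. real n \<le> \<bar>x \<bullet> a\<bar>} x \<le> f x" for n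
   by (intro AE_I2) (auto simp: indicator_def)
  show "AE x in lebesgue. (\<lambda>n. f x * indicator {x. real n \<le> \<bar>x \<bullet> a\<bar>} x) \<longlonglongrightarrow> 0"
  proof (rule AE_I2, rule tendsto_eventually)
   fix x
   obtain N :: nat where "\<bar>x \<bullet> a\<bar> < real N" using reals_Archimedean2 by blast
   then show "eventually (\<lambda>n. f x * indicator {x. real n \<le> \<bar>x \<bullet> a\<bar>} x = 0) sequentially"
    unfolding eventually_sequentially by (intro exI[of _ N]) (auto simp: indicator_def)
  qed
 qed (use f fin in auto)
 then have "eventually (\<lambda>n. (\<integral>\<^sup>+x. f x * indicator {x. real n \<le> \<bar>x \<bullet> a\<bar>} x \<partial>lebesgue) < ennreal \<epsilon>) sequentially"
  using eps by (intro order_tendstoD(2)) auto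
 then obtain N where N: "(\<integral>\<^sup>+x. f x * indicator {x. real N \<le> \<bar>x \<bullet> a\<bar>} x \<partial>lebesgue) < ennreal \<epsilon>"
  by (auto simp: eventually_sequentially)
 show ?thesis
 proof (intro exI[of _ "real N"] allI impI)
  fix h :: real assume "real N \<le> h"
  then have "(\<integral>\<^sup>+x. f x * indicator {x. h \<le> \<bar>x \<bullet> a\<bar>} x \<partial>lebesgue) \<le> (\<integral>\<^sup>+x. f x * indicator {x. real N \<le> \<bar>x \<bullet> a\<bar>} x \<partial>lebesgue)"
   by (intro nn_integral_mono mult_left_mono) (auto simp: indicator_def)
  then show "(\<integral>\<^sup>+x. f x * indicator {x. h \<le> \<bar>x \<bullet> a\<bar>} x \<partial>lebesgue) \<le> ennreal \<epsilon>" using N by simp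
 qed
qed

section \<open>From infinite to finite height\<close>

context medium
begin

text \<open>W vanishes at the wells at no particular rate, so it is not bounded by a quadratic
  there. Continuity gives \<eta> near a well, and away from it the maximum of W is absorbed by a
  large multiple of the squared distance.\<close>

lemma Wc_modulus:
 assumes "0 < \<eta>"
 shows "\<exists>K\<ge>0. \<forall>s. \<forall>\<sigma>\<in>{-1,1}. Wc s \<le> \<eta> + K * (\<sigma> - s)\<^sup>2"
proof -
 obtain C where C: "0 \<le> C" "\<And>s. Wc s \<le> C" using Wc_bounded by blast
 have "\<exists>\<delta>>0. \<forall>s. \<bar>s - \<sigma>\<bar> < \<delta> \<longrightarrow> Wc s < \<eta>" if "\<sigma> \<in> {-1, 1}" for \<sigma>
 proof -
  have z: "Wc \<sigma> = 0" using that W_zero[of \<sigma>] by (auto simp: Wc_def)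
  have "isCont Wc \<sigma>" using Wc_continuous by (simp add: continuous_on_eq_continuous_at)
  then obtain \<delta> where "\<delta> > 0" "\<And>s. dist s \<sigma> < \<delta> \<Longrightarrow> dist (Wc s) (Wc \<sigma>) < \<eta>"
   using assms unfolding continuous_at_eps_delta by blast
  then have "Wc s < \<eta>" if "\<bar>s - \<sigma>\<bar> < \<delta>" for s using z that by (fastforce simp: dist_real_def)
  then show ?thesis using \<open>\<delta> > 0\<close> by (intro exI[of _ \<delta>]) simp
 qed
 then obtain d1 d2 where d: "0 < d1" "\<And>s. \<bar>s - (-1)\<bar> < d1 \<Longrightarrow> Wc s < \<eta>" "0 < d2" "\<And>s. \<bar>s - 1\<bar> < d2 \<Longrightarrow> Wc s < \<eta>"
  by (metis insertCI)
 define \<delta> where "\<delta> = min d1 d2"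
 have d0: "0 < \<delta>" using d by (simp add: \<delta>_def)
 show ?thesis
 proof (intro exI[of _ "C / \<delta>\<^sup>2"] conjI allI ballI)
  show "0 \<le> C / \<delta>\<^sup>2" using C by simp
  fix s \<sigma> :: real assume s: "\<sigma> \<in> {-1, 1}"
  show "Wc s \<le> \<eta> + C / \<delta>\<^sup>2 * (\<sigma> - s)\<^sup>2"
  proof (cases "\<bar>s - \<sigma>\<bar> < \<delta>")
   case True
   then have "Wc s < \<eta>" using d s by (auto simp: \<delta>_def)
   moreover have "0 \<le> C / \<delta>\<^sup>2 * (\<sigma> - s)\<^sup>2" using C by simp
   ultimately show ?thesis by linarith
  next
   case False
   then have "\<delta>\<^sup>2 \<le> (\<sigma> - s)\<^sup>2" using d0 by (intro abs_le_square_iff[THEN iffD1]) auto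
   then have "C * 1 \<le> C * ((\<sigma> - s)\<^sup>2 / \<delta>\<^sup>2)" using C d0 by (intro mult_left_mono) auto
   then show ?thesis using C(2)[of s] assms by simp
  qed
 qed
qed

text \<open>The difference to the planar profile is multiplied by a plateau in the direction
  \<open>e\<close>. In the transition layers the energy is bounded by a tail of an integrable
  function and a small constant \<eta> coming from the potential. The latter is harmless because the
  layers have a volume independent of h.\<close>

lemma mE_cutoff:
 assumes w: "\<omega> \<in> space M" and a: "(v, G) \<in> Adm (dom 0 \<rho> UNIV)" and eps: "0 < \<epsilon>"
 shows "\<exists>h0. \<forall>h\<ge>h0. mE \<omega> (dom 0 \<rho> {-h<..<h}) \<le> ener \<omega> (dom 0 \<rho> UNIV) v G + ennreal \<epsilon>"
proof -
 let ?D = "dom 0 \<rho> UNIV"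
 have D: "open ?D" by (rule open_dom) simp
 have Db: "?D \<in> sets borel" using D by (rule borel_open)
 obtain L0 where L0: "\<And>t. \<bar>deriv smooth_step t\<bar> \<le> L0" using smooth_step_deriv_bound by blast
 define L where "L = 2 * L0"
 have L: "0 \<le> L" using L0[of 0] by (simp add: L_def)
 \<comment> \<open>Volume of the two layers of thickness 2 in which the competitor is
   altered.\<close>
 define c4 where "c4 = 4 * enn2real (cvol (cube 0 \<rho>))"
 have c40: "0 \<le> c4" by (simp add: c4_def)
 define \<eta> where "\<eta> = \<epsilon> / (4 * c4 + 4)"
 have eta0: "0 < \<eta>" using eps c40 by (simp add: \<eta>_def)
 obtain K where K: "0 \<le> K" "\<And>s \<sigma>. \<sigma> \<in> {-1,1} \<Longrightarrow> Wc s \<le> \<eta> + K * (\<sigma> - s)\<^sup>2" using Wc_modulus[OF eta0] by blast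
 \<comment> \<open>Sum of the coefficients that arise below: 2 Lam for the gradient of v, 2 Lam L^2
   + 2 K for v itself, and at most this for the derivative of q.\<close>
 define C1 where "C1 = 2 * Lam + 2 * Lam * L\<^sup>2 + 2 * K"
 have C10: "0 \<le> C1" using Lam_pos K by (simp add: C1_def)
 define k where "k = (\<lambda>x. C1 * (indicator ?D x * ((v x)\<^sup>2 + (norm (G x))\<^sup>2)) + C1 * (indicator ?D x * (dqe x)\<^sup>2))"
 note H = AdmD(1)[OF D a] note hd = H10D[OF D H]
 have k1: "(\<lambda>x. indicator ?D x * ((v x)\<^sup>2 + (norm (G x))\<^sup>2)) \<in> borel_measurable lebesgue" by (rule measH_sq(3)[OF hd(1)])
 have k2: "(\<lambda>x. indicator ?D x * (dqe x)\<^sup>2) \<in> borel_measurable lebesgue"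
  by (rule measurable_completion) (use Db in measurable)
 have km: "k \<in> borel_measurable lebesgue" unfolding k_def
  by (intro borel_measurable_add borel_measurable_times borel_measurable_const k1 k2)
 have k0: "0 \<le> k x" for x unfolding k_def using C10 by simp
 have dq: "(\<integral>\<^sup>+x. ennreal (indicator ?D x * (dqe x)\<^sup>2) \<partial>lebesgue) < \<infinity>"
 proof -
  have "(\<integral>\<^sup>+x. ennreal (indicator ?D x * (dqe x)\<^sup>2) \<partial>lebesgue) \<le> (\<integral>\<^sup>+x. ennreal (2 / Lam) * ennreal (indicator ?D x * f0 (x \<bullet> e)) \<partial>lebesgue)"
  proof (rule nn_integral_mono)
   fix x
   have "(dqe x)\<^sup>2 = 2 / Lam * (Lam / 2 * (dqe x)\<^sup>2)" using Lam_pos by simp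
   also have "\<dots> \<le> 2 / Lam * f0 (x \<bullet> e)"
    unfolding f0_def using Lam_pos Wc_nonneg by (intro mult_left_mono) auto
   finally have "indicator ?D x * (dqe x)\<^sup>2 \<le> 2 / Lam * (indicator ?D x * f0 (x \<bullet> e))" by (simp add: indicator_def)
   then show "ennreal (indicator ?D x * (dqe x)\<^sup>2) \<le> ennreal (2 / Lam) * ennreal (indicator ?D x * f0 (x \<bullet> e))"
    using Lam_pos by (subst ennreal_mult'[symmetric]) (auto intro!: ennreal_leI)
  qed
  also have "\<dots> = ennreal (2 / Lam) * V ?D" unfolding V_eq_lebesgue
   by (rule nn_integral_cmult, rule measurable_completion) (use Db in measurable)
  also have "\<dots> < \<infinity>" using V_dom_finite by (simp add: ennreal_mult_less_top)
  finally show ?thesis .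
 qed
 have kfin: "(\<integral>\<^sup>+x. ennreal (k x) \<partial>lebesgue) < \<infinity>"
 proof -
  have "(\<integral>\<^sup>+x. ennreal (k x) \<partial>lebesgue) = (\<integral>\<^sup>+x. ennreal C1 * ennreal (indicator ?D x * ((v x)\<^sup>2 + (norm (G x))\<^sup>2)) + ennreal C1 * ennreal (indicator ?D x * (dqe x)\<^sup>2) \<partial>lebesgue)"
  proof (rule nn_integral_cong)
   fix x
   have "ennreal (C1 * a + C1 * b) = ennreal C1 * ennreal a + ennreal C1 * ennreal b" if "0 \<le> a" "0 \<le> b" for a b
    using that C10 by (simp add: ennreal_mult)
   then show "ennreal (k x) = ennreal C1 * ennreal (indicator ?D x * ((v x)\<^sup>2 + (norm (G x))\<^sup>2)) + ennreal C1 * ennreal (indicator ?D x * (dqe x)\<^sup>2)"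
    unfolding k_def by simp
  qed
  also have "\<dots> = ennreal C1 * sob ?D v G + ennreal C1 * (\<integral>\<^sup>+x. ennreal (indicator ?D x * (dqe x)\<^sup>2) \<partial>lebesgue)"
   unfolding sob_def using k1 k2 by (subst nn_integral_add) (auto simp: nn_integral_cmult)
  also have "\<dots> < \<infinity>" using hd(2) dq by (simp add: ennreal_mult_less_top)
  finally show ?thesis .
 qed
 obtain h1 where h1: "\<And>h. h1 \<le> h \<Longrightarrow> (\<integral>\<^sup>+x. ennreal (k x) * indicator {x. h \<le> \<bar>x \<bullet> e\<bar>} x \<partial>lebesgue) \<le> ennreal (\<epsilon> / 2)"
  using nn_integral_tail_inner[OF _ kfin, of "\<epsilon> / 2" e] km eps by auto
 \<comment> \<open>With this tolerance the distance of q to the nearest well contributes at most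
   \<eta> after multiplication by 2 K.\<close>
 have K1: "0 < \<eta> / (2 * K + 1)" using eta0 K(1) by simp
 obtain t1 where t1: "\<And>t. t1 \<le> t \<Longrightarrow> (1 - q t)\<^sup>2 < \<eta> / (2 * K + 1)"
 proof -
  have "((\<lambda>t. (1 - q t)\<^sup>2) \<longlongrightarrow> (1 - 1)\<^sup>2) at_top" by (intro tendsto_intros q_top)
  then have "eventually (\<lambda>t. (1 - q t)\<^sup>2 < \<eta> / (2 * K + 1)) at_top" using K1 by (intro order_tendstoD(2)) auto
  then show ?thesis using that by (auto simp: eventually_at_top_linorder)
 qed
 obtain t2 where t2: "\<And>t. t \<le> t2 \<Longrightarrow> (- 1 - q t)\<^sup>2 < \<eta> / (2 * K + 1)"
 proof -
  have "((\<lambda>t. (- 1 - q t)\<^sup>2) \<longlongrightarrow> (- 1 - (-1))\<^sup>2) at_bot" by (intro tendsto_intros q_bot)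
  then have "eventually (\<lambda>t. (- 1 - q t)\<^sup>2 < \<eta> / (2 * K + 1)) at_bot" using K1 by (intro order_tendstoD(2)) auto
  then show ?thesis using that by (auto simp: eventually_at_bot_linorder)
 qed
 have q1: "\<exists>\<sigma>\<in>{-1,1}. (\<sigma> - q t)\<^sup>2 \<le> \<eta> / (2 * K + 1)" if "\<bar>t1\<bar> + \<bar>t2\<bar> \<le> \<bar>t\<bar>" for t
 proof (cases "0 \<le> t")
  case True
  then have "(1 - q t)\<^sup>2 < \<eta> / (2 * K + 1)" using that by (intro t1) linarith
  then show ?thesis by (intro bexI[of _ 1]) auto
 next
  case False
  then have "(- 1 - q t)\<^sup>2 < \<eta> / (2 * K + 1)" using that by (intro t2) linarith
  then show ?thesis by (intro bexI[of _ "-1"]) auto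
 qed
 show ?thesis
 proof (intro exI[of _ "max 2 (max (h1 + 2) (\<bar>t1\<bar> + \<bar>t2\<bar> + 2))"] allI impI)
  fix h assume h: "max 2 (max (h1 + 2) (\<bar>t1\<bar> + \<bar>t2\<bar> + 2)) \<le> h"
  let ?Dh = "dom 0 \<rho> {-h<..<h}"
  have Dh: "open ?Dh" by (rule open_dom) simp
  have sub: "?Dh \<subseteq> ?D" by (auto simp: dom_def)
  \<comment> \<open>The descent takes place between heights h - 2 and h - 1; the last unit keeps the
    support away from the ends of the cylinder.\<close>
  define \<theta> where "\<theta> = plateau 1 (h - 2) e"
  have th: "smooth_fn \<theta>" "\<And>x. 0 \<le> \<theta> x" "\<And>x. \<theta> x \<le> 1" unfolding \<theta>_def
   using smooth_fn_plateau plateau_bounds by auto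
  have thg: "norm (grad_fn \<theta> x) \<le> L" for x
   unfolding \<theta>_def L_def using plateau_grad_bound[OF L0, of 1 e] norm_e by simp
  have th1: "\<theta> x = 1" "grad_fn \<theta> x = 0" if "\<bar>x \<bullet> e\<bar> < h - 2" for x
   unfolding \<theta>_def using that plateau_eq_1[of 1 x e "h - 2"] plateau_grad_eq_0[of 1 x e "h - 2"] by auto
  have th0: "\<theta> x = 0" if "h - 1 \<le> \<bar>x \<bullet> e\<bar>" for x
   unfolding \<theta>_def using that by (intro plateau_eq_0) auto
  let ?v = "\<lambda>x. \<theta> x * v x" and ?G = "\<lambda>x. \<theta> x *\<^sub>R G x + v x *\<^sub>R grad_fn \<theta> x"
  have "H10 ?Dh ?v ?G"
  proof (rule H10_mult[OF D Dh sub H th(1)])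
   show "\<bar>\<theta> x\<bar> \<le> 1" for x using th(2,3)[of x] by simp
   show "norm (grad_fn \<theta> x) \<le> L" for x by (rule thg)
   fix \<psi> assume t: "test_fn ?D \<psi>"
   show "test_fn ?Dh (\<lambda>x. \<theta> x * \<psi> x)"
   proof (rule test_fn_mult_restrict[OF t th(1)])
    show "closed {x. \<bar>x \<bullet> e\<bar> \<le> h - 1}" by (intro closed_Collect_le continuous_intros)
    show "\<theta> x = 0" if "x \<notin> {x. \<bar>x \<bullet> e\<bar> \<le> h - 1}" for x using that by (intro th0) auto
    show "?D \<inter> {x. \<bar>x \<bullet> e\<bar> \<le> h - 1} \<subseteq> ?Dh" by (auto simp: dom_def)
   qed
  qed
  moreover have rng: "qe x + ?v x \<in> {-1..1}" if "x \<in> ?D" for x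
  proof -
   \<comment> \<open>A convex combination of the profile and the competitor, which preserves the
     range [-1, 1].\<close>
   have c: "qe x + \<theta> x * v x = (1 - \<theta> x) * qe x + \<theta> x * (qe x + v x)" by (simp add: algebra_simps)
   have 1: "qe x + v x \<in> {-1..1}" by (rule AdmD(3)[OF D a that])
   have "(1 - \<theta> x) * qe x + \<theta> x * (qe x + v x) \<le> (1 - \<theta> x) * 1 + \<theta> x * 1"
    using th(2,3)[of x] 1 q_range[of "x \<bullet> e"] by (intro add_mono mult_left_mono) auto
   moreover have "(1 - \<theta> x) * (-1) + \<theta> x * (-1) \<le> (1 - \<theta> x) * qe x + \<theta> x * (qe x + v x)"
    using th(2,3)[of x] 1 q_range[of "x \<bullet> e"] by (intro add_mono mult_left_mono) auto
   ultimately show ?thesis unfolding c by simp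
  qed
  ultimately have adm: "(?v, ?G) \<in> Adm ?Dh" using sub unfolding Adm_def by force
  let ?S = "{x. h - 2 \<le> \<bar>x \<bullet> e\<bar>}"
  let ?T = "?D \<inter> {x. h - 2 \<le> \<bar>x \<bullet> e\<bar> \<and> \<bar>x \<bullet> e\<bar> \<le> h}"
  let ?d = "dens \<omega> ?D (\<lambda>x. qe x + v x) (\<lambda>x. dqe x *\<^sub>R e + G x)"
  have Tb: "?T \<in> sets borel" using Db by measurable
  have Sb: "?S \<in> sets borel" by measurable
  have "mE \<omega> ?Dh \<le> ener \<omega> ?Dh ?v ?G" by (rule ener_lower[OF adm])
  also have "\<dots> \<le> (\<integral>\<^sup>+x. ennreal (?d x) + (ennreal (k x) * indicator ?S x + ennreal (2 * \<eta>) * indicator ?T x) \<partial>lebesgue)"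
   unfolding ener_def energy_dens
  proof (rule nn_integral_mono)
   fix x
   let ?dh = "dens \<omega> ?Dh (\<lambda>x. qe x + ?v x) (\<lambda>x. dqe x *\<^sub>R e + ?G x) x"
   consider "x \<notin> ?Dh" | "x \<in> ?Dh" "\<bar>x \<bullet> e\<bar> < h - 2" | "x \<in> ?Dh" "h - 2 \<le> \<bar>x \<bullet> e\<bar>" by linarith
   then show "ennreal ?dh \<le> ennreal (?d x) + (ennreal (k x) * indicator ?S x + ennreal (2 * \<eta>) * indicator ?T x)"
   proof cases
    case 1
    then show ?thesis by (simp add: dens_def)
   next
    case 2
    then have "?dh = ?d x" using sub by (auto simp: dens_def th1)
    then show ?thesis by simp
   next
    case 3
    have xD: "x \<in> ?D" using 3 sub by blast
    have xT: "x \<in> ?T" "x \<in> ?S" using 3 by (auto simp: dom_def abs_less_iff)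
    obtain \<sigma> where sg: "\<sigma> \<in> {-1,1}" "(\<sigma> - qe x)\<^sup>2 \<le> \<eta> / (2 * K + 1)" using q1[of "x \<bullet> e"] h 3 by auto
    have c1: "(\<theta> x)\<^sup>2 \<le> 1" using th(2,3)[of x] by (simp add: power_le_one)
    have c2: "(norm (grad_fn \<theta> x))\<^sup>2 \<le> L\<^sup>2" using thg[of x] by (intro power_mono) auto
    have g: "(norm (dqe x *\<^sub>R e + ?G x))\<^sup>2 \<le> 2 * (dqe x)\<^sup>2 + 4 * (norm (G x))\<^sup>2 + 4 * (L\<^sup>2 * (v x)\<^sup>2)"
    proof -
     have "(norm (dqe x *\<^sub>R e + ?G x))\<^sup>2 \<le> 2 * (norm (dqe x *\<^sub>R e))\<^sup>2 + 2 * (norm (?G x))\<^sup>2" by (rule norm_sq_add_le)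
     also have "(norm (?G x))\<^sup>2 \<le> 2 * (norm (\<theta> x *\<^sub>R G x))\<^sup>2 + 2 * (norm (v x *\<^sub>R grad_fn \<theta> x))\<^sup>2" by (rule norm_sq_add_le)
     also have "(norm (\<theta> x *\<^sub>R G x))\<^sup>2 \<le> (norm (G x))\<^sup>2"
     proof -
      have "(norm (\<theta> x *\<^sub>R G x))\<^sup>2 = (\<theta> x)\<^sup>2 * (norm (G x))\<^sup>2" by (simp add: power_mult_distrib)
      also have "\<dots> \<le> 1 * (norm (G x))\<^sup>2" using c1 by (rule mult_right_mono) simp
      finally show ?thesis by simp
     qed
     also have "(norm (v x *\<^sub>R grad_fn \<theta> x))\<^sup>2 \<le> L\<^sup>2 * (v x)\<^sup>2"
     proof -
      have "(norm (v x *\<^sub>R grad_fn \<theta> x))\<^sup>2 = (norm (grad_fn \<theta> x))\<^sup>2 * (v x)\<^sup>2" by (simp add: power_mult_distrib)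
      also have "\<dots> \<le> L\<^sup>2 * (v x)\<^sup>2" using c2 by (rule mult_right_mono) simp
      finally show ?thesis .
     qed
     finally show ?thesis using norm_e by simp
    qed
    have W1: "W (qe x + ?v x) \<le> 2 * \<eta> + 2 * K * (v x)\<^sup>2"
    proof -
     have "W (qe x + ?v x) = Wc (qe x + ?v x)" using Wc_eq[OF rng[OF xD]] by simp
     also have "\<dots> \<le> \<eta> + K * (\<sigma> - (qe x + ?v x))\<^sup>2" by (rule K(2)[OF sg(1)])
     also have "(\<sigma> - (qe x + ?v x))\<^sup>2 = ((\<sigma> - qe x) + (- ?v x))\<^sup>2" by (simp add: algebra_simps)
     also have "\<dots> \<le> 2 * (\<sigma> - qe x)\<^sup>2 + 2 * (- ?v x)\<^sup>2" by (rule sq_add_le)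
     also have "(- ?v x)\<^sup>2 \<le> (v x)\<^sup>2"
     proof -
      have "(- ?v x)\<^sup>2 = (\<theta> x)\<^sup>2 * (v x)\<^sup>2" by (simp add: power_mult_distrib)
      also have "\<dots> \<le> 1 * (v x)\<^sup>2" using c1 by (rule mult_right_mono) simp
      finally show ?thesis by simp
     qed
     finally have "W (qe x + ?v x) \<le> \<eta> + K * (2 * (\<sigma> - qe x)\<^sup>2 + 2 * (v x)\<^sup>2)"
      using K(1) by (simp add: mult_left_mono)
     also have "\<dots> = \<eta> + 2 * K * (\<sigma> - qe x)\<^sup>2 + 2 * K * (v x)\<^sup>2" by (simp add: algebra_simps)
     also have "2 * K * (\<sigma> - qe x)\<^sup>2 \<le> \<eta>"
     proof -
      have "2 * K * (\<sigma> - qe x)\<^sup>2 \<le> 2 * K * (\<eta> / (2 * K + 1))" using sg(2) K(1) by (intro mult_left_mono) auto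
      also have "\<dots> \<le> \<eta>" using K(1) eta0 by (simp add: pos_divide_le_eq algebra_simps)
      finally show ?thesis .
     qed
     finally show ?thesis by simp
    qed
    have "?dh = 1 / 2 * (\<Phi> (\<tau> x \<omega>) (dqe x *\<^sub>R e + ?G x))\<^sup>2 + W (qe x + ?v x)"
     using 3 by (simp add: dens_def)
    also have "\<dots> \<le> Lam / 2 * (norm (dqe x *\<^sub>R e + ?G x))\<^sup>2 + W (qe x + ?v x)"
     using Phi_sq_le[OF w, of x "dqe x *\<^sub>R e + ?G x"] by simp
    also have "\<dots> \<le> Lam / 2 * (2 * (dqe x)\<^sup>2 + 4 * (norm (G x))\<^sup>2 + 4 * (L\<^sup>2 * (v x)\<^sup>2)) + (2 * \<eta> + 2 * K * (v x)\<^sup>2)"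
     using g W1 Lam_pos by (intro add_mono mult_left_mono) auto
    also have "\<dots> \<le> k x + 2 * \<eta>"
    proof -
     have "0 \<le> Lam * (dqe x)\<^sup>2" "0 \<le> Lam * L\<^sup>2 * (dqe x)\<^sup>2" "0 \<le> K * (dqe x)\<^sup>2"
      "0 \<le> Lam * L\<^sup>2 * (norm (G x))\<^sup>2" "0 \<le> K * (norm (G x))\<^sup>2" "0 \<le> Lam * (v x)\<^sup>2"
      using Lam_pos K(1) by auto
     then show ?thesis using xD unfolding k_def C1_def by (simp add: algebra_simps)
    qed
    finally have "?dh \<le> k x + 2 * \<eta>" .
    then have "ennreal ?dh \<le> ennreal (k x) + ennreal (2 * \<eta>)"
     using k0 eta0 by (simp add: ennreal_plus[symmetric] ennreal_leI del: ennreal_plus)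
    then show ?thesis using xT by (simp add: add_increasing)
   qed
  qed
  also have "\<dots> = ener \<omega> ?D v G + ((\<integral>\<^sup>+x. ennreal (k x) * indicator ?S x \<partial>lebesgue) + ennreal (2 * \<eta>) * emeasure lebesgue ?T)"
  proof -
   have m1: "(\<lambda>x. ennreal (?d x)) \<in> borel_measurable lebesgue" using Adm_dens_measurable[OF w D a] by measurable
   have m2: "(\<lambda>x. ennreal (k x) * indicator ?S x) \<in> borel_measurable lebesgue"
    using Sb km by (intro borel_measurable_times_ennreal borel_measurable_indicator) auto
   have T: "?T \<in> sets lebesgue" using Tb by simp
   have m3: "(\<lambda>x. ennreal (2 * \<eta>) * indicator ?T x) \<in> borel_measurable lebesgue"
    using T by (intro borel_measurable_times_ennreal borel_measurable_indicator) auto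
   show ?thesis unfolding ener_def energy_dens
    unfolding nn_integral_add[OF m1 borel_measurable_add[OF m2 m3]] nn_integral_add[OF m2 m3] nn_integral_cmult_indicator[OF T] ..
  qed
  also have "emeasure lebesgue ?T = ennreal c4"
  proof -
   have "emeasure lebesgue ?T = emeasure lborel ?T" using Tb by simp
   also have "\<dots> = (\<integral>\<^sup>+x. indicator ?D x * indicator {t. h - 2 \<le> \<bar>t\<bar> \<and> \<bar>t\<bar> \<le> h} (x \<bullet> e + 0) \<partial>lborel)"
   proof -
    have "emeasure lborel ?T = (\<integral>\<^sup>+x. indicator ?T x \<partial>lborel)" using Tb by simp
    also have "\<dots> = (\<integral>\<^sup>+x. indicator ?D x * indicator {t. h - 2 \<le> \<bar>t\<bar> \<and> \<bar>t\<bar> \<le> h} (x \<bullet> e + 0) \<partial>lborel)"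
     by (intro nn_integral_cong) (auto simp: indicator_def)
    finally show ?thesis .
   qed
   also have "\<dots> = emeasure lborel (?D \<inter> slab0) * (\<integral>\<^sup>+t. indicator {t. h - 2 \<le> \<bar>t\<bar> \<and> \<bar>t\<bar> \<le> h} t \<partial>lborel)"
   proof (rule nn_integral_cylinder[where g="\<lambda>_. 0" and F="indicator {t. h - 2 \<le> \<bar>t\<bar> \<and> \<bar>t\<bar> \<le> h}"])
    show "x + t *\<^sub>R e \<in> ?D \<longleftrightarrow> x \<in> ?D" for x t using cube_e[of x t 0 \<rho>] by (simp add: dom_cube)
   qed (use Db in auto)
   also have "(\<integral>\<^sup>+t. indicator {t. h - 2 \<le> \<bar>t\<bar> \<and> \<bar>t\<bar> \<le> h} t \<partial>lborel) = ennreal 4"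
   proof -
    have "{t. h - 2 \<le> \<bar>t\<bar> \<and> \<bar>t\<bar> \<le> h} = {-h..-(h - 2)} \<union> {h - 2..h}" using h by (auto simp: abs_le_iff abs_if split: if_splits)
    moreover have "emeasure lborel ({-h..-(h - 2)} \<union> {h - 2..h}) = emeasure lborel {-h..-(h - 2)} + emeasure lborel {h - 2..h}"
    proof (cases "h = 2")
     case False
     then show ?thesis using h by (intro plus_emeasure[symmetric]) auto
    next
     case True
     then have "{-h..-(h - 2)} \<union> {h - 2..h} = {-2..2}" by auto
     then show ?thesis using True by (simp flip: ennreal_plus)
    qed
    ultimately show ?thesis using h by (simp flip: ennreal_plus)
   qed
   also have "emeasure lborel (?D \<inter> slab0) = ennreal (c4 / 4)"
    using cvol_cube_finite[of \<rho>] by (simp add: c4_def cvol_def dom_cube ennreal_enn2real_if less_top)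
   also have "ennreal (c4 / 4) * ennreal 4 = ennreal c4" using c40 by (subst ennreal_mult[symmetric]) auto
   finally show ?thesis .
  qed
  also have "ennreal (2 * \<eta>) * ennreal c4 \<le> ennreal (\<epsilon> / 2)"
  proof -
   have "2 * \<eta> * c4 = \<epsilon> / 2 * (c4 / (c4 + 1))" using c40 by (simp add: \<eta>_def field_simps)
   also have "\<dots> \<le> \<epsilon> / 2 * 1" using eps c40 by (intro mult_left_mono) (auto simp: divide_le_eq)
   finally show ?thesis using eta0 c40 by (subst ennreal_mult[symmetric]) (auto intro!: ennreal_leI)
  qed
  also have "(\<integral>\<^sup>+x. ennreal (k x) * indicator ?S x \<partial>lebesgue) \<le> ennreal (\<epsilon> / 2)" using h by (intro h1) auto
  also have "ennreal (\<epsilon> / 2) + ennreal (\<epsilon> / 2) = ennreal \<epsilon>" using eps by (simp flip: ennreal_plus)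
  finally show "mE \<omega> ?Dh \<le> ener \<omega> ?D v G + ennreal \<epsilon>" by (simp add: add_mono)
 qed
qed

end

section \<open>Shifting the boundary profile along e\<close>

lemma grad_fn_prod_bound:
 assumes "finite I" "\<And>i. i \<in> I \<Longrightarrow> smooth_fn (f i)" "\<And>i. i \<in> I \<Longrightarrow> \<bar>f i x\<bar> \<le> 1"
  "\<And>i. i \<in> I \<Longrightarrow> norm (grad_fn (f i) x) \<le> K"
 shows "norm (grad_fn (\<lambda>x. \<Prod>i\<in>I. f i x) x) \<le> real (card I) * K"
 using assms
proof (induction I rule: finite_induct)
 case empty
 have "grad_fn (\<lambda>x. \<Prod>i\<in>{}. f i x) x = 0" by (simp add: grad_fn_def)
 then show ?case by simp
next
 case (insert i I)
 have s: "smooth_fn (f i)" "smooth_fn (\<lambda>x. \<Prod>i\<in>I. f i x)"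
  using insert.prems(1) insert.hyps(1) by (auto intro!: smooth_fn_prod)
 have p1: "\<bar>\<Prod>i\<in>I. f i x\<bar> \<le> 1"
  unfolding abs_prod by (rule prod_le_1) (use insert.prems(2) in auto)
 have "grad_fn (\<lambda>x. \<Prod>i\<in>insert i I. f i x) x = f i x *\<^sub>R grad_fn (\<lambda>x. \<Prod>i\<in>I. f i x) x + (\<Prod>i\<in>I. f i x) *\<^sub>R grad_fn (f i) x"
  unfolding prod.insert[OF insert.hyps] by (rule grad_fn_mult[OF s])
 then have "norm (grad_fn (\<lambda>x. \<Prod>i\<in>insert i I. f i x) x) \<le> \<bar>f i x\<bar> * norm (grad_fn (\<lambda>x. \<Prod>i\<in>I. f i x) x) + \<bar>\<Prod>i\<in>I. f i x\<bar> * norm (grad_fn (f i) x)"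
  using norm_triangle_ineq[of "f i x *\<^sub>R grad_fn (\<lambda>x. \<Prod>i\<in>I. f i x) x" "(\<Prod>i\<in>I. f i x) *\<^sub>R grad_fn (f i) x"] by (simp only: norm_scaleR)
 also have "\<dots> \<le> 1 * (real (card I) * K) + 1 * K"
  using insert.prems insert.IH p1 by (intro add_mono mult_mono) auto
 finally show ?case using insert.hyps by (simp add: algebra_simps)
qed

context medium
begin

text \<open>The Cauchy-Schwarz inequality for the integral of the derivative over [0, 1], obtained
  by expanding a square with nonnegative integral. It makes differences of shifted profiles square
  integrable although q itself is not.\<close>

lemma q_increment_sq_le:
 "ennreal ((q (a + \<sigma>) - q a)\<^sup>2) \<le> (\<integral>\<^sup>+r. ennreal (\<sigma>\<^sup>2 * (deriv q (a + \<sigma> * r))\<^sup>2 * indicator {0..1} r) \<partial>lborel)"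
proof -
 let ?h = "\<lambda>r. \<sigma> * deriv q (a + \<sigma> * r)" and ?p = "q (a + \<sigma>) - q a"
 have cq: "continuous_on UNIV (deriv q)" by (rule smooth_fn_continuous[OF smooth_fn_deriv[OF q_smooth]])
 have ch: "continuous_on UNIV ?h"
  by (intro continuous_intros continuous_on_compose2[OF cq]) auto
 have F: "((\<lambda>r. q (a + \<sigma> * r)) has_real_derivative ?h r) (at r)" for r
 proof -
  have "((\<lambda>r. a + \<sigma> * r) has_real_derivative \<sigma>) (at r)" by (auto intro!: derivative_eq_intros)
  from DERIV_chain2[OF smooth_fn_has_real_derivative[OF q_smooth] this]
  show ?thesis by (simp add: mult.commute)
 qed
 have I1: "(\<integral>r. ?h r * indicator {0..1} r \<partial>lborel) = ?p"
  using integral_FTC_Icc_real[of 0 1 "\<lambda>r. q (a + \<sigma> * r)" ?h] F ch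
  by (simp add: continuous_on_eq_continuous_at)
 have int: "integrable lborel (\<lambda>r. g r * indicator {0..1} r)" if "continuous_on UNIV g" for g :: "real \<Rightarrow> real"
  using borel_integrable_atLeastAtMost'[OF continuous_on_subset[OF that], of 0 1]
  by (simp add: set_integrable_def mult.commute)
 note i1 = int[OF ch]
 have i2: "integrable lborel (\<lambda>r. (?h r)\<^sup>2 * indicator {0..1} r)" by (intro int continuous_intros ch)
 have i3: "integrable lborel (\<lambda>r::real. (1::real) * indicator {0..1} r)" by (intro int continuous_intros)
 have "0 \<le> (\<integral>r. (?h r - ?p)\<^sup>2 * indicator {0..1} r \<partial>lborel)" by (intro Bochner_Integration.integral_nonneg) auto
 also have "\<dots> = (\<integral>r. (?h r)\<^sup>2 * indicator {0..1} r - 2 * ?p * (?h r * indicator {0..1} r) + ?p\<^sup>2 * (1 * indicator {0..1} r) \<partial>lborel)"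
 proof (intro Bochner_Integration.integral_cong refl)
  have "(h - p)\<^sup>2 * i = h\<^sup>2 * i - 2 * p * (h * i) + p\<^sup>2 * (1 * i)" for h p i :: real
   by (simp add: power2_eq_square algebra_simps)
  then show "(?h r - ?p)\<^sup>2 * indicator {0..1} r = (?h r)\<^sup>2 * indicator {0..1} r - 2 * ?p * (?h r * indicator {0..1} r) + ?p\<^sup>2 * (1 * indicator {0..1} r)" for r
   by blast
 qed
 also have "\<dots> = (\<integral>r. (?h r)\<^sup>2 * indicator {0..1} r \<partial>lborel) - 2 * ?p * (\<integral>r. ?h r * indicator {0..1} r \<partial>lborel) + ?p\<^sup>2 * (\<integral>r. 1 * indicator {0..1::real} r \<partial>lborel)"
 proof -
  define H1 where "H1 = (\<lambda>r. ?h r * indicator {0..1} r)"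
  define H2 where "H2 = (\<lambda>r. (?h r)\<^sup>2 * indicator {0..1} r)"
  define H3 where "H3 = (\<lambda>r::real. 1 * indicator {0..1} r :: real)"
  have "integrable lborel H1" "integrable lborel H2" "integrable lborel H3"
   unfolding H1_def H2_def H3_def using i1 i2 i3 by auto
  then have "(\<integral>r. H2 r - c * H1 r + d * H3 r \<partial>lborel) = (\<integral>r. H2 r \<partial>lborel) - c * (\<integral>r. H1 r \<partial>lborel) + d * (\<integral>r. H3 r \<partial>lborel)" for c d
   by simp
  then show ?thesis unfolding H1_def H2_def H3_def .
 qed
 also have "\<dots> = (\<integral>r. (?h r)\<^sup>2 * indicator {0..1} r \<partial>lborel) - ?p\<^sup>2"
  unfolding I1 by (simp add: power2_eq_square)
 finally have "?p\<^sup>2 \<le> (\<integral>r. (?h r)\<^sup>2 * indicator {0..1} r \<partial>lborel)" by simp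
 then have "ennreal (?p\<^sup>2) \<le> ennreal (\<integral>r. (?h r)\<^sup>2 * indicator {0..1} r \<partial>lborel)" by (rule ennreal_leI)
 also have "\<dots> = (\<integral>\<^sup>+r. ennreal ((?h r)\<^sup>2 * indicator {0..1} r) \<partial>lborel)"
  by (rule nn_integral_eq_integral[symmetric, OF i2]) auto
 finally show ?thesis by (simp add: power_mult_distrib)
qed

lemma q_deriv_sq_finite: "(\<integral>\<^sup>+t. ennreal ((deriv q t)\<^sup>2) \<partial>lborel) < \<infinity>"
proof -
 have "(\<integral>\<^sup>+t. ennreal ((deriv q t)\<^sup>2) \<partial>lborel) \<le> (\<integral>\<^sup>+t. ennreal (2 / Lam) * ennreal (f0 t) \<partial>lborel)"
 proof (rule nn_integral_mono)
  fix t
  have "(deriv q t)\<^sup>2 = 2 / Lam * (Lam / 2 * (deriv q t)\<^sup>2)" using Lam_pos by simp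
  also have "\<dots> \<le> 2 / Lam * f0 t"
   unfolding f0_def using Lam_pos Wc_nonneg by (intro mult_left_mono) auto
  finally show "ennreal ((deriv q t)\<^sup>2) \<le> ennreal (2 / Lam) * ennreal (f0 t)"
   using Lam_pos by (subst ennreal_mult'[symmetric]) (auto intro!: ennreal_leI)
 qed
 also have "\<dots> = ennreal (2 / Lam) * (\<integral>\<^sup>+t. ennreal (f0 t) \<partial>lborel)" by (rule nn_integral_cmult) measurable
 also have "\<dots> < \<infinity>" using f0_finite by (simp add: ennreal_mult_less_top)
 finally show ?thesis .
qed

text \<open>A lateral cutoff, constant along \<open>e\<close>. Steepness 2 makes it vanish beyond
  \<rho> + 1/2, which leaves room for compact support inside the cube of half-side \<rho> +
  1.\<close>

definition zeta :: "real \<Rightarrow> 'd \<Rightarrow> real" where "zeta \<rho> x = (\<Prod>b\<in>B. plateau 2 \<rho> b x)"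

lemma zeta_smooth: "smooth_fn (zeta \<rho>)"
 unfolding zeta_def[abs_def] using finB by (intro smooth_fn_prod smooth_fn_plateau)

lemma zeta_bounds: "0 \<le> zeta \<rho> x" "zeta \<rho> x \<le> 1"
 unfolding zeta_def using plateau_bounds by (auto intro!: prod_nonneg prod_le_1)

lemma zeta_e: "zeta \<rho> (x + t *\<^sub>R e) = zeta \<rho> x"
 unfolding zeta_def plateau_def by (intro prod.cong refl) (simp add: inner_add_left eB)

lemma zeta_eq_1: "x \<in> cube 0 \<rho> \<Longrightarrow> zeta \<rho> x = 1"
 unfolding zeta_def by (intro prod.neutral ballI plateau_eq_1) (auto simp: cube_def intro: less_imp_le)

lemma zeta_eq_0: "b \<in> B \<Longrightarrow> \<rho> + 1 / 2 \<le> \<bar>x \<bullet> b\<bar> \<Longrightarrow> zeta \<rho> x = 0"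
 unfolding zeta_def using finB by (intro prod_zero bexI[of _ b] plateau_eq_0) auto

lemma zeta_grad_eq_0: "x \<in> cube 0 \<rho> \<Longrightarrow> grad_fn (zeta \<rho>) x = 0"
proof -
 assume x: "x \<in> cube 0 \<rho>"
 have "norm (grad_fn (\<lambda>x. \<Prod>b\<in>B. plateau 2 \<rho> b x) x) \<le> real (card B) * 0"
 proof (rule grad_fn_prod_bound[OF finB smooth_fn_plateau])
  fix b assume b: "b \<in> B"
  show "\<bar>plateau 2 \<rho> b x\<bar> \<le> 1" using plateau_bounds[of 2 \<rho> b x] by simp
  show "norm (grad_fn (plateau 2 \<rho> b) x) \<le> 0" using x b by (simp add: cube_def plateau_grad_eq_0)
 qed
 then show ?thesis by (simp add: zeta_def[abs_def])
qed

lemma zeta_grad_bound: "\<exists>L\<ge>0. \<forall>\<rho> x. norm (grad_fn (zeta \<rho>) x) \<le> L"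
proof -
 obtain L0 where L0: "\<And>t. \<bar>deriv smooth_step t\<bar> \<le> L0" using smooth_step_deriv_bound by blast
 have L00: "0 \<le> L0" using L0[of 0] by simp
 have "norm (grad_fn (zeta \<rho>) x) \<le> real (card B) * (2 * 2 * L0)" for \<rho> x
  unfolding zeta_def[abs_def]
 proof (rule grad_fn_prod_bound[OF finB smooth_fn_plateau])
  fix b assume b: "b \<in> B"
  show "\<bar>plateau 2 \<rho> b x\<bar> \<le> 1" using plateau_bounds[of 2 \<rho> b x] by simp
  show "norm (grad_fn (plateau 2 \<rho> b) x) \<le> 2 * 2 * L0" by (rule plateau_grad_bound[OF L0 _ B_norm[OF b]]) simp
 qed
 then show ?thesis using L00 by (intro exI[of _ "real (card B) * (2 * 2 * L0)"]) auto
qed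

text \<open>Convex combinations of \<open>q\<close> and its translate need not have finite potential energy; bending
 the argument of \<open>q\<close> by \<open>s * zeta \<rho> x\<close> does not change the integral over lines parallel to \<open>e\<close>.\<close>

definition bent :: "real \<Rightarrow> real \<Rightarrow> 'd \<Rightarrow> real" where "bent s \<rho> x = q (x \<bullet> e + s * zeta \<rho> x)"

lemma bent_smooth: "smooth_fn (bent s \<rho>)"
 unfolding bent_def[abs_def]
 by (intro smooth_fn_comp[OF q_smooth] smooth_fn_add smooth_fn_inner smooth_fn_mult smooth_fn_const zeta_smooth)

lemma bent_grad: "grad_fn (bent s \<rho>) x = deriv q (x \<bullet> e + s * zeta \<rho> x) *\<^sub>R (e + s *\<^sub>R grad_fn (zeta \<rho>) x)"
proof (rule grad_fn_eqI)
 have 1: "((\<lambda>x. x \<bullet> e + s * zeta \<rho> x) has_derivative (\<lambda>v. (e + s *\<^sub>R grad_fn (zeta \<rho>) x) \<bullet> v)) (at x)"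
  using smooth_fn_has_derivative_grad[OF zeta_smooth, of \<rho> x]
  by (auto intro!: derivative_eq_intros simp: inner_add_left inner_add_right inner_commute fun_eq_iff)
 have 2: "(q has_derivative (*) (deriv q (x \<bullet> e + s * zeta \<rho> x))) (at (x \<bullet> e + s * zeta \<rho> x))"
  using smooth_fn_has_real_derivative[OF q_smooth] by (simp add: has_field_derivative_def)
 show "(bent s \<rho> has_derivative (\<bullet>) (deriv q (x \<bullet> e + s * zeta \<rho> x) *\<^sub>R (e + s *\<^sub>R grad_fn (zeta \<rho>) x))) (at x)"
  unfolding bent_def[abs_def] using has_derivative_compose[OF 1 2] by (rule has_derivative_eq_rhs) (simp add: fun_eq_iff)
qed

lemma zeta_measurable [measurable]: "zeta \<rho> \<in> borel_measurable borel"
 by (rule smooth_fn_borel_measurable[OF zeta_smooth])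

text \<open>The shift of the argument of q depends on the lateral position only, so along each line
  parallel to \<open>e\<close> the integrals of the squared derivative are those of q. The function
  itself is treated with \<open>q_increment_sq_le\<close>, its gradient with the bound on the
  gradient of \<open>zeta\<close>.\<close>

lemma bent_sob_finite:
 "sob (cube 0 \<rho>') (\<lambda>x. bent s \<rho> x - qe x) (grad_fn (\<lambda>x. bent s \<rho> x - qe x)) < \<infinity>"
proof -
 let ?D = "cube 0 \<rho>'" and ?p = "\<lambda>x. bent s \<rho> x - qe x"
 obtain L where L: "0 \<le> L" "\<And>\<rho> x. norm (grad_fn (zeta \<rho>) x) \<le> L" using zeta_grad_bound by blast
 let ?Q = "\<integral>\<^sup>+t. ennreal ((deriv q t)\<^sup>2) \<partial>lborel"
 have cyl: "(\<integral>\<^sup>+x. indicator ?D x * ennreal ((deriv q (x \<bullet> e + r * zeta \<rho> x))\<^sup>2) \<partial>lborel) = cvol ?D * ?Q" for r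
  unfolding cvol_def
  by (rule nn_integral_cylinder[where F="\<lambda>t. ennreal ((deriv q t)\<^sup>2)" and g="\<lambda>x. r * zeta \<rho> x"]) (auto simp: cube_e zeta_e)
 have fin: "cvol ?D * ?Q < \<infinity>" using cvol_cube_finite q_deriv_sq_finite by (simp add: ennreal_mult_less_top)
 have P: "(\<integral>\<^sup>+x. ennreal (indicator ?D x * (?p x)\<^sup>2) \<partial>lborel) < \<infinity>"
 proof -
  let ?f = "\<lambda>z. indicator ?D (fst z) * ennreal (s\<^sup>2 * (deriv q (fst z \<bullet> e + s * snd z * zeta \<rho> (fst z)))\<^sup>2 * indicator {0..1} (snd z))"
  have "(\<integral>\<^sup>+x. ennreal (indicator ?D x * (?p x)\<^sup>2) \<partial>lborel) \<le> (\<integral>\<^sup>+x. (\<integral>\<^sup>+r. ?f (x, r) \<partial>lborel) \<partial>lborel)"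
  proof (rule nn_integral_mono)
   fix x
   have "ennreal (indicator ?D x * (?p x)\<^sup>2) = indicator ?D x * ennreal ((?p x)\<^sup>2)" by (cases "x \<in> ?D") auto
   also have "\<dots> \<le> indicator ?D x * (\<integral>\<^sup>+r. ennreal ((s * zeta \<rho> x)\<^sup>2 * (deriv q (x \<bullet> e + s * zeta \<rho> x * r))\<^sup>2 * indicator {0..1} r) \<partial>lborel)"
    unfolding bent_def by (intro mult_left_mono q_increment_sq_le) simp
   also have "\<dots> \<le> indicator ?D x * (\<integral>\<^sup>+r. ennreal (s\<^sup>2 * (deriv q (x \<bullet> e + s * r * zeta \<rho> x))\<^sup>2 * indicator {0..1} r) \<partial>lborel)"
   proof (intro mult_left_mono nn_integral_mono ennreal_leI mult_right_mono)
    fix r :: real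
    have "(s * zeta \<rho> x)\<^sup>2 \<le> s\<^sup>2 * 1" unfolding power_mult_distrib
     using zeta_bounds[of \<rho> x] by (intro mult_left_mono power_le_one) auto
    then have "(s * zeta \<rho> x)\<^sup>2 \<le> s\<^sup>2" by simp
    from mult_right_mono[OF this, of "(deriv q (x \<bullet> e + s * r * zeta \<rho> x))\<^sup>2"]
    have "(s * zeta \<rho> x)\<^sup>2 * (deriv q (x \<bullet> e + s * r * zeta \<rho> x))\<^sup>2 \<le> s\<^sup>2 * (deriv q (x \<bullet> e + s * r * zeta \<rho> x))\<^sup>2" by simp
    moreover have "s * zeta \<rho> x * r = s * r * zeta \<rho> x" by simp
    ultimately show "(s * zeta \<rho> x)\<^sup>2 * (deriv q (x \<bullet> e + s * zeta \<rho> x * r))\<^sup>2 \<le> s\<^sup>2 * (deriv q (x \<bullet> e + s * r * zeta \<rho> x))\<^sup>2"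
     by (simp only:)
   qed auto
   also have "\<dots> = (\<integral>\<^sup>+r. ?f (x, r) \<partial>lborel)" by (subst nn_integral_cmult[symmetric]) auto
   finally show "ennreal (indicator ?D x * (?p x)\<^sup>2) \<le> (\<integral>\<^sup>+r. ?f (x, r) \<partial>lborel)" .
  qed
  \<comment> \<open>After the exchange, the shift for fixed r is constant along \<open>e\<close>, so
    the inner integral is the same for every r.\<close>
  also have "\<dots> = (\<integral>\<^sup>+r. (\<integral>\<^sup>+x. ?f (x, r) \<partial>lborel) \<partial>lborel)"
   by (rule lborel_pair.Fubini[symmetric]) measurable
  also have "\<dots> = (\<integral>\<^sup>+r. ennreal (s\<^sup>2) * (cvol ?D * ?Q) * indicator {0..1::real} r \<partial>lborel)"
  proof (rule nn_integral_cong)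
   fix r :: real
   have "?f (x, r) = (ennreal (s\<^sup>2) * indicator {0..1} r) * (indicator ?D x * ennreal ((deriv q (x \<bullet> e + s * r * zeta \<rho> x))\<^sup>2))" for x
    by (cases "r \<in> {0..1}"; cases "x \<in> ?D") (auto simp: ennreal_mult')
   then have "(\<integral>\<^sup>+x. ?f (x, r) \<partial>lborel) = (ennreal (s\<^sup>2) * indicator {0..1} r) * (\<integral>\<^sup>+x. indicator ?D x * ennreal ((deriv q (x \<bullet> e + s * r * zeta \<rho> x))\<^sup>2) \<partial>lborel)"
    by (simp only:) (rule nn_integral_cmult, measurable)
   also have "\<dots> = ennreal (s\<^sup>2) * (cvol ?D * ?Q) * indicator {0..1} r" unfolding cyl by (simp add: ac_simps)
   finally show "(\<integral>\<^sup>+x. ?f (x, r) \<partial>lborel) = \<dots>" .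
  qed
  also have "\<dots> = ennreal (s\<^sup>2) * (cvol ?D * ?Q)" by (simp add: nn_integral_cmult_indicator)
  also have "\<dots> < \<infinity>" using fin by (simp add: ennreal_mult_less_top)
  finally show ?thesis .
 qed
 define A where "A = (1 + \<bar>s\<bar> * L)\<^sup>2"
 have g: "(norm (grad_fn ?p x))\<^sup>2 \<le> 2 * A * (deriv q (x \<bullet> e + s * zeta \<rho> x))\<^sup>2 + 2 * (deriv q (x \<bullet> e + 0 * zeta \<rho> x))\<^sup>2" for x
 proof -
  have "grad_fn ?p x = grad_fn (bent s \<rho>) x + (- 1) *\<^sub>R grad_fn (\<lambda>x. qe x) x"
   using has_derivative_diff[OF smooth_fn_has_derivative_grad[OF bent_smooth[of s \<rho>], of x] smooth_fn_has_derivative_grad[OF qe_smooth, of x]]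
   by (intro grad_fn_eqI) (simp add: inner_diff_left)
  then have "(norm (grad_fn ?p x))\<^sup>2 \<le> 2 * (norm (grad_fn (bent s \<rho>) x))\<^sup>2 + 2 * (norm ((- 1) *\<^sub>R grad_fn (\<lambda>x. qe x) x))\<^sup>2"
   by (simp only: norm_sq_add_le)
  also have "(norm (grad_fn (bent s \<rho>) x))\<^sup>2 \<le> A * (deriv q (x \<bullet> e + s * zeta \<rho> x))\<^sup>2"
  proof -
   have "norm (e + s *\<^sub>R grad_fn (zeta \<rho>) x) \<le> 1 + \<bar>s\<bar> * L"
    using norm_triangle_ineq[of e "s *\<^sub>R grad_fn (zeta \<rho>) x"] norm_e mult_left_mono[OF L(2)[of \<rho> x], of "\<bar>s\<bar>"] by simp
   then have "(norm (e + s *\<^sub>R grad_fn (zeta \<rho>) x))\<^sup>2 \<le> A" unfolding A_def by (intro power_mono) auto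
   from mult_right_mono[OF this, of "(deriv q (x \<bullet> e + s * zeta \<rho> x))\<^sup>2"]
   show ?thesis unfolding bent_grad norm_scaleR power_mult_distrib by (simp add: mult.commute)
  qed
  finally show ?thesis using norm_e by (simp add: qe_grad)
 qed
 have "sob ?D ?p (grad_fn ?p) \<le> (\<integral>\<^sup>+x. ennreal (indicator ?D x * (?p x)\<^sup>2) + (ennreal (2 * A) * (indicator ?D x * ennreal ((deriv q (x \<bullet> e + s * zeta \<rho> x))\<^sup>2))
   + 2 * (indicator ?D x * ennreal ((deriv q (x \<bullet> e + 0 * zeta \<rho> x))\<^sup>2))) \<partial>lborel)"
  unfolding sob_def nn_integral_completion
 proof (rule nn_integral_mono)
  fix x
  show "ennreal (indicator ?D x * ((?p x)\<^sup>2 + (norm (grad_fn ?p x))\<^sup>2)) \<le> ennreal (indicator ?D x * (?p x)\<^sup>2)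
   + (ennreal (2 * A) * (indicator ?D x * ennreal ((deriv q (x \<bullet> e + s * zeta \<rho> x))\<^sup>2)) + 2 * (indicator ?D x * ennreal ((deriv q (x \<bullet> e + 0 * zeta \<rho> x))\<^sup>2)))"
  proof (cases "x \<in> ?D")
   case True
   have "ennreal ((?p x)\<^sup>2 + (norm (grad_fn ?p x))\<^sup>2) \<le> ennreal ((?p x)\<^sup>2 + (2 * A * (deriv q (x \<bullet> e + s * zeta \<rho> x))\<^sup>2 + 2 * (deriv q (x \<bullet> e + 0 * zeta \<rho> x))\<^sup>2))"
    using g[of x] by (intro ennreal_leI) auto
   also have "\<dots> = ennreal ((?p x)\<^sup>2) + (ennreal (2 * A) * ennreal ((deriv q (x \<bullet> e + s * zeta \<rho> x))\<^sup>2) + 2 * ennreal ((deriv q (x \<bullet> e + 0 * zeta \<rho> x))\<^sup>2))"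
    by (simp add: A_def ennreal_mult')
   finally show ?thesis using True by simp
  qed simp
 qed
 also have "\<dots> = (\<integral>\<^sup>+x. ennreal (indicator ?D x * (?p x)\<^sup>2) \<partial>lborel) + (ennreal (2 * A) * (cvol ?D * ?Q) + 2 * (cvol ?D * ?Q))"
 proof -
  have [measurable]: "bent s \<rho> \<in> borel_measurable borel" by (rule smooth_fn_borel_measurable[OF bent_smooth])
  have m1: "(\<lambda>x. ennreal (indicator ?D x * (?p x)\<^sup>2)) \<in> borel_measurable lborel" by measurable
  have m2: "(\<lambda>x. indicator ?D x * ennreal ((deriv q (x \<bullet> e + r * zeta \<rho> x))\<^sup>2)) \<in> borel_measurable lborel" for r by measurable
  show ?thesis
   by (subst nn_integral_add[OF m1]) (use m2[of s] m2[of 0] in measurable, subst nn_integral_add,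
     use m2[of s] m2[of 0] in \<open>auto simp only: nn_integral_cmult cyl borel_measurable_times_ennreal borel_measurable_const\<close>)
 qed
 also have "\<dots> < \<infinity>" using P fin by (simp add: ennreal_mult_less_top)
 finally show ?thesis .
qed


lemma dom_UNIV: "dom y \<rho> UNIV = cube y \<rho>" by (simp add: dom_cube)

text \<open>Laterally the support is compact because of \<open>zeta\<close>; along \<open>e\<close>
  it is made compact by plateaus of growing height, which the finite norm allows to be removed in
  the limit.\<close>

lemma bent_H10: "H10 (cube 0 (\<rho> + 1)) (\<lambda>x. bent s \<rho> x - qe x) (grad_fn (\<lambda>x. bent s \<rho> x - qe x))"
proof -
 obtain L0 where L0: "\<And>t. \<bar>deriv smooth_step t\<bar> \<le> L0" using smooth_step_deriv_bound by blast
 let ?p = "\<lambda>x. bent s \<rho> x - qe x"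
 have ps: "smooth_fn ?p" by (rule smooth_fn_diff[OF bent_smooth qe_smooth])
 show ?thesis
 proof (rule H10_smooth[OF open_cube ps bent_sob_finite, where \<eta>="\<lambda>n. plateau 1 (real n) e" and L="2 * 1 * L0"])
  show "smooth_fn (plateau 1 (real n) e)" for n by (rule smooth_fn_plateau)
  show "\<bar>plateau 1 (real n) e x\<bar> \<le> 1" for n x using plateau_bounds[of 1 "real n" e x] by simp
  show "norm (grad_fn (plateau 1 (real n) e) x) \<le> 2 * 1 * L0" for n x
   by (rule plateau_grad_bound[OF L0 _ norm_e]) simp
  show "eventually (\<lambda>n. plateau 1 (real n) e x = 1 \<and> grad_fn (plateau 1 (real n) e) x = 0) sequentially" for x
  proof -
   obtain N :: nat where N: "\<bar>x \<bullet> e\<bar> < real N" using reals_Archimedean2 by blast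
   have "plateau 1 (real n) e x = 1 \<and> grad_fn (plateau 1 (real n) e) x = 0" if "n \<ge> N" for n
    using N that plateau_eq_1[of 1 x e "real n"] plateau_grad_eq_0[of 1 x e "real n"] by simp
   then show ?thesis unfolding eventually_sequentially by blast
  qed
  fix n
  let ?K = "{x. \<bar>x \<bullet> e\<bar> \<le> real n + 1} \<inter> (\<Inter>b\<in>B. {x. \<bar>x \<bullet> b\<bar> \<le> \<rho> + 1 / 2})"
  let ?f = "\<lambda>x. plateau 1 (real n) e x * ?p x"
  have cl: "closed ?K" using finB by (intro closed_Int closed_INT ballI closed_Collect_le continuous_intros)
  have "?K \<subseteq> dom 0 (\<rho> + 1) {- (real n + 2)<..<real n + 2}" by (auto simp: dom_def abs_le_iff) (force simp: abs_le_iff)+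
  then have "bounded ?K" by (rule bounded_subset[OF bounded_dom, rotated]) simp
  then have K: "compact ?K" using cl by (simp add: compact_eq_bounded_closed)
  have z: "?f x = 0" if nK: "x \<notin> ?K" for x
  proof (cases "\<bar>x \<bullet> e\<bar> \<le> real n + 1")
   case True
   then obtain b where "b \<in> B" "\<rho> + 1 / 2 < \<bar>x \<bullet> b\<bar>" using nK by (auto simp: not_le)
   then have "zeta \<rho> x = 0" by (intro zeta_eq_0) auto
   then show ?thesis by (simp add: bent_def)
  next
   case False
   then have "plateau 1 (real n) e x = 0" by (intro plateau_eq_0) auto
   then show ?thesis by simp
  qed
  have "tsupport ?f \<subseteq> ?K" by (rule tsupport_subsetI[OF compact_imp_closed[OF K]]) (rule z)
  moreover have "compact (tsupport ?f)" by (rule compact_tsupportI[OF K]) (rule z)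
  moreover have "?K \<subseteq> cube 0 (\<rho> + 1)" by (force simp: cube_def)
  ultimately show "test_fn (cube 0 (\<rho> + 1)) ?f"
   unfolding test_fn_def using smooth_fn_mult[OF smooth_fn_plateau ps] by (meson subset_trans)
 qed
qed

text \<open>In the inner cube the competitor is the given one shifted by s along \<open>e\<close>;
  its boundary values are those of the shifted profile. In the shell of width one the bent profile
  leads back to the unshifted one. The constant depends on s but not on the size, so the extra cost
  is a surface term.\<close>

lemma mE_shift_e:
 "\<exists>C\<ge>0. \<forall>\<rho> \<omega>. \<omega> \<in> space M \<longrightarrow>
   mE (\<tau> (s *\<^sub>R e) \<omega>) (dom 0 (\<rho> + 1) UNIV) \<le> mE \<omega> (dom 0 \<rho> UNIV) + ennreal C * V (dom 0 (\<rho> + 1) UNIV - dom 0 \<rho> UNIV)"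
proof -
 obtain L where L: "0 \<le> L" "\<And>\<rho> x. norm (grad_fn (zeta \<rho>) x) \<le> L" using zeta_grad_bound by blast
 \<comment> \<open>Bounds the squared norm of
   \<open>e + s *\<^sub>R grad_fn (zeta \<rho>) x\<close>, by which bending stretches the gradient.
   Being at least 1 it also dominates the coefficient of the potential.\<close>
 define C where "C = (1 + \<bar>s\<bar> * L)\<^sup>2"
 have C1: "1 \<le> C" unfolding C_def using L by (simp add: one_le_power)
 show ?thesis
 proof (intro exI[of _ C] conjI allI impI)
  show "0 \<le> C" using C1 by simp
  fix \<rho> \<omega> assume w: "\<omega> \<in> space M"
  let ?D = "cube 0 \<rho>" and ?D' = "cube 0 (\<rho> + 1)" and ?w = "\<tau> (s *\<^sub>R e) \<omega>"
  have D: "open ?D" "open ?D'" by (rule open_cube)+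
  have sub: "?D \<subseteq> ?D'" by (rule cube_subset) simp
  have tD: "{x. x + s *\<^sub>R e \<in> ?D} = ?D" by (simp add: cube_e)
  let ?p = "\<lambda>x. bent s \<rho> x - qe x"
  have pg: "dqe x *\<^sub>R e + grad_fn ?p x = grad_fn (bent s \<rho>) x" for x
  proof -
   have "grad_fn ?p x = grad_fn (bent s \<rho>) x - grad_fn (\<lambda>x. qe x) x"
    using has_derivative_diff[OF smooth_fn_has_derivative_grad[OF bent_smooth[of s \<rho>], of x] smooth_fn_has_derivative_grad[OF qe_smooth, of x]]
    by (intro grad_fn_eqI) (simp add: inner_diff_left)
   then show ?thesis by (simp add: qe_grad)
  qed
  let ?R = "?D' - ?D"
  have Rm [measurable]: "?R \<in> sets borel" by measurable
  have "mE ?w ?D' \<le> ener \<omega> ?D v G + ennreal C * V ?R" if a: "(v, G) \<in> Adm ?D" for v G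
  proof -
   let ?v = "\<lambda>x. ?p x + indicator ?D x * v (x + s *\<^sub>R e)" and ?G = "\<lambda>x. grad_fn ?p x + indicator ?D x *\<^sub>R G (x + s *\<^sub>R e)"
   have "H10 ?D (\<lambda>x. v (x + s *\<^sub>R e)) (\<lambda>x. G (x + s *\<^sub>R e))"
    using H10_translate[OF D(1) AdmD(1)[OF D(1) a], of "s *\<^sub>R e"] unfolding tD .
   then have "H10 ?D' (\<lambda>x. indicator ?D x * v (x + s *\<^sub>R e)) (\<lambda>x. indicator ?D x *\<^sub>R G (x + s *\<^sub>R e))"
    by (rule H10_extend[OF D(2,1) sub])
   then have H: "H10 ?D' ?v ?G" by (rule H10_add[OF D(2) bent_H10])
   have vin: "qe x + ?v x = q ((x + s *\<^sub>R e) \<bullet> e) + v (x + s *\<^sub>R e)"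
     "dqe x *\<^sub>R e + ?G x = deriv q ((x + s *\<^sub>R e) \<bullet> e) *\<^sub>R e + G (x + s *\<^sub>R e)" if "x \<in> ?D" for x
    using that pg[of x] by (simp_all add: bent_def bent_grad zeta_eq_1 zeta_grad_eq_0 inner_add_left add.assoc[symmetric])
   have vout: "qe x + ?v x = bent s \<rho> x" "dqe x *\<^sub>R e + ?G x = grad_fn (bent s \<rho>) x" if "x \<notin> ?D" for x
    using that pg[of x] by simp_all
   have "qe x + ?v x \<in> {-1..1}" for x
   proof (cases "x \<in> ?D")
    case True
    then have "x + s *\<^sub>R e \<in> ?D" by (simp add: cube_e)
    from AdmD(3)[OF D(1) a this] show ?thesis unfolding vin(1)[OF True] .
   next
    case False
    then show ?thesis unfolding vout(1)[OF False] bent_def using q_range by simp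
   qed
   then have adm: "(?v, ?G) \<in> Adm ?D'" unfolding Adm_def using H by simp
   let ?d = "dens \<omega> ?D (\<lambda>x. qe x + v x) (\<lambda>x. dqe x *\<^sub>R e + G x)"
   have dm: "(\<lambda>x. ennreal (?d x)) \<in> borel_measurable lebesgue" using Adm_dens_measurable[OF w D(1) a] by measurable
   have "mE ?w ?D' \<le> ener ?w ?D' ?v ?G" by (rule ener_lower[OF adm])
   also have "\<dots> \<le> (\<integral>\<^sup>+x. ennreal (?d (x + s *\<^sub>R e)) + ennreal C * (indicator ?R x * ennreal (f0 (x \<bullet> e + s * zeta \<rho> x))) \<partial>lebesgue)"
    unfolding ener_def energy_dens
   proof (rule nn_integral_mono)
    fix x
    let ?dh = "dens ?w ?D' (\<lambda>x. qe x + ?v x) (\<lambda>x. dqe x *\<^sub>R e + ?G x) x"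
    consider "x \<in> ?D" | "x \<in> ?R" | "x \<notin> ?D'" by blast
    then show "ennreal ?dh \<le> ennreal (?d (x + s *\<^sub>R e)) + ennreal C * (indicator ?R x * ennreal (f0 (x \<bullet> e + s * zeta \<rho> x)))"
    proof cases
     case 1
     have "x \<in> ?D'" using 1 sub by blast
     have "\<tau> x ?w = \<tau> (x + s *\<^sub>R e) \<omega>" using tau_add[OF w, of x "s *\<^sub>R e"] by simp
     then have "?dh = ?d (x + s *\<^sub>R e)"
      unfolding dens_def vin[OF 1] using 1 \<open>x \<in> ?D'\<close> by (simp add: cube_e)
     then show ?thesis by simp
    next
     case 2
     then have xD: "x \<in> ?D'" "x \<notin> ?D" by auto
     have "?dh = 1 / 2 * (\<Phi> (\<tau> x ?w) (grad_fn (bent s \<rho>) x))\<^sup>2 + W (bent s \<rho> x)"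
      unfolding dens_def vout[OF xD(2)] using xD by simp
     also have "\<dots> \<le> Lam / 2 * (norm (grad_fn (bent s \<rho>) x))\<^sup>2 + W (bent s \<rho> x)"
      using Phi_sq_le[OF tau_space[OF w], of x "s *\<^sub>R e" "grad_fn (bent s \<rho>) x"] by simp
     also have "\<dots> \<le> C * f0 (x \<bullet> e + s * zeta \<rho> x)"
     proof -
      let ?t = "x \<bullet> e + s * zeta \<rho> x"
      have "norm (e + s *\<^sub>R grad_fn (zeta \<rho>) x) \<le> 1 + \<bar>s\<bar> * L"
       using norm_triangle_ineq[of e "s *\<^sub>R grad_fn (zeta \<rho>) x"] norm_e mult_left_mono[OF L(2)[of \<rho> x], of "\<bar>s\<bar>"] by simp
      then have "(norm (e + s *\<^sub>R grad_fn (zeta \<rho>) x))\<^sup>2 \<le> C" unfolding C_def by (intro power_mono) auto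
      from mult_right_mono[OF this, of "(deriv q ?t)\<^sup>2"]
      have "(norm (grad_fn (bent s \<rho>) x))\<^sup>2 \<le> C * (deriv q ?t)\<^sup>2"
       unfolding bent_grad norm_scaleR power_mult_distrib by (simp add: mult.commute)
      then have 1: "Lam / 2 * (norm (grad_fn (bent s \<rho>) x))\<^sup>2 \<le> Lam / 2 * (C * (deriv q ?t)\<^sup>2)"
       using Lam_pos by (intro mult_left_mono) auto
      have "W (bent s \<rho> x) = 1 * Wc (q ?t)" using q_range[of ?t] by (simp add: bent_def Wc_eq)
      also have "\<dots> \<le> C * Wc (q ?t)" using C1 Wc_nonneg by (rule mult_right_mono)
      finally show ?thesis using 1 by (simp add: f0_def algebra_simps)
     qed
     finally have "ennreal ?dh \<le> ennreal C * ennreal (f0 (x \<bullet> e + s * zeta \<rho> x))"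
      using C1 f0_nonneg by (subst ennreal_mult[symmetric]) (auto intro!: ennreal_leI)
     then show ?thesis using 2 by (simp add: add_increasing)
    next
     case 3
     then show ?thesis by (simp add: dens_def)
    qed
   qed
   also have "\<dots> = (\<integral>\<^sup>+x. ennreal (?d (x + s *\<^sub>R e)) \<partial>lebesgue) + ennreal C * (\<integral>\<^sup>+x. indicator ?R x * ennreal (f0 (x \<bullet> e + s * zeta \<rho> x)) \<partial>lebesgue)"
   proof -
    have "(\<lambda>x. indicator ?R x * ennreal (f0 (x \<bullet> e + s * zeta \<rho> x))) \<in> borel_measurable lborel" by measurable
    then have m2: "(\<lambda>x. indicator ?R x * ennreal (f0 (x \<bullet> e + s * zeta \<rho> x))) \<in> borel_measurable lebesgue"
     by (rule measurable_completion)
    have m1: "(\<lambda>x. ennreal (?d (x + s *\<^sub>R e))) \<in> borel_measurable lebesgue"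
     by (rule measurable_compose[OF lebesgue_translate(1) dm])
    show ?thesis
     unfolding nn_integral_add[OF m1 borel_measurable_times_ennreal[OF borel_measurable_const m2]] nn_integral_cmult[OF m2] ..
   qed
   also have "(\<integral>\<^sup>+x. ennreal (?d (x + s *\<^sub>R e)) \<partial>lebesgue) = ener \<omega> ?D v G"
    unfolding ener_def energy_dens by (rule nn_integral_lebesgue_translate[OF dm])
   also have "(\<integral>\<^sup>+x. indicator ?R x * ennreal (f0 (x \<bullet> e + s * zeta \<rho> x)) \<partial>lebesgue) = V ?R"
   proof -
    have Re: "x + t *\<^sub>R e \<in> ?R \<longleftrightarrow> x \<in> ?R" for x t by (simp add: cube_e)
    have "(\<integral>\<^sup>+x. indicator ?R x * ennreal (f0 (x \<bullet> e + s * zeta \<rho> x)) \<partial>lborel) = emeasure lborel (?R \<inter> slab0) * (\<integral>\<^sup>+t. ennreal (f0 t) \<partial>lborel)"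
     by (rule nn_integral_cylinder[where F="\<lambda>t. ennreal (f0 t)" and g="\<lambda>x. s * zeta \<rho> x"]) (use Re in \<open>auto simp: zeta_e\<close>)
    moreover have "V ?R = cvol ?R * qmass UNIV" using V_cylinder[OF Rm Re, of UNIV] by simp
    ultimately show ?thesis by (simp add: nn_integral_completion cvol_def qmass_def)
   qed
   finally show ?thesis .
  qed
  note key = this
  have "V ?R \<le> V (dom 0 (\<rho> + 1) UNIV)"
   unfolding V_def dom_UNIV by (intro nn_integral_mono ennreal_leI mult_right_mono f0_nonneg) (auto simp: indicator_def)
  then have "V ?R < \<top>" using V_dom_finite[of "\<rho> + 1" UNIV] by (simp add: order_le_less_trans)
  then have K: "ennreal C * V ?R < \<top>" by (simp add: ennreal_mult_less_top)
  have iff: "a - k \<le> b \<longleftrightarrow> a \<le> b + k" if "k < \<top>" for a b k :: ennreal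
   using ennreal_minus_le_iff[of a k b] that by (auto simp: add.commute)
  have "mE ?w ?D' - ennreal C * V ?R \<le> mE \<omega> ?D"
   unfolding mE_def[of \<omega>]
  proof (rule INF_greatest, clarify)
   fix v G assume "(v, G) \<in> Adm ?D"
   from key[OF this] show "mE ?w ?D' - ennreal C * V ?R \<le> ener \<omega> ?D v G"
    by (simp only: iff[OF K])
  qed
  then have "mE ?w ?D' \<le> mE \<omega> ?D + ennreal C * V ?R"
   by (simp only: iff[OF K])
  then show "mE ?w (dom 0 (\<rho> + 1) UNIV) \<le> mE \<omega> (dom 0 \<rho> UNIV) + ennreal C * V (dom 0 (\<rho> + 1) UNIV - dom 0 \<rho> UNIV)"
   by (simp add: dom_UNIV)
 qed
qed

end

section \<open>Measurability of the minimal energy\<close>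

text \<open>A countable family of step functions, indexed by a mesh \<open>k\<close> and a list of values: the value at
 \<open>x\<close> is selected by the first point of a fixed dense sequence at distance less than \<open>1 / (k + 1)\<close>.\<close>

definition dense_seq :: "nat \<Rightarrow> 'a::{second_countable_topology,real_normed_vector}" where
 "dense_seq = (SOME c. \<forall>U. open U \<and> U \<noteq> {} \<longrightarrow> (\<exists>i. c i \<in> U))"

lemma dense_seq: "open U \<Longrightarrow> U \<noteq> {} \<Longrightarrow> \<exists>i. (dense_seq i :: 'a::{second_countable_topology,real_normed_vector}) \<in> U"
proof -
 obtain C :: "'a set" where C: "countable C" "\<And>U. open U \<Longrightarrow> U \<noteq> {} \<Longrightarrow> \<exists>d\<in>C. d \<in> U"
  using countable_dense_exists by blast
 have "\<forall>U. open U \<and> U \<noteq> {} \<longrightarrow> (\<exists>i. from_nat_into C i \<in> U)"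
 proof (intro allI impI)
  fix U :: "'a set" assume "open U \<and> U \<noteq> {}"
  then obtain d where "d \<in> C" "d \<in> U" using C(2) by blast
  then show "\<exists>i. from_nat_into C i \<in> U" using from_nat_into_surj[OF C(1)] by metis
 qed
 from someI[of "\<lambda>c. \<forall>U. open U \<and> U \<noteq> {} \<longrightarrow> (\<exists>i. c i \<in> U)", OF this]
 show "open U \<Longrightarrow> U \<noteq> {} \<Longrightarrow> \<exists>i. dense_seq i \<in> U" unfolding dense_seq_def by blast
qed

definition cell_index :: "nat \<Rightarrow> 'a::euclidean_space \<Rightarrow> nat" where
 "cell_index k x = (LEAST i. dist x (dense_seq i) < 1 / real (Suc k))"

definition step_fn :: "nat \<times> nat list \<Rightarrow> 'a::euclidean_space \<Rightarrow> real \<times> 'a" where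
 "step_fn p x = (if cell_index (fst p) x < length (snd p) then dense_seq (snd p ! cell_index (fst p) x) else 0)"

lemma cell_index_dist: "dist x (dense_seq (cell_index k x)) < 1 / real (Suc k)"
proof -
 have "\<exists>i. dense_seq i \<in> ball x (1 / real (Suc k))" by (rule dense_seq) auto
 then obtain i where "dist x (dense_seq i) < 1 / real (Suc k)" by auto
 then show ?thesis unfolding cell_index_def by (rule LeastI)
qed

lemma cell_index_measurable [measurable]: "cell_index k \<in> borel \<rightarrow>\<^sub>M count_space UNIV"
 unfolding cell_index_def[abs_def] by measurable

lemma step_fn_measurable [measurable]: "step_fn p \<in> borel_measurable borel"
proof -
 have "(\<lambda>i. if i < length (snd p) then dense_seq (snd p ! i) else (0 :: real \<times> 'a)) \<in> borel_measurable (count_space UNIV)" by simp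
 from measurable_compose[OF cell_index_measurable this] show ?thesis unfolding step_fn_def[abs_def] .
qed

lemma measH_step: "D \<in> sets lebesgue \<Longrightarrow> measH D (\<lambda>x. fst (step_fn p x)) (\<lambda>x. snd (step_fn p x))"
proof -
 assume [measurable]: "D \<in> sets lebesgue"
 have [measurable]: "(\<lambda>x. fst (step_fn p x)) \<in> borel_measurable lebesgue" "(\<lambda>x. snd (step_fn p x)) \<in> borel_measurable lebesgue"
  using measurable_compose[OF step_fn_measurable[of p] borel_measurable_continuous_onI[of fst]]
   measurable_compose[OF step_fn_measurable[of p] borel_measurable_continuous_onI[of snd]]
  by (auto intro!: measurable_completion simp: continuous_on_fst continuous_on_snd continuous_on_id)
 show ?thesis unfolding measH_def by (intro conjI; measurable)
qed

text \<open>The function and its gradient are uniformly continuous, so it suffices to freeze them at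
  the selected dense points and round the values to the dense sequence. Compactness of the closure
  shows that finitely many points are selected, hence a finite list of values is enough.\<close>

lemma step_fn_approx:
 fixes \<psi> :: "'a::euclidean_space \<Rightarrow> real"
 assumes s: "smooth_fn \<psi>" and D: "bounded D" "open D" and d: "0 < \<delta>"
 shows "\<exists>p. sob D (\<lambda>x. \<psi> x - fst (step_fn p x)) (\<lambda>x. grad_fn \<psi> x - snd (step_fn p x)) \<le> ennreal \<delta>"
proof -
 obtain R where R: "\<And>x. x \<in> D \<Longrightarrow> norm x \<le> R" using D(1) unfolding bounded_iff by blast
 \<comment> \<open>The radius is enlarged by one because the selected dense points may lie outside
   \<open>D\<close>.\<close>
 let ?K = "cball (0::'a) (R + 1)" and ?F = "\<lambda>x. (\<psi> x, grad_fn \<psi> x)"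
 define vol where "vol = enn2real (emeasure lborel D)"
 have vol: "emeasure lborel D = ennreal vol"
  using emeasure_bounded_finite[OF D(1)] by (simp add: vol_def ennreal_enn2real_if less_top)
 have v0: "0 \<le> vol" by (simp add: vol_def)
 \<comment> \<open>Freezing and rounding each cost \<epsilon>; the square of their sum times the
   volume must not exceed \<delta>.\<close>
 define \<epsilon> where "\<epsilon> = sqrt (\<delta> / (vol + 1)) / 2"
 have e0: "0 < \<epsilon>" using d v0 by (simp add: \<epsilon>_def)
 have e2: "(2 * \<epsilon>)\<^sup>2 * vol \<le> \<delta>"
 proof -
  have "(2 * \<epsilon>)\<^sup>2 = \<delta> / (vol + 1)" using d v0 by (simp add: \<epsilon>_def)
  then show ?thesis using d v0 by (simp add: pos_divide_le_eq algebra_simps)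
 qed
 have "continuous_on ?K ?F" by (intro continuous_intros smooth_fn_continuous grad_fn_continuous s)
 then have "uniformly_continuous_on ?K ?F" by (intro compact_uniformly_continuous) auto
 then obtain d1 where d1: "0 < d1" "\<And>x y. x \<in> ?K \<Longrightarrow> y \<in> ?K \<Longrightarrow> dist y x < d1 \<Longrightarrow> dist (?F y) (?F x) < \<epsilon>"
  using e0 unfolding uniformly_continuous_on_def by blast
 obtain k where k: "1 / real (Suc k) < min d1 1" using d1(1) reals_Archimedean[of "min d1 1"] by (auto simp: inverse_eq_divide)
 have "\<exists>m. \<forall>x\<in>D. cell_index k x < m"
 proof -
  have cpt: "compact (closure D)" using D(1) by (simp add: compact_closure)
  have cov: "closure D \<subseteq> (\<Union>i\<in>UNIV. ball (dense_seq i) (1 / real (Suc k)))"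
   using cell_index_dist by (force simp: dist_commute)
  obtain I where I: "I \<subseteq> UNIV" "finite I" "closure D \<subseteq> (\<Union>i\<in>I. ball (dense_seq i) (1 / real (Suc k)))"
   by (rule compactE_image[OF cpt _ cov]) auto
  obtain m where m: "\<And>i. i \<in> I \<Longrightarrow> i < m" using I(2) by (meson finite_nat_set_iff_bounded)
  have "cell_index k x < m" if "x \<in> D" for x
  proof -
   have "x \<in> closure D" using that closure_subset by blast
   then obtain i where i: "i \<in> I" "dist x (dense_seq i) < 1 / real (Suc k)" using I(3) by (auto simp: dist_commute)
   then have "cell_index k x \<le> i" unfolding cell_index_def by (intro Least_le)
   then show ?thesis using m[OF i(1)] by simp
  qed
  then show ?thesis by blast
 qed
 then obtain m where m: "\<And>x. x \<in> D \<Longrightarrow> cell_index k x < m" by blast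
 have "\<exists>j. dist (?F (dense_seq i)) (dense_seq j) < \<epsilon>" for i
 proof -
  have "\<exists>j. dense_seq j \<in> ball (?F (dense_seq i)) \<epsilon>" using e0 by (intro dense_seq) auto
  then show ?thesis by auto
 qed
 then obtain J where J: "\<And>i. dist (?F (dense_seq i)) (dense_seq (J i)) < \<epsilon>" by metis
 let ?p = "(k, map J [0..<m])"
 have close: "norm (?F x - step_fn ?p x) \<le> 2 * \<epsilon>" if x: "x \<in> D" for x
 proof -
  let ?i = "cell_index k x"
  have sp: "step_fn ?p x = dense_seq (J ?i)" using m[OF x] by (simp add: step_fn_def)
  have di: "dist x (dense_seq ?i) < 1 / real (Suc k)" by (rule cell_index_dist)
  then have dd: "dist x (dense_seq ?i) < d1" "dist x (dense_seq ?i) < 1"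
   using k unfolding min_less_iff_conj by linarith+
  have xK: "x \<in> ?K" using R[OF x] by simp
  have "norm (dense_seq ?i :: 'a) \<le> norm x + dist x (dense_seq ?i)"
   using norm_triangle_ineq4[of x "x - dense_seq ?i"] by (simp add: dist_norm)
  then have "norm (dense_seq ?i :: 'a) \<le> R + 1" using R[OF x] dd(2) by linarith
  then have cK: "dense_seq ?i \<in> ?K" by simp
  have "dist (?F x) (?F (dense_seq ?i)) < \<epsilon>" by (rule d1(2)[OF cK xK dd(1)])
  then have "dist (?F x) (dense_seq (J ?i)) < 2 * \<epsilon>" using J[of ?i] dist_triangle[of "?F x" "dense_seq (J ?i)" "?F (dense_seq ?i)"] by simp
  then show ?thesis unfolding sp by (simp add: dist_norm)
 qed
 have "sob D (\<lambda>x. \<psi> x - fst (step_fn ?p x)) (\<lambda>x. grad_fn \<psi> x - snd (step_fn ?p x)) \<le> (\<integral>\<^sup>+x. ennreal ((2 * \<epsilon>)\<^sup>2) * indicator D x \<partial>lebesgue)"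
  unfolding sob_def
 proof (rule nn_integral_mono)
  fix x
  show "ennreal (indicator D x * ((\<psi> x - fst (step_fn ?p x))\<^sup>2 + (norm (grad_fn \<psi> x - snd (step_fn ?p x)))\<^sup>2)) \<le> ennreal ((2 * \<epsilon>)\<^sup>2) * indicator D x"
  proof (cases "x \<in> D")
   case True
   have "(norm (?F x - step_fn ?p x))\<^sup>2 \<le> (2 * \<epsilon>)\<^sup>2" using close[OF True] by (intro power_mono) auto
   then have "(\<psi> x - fst (step_fn ?p x))\<^sup>2 + (norm (grad_fn \<psi> x - snd (step_fn ?p x)))\<^sup>2 \<le> (2 * \<epsilon>)\<^sup>2"
    by (simp add: norm_prod_def)
   then show ?thesis using True by (simp add: ennreal_leI del: ennreal_plus)
  qed simp
 qed
 also have "\<dots> = ennreal ((2 * \<epsilon>)\<^sup>2) * emeasure lborel D" using D(2) by (simp add: nn_integral_completion nn_integral_cmult_indicator)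
 also have "\<dots> = ennreal ((2 * \<epsilon>)\<^sup>2 * vol)" unfolding vol by (rule ennreal_mult[symmetric]) (use v0 in auto)
 also have "\<dots> \<le> ennreal \<delta>" using e2 by (rule ennreal_leI)
 finally show ?thesis by blast
qed

section \<open>Separability of the set of competitors\<close>

context medium
begin

lemma sob_sym: "sob D (\<lambda>x. w x - w' x) (\<lambda>x. G x - G' x) = sob D (\<lambda>x. w' x - w x) (\<lambda>x. G' x - G x)"
 unfolding sob_def by (simp add: power2_commute norm_minus_commute)

lemma sob_triangle:
 assumes "measH D w G" "measH D w' G'" "measH D w'' G''"
 shows "sob D (\<lambda>x. w x - w'' x) (\<lambda>x. G x - G'' x)
  \<le> 2 * sob D (\<lambda>x. w x - w' x) (\<lambda>x. G x - G' x) + 2 * sob D (\<lambda>x. w' x - w'' x) (\<lambda>x. G' x - G'' x)"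
 using sob_add_le[OF measH_diff[OF assms(1,2)] measH_diff[OF assms(2,3)]] by simp

text \<open>Step functions are countable and dense but need not be admissible. For each step
  function and each accuracy that some admissible pair attains, one such pair is picked: a subset of
  a separable space is separable.\<close>

lemma Adm_separable:
 assumes D: "open D" "bounded D"
 shows "\<exists>A. countable A \<and> A \<subseteq> Adm D \<and> (\<forall>v G \<delta>. (v, G) \<in> Adm D \<longrightarrow> 0 < \<delta> \<longrightarrow>
   (\<exists>(v', G')\<in>A. sob D (\<lambda>x. v x - v' x) (\<lambda>x. G x - G' x) \<le> ennreal \<delta>))"
proof -
 have Dm: "D \<in> sets lebesgue" using D by (simp add: borel_open)
 let ?ds = "\<lambda>a p. sob D (\<lambda>x. fst a x - fst (step_fn p x)) (\<lambda>x. snd a x - snd (step_fn p x))"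
 have am: "measH D (fst a) (snd a)" if "a \<in> Adm D" for a
  using that H10D(1)[OF D(1)] by (auto simp: Adm_def)
 have near: "\<exists>p. ?ds a p \<le> ennreal \<delta>" if a: "a \<in> Adm D" and d: "0 < \<delta>" for a \<delta>
 proof -
  have H: "H10 D (fst a) (snd a)" using a by (auto simp: Adm_def)
  obtain \<psi> where t: "\<And>n. test_fn D (\<psi> n)" and
   l: "(\<lambda>n. sob D (\<lambda>x. fst a x - \<psi> n x) (\<lambda>x. snd a x - grad_fn (\<psi> n) x)) \<longlonglongrightarrow> 0"
   using H10D(3)[OF D(1) H] by blast
  have "eventually (\<lambda>n. sob D (\<lambda>x. fst a x - \<psi> n x) (\<lambda>x. snd a x - grad_fn (\<psi> n) x) < ennreal (\<delta> / 4)) sequentially"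
   using d by (intro order_tendstoD(2)[OF l]) auto
  then obtain n where n: "sob D (\<lambda>x. fst a x - \<psi> n x) (\<lambda>x. snd a x - grad_fn (\<psi> n) x) < ennreal (\<delta> / 4)"
   by (auto simp: eventually_sequentially)
  have ts: "smooth_fn (\<psi> n)" using t by (auto simp: test_fn_def)
  have d4: "0 < \<delta> / 4" using d by simp
  obtain p where p: "sob D (\<lambda>x. \<psi> n x - fst (step_fn p x)) (\<lambda>x. grad_fn (\<psi> n) x - snd (step_fn p x)) \<le> ennreal (\<delta> / 4)"
   using step_fn_approx[OF ts D(2,1) d4] by blast
  have "?ds a p \<le> 2 * sob D (\<lambda>x. fst a x - \<psi> n x) (\<lambda>x. snd a x - grad_fn (\<psi> n) x) + 2 * sob D (\<lambda>x. \<psi> n x - fst (step_fn p x)) (\<lambda>x. grad_fn (\<psi> n) x - snd (step_fn p x))"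
   by (intro sob_triangle am a measH_smooth Dm ts measH_step)
  also have "\<dots> \<le> 2 * ennreal (\<delta> / 4) + 2 * ennreal (\<delta> / 4)" using n p by (intro add_mono mult_left_mono) auto
  also have "\<dots> = ennreal \<delta>"
  proof -
   have "2 * ennreal (\<delta> / 4) = ennreal (\<delta> / 2)" using ennreal_mult[of 2 "\<delta> / 4"] d by simp
   then show ?thesis using d by (simp flip: ennreal_plus)
  qed
  finally show ?thesis by blast
 qed
 \<comment> \<open>The choice is meaningful only for those pairs of a step function and an accuracy
   for which a close competitor exists; \<open>A\<close> is the image of exactly these.\<close>
 define c where "c = (\<lambda>(p, n::nat). SOME a. a \<in> Adm D \<and> ?ds a p \<le> ennreal (1 / real (Suc n)))"
 define A where "A = c ` {(p, n). \<exists>a. a \<in> Adm D \<and> ?ds a p \<le> ennreal (1 / real (Suc n))}"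
 have cp: "c (p, n) \<in> Adm D" "?ds (c (p, n)) p \<le> ennreal (1 / real (Suc n))"
  if "\<exists>a. a \<in> Adm D \<and> ?ds a p \<le> ennreal (1 / real (Suc n))" for p n
  using someI_ex[OF that] unfolding c_def by auto
 show ?thesis
 proof (intro exI[of _ A] conjI allI impI)
  show "countable A" unfolding A_def by (intro countable_image countableI_type)
  show "A \<subseteq> Adm D"
  proof
   fix a assume "a \<in> A"
   then obtain p n where "a = c (p, n)" "\<exists>a. a \<in> Adm D \<and> ?ds a p \<le> ennreal (1 / real (Suc n))"
    unfolding A_def by blast
   then show "a \<in> Adm D" using cp(1)[of p n] by simp
  qed
  fix v :: "'d \<Rightarrow> real" and G :: "'d \<Rightarrow> 'd" and \<delta> :: real assume a: "(v, G) \<in> Adm D" and d: "0 < \<delta>"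
  obtain n where n: "1 / real (Suc n) < \<delta> / 4" using d reals_Archimedean[of "\<delta> / 4"] by (auto simp: inverse_eq_divide)
  obtain p where p: "?ds (v, G) p \<le> ennreal (1 / real (Suc n))" using near[OF a, of "1 / real (Suc n)"] by auto
  have ex: "\<exists>a. a \<in> Adm D \<and> ?ds a p \<le> ennreal (1 / real (Suc n))" using a p by blast
  let ?a = "c (p, n)"
  have aA: "?a \<in> A" unfolding A_def using ex by (intro imageI) simp
  have "sob D (\<lambda>x. v x - fst ?a x) (\<lambda>x. G x - snd ?a x) \<le> 2 * ?ds (v, G) p + 2 * sob D (\<lambda>x. fst (step_fn p x) - fst ?a x) (\<lambda>x. snd (step_fn p x) - snd ?a x)"
   using sob_triangle[OF am[OF a] measH_step[OF Dm] am[OF cp(1)[OF ex]], of p] by simp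
  also have "sob D (\<lambda>x. fst (step_fn p x) - fst ?a x) (\<lambda>x. snd (step_fn p x) - snd ?a x) = ?ds ?a p" by (rule sob_sym)
  also have "2 * ?ds (v, G) p + 2 * ?ds ?a p \<le> 2 * ennreal (\<delta> / 4) + 2 * ennreal (\<delta> / 4)"
   using order_trans[OF p ennreal_leI[OF less_imp_le[OF n]]] order_trans[OF cp(2)[OF ex] ennreal_leI[OF less_imp_le[OF n]]]
   by (intro add_mono mult_left_mono) auto
  also have "\<dots> = ennreal \<delta>"
  proof -
   have "2 * ennreal (\<delta> / 4) = ennreal (\<delta> / 2)" using ennreal_mult[of 2 "\<delta> / 4"] d by simp
   then show ?thesis using d by (simp flip: ennreal_plus)
  qed
  finally show "\<exists>(v', G')\<in>A. sob D (\<lambda>x. v x - v' x) (\<lambda>x. G x - G' x) \<le> ennreal \<delta>"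
   using aA by (intro bexI[of _ ?a]) (auto simp: case_prod_unfold)
 qed
qed

end

section \<open>Measurability in the medium\<close>

lemma completion_ex_borel_measurable_euclidean:
 fixes G :: "'a \<Rightarrow> 'b::euclidean_space"
 assumes "G \<in> borel_measurable (completion M)"
 shows "\<exists>G'\<in>borel_measurable M. AE x in M. G x = G' x"
proof -
 have "\<exists>g\<in>borel_measurable M. AE x in M. G x \<bullet> b = g x" for b
  by (intro completion_ex_borel_measurable_real borel_measurable_inner[OF assms borel_measurable_const])
 then obtain g where g: "\<And>b. g b \<in> borel_measurable M" "\<And>b. AE x in M. G x \<bullet> b = g b x" by metis
 have "AE x in M. \<forall>b\<in>Basis. G x \<bullet> b = g b x" using g(2) by (intro AE_finite_allI) auto
 then have "AE x in M. G x = (\<Sum>b\<in>Basis. g b x *\<^sub>R b)"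
 proof eventually_elim
  case (elim x)
  have "G x = (\<Sum>b\<in>Basis. (G x \<bullet> b) *\<^sub>R b)" by (simp add: euclidean_representation)
  also have "\<dots> = (\<Sum>b\<in>Basis. g b x *\<^sub>R b)" using elim by (intro sum.cong) auto
  finally show ?case .
 qed
 moreover have "(\<lambda>x. \<Sum>b\<in>Basis. g b x *\<^sub>R b) \<in> borel_measurable M" using g(1) by measurable
 ultimately show ?thesis by (rule bexI)
qed

context medium
begin

interpretation prob_space M by (rule P)

text \<open>Competitors are only Lebesgue measurable. Borel representatives change the integrand on
  a null set of positions independent of the medium and make it jointly measurable.\<close>

lemma ener_measurable:
 assumes D: "open D" and a: "(v, G) \<in> Adm D"
 shows "(\<lambda>\<omega>. ener \<omega> D v G) \<in> borel_measurable M"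
proof -
 let ?u = "\<lambda>x. indicator D x * (qe x + v x)" and ?G = "\<lambda>x. indicator D x *\<^sub>R (dqe x *\<^sub>R e + G x)"
 have m: "?u \<in> borel_measurable lebesgue" "?G \<in> borel_measurable lebesgue"
  using AdmD(2)[OF D a] by (auto simp: measH_def)
 obtain u' where u': "u' \<in> borel_measurable lborel" "AE x in lborel. ?u x = u' x"
  using completion_ex_borel_measurable_real[OF m(1)] by blast
 obtain G' where G': "G' \<in> borel_measurable lborel" "AE x in lborel. ?G x = G' x"
  using completion_ex_borel_measurable_euclidean[OF m(2)] by blast
 have [measurable]: "u' \<in> borel_measurable borel" "G' \<in> borel_measurable borel" using u'(1) G'(1) by auto
 have Db [measurable]: "D \<in> sets borel" using D by (rule borel_open)
 let ?f = "\<lambda>\<omega> x. ennreal (indicator D x * (1 / 2 * (\<Phi> (\<tau> x \<omega>) (G' x))\<^sup>2 + Wc (u' x)))"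
 have "ener \<omega> D v G = (\<integral>\<^sup>+x. ?f \<omega> x \<partial>lborel)" for \<omega>
  unfolding ener_def energy_dens nn_integral_completion
 proof (rule nn_integral_cong_AE)
  show "AE x in lborel. ennreal (dens \<omega> D (\<lambda>x. qe x + v x) (\<lambda>x. dqe x *\<^sub>R e + G x) x) = ?f \<omega> x"
   using u'(2) G'(2)
  proof eventually_elim
   case (elim x)
   show ?case
   proof (cases "x \<in> D")
    case True
    then have "u' x = qe x + v x" "G' x = dqe x *\<^sub>R e + G x" using elim by auto
    then show ?thesis using True Wc_eq[OF AdmD(3)[OF D a True]] by (simp add: dens_def)
   qed (simp add: dens_def)
  qed
 qed
 moreover have "(\<lambda>\<omega>. \<integral>\<^sup>+x. ?f \<omega> x \<partial>lborel) \<in> borel_measurable M"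
 proof (rule sigma_finite_measure.borel_measurable_nn_integral[OF sigma_finite_lborel])
  have "(\<lambda>z. ((snd z, G' (snd z)), fst z)) \<in> M \<Otimes>\<^sub>M lborel \<rightarrow>\<^sub>M (borel \<Otimes>\<^sub>M borel) \<Otimes>\<^sub>M M" by measurable
  from measurable_compose[OF this Phi_joint]
  have [measurable]: "(\<lambda>z. \<Phi> (\<tau> (snd z) (fst z)) (G' (snd z))) \<in> borel_measurable (M \<Otimes>\<^sub>M lborel)" by simp
  show "(\<lambda>(\<omega>, x). ?f \<omega> x) \<in> borel_measurable (M \<Otimes>\<^sub>M lborel)" unfolding case_prod_unfold by measurable
 qed
 ultimately show ?thesis by simp
qed

lemma Fclass_triangle:
 assumes f: "\<psi> \<in> Fclass lam Lam"
 shows "\<psi> (a + b) \<le> \<psi> a + \<psi> b"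
proof -
 have c: "convex_on UNIV \<psi>" and h: "\<And>t p. 0 \<le> t \<Longrightarrow> \<psi> (t *\<^sub>R p) = t * \<psi> p" using f by (auto simp: Fclass_def)
 have "\<psi> ((1/2) *\<^sub>R a + (1/2) *\<^sub>R b) \<le> (1/2) * \<psi> a + (1/2) * \<psi> b"
  using convex_onD[OF c, of "1/2" a b] by simp
 moreover have "\<psi> (2 *\<^sub>R ((1/2) *\<^sub>R a + (1/2) *\<^sub>R b)) = 2 * \<psi> ((1/2) *\<^sub>R a + (1/2) *\<^sub>R b)" by (rule h) simp
 moreover have "2 *\<^sub>R ((1/2) *\<^sub>R a + (1/2) *\<^sub>R b) = a + b" by (simp add: scaleR_add_right)
 ultimately show ?thesis by simp
qed

text \<open>Young's inequality with weight t, so that the main term keeps a factor close to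
  1.\<close>

lemma Phi_sq_perturb:
 assumes w: "\<omega> \<in> space M" and t: "0 < t"
 shows "(\<Phi> (\<tau> x \<omega>) p')\<^sup>2 \<le> (1 + t) * (\<Phi> (\<tau> x \<omega>) p)\<^sup>2 + (1 + 1 / t) * (Lam * (norm (p - p'))\<^sup>2)"
proof -
 note F = Phi_class[OF tau_space[OF w]]
 let ?f = "\<Phi> (\<tau> x \<omega>)"
 have "?f p' \<le> ?f p + ?f (p' - p)" using Fclass_triangle[OF F, of x p "p' - p"] by simp
 also have "?f (p' - p) \<le> sqrt Lam * norm (p - p')" using Fclass_bounds(2)[OF F, of x "p' - p"] by (simp add: norm_minus_commute)
 finally have le: "?f p' \<le> ?f p + sqrt Lam * norm (p - p')" by simp
 let ?d = "sqrt Lam * norm (p - p')"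
 have "(?f p')\<^sup>2 \<le> (?f p + ?d)\<^sup>2" using le Fclass_bounds(1)[OF F, of x p'] by (intro power_mono) auto
 also have "\<dots> \<le> (1 + t) * (?f p)\<^sup>2 + (1 + 1 / t) * ?d\<^sup>2"
 proof -
  have "0 \<le> (t * ?f p - ?d)\<^sup>2 / t" using t by simp
  also have "\<dots> = t * (?f p)\<^sup>2 - 2 * ?f p * ?d + 1 / t * ?d\<^sup>2"
   using t by (simp add: power2_eq_square field_simps)
  finally show ?thesis by (simp add: power2_sum algebra_simps)
 qed
 also have "?d\<^sup>2 = Lam * (norm (p - p'))\<^sup>2" using Lam_pos by (simp add: power_mult_distrib)
 finally show ?thesis .
qed

lemma Wc_perturb:
 assumes "0 < \<eta>"
 shows "\<exists>K\<ge>0. \<forall>s s'. s \<in> {-1..1} \<longrightarrow> s' \<in> {-1..1} \<longrightarrow> Wc s' \<le> Wc s + \<eta> + K * (s - s')\<^sup>2"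
proof -
 obtain C where C: "0 \<le> C" "\<And>s. Wc s \<le> C" using Wc_bounded by blast
 have "uniformly_continuous_on {-1..1} Wc"
  using Wc_continuous by (intro compact_uniformly_continuous continuous_on_subset[OF Wc_continuous]) auto
 then obtain d where d: "0 < d" "\<And>s s'. s \<in> {-1..1} \<Longrightarrow> s' \<in> {-1..1} \<Longrightarrow> dist s' s < d \<Longrightarrow> dist (Wc s') (Wc s) < \<eta>"
  using assms unfolding uniformly_continuous_on_def by blast
 show ?thesis
 proof (intro exI[of _ "C / d\<^sup>2"] conjI allI impI)
  show "0 \<le> C / d\<^sup>2" using C by simp
  fix s s' :: real assume s: "s \<in> {-1..1}" "s' \<in> {-1..1}"
  show "Wc s' \<le> Wc s + \<eta> + C / d\<^sup>2 * (s - s')\<^sup>2"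
  proof (cases "dist s' s < d")
   case True
   then have "\<bar>Wc s' - Wc s\<bar> < \<eta>" using d(2)[OF s] by (simp add: dist_real_def)
   moreover have "0 \<le> C / d\<^sup>2 * (s - s')\<^sup>2" using C by simp
   ultimately show ?thesis by linarith
  next
   case False
   then have "d\<^sup>2 \<le> (s - s')\<^sup>2" using d(1) by (intro abs_le_square_iff[THEN iffD1]) (auto simp: dist_real_def)
   then have "C * 1 \<le> C * ((s - s')\<^sup>2 / d\<^sup>2)" using C d(1) by (intro mult_left_mono) auto
   then show ?thesis using C(2)[of s'] assms Wc_nonneg[of s] by simp
  qed
 qed
qed

text \<open>Continuity of the energy in the Sobolev norm, in the one direction needed to compare
  infima; \<delta> may depend on the competitor. The range condition on both pairs lets the
  potential be estimated by its uniform continuity.\<close>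

lemma ener_approx:
 assumes D: "open D" "bounded D" and w: "\<omega> \<in> space M" and a: "(v, G) \<in> Adm D" and eps: "0 < \<epsilon>"
 shows "\<exists>\<delta>>0. \<forall>v' G'. (v', G') \<in> Adm D \<longrightarrow> sob D (\<lambda>x. v x - v' x) (\<lambda>x. G x - G' x) \<le> ennreal \<delta> \<longrightarrow>
   ener \<omega> D v' G' \<le> ener \<omega> D v G + ennreal \<epsilon>"
proof -
 have Dm: "D \<in> sets lebesgue" using D by (simp add: borel_open)
 let ?u = "\<lambda>x. qe x + v x" and ?H = "\<lambda>x. dqe x *\<^sub>R e + G x"
 note hm = AdmD(2)[OF D(1) a]
 have "sob D ?u ?H \<le> 2 * sob D (\<lambda>x. qe x) (\<lambda>x. dqe x *\<^sub>R e) + 2 * sob D v G"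
  by (rule sob_add_le[OF qe_measH[OF D(1)] H10D(1)[OF D(1) AdmD(1)[OF D(1) a]]])
 also have "\<dots> < \<infinity>"
  using sob_smooth_bounded[OF D(2) qe_smooth] H10D(2)[OF D(1) AdmD(1)[OF D(1) a]]
  unfolding qe_grad[abs_def] by (simp add: ennreal_mult_less_top)
 finally have sfin: "sob D ?u ?H < \<infinity>" .
 define A where "A = enn2real (sob D ?u ?H)"
 have A: "sob D ?u ?H = ennreal A" "0 \<le> A" using sfin by (auto simp: A_def ennreal_enn2real_if less_top)
 define vol where "vol = enn2real (emeasure lborel D)"
 have vol: "emeasure lborel D = ennreal vol" "0 \<le> vol"
  using emeasure_bounded_finite[OF D(2)] by (auto simp: vol_def ennreal_enn2real_if less_top)
 \<comment> \<open>The constants t, \<eta> and \<delta> have the same shape \<epsilon> / (3 (b +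
   1)), where b is the factor each of them meets later; every error term is then at most \<epsilon>
   / 3. The weight t comes before \<delta> since 1 / t enters \<open>K'\<close>.\<close>
 define t where "t = \<epsilon> / (3 * (Lam / 2 * A + 1))"
 have t0: "0 < t" unfolding t_def using eps Lam_pos A(2) by (intro divide_pos_pos) (auto intro!: add_nonneg_pos mult_nonneg_nonneg)
 define \<eta> where "\<eta> = \<epsilon> / (3 * (vol + 1))"
 have \<eta>0: "0 < \<eta>" unfolding \<eta>_def using eps vol(2) by simp
 obtain K where K: "0 \<le> K" "\<And>s s'. s \<in> {-1..1} \<Longrightarrow> s' \<in> {-1..1} \<Longrightarrow> Wc s' \<le> Wc s + \<eta> + K * (s - s')\<^sup>2"
  using Wc_perturb[OF \<eta>0] by blast
 define K' where "K' = K + (1 + 1 / t) * (Lam / 2)"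
 have K'0: "0 \<le> K'" unfolding K'_def using K(1) t0 Lam_pos by (intro add_nonneg_nonneg mult_nonneg_nonneg) auto
 define \<delta> where "\<delta> = \<epsilon> / (3 * (K' + 1))"
 have \<delta>0: "0 < \<delta>" unfolding \<delta>_def using eps K'0 by simp
 have frac: "b * (\<epsilon> / (3 * (b + 1))) \<le> \<epsilon> / 3" if "0 \<le> b" for b
  using that eps by (simp add: field_simps)
 show ?thesis
 proof (intro exI[of _ \<delta>] conjI allI impI \<delta>0)
  fix v' G' assume a': "(v', G') \<in> Adm D" and s: "sob D (\<lambda>x. v x - v' x) (\<lambda>x. G x - G' x) \<le> ennreal \<delta>"
  let ?u' = "\<lambda>x. qe x + v' x" and ?H' = "\<lambda>x. dqe x *\<^sub>R e + G' x"
  let ?h = "\<lambda>x. indicator D x * ((?u x)\<^sup>2 + (norm (?H x))\<^sup>2)"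
  let ?s = "\<lambda>x. indicator D x * ((v x - v' x)\<^sup>2 + (norm (G x - G' x))\<^sup>2)"
  have ms: "measH D (\<lambda>x. v x - v' x) (\<lambda>x. G x - G' x)"
   by (rule measH_diff[OF H10D(1)[OF D(1) AdmD(1)[OF D(1) a]] H10D(1)[OF D(1) AdmD(1)[OF D(1) a']]])
  have pt: "dens \<omega> D ?u' ?H' x \<le> dens \<omega> D ?u ?H x + (t * (Lam / 2)) * ?h x + \<eta> * indicator D x + K' * ?s x" for x
  proof (cases "x \<in> D")
   case True
   have 1: "Wc (?u' x) \<le> Wc (?u x) + \<eta> + K * (v x - v' x)\<^sup>2"
    using K(2)[OF AdmD(3)[OF D(1) a True] AdmD(3)[OF D(1) a' True]] by simp
   have "?H x - ?H' x = G x - G' x" by simp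
   then have 2: "(\<Phi> (\<tau> x \<omega>) (?H' x))\<^sup>2 \<le> (1 + t) * (\<Phi> (\<tau> x \<omega>) (?H x))\<^sup>2 + (1 + 1 / t) * (Lam * (norm (G x - G' x))\<^sup>2)"
    using Phi_sq_perturb[OF w t0, of x "?H' x" "?H x"] by simp
   have "t * (1 / 2 * (\<Phi> (\<tau> x \<omega>) (?H x))\<^sup>2) \<le> t * (Lam / 2 * (norm (?H x))\<^sup>2)"
    using Phi_sq_le[OF w, of x "?H x"] t0 by (intro mult_left_mono) auto
   also have "\<dots> \<le> t * (Lam / 2) * ((?u x)\<^sup>2 + (norm (?H x))\<^sup>2)" using t0 Lam_pos by (simp add: algebra_simps)
   finally have 3: "t * (1 / 2 * (\<Phi> (\<tau> x \<omega>) (?H x))\<^sup>2) \<le> t * (Lam / 2) * ((?u x)\<^sup>2 + (norm (?H x))\<^sup>2)" .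
   have 4: "0 \<le> K * (norm (G x - G' x))\<^sup>2" "0 \<le> (1 + 1 / t) * (Lam / 2) * (v x - v' x)\<^sup>2" using K(1) t0 Lam_pos by auto
   have 5: "K' * ((v x - v' x)\<^sup>2 + (norm (G x - G' x))\<^sup>2) = K * (v x - v' x)\<^sup>2 + K * (norm (G x - G' x))\<^sup>2
     + (1 + 1 / t) * (Lam / 2) * (v x - v' x)\<^sup>2 + (1 + 1 / t) * (Lam * (norm (G x - G' x))\<^sup>2) / 2"
    unfolding K'_def by (simp add: algebra_simps)
   have 6: "(1 + t) * (\<Phi> (\<tau> x \<omega>) (?H x))\<^sup>2 = (\<Phi> (\<tau> x \<omega>) (?H x))\<^sup>2 + 2 * (t * (1 / 2 * (\<Phi> (\<tau> x \<omega>) (?H x))\<^sup>2))" by (simp add: algebra_simps)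
   have "1 / 2 * (\<Phi> (\<tau> x \<omega>) (?H' x))\<^sup>2 + Wc (?u' x) \<le> (1 / 2 * (\<Phi> (\<tau> x \<omega>) (?H x))\<^sup>2 + Wc (?u x)) + (t * (Lam / 2)) * ((?u x)\<^sup>2 + (norm (?H x))\<^sup>2) + \<eta>
     + K' * ((v x - v' x)\<^sup>2 + (norm (G x - G' x))\<^sup>2)"
   proof -
    have "1 / 2 * P' + w' \<le> (1 / 2 * P + w) + T + \<eta> + R"
     if "w' \<le> w + \<eta> + Kv" "P' \<le> Q + S" "tP \<le> T" "0 \<le> KG" "0 \<le> Z" "R = Kv + KG + Z + S / 2" "Q = P + 2 * tP"
     for P P' w w' T R Kv KG Z S Q tP :: real using that by linarith
    from this[OF 1 2 3 4 5 6] show ?thesis .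
   qed
   then show ?thesis using True Wc_eq[OF AdmD(3)[OF D(1) a True]] Wc_eq[OF AdmD(3)[OF D(1) a' True]] by (simp add: dens_def)
  qed (simp add: dens_def)
  let ?d = "dens \<omega> D ?u ?H"
  have d0: "0 \<le> ?d x" for x by (rule dens_nonneg) (rule AdmD(3)[OF D(1) a])
  have tL: "0 \<le> t * (Lam / 2)" using t0 Lam_pos by simp
  have "ener \<omega> D v' G' \<le> (\<integral>\<^sup>+x. ennreal (?d x) + (ennreal (t * (Lam / 2)) * ennreal (?h x) + (ennreal \<eta> * indicator D x + ennreal K' * ennreal (?s x))) \<partial>lebesgue)"
   unfolding ener_def energy_dens
  proof (rule nn_integral_mono)
   fix x
   have h0: "0 \<le> ?h x" "0 \<le> ?s x" by auto
   have "ennreal (dens \<omega> D ?u' ?H' x) \<le> ennreal (?d x + ((t * (Lam / 2)) * ?h x + (\<eta> * indicator D x + K' * ?s x)))"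
    using pt[of x] by (intro ennreal_leI) (simp add: add.assoc)
   also have "\<dots> = ennreal (?d x) + (ennreal (t * (Lam / 2) * ?h x) + (ennreal (\<eta> * indicator D x) + ennreal (K' * ?s x)))"
   proof -
    have "0 \<le> t * (Lam / 2) * ?h x" "0 \<le> \<eta> * indicator D x" "0 \<le> K' * ?s x"
     using tL K'0 \<eta>0 h0 by (auto intro!: mult_nonneg_nonneg)
    then show ?thesis using d0[of x] by (simp only: ennreal_plus add_nonneg_nonneg)
   qed
   also have "ennreal (t * (Lam / 2) * ?h x) = ennreal (t * (Lam / 2)) * ennreal (?h x)" by (rule ennreal_mult[OF tL h0(1)])
   also have "ennreal (K' * ?s x) = ennreal K' * ennreal (?s x)" by (rule ennreal_mult[OF K'0 h0(2)])
   also have "ennreal (\<eta> * indicator D x) = ennreal \<eta> * indicator D x" by (cases "x \<in> D") auto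
   finally show "ennreal (dens \<omega> D ?u' ?H' x) \<le> ennreal (?d x) + (ennreal (t * (Lam / 2)) * ennreal (?h x) + (ennreal \<eta> * indicator D x + ennreal K' * ennreal (?s x)))" .
  qed
  also have "\<dots> = ener \<omega> D v G + (ennreal (t * (Lam / 2)) * sob D ?u ?H + (ennreal \<eta> * emeasure lebesgue D + ennreal K' * sob D (\<lambda>x. v x - v' x) (\<lambda>x. G x - G' x)))"
  proof -
   have m1: "(\<lambda>x. ennreal (?d x)) \<in> borel_measurable lebesgue" using Adm_dens_measurable[OF w D(1) a] by measurable
   have m2: "(\<lambda>x. ennreal (?h x)) \<in> borel_measurable lebesgue" using measH_sq(3)[OF hm] by measurable
   have m3: "(\<lambda>x. ennreal (?s x)) \<in> borel_measurable lebesgue" using measH_sq(3)[OF ms] by measurable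
   have m2': "(\<lambda>x. ennreal (t * (Lam / 2)) * ennreal (?h x)) \<in> borel_measurable lebesgue"
    by (rule borel_measurable_times_ennreal[OF borel_measurable_const m2])
   have m3': "(\<lambda>x. ennreal K' * ennreal (?s x)) \<in> borel_measurable lebesgue"
    by (rule borel_measurable_times_ennreal[OF borel_measurable_const m3])
   have m4: "(\<lambda>x. ennreal \<eta> * indicator D x) \<in> borel_measurable lebesgue"
    by (rule borel_measurable_times_ennreal[OF borel_measurable_const borel_measurable_indicator[OF Dm]])
   show ?thesis unfolding ener_def energy_dens sob_def
    unfolding nn_integral_add[OF m1 borel_measurable_add[OF m2' borel_measurable_add[OF m4 m3']]]
     nn_integral_add[OF m2' borel_measurable_add[OF m4 m3']] nn_integral_add[OF m4 m3']
     nn_integral_cmult[OF m2] nn_integral_cmult[OF m3] nn_integral_cmult_indicator[OF Dm] ..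
  qed
  also have "\<dots> \<le> ener \<omega> D v G + (ennreal (\<epsilon> / 3) + (ennreal (\<epsilon> / 3) + ennreal (\<epsilon> / 3)))"
  proof (intro add_left_mono add_mono)
   have "ennreal (t * (Lam / 2)) * sob D ?u ?H = ennreal (Lam / 2 * A * t)"
    unfolding A(1) by (subst ennreal_mult[symmetric]) (use tL A(2) in \<open>auto simp: ac_simps\<close>)
   also have "\<dots> \<le> ennreal (\<epsilon> / 3)" unfolding t_def using Lam_pos A(2) by (intro ennreal_leI frac) auto
   finally show "ennreal (t * (Lam / 2)) * sob D ?u ?H \<le> ennreal (\<epsilon> / 3)" .
   have "ennreal \<eta> * emeasure lebesgue D = ennreal (vol * \<eta>)"
    using vol \<eta>0 D(1) by (simp add: ennreal_mult'[symmetric] mult.commute)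
   also have "\<dots> \<le> ennreal (\<epsilon> / 3)" unfolding \<eta>_def using vol by (intro ennreal_leI frac) auto
   finally show "ennreal \<eta> * emeasure lebesgue D \<le> ennreal (\<epsilon> / 3)" .
   have "ennreal K' * sob D (\<lambda>x. v x - v' x) (\<lambda>x. G x - G' x) \<le> ennreal K' * ennreal \<delta>" using s by (rule mult_left_mono) simp
   also have "\<dots> = ennreal (K' * \<delta>)" using K'0 \<delta>0 by (simp add: ennreal_mult)
   also have "\<dots> \<le> ennreal (\<epsilon> / 3)" unfolding \<delta>_def using K'0 by (intro ennreal_leI frac) auto
   finally show "ennreal K' * sob D (\<lambda>x. v x - v' x) (\<lambda>x. G x - G' x) \<le> ennreal (\<epsilon> / 3)" .
  qed
  also have "ennreal (\<epsilon> / 3) + (ennreal (\<epsilon> / 3) + ennreal (\<epsilon> / 3)) = ennreal \<epsilon>" using eps by (simp flip: ennreal_plus)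
  finally show "ener \<omega> D v' G' \<le> ener \<omega> D v G + ennreal \<epsilon>" .
 qed
qed

text \<open>The infimum may be taken over a countable dense set of competitors, chosen independently
  of the medium.\<close>

lemma mE_measurable_bounded:
 assumes D: "open D" "bounded D"
 shows "(\<lambda>\<omega>. mE \<omega> D) \<in> borel_measurable M"
proof -
 obtain A where A: "countable A" "A \<subseteq> Adm D" "\<And>v G \<delta>. (v, G) \<in> Adm D \<Longrightarrow> 0 < \<delta> \<Longrightarrow>
   \<exists>(v', G')\<in>A. sob D (\<lambda>x. v x - v' x) (\<lambda>x. G x - G' x) \<le> ennreal \<delta>"
  using Adm_separable[OF D] by (elim exE conjE) (rule that, assumption, assumption, blast)
 have eq: "mE \<omega> D = (INF (v, G)\<in>A. ener \<omega> D v G)" if w: "\<omega> \<in> space M" for \<omega>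
 proof (rule antisym)
  show "mE \<omega> D \<le> (INF (v, G)\<in>A. ener \<omega> D v G)"
   unfolding mE_def by (rule INF_superset_mono[OF A(2)]) auto
  show "(INF (v, G)\<in>A. ener \<omega> D v G) \<le> mE \<omega> D"
   unfolding mE_def
  proof (rule INF_greatest, clarify)
   fix v G assume a: "(v, G) \<in> Adm D"
   show "(INF (v, G)\<in>A. ener \<omega> D v G) \<le> ener \<omega> D v G"
   proof (rule ennreal_le_epsilon)
    fix \<epsilon> :: real assume "0 < \<epsilon>"
    then obtain \<delta> where d: "0 < \<delta>" "\<And>v' G'. (v', G') \<in> Adm D \<Longrightarrow> sob D (\<lambda>x. v x - v' x) (\<lambda>x. G x - G' x) \<le> ennreal \<delta> \<Longrightarrow>
      ener \<omega> D v' G' \<le> ener \<omega> D v G + ennreal \<epsilon>"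
     using ener_approx[OF D w a] by blast
    obtain v' G' where vG: "(v', G') \<in> A" "sob D (\<lambda>x. v x - v' x) (\<lambda>x. G x - G' x) \<le> ennreal \<delta>"
     using A(3)[OF a d(1)] by blast
    have "(INF (v, G)\<in>A. ener \<omega> D v G) \<le> ener \<omega> D v' G'" using vG(1) by (intro INF_lower2[of "(v', G')"]) auto
    also have "\<dots> \<le> ener \<omega> D v G + ennreal \<epsilon>" using vG A(2) by (intro d(2)) auto
    finally show "(INF (v, G)\<in>A. ener \<omega> D v G) \<le> ener \<omega> D v G + ennreal \<epsilon>" .
   qed
  qed
 qed
 have "(\<lambda>\<omega>. INF p\<in>A. ener \<omega> D (fst p) (snd p)) \<in> borel_measurable M"
 proof (rule borel_measurable_INF[OF A(1)])
  fix p assume "p \<in> A"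
  then have "(fst p, snd p) \<in> Adm D" using A(2) by auto
  then show "(\<lambda>\<omega>. ener \<omega> D (fst p) (snd p)) \<in> borel_measurable M" by (rule ener_measurable[OF D(1)])
 qed
 moreover have "(INF p\<in>A. ener \<omega> D (fst p) (snd p)) = mE \<omega> D" if "\<omega> \<in> space M" for \<omega>
  using eq[OF that] by (simp add: case_prod_unfold)
 ultimately show ?thesis using measurable_cong[of M "\<lambda>\<omega>. INF p\<in>A. ener \<omega> D (fst p) (snd p)" "\<lambda>\<omega>. mE \<omega> D" borel] by simp
qed

end

section \<open>The limit\<close>

lemma AE_eq_if_nn_integral_le:
 fixes f g :: "'a \<Rightarrow> ennreal"
 assumes [measurable]: "f \<in> borel_measurable M" "g \<in> borel_measurable M"
  and le: "AE x in M. f x \<le> g x" and int: "(\<integral>\<^sup>+x. g x \<partial>M) \<le> (\<integral>\<^sup>+x. f x \<partial>M)" "(\<integral>\<^sup>+x. f x \<partial>M) \<noteq> \<infinity>"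
 shows "AE x in M. g x \<le> f x"
proof -
 have "(\<integral>\<^sup>+x. g x - f x \<partial>M) = (\<integral>\<^sup>+x. g x \<partial>M) - (\<integral>\<^sup>+x. f x \<partial>M)"
  using le int(2) by (intro nn_integral_diff) auto
 also have "\<dots> = 0" using int by (simp add: diff_eq_0_iff_ennreal top.not_eq_extremum)
 finally have "AE x in M. g x - f x = 0" by (subst (asm) nn_integral_0_iff_AE) auto
 then show ?thesis by eventually_elim (simp add: diff_eq_0_iff_ennreal)
qed

section \<open>Comparison of cubes of neighbouring sizes\<close>

lemma add_mult_diff_divide:
 fixes a b :: real
 shows "b \<noteq> 0 \<Longrightarrow> (x + K * (b - a)) / b = x / b + K * (1 - a / b)"
  "a \<noteq> 0 \<Longrightarrow> (x + K * (b - a)) / a = x / a + K * (b / a - 1)"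
 by (simp_all add: field_simps)

lemma tendsto_box_ratio:
 "(\<lambda>N. K * (1 - (2 * real N) ^ n / (2 * real (N + k)) ^ n)) \<longlonglongrightarrow> 0"
proof -
 have "(\<lambda>N. real N / real (N + k)) \<longlonglongrightarrow> 1" by real_asymp
 then have "(\<lambda>N. K * (1 - (real N / real (N + k)) ^ n)) \<longlonglongrightarrow> K * (1 - 1 ^ n)" by (intro tendsto_intros)
 moreover have "(real N / real (N + k)) ^ n = (2 * real N) ^ n / (2 * real (N + k)) ^ n" for N
  by (subst power_divide[symmetric]) (simp del: of_nat_add)
 ultimately show ?thesis by (simp del: of_nat_add)
qed

lemma eventually_shifted_quotient_le:
 fixes x x' :: "nat \<Rightarrow> real"
 assumes x: "\<And>N. 0 \<le> x N" and le: "\<And>N. x' (N + k) \<le> x N + K * ((2 * real (N + k)) ^ n - (2 * real N) ^ n)"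
  and eps: "0 < \<epsilon>"
 shows "eventually (\<lambda>N. x' (N + k) / (2 * real (N + k)) ^ n \<le> x N / (2 * real N) ^ n + \<epsilon>) sequentially"
proof -
 have "eventually (\<lambda>N. K * (1 - (2 * real N) ^ n / (2 * real (N + k)) ^ n) < \<epsilon>) sequentially"
  by (rule order_tendstoD(2)[OF tendsto_box_ratio eps])
 then show ?thesis using eventually_gt_at_top[of 0]
 proof eventually_elim
  case (elim N)
  let ?a = "(2 * real N) ^ n" and ?b = "(2 * real (N + k)) ^ n"
  have ab: "0 < ?a" "?a \<le> ?b" using elim(2) by (simp, intro power_mono, simp_all)
  have "x' (N + k) / ?b \<le> (x N + K * (?b - ?a)) / ?b" using le[of N] ab by (intro divide_right_mono) auto
  also have "\<dots> = x N / ?b + K * (1 - ?a / ?b)" using ab by (intro add_mult_diff_divide) linarith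
  also have "\<dots> \<le> x N / ?a + K * (1 - ?a / ?b)" using ab x[of N] by (intro add_right_mono divide_left_mono) auto
  finally show ?case using elim(1) by linarith
 qed
qed

lemma Limsup_le_Limsup_comp:
 fixes f :: "'a \<Rightarrow> ennreal" and g :: "'b \<Rightarrow> ennreal"
 assumes k: "filterlim k G F" and le: "\<And>\<epsilon>::real. 0 < \<epsilon> \<Longrightarrow> eventually (\<lambda>x. f x \<le> g (k x) + ennreal \<epsilon>) F"
 shows "Limsup F f \<le> Limsup G g"
proof (rule Limsup_ennreal_leI)
 fix \<epsilon> :: real assume e: "0 < \<epsilon>"
 then have e2: "0 < \<epsilon> / 2" by simp
 show "eventually (\<lambda>x. f x \<le> Limsup G g + ennreal \<epsilon>) F"
  using le[OF e2] eventually_compose_filterlim[OF eventually_le_Limsup_ennreal[OF e2, of g G] k]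
 proof eventually_elim
  case (elim x)
  have "f x \<le> Limsup G g + ennreal (\<epsilon> / 2) + ennreal (\<epsilon> / 2)"
   by (rule order_trans[OF elim(1) add_right_mono[OF elim(2)]])
  then show ?case using e by (simp add: add.assoc flip: ennreal_plus)
 qed
qed

lemma Liminf_comp_le_Liminf:
 fixes f :: "'a \<Rightarrow> ennreal" and g :: "'b \<Rightarrow> ennreal"
 assumes k: "filterlim k G F" and le: "\<And>\<epsilon>::real. 0 < \<epsilon> \<Longrightarrow> eventually (\<lambda>x. g (k x) \<le> f x + ennreal \<epsilon>) F"
  and fin: "Liminf G g < \<top>"
 shows "Liminf G g \<le> Liminf F f"
proof (rule Liminf_ennreal_geI)
 fix \<epsilon> :: real assume e: "0 < \<epsilon>"
 then have e2: "0 < \<epsilon> / 2" by simp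
 show "eventually (\<lambda>x. Liminf G g \<le> f x + ennreal \<epsilon>) F"
  using le[OF e2] eventually_compose_filterlim[OF eventually_Liminf_le_ennreal[OF e2 fin] k]
 proof eventually_elim
  case (elim x)
  have "Liminf G g \<le> f x + ennreal (\<epsilon> / 2) + ennreal (\<epsilon> / 2)"
   by (rule order_trans[OF elim(2) add_right_mono[OF elim(1)]])
  then show ?case using e by (simp add: add.assoc flip: ennreal_plus)
 qed
qed

text \<open>A bounded enlargement of the cube adds only a shell, which is negligible against the
  volume. The limsup is compared along N - k, the liminf along N + k; the bound c makes the liminf
  finite, as the additive comparison requires.\<close>

lemma
 fixes x x' :: "nat \<Rightarrow> real"
 assumes x: "\<And>N. 0 \<le> x N" and le: "\<And>N. x' (N + k) \<le> x N + K * ((2 * real (N + k)) ^ n - (2 * real N) ^ n)"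
 shows limsup_shifted_quotient_le:
   "limsup (\<lambda>N. ennreal (x' N / (2 * real N) ^ n)) \<le> limsup (\<lambda>N. ennreal (x N / (2 * real N) ^ n))"
  and liminf_shifted_quotient_le: "(\<And>N. x' N \<le> c * (2 * real N) ^ n) \<Longrightarrow>
   liminf (\<lambda>N. ennreal (x' N / (2 * real N) ^ n)) \<le> liminf (\<lambda>N. ennreal (x N / (2 * real N) ^ n))"
proof -
 let ?f = "\<lambda>N. ennreal (x N / (2 * real N) ^ n)" and ?g = "\<lambda>N. ennreal (x' N / (2 * real N) ^ n)"
 have ev: "eventually (\<lambda>N. ?g (N + k) \<le> ?f N + ennreal \<epsilon>) sequentially" if "0 < \<epsilon>" for \<epsilon>
  using eventually_shifted_quotient_le[OF x le that]
 proof eventually_elim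
  case (elim N)
  have "?g (N + k) \<le> ennreal (x N / (2 * real N) ^ n + \<epsilon>)" using elim by (rule ennreal_leI)
  also have "\<dots> = ?f N + ennreal \<epsilon>" using x[of N] that by (intro ennreal_plus) auto
  finally show ?case .
 qed
 have "eventually (\<lambda>N. ?g N \<le> ?f (N - k) + ennreal \<epsilon>) sequentially" if "0 < \<epsilon>" for \<epsilon>
  using ev[OF that] by (subst eventually_sequentially_seg[of _ k, symmetric]) simp
 then show "limsup ?g \<le> limsup ?f" by (rule Limsup_le_Limsup_comp[OF filterlim_minus_const_nat_at_top])
 assume c: "\<And>N. x' N \<le> c * (2 * real N) ^ n"
 have "?g N \<le> ennreal (max c 0)" for N
 proof (rule ennreal_leI, cases "(2 * real N) ^ n = 0")
  case False
  then have p: "0 < (2 * real N) ^ n" by (intro order.not_eq_order_implies_strict[OF not_sym]) simp_all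
  then have "x' N \<le> max c 0 * (2 * real N) ^ n" by (intro order_trans[OF c] mult_right_mono) auto
  then show "x' N / (2 * real N) ^ n \<le> max c 0" using p by (simp only: pos_divide_le_eq)
 next
  case True
  show "x' N / (2 * real N) ^ n \<le> max c 0" unfolding True by simp
 qed
 then have "liminf ?g \<le> ennreal (max c 0)"
  by (intro order_trans[OF Liminf_le_Limsup Limsup_bounded]) (auto intro!: always_eventually)
 then have fin: "liminf ?g < \<top>" using ennreal_less_top order_le_less_trans by blast
 show "liminf ?g \<le> liminf ?f" by (rule Liminf_comp_le_Liminf[OF filterlim_add_const_nat_at_top ev fin])
qed

text \<open>From integer to real sizes: R / 2 lies between its integer part N and N + 1, and g is
  monotone up to shell volumes. The limsup is compared with the cube of half-side N inside, the
  liminf with that of half-side N + 1 outside.\<close>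

lemma
 fixes g v :: "real \<Rightarrow> real"
 assumes g: "\<And>\<rho>. 0 \<le> g \<rho>" and mono: "\<And>\<rho> \<rho>'. \<rho> \<le> \<rho>' \<Longrightarrow> g \<rho>' \<le> g \<rho> + (v \<rho>' - v \<rho>)"
  and v_mono: "\<And>\<rho> \<rho>'. \<rho> \<le> \<rho>' \<Longrightarrow> v \<rho> \<le> v \<rho>'" and v: "\<And>N. v (real N) = c * (2 * real N) ^ n"
 shows Limsup_quotient_le_limsup:
   "Limsup at_top (\<lambda>R. ennreal (g (R / 2) / R ^ n)) \<le> limsup (\<lambda>N. ennreal (g (real N) / (2 * real N) ^ n))"
  and liminf_le_Liminf_quotient: "liminf (\<lambda>N. ennreal (g (real N) / (2 * real N) ^ n)) < \<top> \<Longrightarrow>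
   liminf (\<lambda>N. ennreal (g (real N) / (2 * real N) ^ n)) \<le> Liminf at_top (\<lambda>R. ennreal (g (R / 2) / R ^ n))"
proof -
 let ?N = "\<lambda>R::real. nat \<lfloor>R / 2\<rfloor>" and ?f = "\<lambda>N. ennreal (g (real N) / (2 * real N) ^ n)"
 have lim: "filterlim ?N sequentially at_top"
  by (rule filterlim_compose[OF filterlim_nat_sequentially]) real_asymp
 have c: "0 \<le> c * ((2 * real (Suc N)) ^ n - (2 * real N) ^ n)" for N
  using v_mono[of "real N" "real (Suc N)"] v[of N] v[of "Suc N"] by (simp add: right_diff_distrib)
 have "(\<lambda>N. c * ((2 * real (Suc N)) ^ n / (2 * real N) ^ n - 1)) \<longlonglongrightarrow> 0"
 proof -
  have "(\<lambda>N. real (Suc N) / real N) \<longlonglongrightarrow> 1" by real_asymp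
  then have "(\<lambda>N. c * ((real (Suc N) / real N) ^ n - 1)) \<longlonglongrightarrow> c * (1 ^ n - 1)" by (intro tendsto_intros)
  moreover have "(real (Suc N) / real N) ^ n = (2 * real (Suc N)) ^ n / (2 * real N) ^ n" for N
   by (subst power_divide[symmetric]) (simp del: of_nat_Suc)
  ultimately show ?thesis by (simp del: of_nat_Suc)
 qed
 from order_tendstoD(2)[OF this] have ev: "eventually (\<lambda>N. c * ((2 * real (Suc N)) ^ n / (2 * real N) ^ n - 1) < \<epsilon>) sequentially"
  if "0 < \<epsilon>" for \<epsilon> using that .
 have bd: "real (?N R) \<le> R / 2" "R / 2 \<le> real (Suc (?N R))" if "2 \<le> R" for R using that by linarith+
 have up: "eventually (\<lambda>R. ennreal (g (R / 2) / R ^ n) \<le> ?f (?N R) + ennreal \<epsilon>) at_top" if e: "0 < \<epsilon>" for \<epsilon>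
  using eventually_compose_filterlim[OF ev[OF e] lim] eventually_ge_at_top[of 2]
 proof eventually_elim
  case (elim R)
  let ?a = "(2 * real (?N R)) ^ n" and ?b = "(2 * real (Suc (?N R))) ^ n"
  have a: "0 < ?a" "?a \<le> R ^ n" using elim(2) power_mono[of "2 * real (?N R)" R n] bd(1)[OF elim(2)] by simp_all
  have "g (R / 2) \<le> g (real (?N R)) + c * (?b - ?a)"
   using mono[OF bd(1)[OF elim(2)]] v_mono[OF bd(2)[OF elim(2)]] v[of "?N R"] v[of "Suc (?N R)"] by (simp add: right_diff_distrib)
  then have "g (R / 2) / R ^ n \<le> (g (real (?N R)) + c * (?b - ?a)) / ?a"
   using a g c[of "?N R"] by (intro frac_le) auto
  also have "\<dots> = g (real (?N R)) / ?a + c * (?b / ?a - 1)" using a by (intro add_mult_diff_divide) linarith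
  also have "\<dots> \<le> g (real (?N R)) / ?a + \<epsilon>" using elim(1) by linarith
  finally have "ennreal (g (R / 2) / R ^ n) \<le> ennreal (g (real (?N R)) / ?a + \<epsilon>)" by (rule ennreal_leI)
  also have "\<dots> = ?f (?N R) + ennreal \<epsilon>" using g e by (intro ennreal_plus) auto
  finally show ?case .
 qed
 have low: "eventually (\<lambda>R. ?f (Suc (?N R)) \<le> ennreal (g (R / 2) / R ^ n) + ennreal \<epsilon>) at_top" if e: "0 < \<epsilon>" for \<epsilon>
  using eventually_compose_filterlim[OF ev[OF e] lim] eventually_ge_at_top[of 2]
 proof eventually_elim
  case (elim R)
  let ?a = "(2 * real (?N R)) ^ n" and ?b = "(2 * real (Suc (?N R))) ^ n"
  have a: "0 < ?a" "?a \<le> R ^ n" "R ^ n \<le> ?b" "0 < R ^ n"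
   using elim(2) power_mono[of "2 * real (?N R)" R n] power_mono[of R "2 * real (Suc (?N R))" n] bd[OF elim(2)] by simp_all
  have "g (real (Suc (?N R))) \<le> g (R / 2) + c * (?b - ?a)"
   using mono[OF bd(2)[OF elim(2)]] v_mono[OF bd(1)[OF elim(2)]] v[of "?N R"] v[of "Suc (?N R)"] by (simp add: right_diff_distrib)
  then have "g (real (Suc (?N R))) / ?b \<le> (g (R / 2) + c * (?b - ?a)) / ?b" using a by (intro divide_right_mono) auto
  also have "\<dots> = g (R / 2) / ?b + c * (?b - ?a) / ?b" by (rule add_divide_distrib)
  also have "\<dots> \<le> g (R / 2) / R ^ n + c * (?b - ?a) / ?a"
   using a g c[of "?N R"] by (intro add_mono divide_left_mono) auto
  also have "c * (?b - ?a) / ?a = c * (?b / ?a - 1)"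
   using add_mult_diff_divide(2)[OF less_imp_neq[OF a(1), symmetric], of 0 c ?b] by simp
  also have "g (R / 2) / R ^ n + c * (?b / ?a - 1) \<le> g (R / 2) / R ^ n + \<epsilon>" using elim(1) by linarith
  finally have "?f (Suc (?N R)) \<le> ennreal (g (R / 2) / R ^ n + \<epsilon>)" by (rule ennreal_leI)
  also have "\<dots> = ennreal (g (R / 2) / R ^ n) + ennreal \<epsilon>" using g e a by (intro ennreal_plus) auto
  finally show ?case .
 qed
 show "Limsup at_top (\<lambda>R. ennreal (g (R / 2) / R ^ n)) \<le> limsup ?f" by (rule Limsup_le_Limsup_comp[OF lim up])
 assume fin: "liminf ?f < \<top>"
 show "liminf ?f \<le> Liminf at_top (\<lambda>R. ennreal (g (R / 2) / R ^ n))"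
  by (rule Liminf_comp_le_Liminf[OF filterlim_compose[OF filterlim_Suc lim] low fin])
qed

text \<open>The threshold in R is the same for all heights beyond \<open>h0\<close>. This uniformity
  yields both iterated limits and, since \<kappa> R eventually exceeds \<open>h0\<close>, the limit
  along the diagonal.\<close>

lemma iterated_limits:
 fixes a :: "real \<Rightarrow> real" and b :: "real \<Rightarrow> real \<Rightarrow> real"
 assumes lim': "\<forall>\<epsilon>>0. \<exists>h0. \<exists>R0. \<forall>R\<ge>R0. \<bar>a R - \<gamma>\<bar> \<le> \<epsilon> \<and> (\<forall>h\<ge>h0. \<bar>b R h - \<gamma>\<bar> \<le> \<epsilon>)"
  and g: "0 \<le> \<gamma>"
 shows "((\<lambda>R. ennreal (a R)) \<longlongrightarrow> ennreal \<gamma>) at_top"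
  "((\<lambda>h. Limsup at_top (\<lambda>R. ennreal (b R h))) \<longlongrightarrow> ennreal \<gamma>) at_top"
  "((\<lambda>h. Liminf at_top (\<lambda>R. ennreal (b R h))) \<longlongrightarrow> ennreal \<gamma>) at_top"
  "0 < \<kappa> \<Longrightarrow> ((\<lambda>R. ennreal (b R (\<kappa> * R))) \<longlongrightarrow> ennreal \<gamma>) at_top"
proof -
 note lim = lim'[rule_format]
 have r: "((\<lambda>x. ennreal (f x)) \<longlongrightarrow> ennreal \<gamma>) at_top" if fl: "\<And>\<epsilon>. 0 < \<epsilon> \<Longrightarrow> \<exists>x0. \<forall>x\<ge>x0. \<bar>f x - \<gamma>\<bar> \<le> \<epsilon>" for f :: "real \<Rightarrow> real"
 proof (rule tendsto_ennrealI, rule tendstoI)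
  fix \<epsilon> :: real assume "0 < \<epsilon>"
  then obtain x0 where x0: "\<forall>x\<ge>x0. \<bar>f x - \<gamma>\<bar> \<le> \<epsilon> / 2" using fl[OF half_gt_zero] by blast
  have "dist (f x) \<gamma> < \<epsilon>" if "x0 \<le> x" for x
  proof -
   have "\<bar>f x - \<gamma>\<bar> \<le> \<epsilon> / 2" using x0 that by blast
   also have "\<dots> < \<epsilon>" using \<open>0 < \<epsilon>\<close> by simp
   finally show ?thesis by (simp only: dist_real_def)
  qed
  then show "\<forall>\<^sub>F x in at_top. dist (f x) \<gamma> < \<epsilon>" by (auto simp: eventually_at_top_linorder)
 qed
 show "((\<lambda>R. ennreal (a R)) \<longlongrightarrow> ennreal \<gamma>) at_top" using lim by (intro r) blast
 show "((\<lambda>R. ennreal (b R (\<kappa> * R))) \<longlongrightarrow> ennreal \<gamma>) at_top" if k: "0 < \<kappa>"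
 proof (rule r)
  fix \<epsilon> :: real assume "0 < \<epsilon>"
  then obtain h0 R0 where l: "\<forall>R\<ge>R0. \<bar>a R - \<gamma>\<bar> \<le> \<epsilon> \<and> (\<forall>h\<ge>h0. \<bar>b R h - \<gamma>\<bar> \<le> \<epsilon>)" using lim by blast
  have "\<bar>b R (\<kappa> * R) - \<gamma>\<bar> \<le> \<epsilon>" if "max R0 (h0 / \<kappa>) \<le> R" for R
  proof -
   have "R0 \<le> R" "h0 \<le> \<kappa> * R" using that k by (auto simp: field_simps)
   then show ?thesis using l by blast
  qed
  then show "\<exists>x0. \<forall>R\<ge>x0. \<bar>b R (\<kappa> * R) - \<gamma>\<bar> \<le> \<epsilon>" by blast
 qed
 have bd: "\<exists>h0. \<forall>h\<ge>h0. ennreal (\<gamma> - \<epsilon>) \<le> Liminf at_top (\<lambda>R. ennreal (b R h)) \<and> Limsup at_top (\<lambda>R. ennreal (b R h)) \<le> ennreal (\<gamma> + \<epsilon>)"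
  if e: "0 < \<epsilon>" for \<epsilon>
 proof -
  obtain h0 R0 where l: "\<forall>R\<ge>R0. \<bar>a R - \<gamma>\<bar> \<le> \<epsilon> \<and> (\<forall>h\<ge>h0. \<bar>b R h - \<gamma>\<bar> \<le> \<epsilon>)" using lim[OF e] by blast
  have "ennreal (\<gamma> - \<epsilon>) \<le> Liminf at_top (\<lambda>R. ennreal (b R h)) \<and> Limsup at_top (\<lambda>R. ennreal (b R h)) \<le> ennreal (\<gamma> + \<epsilon>)" if h: "h0 \<le> h" for h
  proof -
   have "\<gamma> - \<epsilon> \<le> b R h \<and> b R h \<le> \<gamma> + \<epsilon>" if "R0 \<le> R" for R using l that h by (fastforce simp: abs_le_iff)
   then show ?thesis
    by (intro conjI Liminf_bounded Limsup_bounded) (auto simp: eventually_at_top_linorder intro!: exI[of _ R0] ennreal_leI)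
  qed
  then show ?thesis by blast
 qed
 have le: "Liminf at_top (\<lambda>R. ennreal (b R h)) \<le> Limsup at_top (\<lambda>R. ennreal (b R h))" for h
  by (rule Liminf_le_Limsup) simp
 have r2: "(f \<longlongrightarrow> ennreal \<gamma>) at_top" if fl:
  "\<And>\<epsilon>. 0 < \<epsilon> \<Longrightarrow> \<exists>h0. \<forall>h\<ge>h0. ennreal (\<gamma> - \<epsilon>) \<le> f h \<and> f h \<le> ennreal (\<gamma> + \<epsilon>)" for f :: "real \<Rightarrow> ennreal"
 proof -
  \<comment> \<open>For small h the value may be infinite; from some height on it is finite and real
    estimates apply.\<close>
  have "eventually (\<lambda>h. f h = ennreal (enn2real (f h))) at_top"
  proof -
   obtain h0 where "\<forall>h\<ge>h0. f h \<le> ennreal (\<gamma> + 1)" using fl[of 1] by auto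
   then have "f h = ennreal (enn2real (f h))" if "h0 \<le> h" for h
    using that by (intro ennreal_enn2real[symmetric] order_le_less_trans[OF _ ennreal_less_top]) blast
   then show ?thesis unfolding eventually_at_top_linorder by blast
  qed
  moreover have "((\<lambda>h. ennreal (enn2real (f h))) \<longlongrightarrow> ennreal \<gamma>) at_top"
  proof (rule r)
   fix \<epsilon> :: real assume e: "0 < \<epsilon>"
   then obtain h0 where h0: "\<forall>h\<ge>h0. ennreal (\<gamma> - \<epsilon>) \<le> f h \<and> f h \<le> ennreal (\<gamma> + \<epsilon>)" using fl by blast
   have "\<bar>enn2real (f h) - \<gamma>\<bar> \<le> \<epsilon>" if "h0 \<le> h" for h
   proof -
    have f: "ennreal (\<gamma> - \<epsilon>) \<le> f h" "f h \<le> ennreal (\<gamma> + \<epsilon>)" using h0 that by auto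
    then obtain t where t: "0 \<le> t" "f h = ennreal t" by (cases "f h") (auto simp: top_unique)
    have "t \<le> \<gamma> + \<epsilon>" using f(2) t g e by (simp add: ennreal_le_iff del: ennreal_plus)
    moreover have "\<gamma> - \<epsilon> \<le> t" using f(1) t by (cases "0 \<le> \<gamma> - \<epsilon>") (auto simp: ennreal_le_iff)
    ultimately show ?thesis using t by auto
   qed
   then show "\<exists>x0. \<forall>h\<ge>x0. \<bar>enn2real (f h) - \<gamma>\<bar> \<le> \<epsilon>" by blast
  qed
  ultimately show ?thesis by (subst tendsto_cong)
 qed
 show "((\<lambda>h. Limsup at_top (\<lambda>R. ennreal (b R h))) \<longlongrightarrow> ennreal \<gamma>) at_top"
  using bd order_trans[OF _ le] by (intro r2) meson
 show "((\<lambda>h. Liminf at_top (\<lambda>R. ennreal (b R h))) \<longlongrightarrow> ennreal \<gamma>) at_top"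
  using bd order_trans[OF le] by (intro r2) meson
qed

section \<open>Minimal energies as real numbers\<close>

context medium
begin

interpretation prob_space M by (rule P)

definition mR :: "'w \<Rightarrow> 'd \<Rightarrow> real \<Rightarrow> real set \<Rightarrow> real" where
 "mR \<omega> y \<rho> H = enn2real (mE \<omega> (dom y \<rho> H))"

definition vR :: "real \<Rightarrow> real set \<Rightarrow> real" where "vR \<rho> H = enn2real (V (dom 0 \<rho> H))"

lemma ennreal_vR: "H \<in> sets borel \<Longrightarrow> y \<bullet> e = 0 \<Longrightarrow> ennreal (vR \<rho> H) = V (dom y \<rho> H)"
 unfolding vR_def using V_dom_finite[of \<rho> H] V_dom[of H y \<rho>] V_dom[of H 0 \<rho>] by simp

lemma ennreal_mR: "\<omega> \<in> space M \<Longrightarrow> open H \<Longrightarrow> y \<bullet> e = 0 \<Longrightarrow> ennreal (mR \<omega> y \<rho> H) = mE \<omega> (dom y \<rho> H)"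
 unfolding mR_def
 by (rule ennreal_enn2real, rule order_le_less_trans[OF mE_le_V[OF _ open_dom]])
   (simp_all flip: ennreal_vR)

lemma mR_nonneg: "0 \<le> mR \<omega> y \<rho> H" and vR_nonneg: "0 \<le> vR \<rho> H"
 by (simp_all add: mR_def vR_def)

lemma vR_nat: "H \<in> sets borel \<Longrightarrow> vR (real N) H = cH H * (2 * real N) ^ card B"
 unfolding vR_def using V_dom_nat[of H 0 N] cH(2)[of H] by simp

text \<open>The pieces may differ in centre, size and height set. The same inequality therefore
  gives lattice subadditivity, monotonicity in the size and comparison of heights. Subtraction is
  legitimate because the planar energy of a cylinder of finite width is finite.\<close>

lemma mR_subadd:
 assumes w: "\<omega> \<in> space M" and I: "finite I" and H: "open H" and y: "y \<bullet> e = 0"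
  and Ki: "\<And>i. i \<in> I \<Longrightarrow> open (K i)" "\<And>i. i \<in> I \<Longrightarrow> ys i \<bullet> e = 0"
   "\<And>i. i \<in> I \<Longrightarrow> dom (ys i) (r i) (K i) \<subseteq> dom y \<rho> H"
  and disj: "disjoint_family_on (\<lambda>i. dom (ys i) (r i) (K i)) I"
 shows "mR \<omega> y \<rho> H \<le> (\<Sum>i\<in>I. mR \<omega> (ys i) (r i) (K i)) + (vR \<rho> H - (\<Sum>i\<in>I. vR (r i) (K i)))"
proof -
 let ?D = "\<lambda>i. dom (ys i) (r i) (K i)"
 let ?U = "\<Union>i\<in>I. ?D i"
 have b: "?D i \<in> sets borel" if "i \<in> I" for i using Ki(1)[OF that] by (intro dom_borel borel_open)
 have Ub: "?U \<in> sets borel" using I b by (intro sets.finite_UN) auto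
 have Db: "dom y \<rho> H \<in> sets borel" using H by (intro dom_borel borel_open)
 have "V (dom y \<rho> H) = V ((dom y \<rho> H - ?U) \<union> ?U)" using Ki(3) by (intro arg_cong[where f=V]) blast
 also have "\<dots> = V (dom y \<rho> H - ?U) + V ?U" using Db Ub by (intro V_Un) auto
 also have "V ?U = (\<Sum>i\<in>I. V (?D i))" by (rule V_UN[OF I b disj])
 also have "\<dots> = (\<Sum>i\<in>I. ennreal (vR (r i) (K i)))"
  using Ki by (intro sum.cong refl ennreal_vR[symmetric]) auto
 also have "\<dots> = ennreal (\<Sum>i\<in>I. vR (r i) (K i))" by (rule sum_ennreal) (rule vR_nonneg)
 finally have 1: "ennreal (vR \<rho> H) = V (dom y \<rho> H - ?U) + ennreal (\<Sum>i\<in>I. vR (r i) (K i))"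
  using ennreal_vR[of H y \<rho>] y H by simp
 then obtain t where t: "0 \<le> t" "V (dom y \<rho> H - ?U) = ennreal t" by (cases "V (dom y \<rho> H - ?U)") auto
 have s: "0 \<le> (\<Sum>i\<in>I. vR (r i) (K i))" by (intro sum_nonneg vR_nonneg)
 have t2: "vR \<rho> H = t + (\<Sum>i\<in>I. vR (r i) (K i))"
  using 1 t s vR_nonneg[of \<rho> H] by (simp flip: ennreal_plus)
 have "ennreal (mR \<omega> y \<rho> H) = mE \<omega> (dom y \<rho> H)" by (rule ennreal_mR[OF w H y])
 also have "\<dots> \<le> (\<Sum>i\<in>I. mE \<omega> (?D i)) + V (dom y \<rho> H - ?U)"
  using Ki by (intro mE_subadd[OF w I open_dom[OF H] _ _ disj] open_dom) auto
 also have "(\<Sum>i\<in>I. mE \<omega> (?D i)) = (\<Sum>i\<in>I. ennreal (mR \<omega> (ys i) (r i) (K i)))"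
  using Ki by (intro sum.cong refl ennreal_mR[OF w, symmetric]) auto
 also have "\<dots> = ennreal (\<Sum>i\<in>I. mR \<omega> (ys i) (r i) (K i))" by (rule sum_ennreal) (rule mR_nonneg)
 also have "\<dots> + V (dom y \<rho> H - ?U) = ennreal ((\<Sum>i\<in>I. mR \<omega> (ys i) (r i) (K i)) + t)"
  unfolding t(2) using t(1) by (intro ennreal_plus[symmetric] sum_nonneg mR_nonneg)
 finally have "mR \<omega> y \<rho> H \<le> (\<Sum>i\<in>I. mR \<omega> (ys i) (r i) (K i)) + t"
  using t(1) by (subst (asm) ennreal_le_iff) (auto intro!: add_nonneg_nonneg sum_nonneg mR_nonneg)
 then show ?thesis using t2 by simp
qed

lemma mR_mono:
 assumes "\<omega> \<in> space M" "open H" "open K" "K \<subseteq> H" "y \<bullet> e = 0" "y' \<bullet> e = 0"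
  "\<And>b. b \<in> B \<Longrightarrow> \<bar>(y' - y) \<bullet> b\<bar> + \<rho> \<le> \<rho>'"
 shows "mR \<omega> y \<rho>' H \<le> mR \<omega> y' \<rho> K + (vR \<rho>' H - vR \<rho> K)"
 using mR_subadd[of \<omega> "{()}" H y "\<lambda>_. K" "\<lambda>_. y'" "\<lambda>_. \<rho>" \<rho>'] assms dom_subset[OF assms(7) assms(4)]
 by (simp add: disjoint_family_on_def)

lemma mR_le: "\<omega> \<in> space M \<Longrightarrow> open H \<Longrightarrow> y \<bullet> e = 0 \<Longrightarrow> mR \<omega> y \<rho> H \<le> vR \<rho> H"
 using mR_subadd[of \<omega> "{}" H y] by (simp add: disjoint_family_on_def)

lemma vR_mono: "H \<in> sets borel \<Longrightarrow> \<rho> \<le> \<rho>' \<Longrightarrow> vR \<rho> H \<le> vR \<rho>' H"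
proof -
 assume H: "H \<in> sets borel" and r: "\<rho> \<le> \<rho>'"
 have "ennreal (vR \<rho> H) \<le> ennreal (vR \<rho>' H)"
  unfolding ennreal_vR[OF H inner_zero_left] V_dom[OF H inner_zero_left]
  by (intro mult_right_mono cvol_mono cube_borel cube_subset) (use r in auto)
 then show ?thesis by (simp add: vR_nonneg ennreal_le_iff)
qed

section \<open>Cost of extending a cylinder in height\<close>

abbreviation "ivl h \<equiv> {- h<..<h::real}"

text \<open>Planar energy beyond height h, per unit area. The factor \<open>3 ^ card B\<close> pays
  for rounding R / 2 up to an integer N, where 2 N \<le> 3 R as soon as R \<ge> 1.\<close>

definition tail :: "real \<Rightarrow> real" where "tail h = 3 ^ card B * cH (- ivl h)"

lemma tail_nonneg: "0 \<le> tail h" by (simp add: tail_def cH(2))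

lemma vR_Un: "H \<in> sets borel \<Longrightarrow> K \<in> sets borel \<Longrightarrow> H \<inter> K = {} \<Longrightarrow> vR \<rho> (H \<union> K) = vR \<rho> H + vR \<rho> K"
proof -
 assume b: "H \<in> sets borel" "K \<in> sets borel" "H \<inter> K = {}"
 have "dom 0 \<rho> (H \<union> K) = dom 0 \<rho> H \<union> dom 0 \<rho> K" by (auto simp: dom_def)
 moreover have "V (dom 0 \<rho> H \<union> dom 0 \<rho> K) = V (dom 0 \<rho> H) + V (dom 0 \<rho> K)"
  using b by (intro V_Un dom_borel) (auto simp: dom_def)
 ultimately have "ennreal (vR \<rho> (H \<union> K)) = ennreal (vR \<rho> H + vR \<rho> K)"
  using b by (simp add: ennreal_vR[of _ 0] vR_nonneg)
 then show ?thesis by (subst (asm) ennreal_inj) (simp_all add: vR_nonneg)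
qed

lemma vR_tail_le:
 assumes "1 \<le> R" "open H" "ivl h \<subseteq> H"
 shows "vR (R / 2) H - vR (R / 2) (ivl h) \<le> tail h * R ^ card B"
proof -
 let ?N = "nat \<lfloor>R / 2\<rfloor> + 1"
 have Hb: "H \<in> sets borel" using assms by (intro borel_open)
 have "vR (R / 2) H + vR (R / 2) (- H) = vR (R / 2) (H \<union> - H)" using Hb by (intro vR_Un[symmetric]) auto
 also have "\<dots> = vR (R / 2) (ivl h \<union> - ivl h)" by simp
 also have "\<dots> = vR (R / 2) (ivl h) + vR (R / 2) (- ivl h)" by (rule vR_Un) auto
 finally have "vR (R / 2) H - vR (R / 2) (ivl h) \<le> vR (R / 2) (- ivl h)" using vR_nonneg[of "R / 2" "- H"] by linarith
 also have "\<dots> \<le> vR (real ?N) (- ivl h)" by (rule vR_mono) (simp, linarith)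
 also have "\<dots> = cH (- ivl h) * (2 * real ?N) ^ card B" by (rule vR_nat) simp
 also have "\<dots> \<le> cH (- ivl h) * (3 * R) ^ card B"
 proof (rule mult_left_mono[OF power_mono cH(2)])
  show "2 * real ?N \<le> 3 * R" using assms(1) of_nat_floor[of "R / 2"] by simp
 qed simp
 finally show ?thesis by (simp add: tail_def power_mult_distrib mult_ac)
qed

lemma qmass_tail: "(\<lambda>n. qmass (- ivl (real n))) \<longlonglongrightarrow> 0"
proof -
 have "(\<lambda>n. \<integral>\<^sup>+t. ennreal (f0 t) * indicator (- ivl (real n)) t \<partial>lborel) \<longlonglongrightarrow> (\<integral>\<^sup>+t. 0 \<partial>(lborel :: real measure))"
 proof (rule nn_integral_dominated_convergence[where w="\<lambda>t. ennreal (f0 t)"])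
  show "AE t in lborel. (\<lambda>n. ennreal (f0 t) * indicator (- ivl (real n)) t) \<longlonglongrightarrow> 0"
  proof (rule AE_I2)
   fix t :: real
   have "eventually (\<lambda>n. \<bar>t\<bar> < real n) sequentially" by (rule filterlim_at_top_dense[THEN iffD1, OF filterlim_real_sequentially, rule_format])
   then have "eventually (\<lambda>n. ennreal (f0 t) * indicator (- ivl (real n)) t = 0) sequentially"
    by eventually_elim (auto simp: indicator_def)
   then show "(\<lambda>n. ennreal (f0 t) * indicator (- ivl (real n)) t) \<longlonglongrightarrow> 0" by (rule tendsto_eventually)
  qed
  show "(\<integral>\<^sup>+t. ennreal (f0 t) \<partial>lborel) < \<infinity>" by (rule f0_finite)
 qed (auto simp: indicator_def intro!: AE_I2)
 then show ?thesis by (simp add: qmass_def)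
qed

lemma tail_antimono: "h \<le> h' \<Longrightarrow> tail h' \<le> tail h"
proof -
 assume "h \<le> h'"
 then have "qmass (- ivl h') \<le> qmass (- ivl h)" by (intro qmass_mono) auto
 then have "ennreal (cH (- ivl h')) \<le> ennreal (cH (- ivl h))" unfolding cH(1) by (rule mult_left_mono) simp
 then show ?thesis by (simp add: tail_def ennreal_le_iff cH(2))
qed

lemma tail_tendsto: "(\<lambda>n. tail (real n)) \<longlonglongrightarrow> 0"
proof -
 have "(\<lambda>n. cvol1 * qmass (- ivl (real n))) \<longlonglongrightarrow> cvol1 * 0"
  using cvol1_finite by (intro ennreal_tendsto_cmult qmass_tail)  simp
 then have "(\<lambda>n. ennreal (cH (- ivl (real n)))) \<longlonglongrightarrow> ennreal 0" by (simp add: cH(1))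
 then have "(\<lambda>n. cH (- ivl (real n))) \<longlonglongrightarrow> 0" by (subst (asm) tendsto_ennreal_iff) (auto simp: cH(2))
 then have "(\<lambda>n. 3 ^ card B * cH (- ivl (real n))) \<longlonglongrightarrow> 3 ^ card B * 0" by (intro tendsto_intros)
 then show ?thesis by (simp add: tail_def)
qed

text \<open>From above, a near-minimiser of the infinite cylinder is cut off at finite height; from
  below, a competitor of finite height is continued by the planar profile at the price of the tail.
  Measurability thereby passes to infinite height.\<close>

lemma mR_UNIV_tendsto:
 assumes w: "\<omega> \<in> space M"
 shows "(\<lambda>n. mR \<omega> 0 (real N) (ivl (real n))) \<longlonglongrightarrow> mR \<omega> 0 (real N) UNIV"
proof (rule LIMSEQ_I)
 fix \<epsilon> :: real assume e: "0 < \<epsilon>"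
 let ?m = "mR \<omega> 0 (real N) UNIV" and ?D = "dom 0 (real N) UNIV"
 have m: "ennreal ?m = mE \<omega> ?D" by (rule ennreal_mR[OF w]) simp_all
 have "(\<lambda>n. tail (real n) * (2 * real N + 1) ^ card B) \<longlonglongrightarrow> 0 * (2 * real N + 1) ^ card B" by (intro tendsto_mult tail_tendsto tendsto_const)
 then have "eventually (\<lambda>n. tail (real n) * (2 * real N + 1) ^ card B < \<epsilon>) sequentially" using e unfolding mult_zero_left by (rule order_tendstoD(2))
 moreover have "mE \<omega> ?D < mE \<omega> ?D + ennreal (\<epsilon> / 2)"
  unfolding m[symmetric] using e mR_nonneg[of \<omega> 0 "real N" UNIV] ennreal_lessI[of "?m + \<epsilon> / 2" ?m] by (simp add: ennreal_plus)
 then obtain v G where vG: "(v, G) \<in> Adm ?D" "ener \<omega> ?D v G < mE \<omega> ?D + ennreal (\<epsilon> / 2)"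
  unfolding mE_def[of \<omega> ?D] INF_less_iff by (auto simp: case_prod_beta)
 obtain h0 where h0: "\<forall>h\<ge>h0. mE \<omega> (dom 0 (real N) (ivl h)) \<le> ener \<omega> ?D v G + ennreal (\<epsilon> / 4)"
  using mE_cutoff[OF w vG(1), of "\<epsilon> / 4"] e by auto
 have "eventually (\<lambda>n. h0 \<le> real n) sequentially" by (rule filterlim_at_top[THEN iffD1, OF filterlim_real_sequentially, rule_format])
 ultimately have "eventually (\<lambda>n. norm (mR \<omega> 0 (real N) (ivl (real n)) - ?m) < \<epsilon>) sequentially"
 proof eventually_elim
  case (elim n)
  have "ennreal (mR \<omega> 0 (real N) (ivl (real n))) = mE \<omega> (dom 0 (real N) (ivl (real n)))" by (rule ennreal_mR[OF w]) simp_all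
  also have "\<dots> \<le> ener \<omega> ?D v G + ennreal (\<epsilon> / 4)" using h0 elim(2) by blast
  also have "\<dots> \<le> ennreal ?m + ennreal (\<epsilon> / 2) + ennreal (\<epsilon> / 4)" unfolding m by (intro add_right_mono less_imp_le vG(2))
  also have "\<dots> = ennreal (?m + \<epsilon> / 2 + \<epsilon> / 4)" using e mR_nonneg by (subst ennreal_plus, simp, simp, subst ennreal_plus) simp_all
  finally have 1: "mR \<omega> 0 (real N) (ivl (real n)) \<le> ?m + \<epsilon> / 2 + \<epsilon> / 4"
   using e mR_nonneg[of \<omega> 0 "real N" UNIV] by (subst (asm) ennreal_le_iff) auto
  have "?m \<le> mR \<omega> 0 (real N) (ivl (real n)) + (vR (real N) UNIV - vR (real N) (ivl (real n)))"
   by (rule mR_mono[OF w]) simp_all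
  also have "vR (real N) UNIV - vR (real N) (ivl (real n)) \<le> tail (real n) * (2 * real N + 1) ^ card B"
  proof -
   have "vR (real N) UNIV = vR (real N) (ivl (real n)) + vR (real N) (- ivl (real n))"
    using vR_Un[of "ivl (real n)" "- ivl (real n)" "real N"] by simp
   moreover have "vR (real N) (- ivl (real n)) = cH (- ivl (real n)) * (2 * real N) ^ card B" by (rule vR_nat) simp
   moreover have "\<dots> \<le> cH (- ivl (real n)) * (2 * real N + 1) ^ card B" by (intro mult_left_mono power_mono cH(2)) auto
   moreover have "\<dots> \<le> tail (real n) * (2 * real N + 1) ^ card B"
    unfolding tail_def using mult_right_mono[OF one_le_power[of "3::real" "card B"] cH(2)[of "- ivl (real n)"]]
    by (intro mult_right_mono) auto
   ultimately show ?thesis by linarith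
  qed
  finally show ?case using 1 elim(1) e unfolding real_norm_def by linarith
 qed
 then show "\<exists>no. \<forall>n\<ge>no. norm (mR \<omega> 0 (real N) (ivl (real n)) - ?m) < \<epsilon>" by (simp add: eventually_sequentially)
qed

lemma mR_measurable_ivl [measurable]: "(\<lambda>\<omega>. mR \<omega> 0 \<rho> (ivl h)) \<in> borel_measurable M"
proof -
 have "(\<lambda>\<omega>. mE \<omega> (dom 0 \<rho> (ivl h))) \<in> borel_measurable M"
  by (intro mE_measurable_bounded open_dom bounded_dom) auto
 then show ?thesis unfolding mR_def by measurable
qed

lemma mR_measurable_UNIV [measurable]: "(\<lambda>\<omega>. mR \<omega> 0 (real N) UNIV) \<in> borel_measurable M"
 by (rule borel_measurable_LIMSEQ_real[OF mR_UNIV_tendsto]) measurable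

text \<open>Stationarity turns the energy in a cube about a lattice point into the energy in the
  cube about the origin for the translated medium, and separation of centres in one coordinate makes
  the cylinders disjoint.\<close>

lemma subadditive_process_mR:
 assumes H: "open H" and meas: "\<And>N. (\<lambda>\<omega>. mR \<omega> 0 (real N) H) \<in> borel_measurable M"
 shows "subadditive_process M (\<lambda>z. \<tau> (lat z)) B (\<lambda>N \<omega>. mR \<omega> 0 (real N) H) (cH H)"
proof -
 have Hb: "H \<in> sets borel" using H by (rule borel_open)
 have la: "lattice_action M (\<lambda>z. \<tau> (lat z)) B"
 proof (intro_locales, unfold_locales)
  show "finite B" by (rule finB)
  show "\<tau> (lat z) \<in> M \<rightarrow>\<^sub>M M" "distr M M (\<tau> (lat z)) = M" for z by (rule tau_measurable tau_pres)+
  fix z z' x assume x: "x \<in> space M"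
  have "lat (\<lambda>b. z b + z' b) = lat z + lat z'" by (simp add: lat_def scaleR_add_left sum.distrib)
  then show "\<tau> (lat (\<lambda>b. z b + z' b)) x = \<tau> (lat z) (\<tau> (lat z') x)" using tau_add[OF x] by simp
  show "\<tau> (lat (\<lambda>_. 0)) x = x" using tau_0[OF x] by (simp add: lat_def)
  assume "\<And>b. b \<in> B \<Longrightarrow> z b = z' b"
  then have "lat z = lat z'" unfolding lat_def by (intro sum.cong) auto
  then show "\<tau> (lat z) x = \<tau> (lat z') x" by simp
 qed
 show ?thesis
 proof (rule subadditive_process.intro[OF la], unfold_locales)
  show "0 \<le> cH H" by (rule cH(2))
  show "(\<lambda>\<omega>. mR \<omega> 0 (real N) H) \<in> borel_measurable M" for N by (rule meas)
  show "0 \<le> mR x 0 (real N) H" for N x by (rule mR_nonneg)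
  show "mR x 0 (real N) H \<le> cH H * (2 * real N) ^ card B" if "x \<in> space M" for N x
   using mR_le[OF that H, of 0 "real N"] vR_nat[OF Hb, of N] by simp
  fix x N and I :: "(('d \<Rightarrow> int) \<times> nat) set"
  assume x: "x \<in> space M" and I: "finite I"
   and sub: "\<And>z r. (z, r) \<in> I \<Longrightarrow> 1 \<le> r \<and> (\<forall>b\<in>B. \<bar>z b\<bar> + int r \<le> int N)"
   and dis: "\<And>z r z' r'. (z, r) \<in> I \<Longrightarrow> (z', r') \<in> I \<Longrightarrow> (z, r) \<noteq> (z', r') \<Longrightarrow> \<exists>b\<in>B. int (r + r') \<le> \<bar>z b - z' b\<bar>"
  have "mR x 0 (real N) H \<le> (\<Sum>i\<in>I. mR x (lat (fst i)) (real (snd i)) H) + (vR (real N) H - (\<Sum>i\<in>I. vR (real (snd i)) H))"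
  proof (rule mR_subadd[OF x I H _ H lat_e])
   show "dom (lat (fst i)) (real (snd i)) H \<subseteq> dom 0 (real N) H" if "i \<in> I" for i
   proof (rule dom_subset)
    fix b assume b: "b \<in> B"
    have "\<bar>fst i b\<bar> + int (snd i) \<le> int N" using sub[of "fst i" "snd i"] that b by simp
    then have "real_of_int (\<bar>fst i b\<bar> + int (snd i)) \<le> real_of_int (int N)" by (simp only: of_int_le_iff)
    then show "\<bar>(lat (fst i) - 0) \<bullet> b\<bar> + real (snd i) \<le> real N" using lat_inner[OF b] by simp
   qed simp
   show "disjoint_family_on (\<lambda>i. dom (lat (fst i)) (real (snd i)) H) I"
    unfolding disjoint_family_on_def
   proof (intro ballI impI)
    fix i j assume ij: "i \<in> I" "j \<in> I" "i \<noteq> j"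
    then obtain b where b: "b \<in> B" "int (snd i + snd j) \<le> \<bar>fst i b - fst j b\<bar>"
     using dis[of "fst i" "snd i" "fst j" "snd j"] by auto
    from b(2) have "real_of_int (int (snd i + snd j)) \<le> real_of_int \<bar>fst i b - fst j b\<bar>" by (simp only: of_int_le_iff)
    then have "cube (lat (fst i)) (real (snd i)) \<inter> cube (lat (fst j)) (real (snd j)) = {}"
     using lat_inner[OF b(1)] by (intro cube_disjoint[OF b(1)]) (simp add: inner_diff_left)
    then show "dom (lat (fst i)) (real (snd i)) H \<inter> dom (lat (fst j)) (real (snd j)) H = {}"
     unfolding dom_cube by blast
   qed
  qed simp
  also have "(\<Sum>i\<in>I. vR (real (snd i)) H) = cH H * (\<Sum>i\<in>I. (2 * real (snd i)) ^ card B)"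
   by (simp only: vR_nat[OF Hb] sum_distrib_left)
  also have "vR (real N) H = cH H * (2 * real N) ^ card B" by (rule vR_nat[OF Hb])
  also have "(\<Sum>i\<in>I. mR x (lat (fst i)) (real (snd i)) H) = (\<Sum>i\<in>I. mR (\<tau> (lat (fst i)) x) 0 (real (snd i)) H)"
   unfolding mR_def by (simp only: mE_translate[OF x lat_e H])
  finally show "mR x 0 (real N) H \<le> (\<Sum>(z, r)\<in>I. mR (\<tau> (lat z) x) 0 (real r) H)
    + cH H * ((2 * real N) ^ card B - (\<Sum>(z, r)\<in>I. (2 * real r) ^ card B))"
   by (simp add: case_prod_beta right_diff_distrib)
 qed
qed


section \<open>Upper and lower limits and their invariance\<close>

definition upper :: "real set \<Rightarrow> 'w \<Rightarrow> ennreal" where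
 "upper H \<omega> = limsup (\<lambda>N. ennreal (mR \<omega> 0 (real N) H / (2 * real N) ^ card B))"

definition lower :: "real set \<Rightarrow> 'w \<Rightarrow> ennreal" where
 "lower H \<omega> = liminf (\<lambda>N. ennreal (mR \<omega> 0 (real N) H / (2 * real N) ^ card B))"

text \<open>The energy at any larger or infinite height exceeds that at height h by at most
  \<open>tail h\<close> per unit area, so each term of the infimum bounds the upper limits at all
  larger heights.\<close>

definition upper_tail :: "'w \<Rightarrow> ennreal" where
 "upper_tail \<omega> = (INF h::nat. upper (ivl (real h)) \<omega> + ennreal (tail (real h)))"

lemma mR_le_nat: "\<omega> \<in> space M \<Longrightarrow> open H \<Longrightarrow> mR \<omega> 0 (real N) H \<le> cH H * (2 * real N) ^ card B"
 using mR_le[of \<omega> H 0 "real N"] vR_nat[of H N] by simp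

text \<open>The cube of half-side N + k about x contains that of half-side N about the origin when k
  is at least norm x. The inequality holds at every point of the space, which the membership of the
  final event in \<open>Sigma_e\<close> requires.\<close>

lemma upper_lower_tau_orth_le:
 assumes w: "\<omega> \<in> space M" and x: "x \<bullet> e = 0" and H: "open H"
 shows "upper H (\<tau> x \<omega>) \<le> upper H \<omega>" "lower H (\<tau> x \<omega>) \<le> lower H \<omega>"
proof -
 have Hb: "H \<in> sets borel" using H by (rule borel_open)
 define k where "k = nat \<lceil>norm x\<rceil>"
 have k: "\<bar>x \<bullet> b\<bar> \<le> real k" if "b \<in> B" for b
  using Cauchy_Schwarz_ineq2[of x b] B_norm[OF that] by (simp add: k_def) linarith
 have "mR (\<tau> x \<omega>) 0 (real (N + k)) H \<le> mR \<omega> 0 (real N) H + cH H * ((2 * real (N + k)) ^ card B - (2 * real N) ^ card B)" for N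
 proof -
  have "mR (\<tau> x \<omega>) 0 (real (N + k)) H = mR \<omega> x (real (N + k)) H"
   unfolding mR_def by (simp only: mE_translate[OF w x H])
  also have "\<dots> \<le> mR \<omega> 0 (real N) H + (vR (real (N + k)) H - vR (real N) H)"
   using k x by (intro mR_mono[OF w H H]) (auto simp: inner_minus_left)
  finally show ?thesis by (simp only: vR_nat[OF Hb] right_diff_distrib)
 qed
 note le = this
 show "upper H (\<tau> x \<omega>) \<le> upper H \<omega>" unfolding upper_def by (rule limsup_shifted_quotient_le[OF mR_nonneg le])
 show "lower H (\<tau> x \<omega>) \<le> lower H \<omega>" unfolding lower_def
  by (rule liminf_shifted_quotient_le[OF mR_nonneg le mR_le_nat[OF tau_space[OF w] H]])
qed

text \<open>Restricted to infinite height, since a shift along \<open>e\<close> maps a finite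
  cylinder to a different one. The cost from \<open>mE_shift_e\<close> is proportional to the shell
  between half-sides N and N + 1.\<close>

lemma upper_tau_e_le:
 assumes w: "\<omega> \<in> space M"
 shows "upper UNIV (\<tau> (s *\<^sub>R e) \<omega>) \<le> upper UNIV \<omega>"
proof -
 obtain C where C: "0 \<le> C" "\<And>\<rho>. mE (\<tau> (s *\<^sub>R e) \<omega>) (dom 0 (\<rho> + 1) UNIV)
   \<le> mE \<omega> (dom 0 \<rho> UNIV) + ennreal C * V (dom 0 (\<rho> + 1) UNIV - dom 0 \<rho> UNIV)"
  using mE_shift_e[of s] w by blast
 have "mR (\<tau> (s *\<^sub>R e) \<omega>) 0 (real (N + 1)) UNIV
   \<le> mR \<omega> 0 (real N) UNIV + C * cH UNIV * ((2 * real (N + 1)) ^ card B - (2 * real N) ^ card B)" for N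
 proof -
  let ?D = "dom 0 (real (N + 1)) UNIV" and ?D' = "dom 0 (real N) UNIV"
  have sub: "?D' \<subseteq> ?D" by (rule dom_subset) auto
  have "V ?D = V ((?D - ?D') \<union> ?D')" using sub by (simp add: Un_absorb2)
  also have "\<dots> = V (?D - ?D') + V ?D'" by (intro V_Un) auto
  finally have "ennreal (vR (real (N + 1)) UNIV) = V (?D - ?D') + ennreal (vR (real N) UNIV)"
   by (simp only: ennreal_vR[OF borel_open[OF open_UNIV] inner_zero_left])
  then obtain t where t: "0 \<le> t" "V (?D - ?D') = ennreal t" "ennreal (vR (real (N + 1)) UNIV) = ennreal (t + vR (real N) UNIV)"
   by (cases "V (?D - ?D')") (auto simp: ennreal_plus vR_nonneg)
  have t': "vR (real (N + 1)) UNIV = t + vR (real N) UNIV"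
   using t(3) t(1) by (subst (asm) ennreal_inj) (simp_all add: vR_nonneg)
  have t'': "t = cH UNIV * ((2 * real (N + 1)) ^ card B - (2 * real N) ^ card B)"
   using t' unfolding vR_nat[OF borel_open[OF open_UNIV]] right_diff_distrib by linarith
  have "ennreal (mR (\<tau> (s *\<^sub>R e) \<omega>) 0 (real (N + 1)) UNIV) = mE (\<tau> (s *\<^sub>R e) \<omega>) ?D"
   by (rule ennreal_mR[OF tau_space[OF w]]) simp_all
  also have "\<dots> \<le> mE \<omega> ?D' + ennreal C * V (?D - ?D')" using C(2)[of "real N"] by (simp add: add.commute)
  also have "\<dots> = ennreal (mR \<omega> 0 (real N) UNIV) + ennreal C * ennreal t"
   by (simp only: t(2) ennreal_mR[OF w open_UNIV inner_zero_left])
  also have "\<dots> = ennreal (mR \<omega> 0 (real N) UNIV + C * t)"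
   using C(1) t(1) mR_nonneg by (simp add: ennreal_mult' ennreal_plus)
  finally have "mR (\<tau> (s *\<^sub>R e) \<omega>) 0 (real (N + 1)) UNIV \<le> mR \<omega> 0 (real N) UNIV + C * t"
   using C(1) t(1) mR_nonneg by (subst (asm) ennreal_le_iff) auto
  then show ?thesis unfolding t'' by (simp only: mult.assoc)
 qed
 then show ?thesis unfolding upper_def by (rule limsup_shifted_quotient_le[OF mR_nonneg])
qed

text \<open>Monotonicity under the shift by x and under its inverse forces equality.\<close>

lemma invariant_eq_if_le:
 fixes f :: "'w \<Rightarrow> ennreal"
 assumes le: "\<And>x \<omega>. x \<in> S \<Longrightarrow> \<omega> \<in> space M \<Longrightarrow> f (\<tau> x \<omega>) \<le> f \<omega>" and S: "x \<in> S" "- x \<in> S" and w: "\<omega> \<in> space M"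
 shows "f (\<tau> x \<omega>) = f \<omega>"
proof (rule antisym[OF le[OF S(1) w]])
 have "\<tau> (- x) (\<tau> x \<omega>) = \<omega>" using tau_add[OF w, of "- x" x] tau_0[OF w] by simp
 then show "f \<omega> \<le> f (\<tau> x \<omega>)" using le[OF S(2) tau_space[OF w, of x]] by simp
qed

lemma upper_UNIV_tau: "\<omega> \<in> space M \<Longrightarrow> upper UNIV (\<tau> x \<omega>) = upper UNIV \<omega>"
proof (rule invariant_eq_if_le[where S=UNIV and x=x])
 fix x \<omega> assume w: "\<omega> \<in> space M"
 let ?y = "x - (x \<bullet> e) *\<^sub>R e"
 have y: "?y \<bullet> e = 0" by (simp add: inner_diff_left)
 have "\<tau> x \<omega> = \<tau> ?y (\<tau> ((x \<bullet> e) *\<^sub>R e) \<omega>)" using tau_add[OF w, of ?y "(x \<bullet> e) *\<^sub>R e"] by simp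
 then show "upper UNIV (\<tau> x \<omega>) \<le> upper UNIV \<omega>"
  using upper_lower_tau_orth_le(1)[OF tau_space[OF w] y open_UNIV] upper_tau_e_le[OF w] by (simp only:) (rule order_trans)
qed auto

lemma
 assumes w: "\<omega> \<in> space M" and x: "x \<bullet> e = 0"
 shows upper_tau_orth: "open H \<Longrightarrow> upper H (\<tau> x \<omega>) = upper H \<omega>"
  and lower_tau_orth: "open H \<Longrightarrow> lower H (\<tau> x \<omega>) = lower H \<omega>"
  and upper_tail_tau_orth: "upper_tail (\<tau> x \<omega>) = upper_tail \<omega>"
proof -
 show *: "upper H (\<tau> x \<omega>) = upper H \<omega>" if "open H" for H
  by (rule invariant_eq_if_le[where S="{x. x \<bullet> e = 0}"]) (use upper_lower_tau_orth_le(1) that x w in auto)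
 show "lower H (\<tau> x \<omega>) = lower H \<omega>" if "open H" for H
  by (rule invariant_eq_if_le[where S="{x. x \<bullet> e = 0}"]) (use upper_lower_tau_orth_le(2) that x w in auto)
 show "upper_tail (\<tau> x \<omega>) = upper_tail \<omega>" unfolding upper_tail_def by (simp add: *)
qed

lemma upper_measurable [measurable]:
 "upper (ivl h) \<in> borel_measurable M" "upper UNIV \<in> borel_measurable M" "lower UNIV \<in> borel_measurable M"
 "upper_tail \<in> borel_measurable M"
proof -
 show *: "upper (ivl h) \<in> borel_measurable M" for h unfolding upper_def by measurable
 show "upper UNIV \<in> borel_measurable M" "lower UNIV \<in> borel_measurable M" unfolding upper_def lower_def by measurable
 show "upper_tail \<in> borel_measurable M" unfolding upper_tail_def
  using * by (intro borel_measurable_INF borel_measurable_add borel_measurable_const) auto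
qed

lemma mR_tail_le:
 assumes "\<omega> \<in> space M" "1 \<le> R" "open H" "ivl h \<subseteq> H"
 shows "mR \<omega> 0 (R / 2) H / R ^ card B \<le> mR \<omega> 0 (R / 2) (ivl h) / R ^ card B + tail h"
proof -
 have "mR \<omega> 0 (R / 2) H \<le> mR \<omega> 0 (R / 2) (ivl h) + (vR (R / 2) H - vR (R / 2) (ivl h))"
  using assms by (intro mR_mono) auto
 also have "\<dots> \<le> mR \<omega> 0 (R / 2) (ivl h) + tail h * R ^ card B" by (intro add_left_mono vR_tail_le assms)
 finally have "mR \<omega> 0 (R / 2) H / R ^ card B \<le> (mR \<omega> 0 (R / 2) (ivl h) + tail h * R ^ card B) / R ^ card B"
  using assms(2) by (intro divide_right_mono) auto
 then show ?thesis using assms(2) by (simp add: add_divide_distrib)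
qed

lemma upper_UNIV_le: "\<omega> \<in> space M \<Longrightarrow> upper UNIV \<omega> \<le> upper_tail \<omega>"
 unfolding upper_tail_def
proof (rule INF_greatest)
 fix h :: nat assume w: "\<omega> \<in> space M"
 show "upper UNIV \<omega> \<le> upper (ivl (real h)) \<omega> + ennreal (tail (real h))"
  unfolding upper_def[of UNIV]
 proof (rule Limsup_ennreal_leI)
  fix \<epsilon> :: real assume e: "0 < \<epsilon>"
  show "eventually (\<lambda>N. ennreal (mR \<omega> 0 (real N) UNIV / (2 * real N) ^ card B)
    \<le> upper (ivl (real h)) \<omega> + ennreal (tail (real h)) + ennreal \<epsilon>) sequentially"
   using eventually_le_Limsup_ennreal[OF e, of "\<lambda>N. ennreal (mR \<omega> 0 (real N) (ivl (real h)) / (2 * real N) ^ card B)" sequentially]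
    eventually_ge_at_top[of 1]
  proof eventually_elim
   case (elim N)
   have "ennreal (mR \<omega> 0 (real N) UNIV / (2 * real N) ^ card B)
    \<le> ennreal (mR \<omega> 0 (real N) (ivl (real h)) / (2 * real N) ^ card B + tail (real h))"
    using mR_tail_le[OF w, of "2 * real N" UNIV "real h"] elim(2) by (intro ennreal_leI) simp
   also have "\<dots> = ennreal (mR \<omega> 0 (real N) (ivl (real h)) / (2 * real N) ^ card B) + ennreal (tail (real h))"
    by (intro ennreal_plus) (simp_all add: mR_nonneg tail_nonneg)
   also have "\<dots> \<le> upper (ivl (real h)) \<omega> + ennreal \<epsilon> + ennreal (tail (real h))"
    unfolding upper_def by (rule add_right_mono[OF elim(1)])
   finally show ?case by (simp only: ac_simps)
  qed
 qed
qed

text \<open>The value of the limit: a deterministic number, since the energies enter only through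
  their means at infinite height.\<close>

definition rate :: real where
 "rate = (INF k\<in>{1..}. (\<integral>\<omega>. mR \<omega> 0 (real k) UNIV \<partial>M) / (2 * real k) ^ card B)"

lemma sp_UNIV: "subadditive_process M (\<lambda>z. \<tau> (lat z)) B (\<lambda>N \<omega>. mR \<omega> 0 (real N) UNIV) (cH UNIV)"
 by (rule subadditive_process_mR) auto

lemma sp_ivl: "subadditive_process M (\<lambda>z. \<tau> (lat z)) B (\<lambda>N \<omega>. mR \<omega> 0 (real N) (ivl h)) (cH (ivl h))"
 by (rule subadditive_process_mR) auto

lemma rate_nonneg: "0 \<le> rate"
 unfolding rate_def by (intro cINF_greatest divide_nonneg_nonneg integral_nonneg) (auto simp: mR_nonneg)

lemma rate_le: "1 \<le> k \<Longrightarrow> rate * (2 * real k) ^ card B \<le> (\<integral>\<omega>. mR \<omega> 0 (real k) UNIV \<partial>M)"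
proof -
 assume k: "1 \<le> k"
 have "rate \<le> (\<integral>\<omega>. mR \<omega> 0 (real k) UNIV \<partial>M) / (2 * real k) ^ card B"
  unfolding rate_def
  by (rule cINF_lower) (use k in \<open>auto intro!: bdd_belowI2[of _ 0] divide_nonneg_nonneg integral_nonneg simp: mR_nonneg\<close>)
 then show ?thesis using k by (simp add: pos_le_divide_eq)
qed

lemma nn_integral_mR:
 "(\<integral>\<^sup>+\<omega>. ennreal (mR \<omega> 0 (real k) UNIV / (2 * real k) ^ card B) \<partial>M) = ennreal ((\<integral>\<omega>. mR \<omega> 0 (real k) UNIV \<partial>M) / (2 * real k) ^ card B)"
proof -
 have "(\<integral>\<^sup>+\<omega>. ennreal (mR \<omega> 0 (real k) UNIV / (2 * real k) ^ card B) \<partial>M) = ennreal (\<integral>\<omega>. mR \<omega> 0 (real k) UNIV / (2 * real k) ^ card B \<partial>M)"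
  using subadditive_process.X_integrable[OF sp_UNIV, of k]
  by (intro nn_integral_eq_integral integrable_divide_zero) (auto intro!: AE_I2 simp: mR_nonneg)
 then show ?thesis by simp
qed

text \<open>For a fixed size k the ergodic bound is applied at each finite height, and then the
  height tends to infinity: the means converge to that at infinite height and the tails vanish. The
  infimum over k is taken last.\<close>

lemma nn_integral_upper_tail_le: "(\<integral>\<^sup>+\<omega>. upper_tail \<omega> \<partial>M) \<le> ennreal rate"
proof -
 have k: "(\<integral>\<^sup>+\<omega>. upper_tail \<omega> \<partial>M) \<le> ennreal ((\<integral>\<omega>. mR \<omega> 0 (real k) UNIV \<partial>M) / (2 * real k) ^ card B)" if k: "1 \<le> k" for k
 proof (rule LIMSEQ_le_const)
  let ?I = "\<lambda>h::nat. \<integral>\<^sup>+\<omega>. ennreal (mR \<omega> 0 (real k) (ivl (real h)) / (2 * real k) ^ card B) \<partial>M"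
  let ?L = "\<integral>\<^sup>+\<omega>. ennreal (mR \<omega> 0 (real k) UNIV / (2 * real k) ^ card B) \<partial>M"
  have "?I \<longlonglongrightarrow> ?L"
  proof (rule nn_integral_dominated_convergence[where w="\<lambda>_. ennreal (cH UNIV)"])
   show "AE \<omega> in M. (\<lambda>h. ennreal (mR \<omega> 0 (real k) (ivl (real h)) / (2 * real k) ^ card B))
     \<longlonglongrightarrow> ennreal (mR \<omega> 0 (real k) UNIV / (2 * real k) ^ card B)"
    using k by (intro AE_I2 tendsto_ennrealI tendsto_divide mR_UNIV_tendsto tendsto_const) auto
   show "AE \<omega> in M. ennreal (mR \<omega> 0 (real k) (ivl (real h)) / (2 * real k) ^ card B) \<le> ennreal (cH UNIV)" for h
   proof (rule AE_I2, rule ennreal_leI)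
    fix \<omega> assume w: "\<omega> \<in> space M"
    have "ennreal (cH (ivl (real h))) \<le> ennreal (cH UNIV)" unfolding cH(1) by (intro mult_left_mono qmass_mono) auto
    then have "cH (ivl (real h)) \<le> cH UNIV" by (simp add: cH(2) ennreal_le_iff)
    then have "mR \<omega> 0 (real k) (ivl (real h)) \<le> cH UNIV * (2 * real k) ^ card B"
     by (intro order_trans[OF mR_le_nat[OF w] mult_right_mono]) auto
    then show "mR \<omega> 0 (real k) (ivl (real h)) / (2 * real k) ^ card B \<le> cH UNIV" using k by (simp add: pos_divide_le_eq)
   qed
   show "(\<integral>\<^sup>+\<omega>. ennreal (cH UNIV) \<partial>M) < \<infinity>" by (simp add: emeasure_space_1)
  qed measurable
  moreover have "(\<lambda>h. ennreal (tail (real h))) \<longlonglongrightarrow> ennreal 0" by (intro tendsto_ennrealI tail_tendsto)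
  ultimately have "(\<lambda>h. ?I h + ennreal (tail (real h))) \<longlonglongrightarrow> ?L + ennreal 0" by (rule tendsto_add)
  then show "(\<lambda>h. ?I h + ennreal (tail (real h))) \<longlonglongrightarrow> ennreal ((\<integral>\<omega>. mR \<omega> 0 (real k) UNIV \<partial>M) / (2 * real k) ^ card B)"
   by (simp only: nn_integral_mR ennreal_0 add_0_right)
  have "(\<integral>\<^sup>+\<omega>. upper_tail \<omega> \<partial>M) \<le> ?I h + ennreal (tail (real h))" for h
  proof -
   have "(\<integral>\<^sup>+\<omega>. upper_tail \<omega> \<partial>M) \<le> (\<integral>\<^sup>+\<omega>. upper (ivl (real h)) \<omega> + ennreal (tail (real h)) \<partial>M)"
    unfolding upper_tail_def by (intro nn_integral_mono INF_lower) simp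
   also have "\<dots> = (\<integral>\<^sup>+\<omega>. upper (ivl (real h)) \<omega> \<partial>M) + ennreal (tail (real h))"
    by (subst nn_integral_add) (auto simp: emeasure_space_1)
   also have "\<dots> \<le> ?I h + ennreal (tail (real h))"
    unfolding upper_def by (intro add_right_mono subadditive_process.nn_integral_limsup_le[OF sp_ivl k])
   finally show ?thesis .
  qed
  then show "\<exists>N. \<forall>h\<ge>N. (\<integral>\<^sup>+\<omega>. upper_tail \<omega> \<partial>M) \<le> ?I h + ennreal (tail (real h))" by blast
 qed
 have fin: "(\<integral>\<^sup>+\<omega>. upper_tail \<omega> \<partial>M) < \<top>" by (rule order_le_less_trans[OF k[OF order_refl]]) simp
 have "enn2real (\<integral>\<^sup>+\<omega>. upper_tail \<omega> \<partial>M) \<le> rate"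
  unfolding rate_def
 proof (rule cINF_greatest)
  fix k :: nat assume "k \<in> {1..}"
  then have "(\<integral>\<^sup>+\<omega>. upper_tail \<omega> \<partial>M) \<le> ennreal ((\<integral>\<omega>. mR \<omega> 0 (real k) UNIV \<partial>M) / (2 * real k) ^ card B)" by (intro k) simp
  then show "enn2real (\<integral>\<^sup>+\<omega>. upper_tail \<omega> \<partial>M) \<le> (\<integral>\<omega>. mR \<omega> 0 (real k) UNIV \<partial>M) / (2 * real k) ^ card B"
   by (intro enn2real_leI divide_nonneg_nonneg integral_nonneg) (auto simp: mR_nonneg)
 qed auto
 then have "ennreal (enn2real (\<integral>\<^sup>+\<omega>. upper_tail \<omega> \<partial>M)) \<le> ennreal rate" by (rule ennreal_leI)
 then show ?thesis using fin by simp
qed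

text \<open>Every normalised mean is at least the rate; the reverse Fatou lemma moves the limsup
  inside the integral, the planar energy being a common bound.\<close>

lemma rate_le_nn_integral_upper: "ennreal rate \<le> (\<integral>\<^sup>+\<omega>. upper UNIV \<omega> \<partial>M)"
proof -
 let ?u = "\<lambda>N \<omega>. ennreal (mR \<omega> 0 (real N) UNIV / (2 * real N) ^ card B)"
 have "eventually (\<lambda>N. ennreal rate \<le> (\<integral>\<^sup>+\<omega>. ?u N \<omega> \<partial>M)) sequentially"
  using eventually_ge_at_top[of 1]
 proof eventually_elim
  case (elim N)
  show ?case unfolding nn_integral_mR using rate_le[OF elim] elim by (intro ennreal_leI) (simp add: pos_le_divide_eq)
 qed
 then have "ennreal rate \<le> liminf (\<lambda>N. \<integral>\<^sup>+\<omega>. ?u N \<omega> \<partial>M)" by (rule Liminf_bounded)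
 also have "\<dots> \<le> limsup (\<lambda>N. \<integral>\<^sup>+\<omega>. ?u N \<omega> \<partial>M)" by (rule Liminf_le_Limsup) simp
 also have "\<dots> \<le> (\<integral>\<^sup>+\<omega>. limsup (\<lambda>N. ?u N \<omega>) \<partial>M)"
 proof (rule nn_integral_limsup[where w="\<lambda>_. ennreal (cH UNIV)"])
  show "AE \<omega> in M. ?u N \<omega> \<le> ennreal (cH UNIV)" for N
  proof (rule AE_I2, rule ennreal_leI)
   fix \<omega> assume w: "\<omega> \<in> space M"
   show "mR \<omega> 0 (real N) UNIV / (2 * real N) ^ card B \<le> cH UNIV"
   proof (cases "(2 * real N) ^ card B = 0")
    case True
    show ?thesis unfolding True using cH(2) by simp
   next
    case False
    then have "0 < (2 * real N) ^ card B" by (intro order.not_eq_order_implies_strict[OF not_sym]) simp_all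
    then show ?thesis using mR_le_nat[OF w open_UNIV, of N] by (simp only: pos_divide_le_eq)
   qed
  qed
  show "(\<integral>\<^sup>+\<omega>. ennreal (cH UNIV) \<partial>M) < \<infinity>" by (simp add: emeasure_space_1)
 qed measurable
 finally show ?thesis by (simp only: upper_def)
qed

text \<open>Only \<open>upper UNIV\<close> is invariant under all translations, so ergodicity is
  applied to it: if it were below the rate almost surely, its mean would be too small. Hence it is
  at least the rate. Since \<open>upper_tail\<close> is at least as large and has mean at most the
  rate, it equals the rate almost surely. The upper bound on the limsup thus obtained is the input
  of the covering argument for the liminf.\<close>

theorem AE_rate:
 assumes ergodic: "\<And>E. E \<in> sets M \<Longrightarrow> (\<forall>x. \<tau> x -` E \<inter> space M = E) \<Longrightarrow> measure M E = 0 \<or> measure M E = 1"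
 shows "AE \<omega> in M. ennreal rate \<le> lower UNIV \<omega> \<and> upper_tail \<omega> \<le> ennreal rate"
proof -
 let ?E = "{\<omega> \<in> space M. upper UNIV \<omega> < ennreal rate}"
 have E: "?E \<in> sets M" by measurable
 have "\<forall>x. \<tau> x -` ?E \<inter> space M = ?E" using upper_UNIV_tau tau_space by auto
 with ergodic[OF E] have "measure M ?E = 0 \<or> measure M ?E = 1" by blast
 moreover have "measure M ?E \<noteq> 1"
 proof
  assume "measure M ?E = 1"
  then have lt: "AE \<omega> in M. upper UNIV \<omega> < ennreal rate" using prob_Collect_eq_1[OF E] by simp
  have "AE \<omega> in M. ennreal rate \<le> upper UNIV \<omega>"
  proof (rule AE_eq_if_nn_integral_le)
   show "AE \<omega> in M. upper UNIV \<omega> \<le> ennreal rate" using lt by eventually_elim (rule less_imp_le)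
   show "(\<integral>\<^sup>+\<omega>. ennreal rate \<partial>M) \<le> (\<integral>\<^sup>+\<omega>. upper UNIV \<omega> \<partial>M)"
    using rate_le_nn_integral_upper by (simp add: emeasure_space_1)
   have "(\<integral>\<^sup>+\<omega>. upper UNIV \<omega> \<partial>M) \<le> (\<integral>\<^sup>+\<omega>. ennreal rate \<partial>M)"
    using lt by (intro nn_integral_mono_AE) (auto elim!: eventually_mono)
   then show "(\<integral>\<^sup>+\<omega>. upper UNIV \<omega> \<partial>M) \<noteq> \<infinity>" by (auto simp: emeasure_space_1 top_unique)
  qed measurable
  with lt have "AE \<omega> in M. False" by eventually_elim simp
  then show False by simp
 qed
 ultimately have "measure M ?E = 0" by blast
 then have ge: "AE \<omega> in M. ennreal rate \<le> upper UNIV \<omega>" using prob_Collect_eq_0[OF E] by (simp add: not_less)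
 have "AE \<omega> in M. upper_tail \<omega> \<le> ennreal rate"
 proof (rule AE_eq_if_nn_integral_le)
  show "AE \<omega> in M. ennreal rate \<le> upper_tail \<omega>"
   using ge AE_space by eventually_elim (rule order_trans[OF _ upper_UNIV_le])
  show "(\<integral>\<^sup>+\<omega>. upper_tail \<omega> \<partial>M) \<le> (\<integral>\<^sup>+\<omega>. ennreal rate \<partial>M)"
   using nn_integral_upper_tail_le by (simp add: emeasure_space_1)
  show "(\<integral>\<^sup>+\<omega>. ennreal rate \<partial>M) \<noteq> \<infinity>" by (simp add: emeasure_space_1)
 qed measurable
 moreover from this have "AE \<omega> in M. limsup (\<lambda>N. ennreal (mR \<omega> 0 (real N) UNIV / (2 * real N) ^ card B)) \<le> ennreal rate"
  using AE_space by eventually_elim (rule order_trans[OF upper_UNIV_le[unfolded upper_def]])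
 then have "AE \<omega> in M. ennreal rate \<le> lower UNIV \<omega>"
  unfolding lower_def by (rule subadditive_process.AE_liminf_ge[OF sp_UNIV rate_nonneg _ rate_le])
 ultimately show ?thesis by eventually_elim simp
qed

text \<open>No probability is left here: the medium is fixed. One height h1 bounds the energies at
  all larger heights from above, and the infinite cylinder bounds them from below up to the tail.
  Both thresholds in R refer to a single height, h1 or infinity, which makes the estimate uniform in
  h.\<close>

lemma uniform_limit_rate:
 assumes w: "\<omega> \<in> space M" and lo: "ennreal rate \<le> lower UNIV \<omega>" and up: "upper_tail \<omega> \<le> ennreal rate" and eps: "0 < \<epsilon>"
 shows "\<exists>h0. \<exists>R0. \<forall>R\<ge>R0. \<bar>mR \<omega> 0 (R / 2) UNIV / R ^ card B - rate\<bar> \<le> \<epsilon>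
  \<and> (\<forall>h\<ge>h0. \<bar>mR \<omega> 0 (R / 2) (ivl h) / R ^ card B - rate\<bar> \<le> \<epsilon>)"
proof -
 have e2: "0 < \<epsilon> / 2" using eps by simp
 have mono: "mR \<omega> 0 \<rho>' H \<le> mR \<omega> 0 \<rho> H + (vR \<rho>' H - vR \<rho> H)" if "\<rho> \<le> \<rho>'" "open H" for \<rho> \<rho>' H
  using that by (intro mR_mono[OF w]) auto
 have "ennreal rate < ennreal (rate + \<epsilon> / 2)" using e2 rate_nonneg by (intro ennreal_lessI) auto
 \<comment> \<open>The height h1 is nearly optimal in the infimum defining
   \<open>upper_tail\<close>; half of \<epsilon> is kept for the passage from the limsup to large
   R.\<close>
 from order_le_less_trans[OF up this] obtain h1 :: nat where
  h1: "upper (ivl (real h1)) \<omega> + ennreal (tail (real h1)) < ennreal (rate + \<epsilon> / 2)"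
  unfolding upper_tail_def INF_less_iff by blast
 let ?b = "\<lambda>R h. mR \<omega> 0 (R / 2) (ivl h) / R ^ card B" and ?a = "\<lambda>R. mR \<omega> 0 (R / 2) UNIV / R ^ card B"
 have "Limsup at_top (\<lambda>R. ennreal (?b R (real h1))) \<le> upper (ivl (real h1)) \<omega>"
  unfolding upper_def
  by (rule Limsup_quotient_le_limsup[where v="\<lambda>\<rho>. vR \<rho> (ivl (real h1))" and c="cH (ivl (real h1))"])
    (rule mR_nonneg, erule mono, simp, erule vR_mono[rotated], simp, rule vR_nat, simp)
 then have "eventually (\<lambda>R. ennreal (?b R (real h1)) \<le> upper (ivl (real h1)) \<omega> + ennreal (\<epsilon> / 2)) at_top"
  using eventually_le_Limsup_ennreal[OF e2, of "\<lambda>R. ennreal (?b R (real h1))" at_top]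
  by (elim eventually_mono) (erule order_trans, rule add_right_mono)
 moreover have fin: "lower UNIV \<omega> < \<top>"
 proof -
  have "lower UNIV \<omega> \<le> upper UNIV \<omega>" unfolding lower_def upper_def by (rule Liminf_le_Limsup) simp
  also have "\<dots> \<le> ennreal rate" by (rule order_trans[OF upper_UNIV_le[OF w] up])
  finally show ?thesis using ennreal_less_top by (rule order_le_less_trans)
 qed
 have lo': "ennreal rate \<le> Liminf at_top (\<lambda>R. ennreal (?a R))"
  by (rule order_trans[OF lo], unfold lower_def,
    rule liminf_le_Liminf_quotient[where v="\<lambda>\<rho>. vR \<rho> UNIV" and c="cH UNIV"])
    (rule mR_nonneg, erule mono, simp, erule vR_mono[rotated], simp, rule vR_nat, simp, rule fin[unfolded lower_def])
 have "eventually (\<lambda>R. ennreal rate \<le> ennreal (?a R) + ennreal (\<epsilon> / 2)) at_top"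
 proof (cases "Liminf at_top (\<lambda>R. ennreal (?a R)) < \<top>")
  case True
  show ?thesis using eventually_Liminf_le_ennreal[OF e2 True] by (rule eventually_mono) (rule order_trans[OF lo'])
 next
  case False
  then have "ennreal rate < Liminf at_top (\<lambda>R. ennreal (?a R))"
   using ennreal_less_top[of rate] unfolding not_less top_unique by (simp only:)
  then have "eventually (\<lambda>R. ennreal rate < ennreal (?a R)) at_top" by (rule less_LiminfD)
  then show ?thesis by (rule eventually_mono) (simp add: add_increasing2 less_imp_le)
 qed
 ultimately have "eventually (\<lambda>R. 1 \<le> R \<and> ennreal (?b R (real h1)) \<le> upper (ivl (real h1)) \<omega> + ennreal (\<epsilon> / 2)
   \<and> ennreal rate \<le> ennreal (?a R) + ennreal (\<epsilon> / 2)) at_top"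
  using eventually_ge_at_top[of 1] by eventually_elim blast
 then obtain R0 where R0: "\<And>R. R0 \<le> R \<Longrightarrow> 1 \<le> R" "\<And>R. R0 \<le> R \<Longrightarrow> ennreal (?b R (real h1)) \<le> upper (ivl (real h1)) \<omega> + ennreal (\<epsilon> / 2)"
  "\<And>R. R0 \<le> R \<Longrightarrow> ennreal rate \<le> ennreal (?a R) + ennreal (\<epsilon> / 2)"
  unfolding eventually_at_top_linorder by blast
 \<comment> \<open>Beyond h2 the tail is small enough to carry the lower bound from infinite height
   over to height h.\<close>
 obtain h2 :: nat where h2: "tail (real h2) < \<epsilon> / 2"
  using order_tendstoD(2)[OF tail_tendsto e2] unfolding eventually_sequentially by blast
 have "\<bar>?a R - rate\<bar> \<le> \<epsilon> \<and> (\<forall>h\<ge>max (real h1) (real h2). \<bar>?b R h - rate\<bar> \<le> \<epsilon>)" if R: "R0 \<le> R" for R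
 proof -
  note R1 = R0(1)[OF R]
  have nn: "0 \<le> ?a R" "0 \<le> ?b R h" for h using R1 by (simp_all add: mR_nonneg)
  have "ennreal (?b R (real h1) + tail (real h1)) = ennreal (?b R (real h1)) + ennreal (tail (real h1))"
   using nn tail_nonneg by (intro ennreal_plus) auto
  also have "\<dots> \<le> upper (ivl (real h1)) \<omega> + ennreal (\<epsilon> / 2) + ennreal (tail (real h1))" by (rule add_right_mono[OF R0(2)[OF R]])
  also have "\<dots> = upper (ivl (real h1)) \<omega> + ennreal (tail (real h1)) + ennreal (\<epsilon> / 2)" by (simp only: ac_simps)
  also have "\<dots> \<le> ennreal (rate + \<epsilon> / 2) + ennreal (\<epsilon> / 2)" by (rule add_right_mono[OF less_imp_le[OF h1]])
  also have "\<dots> = ennreal (rate + \<epsilon> / 2 + \<epsilon> / 2)" using e2 rate_nonneg by (intro ennreal_plus[symmetric]) auto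
  finally have top: "?b R (real h1) + tail (real h1) \<le> rate + \<epsilon>"
   using eps rate_nonneg by (subst (asm) ennreal_le_iff) auto
  have "ennreal rate \<le> ennreal (?a R + \<epsilon> / 2)" using R0(3)[OF R] nn(1) e2 by (subst ennreal_plus) auto
  then have bot: "rate \<le> ?a R + \<epsilon> / 2" using nn(1) e2 by (subst (asm) ennreal_le_iff) auto
  have a: "?a R \<le> rate + \<epsilon>" using mR_tail_le[OF w R1, of UNIV "real h1"] top by simp
  have "\<bar>?b R h - rate\<bar> \<le> \<epsilon>" if h: "max (real h1) (real h2) \<le> h" for h
  proof -
   have "?b R h \<le> ?b R (real h1) + tail (real h1)" using h by (intro mR_tail_le[OF w R1]) auto
   moreover have "?a R \<le> ?b R h + tail h" by (intro mR_tail_le[OF w R1]) auto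
   moreover have "tail h \<le> tail (real h2)" using h by (intro tail_antimono) simp
   ultimately show ?thesis using top bot h2 unfolding abs_le_iff by linarith
  qed
  moreover have "\<bar>?a R - rate\<bar> \<le> \<epsilon>" using a bot e2 unfolding abs_le_iff by linarith
  ultimately show ?thesis by blast
 qed
 then show ?thesis by blast
qed

end

theorem theorem1p2:
  fixes M :: "'w measure"
    and \<Phi> :: "'w \<Rightarrow> 'd::euclidean_space \<Rightarrow> real"
    and \<tau> :: "'d \<Rightarrow> 'w \<Rightarrow> 'w"
    and W :: "real \<Rightarrow> real" and q :: "real \<Rightarrow> real"
    and B :: "'d \<Rightarrow> 'd set"
    and lam Lam :: real
  assumes lam_pos: "0 < lam" and Lam_pos: "0 < Lam"
    and P: "prob_space M"
    and Phi_meas: "\<Phi> \<in> M \<rightarrow>\<^sub>M Fmeas lam Lam"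
    and tau_meas: "(\<lambda>(x, \<omega>). \<tau> x \<omega>) \<in> (borel \<Otimes>\<^sub>M M) \<rightarrow>\<^sub>M M"
    and tau_add: "\<And>x y \<omega>. \<omega> \<in> space M \<Longrightarrow> \<tau> (x + y) \<omega> = \<tau> x (\<tau> y \<omega>)"
    and tau_0: "\<And>\<omega>. \<omega> \<in> space M \<Longrightarrow> \<tau> 0 \<omega> = \<omega>"
    and tau_pres: "\<And>x. distr M M (\<tau> x) = M"
    and ergodic: "\<And>E. E \<in> sets M \<Longrightarrow> (\<forall>x. \<tau> x -` E \<inter> space M = E) \<Longrightarrow>
                    measure M E = 0 \<or> measure M E = 1"
    and W_cont: "continuous_on {-1..1} W"
    and W_nonneg: "\<And>s. s \<in> {-1..1} \<Longrightarrow> 0 \<le> W s"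
    and W_zero: "\<And>s. s \<in> {-1..1} \<Longrightarrow> W s = 0 \<longleftrightarrow> s = -1 \<or> s = 1"
    and q_smooth: "smooth_fn q"
    and q_range: "\<And>s. -1 \<le> q s \<and> q s \<le> 1"
    and q_energy: "(\<integral>\<^sup>+ s. ennreal (Lam / 2 * (deriv q s)\<^sup>2 + W (q s)) \<partial>lborel) < \<infinity>"
    and q_top: "(q \<longlongrightarrow> 1) at_top" and q_bot: "(q \<longlongrightarrow> -1) at_bot"
    and B_basis: "\<And>e. e \<in> sphere 0 1 \<Longrightarrow> finite (B e) \<and> card (B e) = DIM('d) - 1 \<and>
                    (\<forall>b\<in>B e. norm b = 1 \<and> b \<bullet> e = 0) \<and>
                    (\<forall>b\<in>B e. \<forall>b'\<in>B e. b \<noteq> b' \<longrightarrow> b \<bullet> b' = 0)"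
  shows "\<forall>e\<in>sphere (0::'d) 1. \<exists>\<phi>e::real. \<exists>\<Omega>e \<in> Sigma_e M \<tau> e. measure M \<Omega>e = 1 \<and>
     (\<forall>\<omega>\<in>\<Omega>e. \<forall>\<kappa>>0.
        ((\<lambda>R. ennreal (R powr (1 - real DIM('d))) * phi_inf \<Phi> \<tau> W q B \<omega> e R)
            \<longlongrightarrow> ennreal \<phi>e) at_top \<and>
        ((\<lambda>h. Limsup at_top (\<lambda>R. ennreal (R powr (1 - real DIM('d))) * phi_fin \<Phi> \<tau> W q B \<omega> e R h))
            \<longlongrightarrow> ennreal \<phi>e) at_top \<and>
        ((\<lambda>h. Liminf at_top (\<lambda>R. ennreal (R powr (1 - real DIM('d))) * phi_fin \<Phi> \<tau> W q B \<omega> e R h))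
            \<longlongrightarrow> ennreal \<phi>e) at_top \<and>
        ((\<lambda>R. ennreal (R powr (1 - real DIM('d))) * phi_fin \<Phi> \<tau> W q B \<omega> e R (\<kappa> * R))
            \<longlongrightarrow> ennreal \<phi>e) at_top)"
proof (rule ballI, goal_cases)
 case e: (1 e)
 interpret medium e "B e" M \<Phi> \<tau> W q lam Lam
 proof (intro medium.intro medium_axioms.intro)
  show "frame e (B e)" using e B_basis[OF e] by (intro frame.intro) auto
 qed (fact lam_pos Lam_pos P Phi_meas tau_meas tau_add tau_0 tau_pres W_cont W_nonneg W_zero q_smooth
   q_range q_energy q_top q_bot)+
 interpret prob_space M by (rule P)
 let ?\<Omega> = "{\<omega> \<in> space M. ennreal rate \<le> lower UNIV \<omega> \<and> upper_tail \<omega> \<le> ennreal rate}"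
 have ms: "?\<Omega> \<in> sets M" by measurable
 \<comment> \<open>Both functions are invariant at every point, so the event is itself one of the
   generators of \<open>Sigma_e\<close>.\<close>
 have "\<tau> x -` ?\<Omega> \<inter> space M = ?\<Omega>" if "x \<bullet> e = 0" for x
  using lower_tau_orth[OF _ that open_UNIV] upper_tail_tau_orth[OF _ that] tau_space by auto
 then have 1: "?\<Omega> \<in> Sigma_e M \<tau> e" using ms unfolding Sigma_e_def by (intro sigma_sets.Basic) blast
 have 2: "measure M ?\<Omega> = 1" using AE_rate[OF ergodic] ms by (simp add: prob_Collect_eq_1)
 have card: "card (B e) = DIM('d) - 1" using B_basis[OF e] by simp
 have eq: "ennreal (R powr (1 - real DIM('d))) * mE \<omega> (dom 0 (R / 2) H) = ennreal (mR \<omega> 0 (R / 2) H / R ^ card (B e))"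
  if "0 < R" "\<omega> \<in> space M" "open H" for R \<omega> H
 proof -
  \<comment> \<open>The dimension is at least 1, so the natural-number subtraction in the
    cardinality of the basis is exact.\<close>
  have "1 - real DIM('d) = - real (card (B e))" using card by (simp add: of_nat_diff DIM_positive Suc_leI)
  then have p: "R powr (1 - real DIM('d)) = 1 / R ^ card (B e)" using that(1)
   by (simp only: powr_minus powr_realpow inverse_eq_divide)
  show ?thesis unfolding p ennreal_mR[OF that(2,3) inner_zero_left, symmetric]
   using that(1) by (simp add: mR_nonneg flip: ennreal_mult)
 qed
 show ?case
 proof (rule exI[of _ rate], rule bexI[OF _ 1], rule conjI[OF 2], intro ballI allI impI)
  fix \<omega> and \<kappa> :: real assume w: "\<omega> \<in> ?\<Omega>" and k: "0 < \<kappa>"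
  let ?c = "\<lambda>R. ennreal (R powr (1 - real DIM('d)))"
  let ?i = "\<lambda>R. ?c R * phi_inf \<Phi> \<tau> W q B \<omega> e R" and ?f = "\<lambda>R h. ?c R * phi_fin \<Phi> \<tau> W q B \<omega> e R h"
  have ws: "\<omega> \<in> space M" using w by simp
  let ?a = "\<lambda>R. mR \<omega> 0 (R / 2) UNIV / R ^ card (B e)" and ?b = "\<lambda>R h. mR \<omega> 0 (R / 2) {- h<..<h} / R ^ card (B e)"
  have lim: "\<forall>\<epsilon>>0. \<exists>h0. \<exists>R0. \<forall>R\<ge>R0. \<bar>?a R - rate\<bar> \<le> \<epsilon> \<and> (\<forall>h\<ge>h0. \<bar>?b R h - rate\<bar> \<le> \<epsilon>)"
   using w by (intro allI impI uniform_limit_rate) auto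
  \<comment> \<open>The power with real exponent is identified with 1 / R^(d-1) only for R > 0,
    which suffices at infinity.\<close>
  have a: "eventually (\<lambda>R. ?i R = ennreal (?a R)) at_top"
   using eventually_gt_at_top[of 0] by eventually_elim (simp only: phi_inf_eq eq[OF _ ws open_UNIV])
  have b: "eventually (\<lambda>R. ?f R (g R) = ennreal (?b R (g R))) at_top" for g
   using eventually_gt_at_top[of 0] by eventually_elim (simp only: phi_fin_eq eq[OF _ ws open_greaterThanLessThan])
  note l = iterated_limits[of ?a rate ?b, OF lim rate_nonneg]
  have "(?i \<longlongrightarrow> ennreal rate) at_top" using l(1) by (subst tendsto_cong[OF a])
  moreover have "((\<lambda>R. ?f R (\<kappa> * R)) \<longlongrightarrow> ennreal rate) at_top"
   using l(4)[OF k] by (subst tendsto_cong[OF b[of "\<lambda>R. \<kappa> * R"]])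
  moreover have "Limsup at_top (\<lambda>R. ?f R h) = Limsup at_top (\<lambda>R. ennreal (?b R h))"
   "Liminf at_top (\<lambda>R. ?f R h) = Liminf at_top (\<lambda>R. ennreal (?b R h))" for h
   using b[of "\<lambda>_. h"] by (rule Limsup_eq, rule Liminf_eq)
  ultimately show "(?i \<longlongrightarrow> ennreal rate) at_top \<and>
    ((\<lambda>h. Limsup at_top (\<lambda>R. ?f R h)) \<longlongrightarrow> ennreal rate) at_top \<and>
    ((\<lambda>h. Liminf at_top (\<lambda>R. ?f R h)) \<longlongrightarrow> ennreal rate) at_top \<and>
    ((\<lambda>R. ?f R (\<kappa> * R)) \<longlongrightarrow> ennreal rate) at_top"
   using l(2,3) by (simp only:)
 qed
qed

end
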